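(* Let $T>0$ and let $\Omega\subset\mathbb R^n$ be a bounded domain. For $\varepsilon\ge 0$ let $A_\varepsilon:\mathbb R^n_0\to\mathcal S^n_+$ and $H_\varepsilon:\Omega_T\times\mathbb R^n\to\mathbb R$ be continuous functions satisfying the following conditions. (A1) There exists $k>2$ such that, for every small $\varepsilon\ge 0$, the function $f(x)=|x|^k$ satisfies $\operatorname{tr}\big(A_\varepsilon(\nabla f(x))\nabla^2 f(x)\big)\to 0$ as $x\to 0$. (A2) There exists $L_H\ge 0$ such that $|H_\varepsilon(x_1,t_1,\xi)-H_\varepsilon(x_2,t_2,\xi)|\le L_H(1+|\xi|)(|x_1-x_2|+|t_1-t_2|)$ for all $(x_1,t_1),(x_2,t_2)\in\Omega_T$, $\xi\in\mathbb R^n$ and all $\varepsilon\ge 0$. (C1) There exist $c_A>0$, $\alpha>0$ and $\beta>\frac{2-k}{2(k-1)}$ (with $k$ as in (A1)) such that $\|A_\varepsilon(\xi)^{1/2}-A_0(\xi)^{1/2}\|\le c_A\varepsilon^\alpha(1+|\xi|^\beta)$ for all small $\varepsilon>0$ and all $\xi\in\mathbb R^n_0$. (C2) There exist $c_H>0$ and $\gamma>0$ such that $|H_\varepsilon(x,t,\xi)-H_0(x,t,\xi)|\le c_H\varepsilon^\gamma$ for all small $\varepsilon>0$, $(x,t)\in\Omega_T$ and $\xi\in\mathbb R^n$. For $\varepsilon\ge 0$ let $g_\varepsilon\in C(\partial_p\Omega_T)$ and let $u_\varepsilon\in C(\overline\Omega\times[0,T))$ be a bounded $\mathcal F$-solution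 of $$\partial_t u-\operatorname{tr}(A_\varepsilon(\nabla u)\nabla^2u)+H_\varepsilon(x,t,\nabla u)=0\ \text{ in }\Omega_T,\qquad u=g_\varepsilon\ \text{ on }\partial_p\Omega_T.$$ Assume in addition that there exist $L>0$ and $\theta\in(0,1]$ such that $$|u_\varepsilon(x_1,t_1)-u_\varepsilon(x_2,t_2)|\le L(|x_1-x_2|^\theta+|t_1-t_2|^\theta)$$ for all $(x_1,t_1),(x_2,t_2)\in\overline\Omega\times[0,T)$ and all small $\varepsilon\ge0$. Then, for all small $\varepsilon>0$, $$\sup_{\overline\Omega\times[0,T)}|u_\varepsilon-u_0|\le\sup_{\partial_p\Omega_T}|g_\varepsilon-g_0|+C\varepsilon^\nu+c_HT\varepsilon^\gamma,\qquad \nu=\frac{\alpha\theta}{1+(1-\theta)\max\{\beta,0\}},$$ where $C>0$ is independent of $\varepsilon$ and depends on $T,n,k,L_H,\beta,c_A,\theta,L$.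
   Context: Notation: $\mathbb R^n_0=\mathbb R^n\setminus\{0\}$; $\mathcal S^n_+$ is the set of nonnegative (positive semidefinite) symmetric $n\times n$ matrices; $M^{1/2}$ is the nonnegative square root of $M\in\mathcal S^n_+$; $\|\cdot\|$ is the matrix (operator) norm; $\Omega_T=\Omega\times(0,T)$; $\partial_p\Omega_T=(\Omega\times\{0\})\cup(\partial\Omega\times[0,T))$. $\nabla,\nabla^2$ are the spatial gradient and Hessian. $\mathcal F$-solutions. Let $A:\mathbb R^n_0\to\mathcal S^n_+$ and $H:\Omega_T\times\mathbb R^n\to\mathbb R$ be continuous. Let $\mathcal F=\mathcal F(A)$ be the class of $f\in C^2([0,\infty))$ with $f(0)=f'(0)=f''(0)=0$ and $f''(r)>0$ for all $r>0$, such that both functions $R(x)=\pm f(|x|)$ satisfy $\|A(\nabla R(x))\nabla^2R(x)\|\to0$ as $x\to0$; this class is assumed nonempty (under (A1), $r\mapsto r^k$ belongs to $\mathcal F(A_\varepsilon)$). A function $\psi\in C^2(\Omega_T)$ is compatible with $A$, written $\psi\in C^2_A(\Omega_T)$, if for every $z_0=(x_0,t_0)\in\Omega_T$ with $\nabla\psi(z_0)=0$ there is $f\in\mathcal F$ such that for $z=(x,t)$ near $z_0$, $$|\psi(z)-\psi(z_0)-\partial_t\psi(z_0)(t-t_0)|\le f(|x-x_0|)+o(|t-t_0|).$$ A locally bounded upper semicontinuous $u$ in $\Omega_T$ is an $\mathcal F$-subsolution of $\partial_tu-\operatorname{tr}(A(\nabla u)\nabla^2u)+H(x,t,\nabla u)=0$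 if, whenever $\psi\in C^2_A(\Omega_T)$ and $u-\psi$ has a local maximum at $z_0\in\Omega_T$, one has $\partial_t\psi(z_0)-\operatorname{tr}(A(\nabla\psi(z_0))\nabla^2\psi(z_0))+H(z_0,\nabla\psi(z_0))\le0$ if $\nabla\psi(z_0)\ne0$, and $\partial_t\psi(z_0)+H(z_0,0)\le0$ if $\nabla\psi(z_0)=0$. $\mathcal F$-supersolutions are locally bounded lower semicontinuous functions satisfying the analogous conditions with local minimum and reversed inequalities. A continuous function is an $\mathcal F$-solution if it is both. *)

theory Defs
  imports "HOL-Analysis.Analysis" "HOL-Library.Landau_Symbols"
begin

text \<open>Space-time points are pairs \<open>(x, t)\<close> of type \<open>(real ^ 'n) \<times> real\<close>.\<close>

definition space_time_cylinder :: "(real ^ 'n) set \<Rightarrow> real \<Rightarrow> ((real ^ 'n) \<times> real) set" where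
  "space_time_cylinder \<Omega> T = \<Omega> \<times> {0<..<T}"

definition parabolic_boundary :: "(real ^ 'n) set \<Rightarrow> real \<Rightarrow> ((real ^ 'n) \<times> real) set" where
  "parabolic_boundary \<Omega> T = \<Omega> \<times> {0} \<union> frontier \<Omega> \<times> {0..<T}"

definition psd :: "real ^ 'n ^ 'n \<Rightarrow> bool" where
  "psd M \<longleftrightarrow> transpose M = M \<and> (\<forall>x. 0 \<le> x \<bullet> (M *v x))"

text \<open>By the spectral theorem the description below is proper whenever \<open>psd M\<close> holds;
  otherwise the value is irrelevant.\<close>

definition psd_sqrt :: "real ^ 'n ^ 'n \<Rightarrow> real ^ 'n ^ 'n" where
  "psd_sqrt M = (THE B. psd B \<and> B ** B = M)"

definition op_norm :: "real ^ 'n ^ 'n \<Rightarrow> real" where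
  "op_norm M = onorm (\<lambda>x. M *v x)"

definition gradient :: "(real ^ 'n \<Rightarrow> real) \<Rightarrow> real ^ 'n \<Rightarrow> real ^ 'n" where
  "gradient f x = (\<chi> i. frechet_derivative f (at x) (axis i 1))"

definition hessian :: "(real ^ 'n \<Rightarrow> real) \<Rightarrow> real ^ 'n \<Rightarrow> real ^ 'n ^ 'n" where
  "hessian f x = (\<chi> i j. frechet_derivative (\<lambda>y. gradient f y $ j) (at x) (axis i 1))"

definition space_gradient :: "((real ^ 'n) \<times> real \<Rightarrow> real) \<Rightarrow> (real ^ 'n) \<times> real \<Rightarrow> real ^ 'n" where
  "space_gradient \<psi> z = gradient (\<lambda>x. \<psi> (x, snd z)) (fst z)"

definition space_hessian :: "((real ^ 'n) \<times> real \<Rightarrow> real) \<Rightarrow> (real ^ 'n) \<times> real \<Rightarrow> real ^ 'n ^ 'n" where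
  "space_hessian \<psi> z = hessian (\<lambda>x. \<psi> (x, snd z)) (fst z)"

definition time_deriv :: "((real ^ 'n) \<times> real \<Rightarrow> real) \<Rightarrow> (real ^ 'n) \<times> real \<Rightarrow> real" where
  "time_deriv \<psi> z = deriv (\<lambda>t. \<psi> (fst z, t)) (snd z)"

text \<open>\<open>C\<^sup>2\<close> regularity on an open set, jointly in all (space and time) variables.\<close>

definition C2_on :: "'a::real_normed_vector set \<Rightarrow> ('a \<Rightarrow> real) \<Rightarrow> bool" where
  "C2_on S f \<longleftrightarrow>
     (\<exists>(f' :: 'a \<Rightarrow> 'a \<Rightarrow>\<^sub>L real) (f'' :: 'a \<Rightarrow> 'a \<Rightarrow>\<^sub>L ('a \<Rightarrow>\<^sub>L real)).
        (\<forall>x\<in>S. (f has_derivative blinfun_apply (f' x)) (at x)) \<and>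
        (\<forall>x\<in>S. (f' has_derivative blinfun_apply (f'' x)) (at x)) \<and>
        continuous_on S f'')"

text \<open>The class \<open>\<F>(A)\<close>. Derivatives at the endpoint \<open>0\<close> of \<open>[0,\<infinity>)\<close> are one-sided. The filter
  \<open>at 0\<close> excludes the point \<open>0\<close> itself; since \<open>f' > 0\<close> on \<open>(0,\<infinity>)\<close>, the function \<open>A\<close> is only
  evaluated at nonzero vectors.\<close>

definition F_class :: "(real ^ 'n \<Rightarrow> real ^ 'n ^ 'n) \<Rightarrow> (real \<Rightarrow> real) set" where
  "F_class A = {f.
     (\<exists>f' f''. (\<forall>r\<ge>0. (f has_real_derivative f' r) (at r within {0..})) \<and>
               (\<forall>r\<ge>0. (f' has_real_derivative f'' r) (at r within {0..})) \<and>
               continuous_on {0..} f'' \<and>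
               f 0 = 0 \<and> f' 0 = 0 \<and> f'' 0 = 0 \<and> (\<forall>r>0. f'' r > 0)) \<and>
     (\<forall>R \<in> {\<lambda>x. f (norm x), \<lambda>x. - f (norm x)}.
        ((\<lambda>x. op_norm (A (gradient R x) ** hessian R x)) \<longlongrightarrow> 0) (at 0))}"

text \<open>The remainder \<open>\<omega> (\<bar>t - t\<^sub>0\<bar>)\<close> is \<open>o(\<bar>t - t\<^sub>0\<bar>)\<close>. The filter \<open>nhds 0\<close> (rather than
  \<open>at 0\<close>) forces \<open>\<omega> 0 = 0\<close>, as required by points with \<open>t = t\<^sub>0\<close>.\<close>

definition C2_compatible ::
  "(real ^ 'n \<Rightarrow> real ^ 'n ^ 'n) \<Rightarrow> ((real ^ 'n) \<times> real) set \<Rightarrow> ((real ^ 'n) \<times> real \<Rightarrow> real) \<Rightarrow> bool" where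
  "C2_compatible A Q \<psi> \<longleftrightarrow> C2_on Q \<psi> \<and>
     (\<forall>(x0, t0)\<in>Q. space_gradient \<psi> (x0, t0) = 0 \<longrightarrow>
        (\<exists>f\<in>F_class A. \<exists>\<omega>::real \<Rightarrow> real. \<omega> \<in> o[nhds 0](\<lambda>s. s) \<and>
          (\<forall>\<^sub>F (x, t) in nhds (x0, t0).
             \<bar>\<psi> (x, t) - \<psi> (x0, t0) - time_deriv \<psi> (x0, t0) * (t - t0)\<bar>
               \<le> f (norm (x - x0)) + \<omega> \<bar>t - t0\<bar>)))"

definition locally_bounded_on :: "'a::topological_space set \<Rightarrow> ('a \<Rightarrow> real) \<Rightarrow> bool" where
  "locally_bounded_on S u \<longleftrightarrow> (\<forall>z\<in>S. \<exists>N. open N \<and> z \<in> N \<and> bounded (u ` (N \<inter> S)))"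

definition usc_on :: "'a::topological_space set \<Rightarrow> ('a \<Rightarrow> real) \<Rightarrow> bool" where
  "usc_on S u \<longleftrightarrow> (\<forall>z\<in>S. \<forall>r>u z. \<forall>\<^sub>F w in at z within S. u w < r)"

definition lsc_on :: "'a::topological_space set \<Rightarrow> ('a \<Rightarrow> real) \<Rightarrow> bool" where
  "lsc_on S u \<longleftrightarrow> (\<forall>z\<in>S. \<forall>r<u z. \<forall>\<^sub>F w in at z within S. r < u w)"

text \<open>Below \<open>Q\<close> is an open set of space-time points, and the equation is
  \<open>\<partial>\<^sub>t u - tr (A(\<nabla>u) \<nabla>\<^sup>2 u) + H(x, t, \<nabla>u) = 0\<close> in \<open>Q\<close>.\<close>

definition F_subsolution ::
  "((real ^ 'n) \<times> real) set \<Rightarrow> (real ^ 'n \<Rightarrow> real ^ 'n ^ 'n) \<Rightarrow>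
   ((real ^ 'n) \<times> real \<Rightarrow> real ^ 'n \<Rightarrow> real) \<Rightarrow> ((real ^ 'n) \<times> real \<Rightarrow> real) \<Rightarrow> bool" where
  "F_subsolution Q A H u \<longleftrightarrow> locally_bounded_on Q u \<and> usc_on Q u \<and>
     (\<forall>\<psi> z0. C2_compatible A Q \<psi> \<and> z0 \<in> Q \<and> (\<forall>\<^sub>F z in nhds z0. u z - \<psi> z \<le> u z0 - \<psi> z0) \<longrightarrow>
        (if space_gradient \<psi> z0 \<noteq> 0
         then time_deriv \<psi> z0 - trace (A (space_gradient \<psi> z0) ** space_hessian \<psi> z0)
                + H z0 (space_gradient \<psi> z0) \<le> 0
         else time_deriv \<psi> z0 + H z0 0 \<le> 0))"

definition F_supersolution ::
  "((real ^ 'n) \<times> real) set \<Rightarrow> (real ^ 'n \<Rightarrow> real ^ 'n ^ 'n) \<Rightarrow>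
   ((real ^ 'n) \<times> real \<Rightarrow> real ^ 'n \<Rightarrow> real) \<Rightarrow> ((real ^ 'n) \<times> real \<Rightarrow> real) \<Rightarrow> bool" where
  "F_supersolution Q A H u \<longleftrightarrow> locally_bounded_on Q u \<and> lsc_on Q u \<and>
     (\<forall>\<psi> z0. C2_compatible A Q \<psi> \<and> z0 \<in> Q \<and> (\<forall>\<^sub>F z in nhds z0. u z - \<psi> z \<ge> u z0 - \<psi> z0) \<longrightarrow>
        (if space_gradient \<psi> z0 \<noteq> 0
         then time_deriv \<psi> z0 - trace (A (space_gradient \<psi> z0) ** space_hessian \<psi> z0)
                + H z0 (space_gradient \<psi> z0) \<ge> 0
         else time_deriv \<psi> z0 + H z0 0 \<ge> 0))"

definition F_solution ::
  "((real ^ 'n) \<times> real) set \<Rightarrow> (real ^ 'n \<Rightarrow> real ^ 'n ^ 'n) \<Rightarrow>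
   ((real ^ 'n) \<times> real \<Rightarrow> real ^ 'n \<Rightarrow> real) \<Rightarrow> ((real ^ 'n) \<times> real \<Rightarrow> real) \<Rightarrow> bool" where
  "F_solution Q A H u \<longleftrightarrow>
     continuous_on Q u \<and> F_subsolution Q A H u \<and> F_supersolution Q A H u"

end

theory Submission
  imports Defs
begin

text \<open>The solutions are compared by doubling the variables: with
  \<open>r = \<epsilon>\<^bsup>\<alpha>/(1+(1-\<theta>)max \<beta> 0)\<^esup>\<close> and \<open>K = L r\<^bsup>\<theta>-k\<^esup>\<close>, maximise
  \<open>u (x, t) - v (y, s) - K |x - y|\<^bsup>k\<^esup> - (t - s)\<^sup>2/(2\<delta>) - l t - \<eta>/(T - t) - \<eta>/(T - s)\<close>.
  The Hoelder bounds give \<open>|x - y| \<le> r\<close> and, for \<open>\<delta> = r\<^bsup>2-\<theta>\<^esup>/(2 L)\<close>, \<open>|t - s| \<le> r\<close>.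
  If a maximum point lies on the parabolic boundary, the boundary values and the
  Hoelder bounds estimate \<open>u - v\<close>. An interior maximum is
  excluded for large \<open>l\<close>. If \<open>x = y\<close>, the function \<open>K |x - y|\<^bsup>k\<^esup>\<close> itself yields compatible test
  functions with vanishing gradient, as (A1) puts a multiple of \<open>r\<^bsup>k\<^esup>\<close> into both classes
  \<open>\<F>\<close>. If \<open>x \<noteq> y\<close>, the theorem on sums gives Hessians \<open>X\<close>, \<open>Y\<close> dominated by the
  Hessian of the penalty, and \<open>tr (A X) + tr (B Y) \<le> C K |x - y|\<^bsup>k-2\<^esup> \<parallel>A\<^bsup>1/2\<^esup> - B\<^bsup>1/2\<^esup>\<parallel>\<^sup>2\<close>,
  which by (C1) and the choice of \<open>r\<close> is of order \<open>r\<^bsup>\<theta>\<^esup>\<close>; the lower bound on \<open>\<beta>\<close> makes the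
  power of \<open>|x - y|\<close> in this estimate nonnegative.

  The theorem on sums rests on a second-order expansion of semiconvex functions near touching
  points. As the resolvent of a convex function is Lipschitz, this follows from Rademacher's
  theorem, which in turn is reduced to lines and there follows from Vitali's covering theorem.\<close>

section \<open>Differentiability of Lipschitz functions\<close>

text \<open>The obstacle is the equation at vanishing gradient. At each of its critical points in
  the cylinder a test function must be dominated by a member of \<F>, and members have second
  derivative 0 at 0. For x \<noteq> y the same rule forbids an arbitrary paraboloid as test
  function: it has to be modified so that no critical points are left.

  The scale r balances the errors. At |x - y| = r the penalty has gradient k L r^(\<theta>-1) and
  Hessian of order r^(\<theta>-2); multiplied by the square \<epsilon>^(2\<alpha>) (1 +
  |gradient|^(2\<beta>)) from (C1), the Hessian gives r^\<theta> once \<epsilon>^\<alpha> =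
  r^(1+(1-\<theta>) max \<beta> 0). The Lipschitz error of H and the passage from two points to one
  cost r^\<theta> as well, whence \<nu>. Choosing \<delta> of order r^(2-\<theta>) gives the time
  penalty the same scale. The constant must be fixed before \<Omega>, \<alpha>, c_H and \<gamma>, so
  these enter through r and l alone.\<close>

lemma vitali_measure_compare:
  fixes E :: "'a::euclidean_space set" and M1 M2 :: "'a measure" and q1 q2 :: ennreal
  assumes E: "E \<in> sets borel" and s1: "sets M1 = sets borel" and s2: "sets M2 = sets borel"
    and ac: "\<And>A. A \<in> null_sets lborel \<Longrightarrow> emeasure M1 A = 0"
    and reg: "\<And>e. e > 0 \<Longrightarrow> \<exists>G. open G \<and> E \<subseteq> G \<and> emeasure M2 G \<le> emeasure M2 E + ennreal e"
    and cover: "\<And>t d. t \<in> E \<Longrightarrow> d > 0 \<Longrightarrow> \<exists>x r. 0 < r \<and> r < d \<and> t \<in> cball x r \<and>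
       q1 * emeasure M1 (cball x r) \<le> q2 * emeasure M2 (cball x r)"
    and q2: "q2 < \<infinity>"
  shows "q1 * emeasure M1 E \<le> q2 * emeasure M2 E"
proof -
  have *: "q1 * emeasure M1 E \<le> q2 * (emeasure M2 E + ennreal e)" if e: "e > 0" for e
  proof -
    obtain G where G: "open G" "E \<subseteq> G" "emeasure M2 G \<le> emeasure M2 E + ennreal e"
      using reg[OF e] by blast
    \<comment> \<open>Balls inside \<open>G\<close> with the assumed ratio form a Vitali cover of
      \<open>E\<close>. The disjoint subfamily covers \<open>E\<close> up to a Lebesgue null set,
      invisible to \<open>M1\<close> by \<open>ac\<close>, and its union lies in \<open>G\<close>,
      whose \<open>M2\<close>-measure exceeds that of \<open>E\<close> by at most \<open>e\<close>.
      This is why absolute continuity concerns \<open>M1\<close> and outer regularity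
      \<open>M2\<close>.\<close>
    define K where "K = {(x, r). 0 < r \<and> cball x r \<subseteq> G \<and>
       q1 * emeasure M1 (cball x r) \<le> q2 * emeasure M2 (cball x r)}"
    have "\<exists>i. i \<in> K \<and> t \<in> cball (fst i) (snd i) \<and> snd i < d" if t: "t \<in> E" and d: "0 < d" for t d
    proof -
      obtain h where h: "h > 0" "ball t h \<subseteq> G" using G t by (meson openE subsetD)
      define d' where "d' = min d (h/2)"
      have "d' > 0" using d h by (auto simp: d'_def)
      from cover[OF t this] obtain x r where xr: "0 < r" "r < d'" "t \<in> cball x r"
        "q1 * emeasure M1 (cball x r) \<le> q2 * emeasure M2 (cball x r)" by blast
      have "cball x r \<subseteq> ball t h"
      proof
        fix y assume "y \<in> cball x r"
        then have "dist t y \<le> 2 * r" using xr(3) using dist_triangle[of t y x] by (auto simp: dist_commute)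
        then show "y \<in> ball t h" using xr(2) by (simp add: d'_def)
      qed
      then have "(x, r) \<in> K" using xr h by (auto simp: K_def)
      then show ?thesis using xr by (intro exI[of _ "(x, r)"]) (auto simp: d'_def)
    qed
    moreover have "0 < snd i" if "i \<in> K" for i using that by (auto simp: K_def)
    ultimately obtain C where C: "countable C" "C \<subseteq> K"
      "pairwise (\<lambda>i j. disjnt (cball (fst i) (snd i)) (cball (fst j) (snd j))) C"
      "negligible (E - (\<Union>i\<in>C. cball (fst i) (snd i)))"
      using Vitali_covering_theorem_cballs[of K snd E fst] by blast
    let ?B = "\<lambda>i. cball (fst i) (snd i)"
    let ?U = "\<Union>i\<in>C. ?B i"
    have U: "?U \<in> sets borel" using C(1) by auto
    have dis: "disjoint_family_on ?B C"
      using C(3) by (auto simp: disjoint_family_on_def pairwise_def disjnt_def)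
    have "E - ?U \<in> sets borel" using E U by auto
    then have "E - ?U \<in> null_sets lborel"
      using C(4) by (auto simp: negligible_iff_null_sets null_sets_def)
    then have n: "emeasure M1 (E - ?U) = 0" by (rule ac)
    have "emeasure M1 E \<le> emeasure M1 (?U \<union> (E - ?U))"
      using E U s1 by (intro emeasure_mono) auto
    also have "\<dots> \<le> emeasure M1 ?U + emeasure M1 (E - ?U)"
      using E U s1 by (intro emeasure_subadditive) auto
    finally have "emeasure M1 E \<le> emeasure M1 ?U" using n by simp
    then have "q1 * emeasure M1 E \<le> q1 * emeasure M1 ?U" by (rule mult_left_mono) simp
    also have "emeasure M1 ?U = (\<integral>\<^sup>+i. emeasure M1 (?B i) \<partial>count_space C)"
      using C(1) dis s1 by (intro emeasure_UN_countable) auto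
    also have "q1 * \<dots> = (\<integral>\<^sup>+i. q1 * emeasure M1 (?B i) \<partial>count_space C)"
      by (simp add: nn_integral_cmult)
    also have "\<dots> \<le> (\<integral>\<^sup>+i. q2 * emeasure M2 (?B i) \<partial>count_space C)"
      using C(2) by (intro nn_integral_mono) (auto simp: K_def)
    also have "\<dots> = q2 * (\<integral>\<^sup>+i. emeasure M2 (?B i) \<partial>count_space C)"
      by (simp add: nn_integral_cmult)
    also have "(\<integral>\<^sup>+i. emeasure M2 (?B i) \<partial>count_space C) = emeasure M2 ?U"
      using C(1) dis s2 by (intro emeasure_UN_countable[symmetric]) auto
    also have "q2 * \<dots> \<le> q2 * emeasure M2 G"
    proof (intro mult_left_mono emeasure_mono)
      show "?U \<subseteq> G" using C(2) by (fastforce simp: K_def)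
    qed (use G(1) s2 in auto)
    also have "\<dots> \<le> q2 * (emeasure M2 E + ennreal e)"
      using G(3) by (intro mult_left_mono) auto
    finally show ?thesis .
  qed
  show ?thesis
  proof (rule ennreal_le_epsilon)
    fix e :: real assume e: "0 < e"
    obtain q where q: "q2 = ennreal q" "q \<ge> 0" using q2 by (cases q2) auto
    \<comment> \<open>\<open>q + 1\<close> instead of \<open>q\<close> keeps the divisor positive
      when \<open>q = 0\<close>.\<close>
    have "q1 * emeasure M1 E \<le> q2 * (emeasure M2 E + ennreal (e / (q + 1)))"
      using * e q by auto
    also have "\<dots> = q2 * emeasure M2 E + ennreal (q * (e / (q + 1)))"
      using q e by (simp add: distrib_left ennreal_mult[symmetric])
    also have "\<dots> \<le> q2 * emeasure M2 E + ennreal e"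
      using q e by (intro add_left_mono ennreal_leI) (simp add: field_simps)
    finally show "q1 * emeasure M1 E \<le> q2 * emeasure M2 E + ennreal e" .
  qed
qed

section \<open>Almost everywhere differentiability on the real line\<close>

lemma lborel_outer_open:
  assumes "E \<in> sets borel" "e > 0"
  shows "\<exists>G. open G \<and> E \<subseteq> G \<and> emeasure lborel G \<le> emeasure lborel E + ennreal e"
proof -
  have "E \<in> sets lebesgue" using assms by auto
  from sets_lebesgue_outer_open[OF this \<open>e > 0\<close>] obtain G where
    G: "open G" "E \<subseteq> G" "G - E \<in> lmeasurable" "emeasure lebesgue (G - E) < ennreal e" by metis
  have "emeasure lborel G = emeasure lborel (E \<union> (G - E))" using G(2) by (simp add: Un_absorb1)
  also have "\<dots> \<le> emeasure lborel E + emeasure lborel (G - E)"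
    using assms G by (intro emeasure_subadditive) auto
  also have "\<dots> \<le> emeasure lborel E + ennreal e"
    using G assms by (intro add_left_mono) (simp add: order_less_imp_le)
  finally show ?thesis using G by blast
qed

text \<open>Where the derivative fails to exist, rationals p < q separate the lower from the upper
  limit of the difference quotients. Let M measure a set by the length of its image under
  \<open>G\<close>. The Vitali comparison bounds M on the exceptional set by p times Lebesgue
  measure from above and by q times from below, so the set is null. Slopes of at least 1 give
  \<open>G\<close> a 1-Lipschitz inverse, through which \<open>M\<close> is a push-forward.\<close>

lemma bilipschitz_real_differentiable_ae:
  fixes G :: "real \<Rightarrow> real"
  assumes lo: "\<And>s t. s \<le> t \<Longrightarrow> t - s \<le> G t - G s"
    and up: "\<And>s t. s \<le> t \<Longrightarrow> G t - G s \<le> c * (t - s)"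
  shows "negligible {t. \<not> G differentiable at t}"
proof -
  have c1: "c \<ge> 1" using lo[of 0 1] up[of 0 1] by auto
  have lip: "\<bar>G t - G s\<bar> \<le> c * \<bar>t - s\<bar>" for s t
    using lo[of s t] up[of s t] lo[of t s] up[of t s] by (cases "s \<le> t") (auto simp: abs_if)
  have cont: "continuous_on UNIV G"
    by (rule lipschitz_on_continuous_on[of c])
      (use lip c1 in \<open>auto simp: lipschitz_on_def dist_real_def abs_minus_commute\<close>)
  have sm: "s < t \<Longrightarrow> G s < G t" for s t using lo[of s t] by auto
  have inj: "inj G" by (metis injI less_irrefl linorder_neqE_linordered_idom sm)
  have "\<exists>x. G x = y" for y
  proof -
    let ?a = "- \<bar>y - G 0\<bar>" and ?b = "\<bar>y - G 0\<bar>"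
    have "G ?a \<le> y" using lo[of ?a 0] by auto
    moreover have "y \<le> G ?b" using lo[of 0 ?b] by auto
    ultimately show ?thesis
      using IVT'[of G ?a y ?b] continuous_on_subset[OF cont] by auto
  qed
  then have surj: "surj G" by (metis surjI)
  define J where "J = inv G"
  have GJ: "G (J y) = y" for y unfolding J_def by (rule surj_f_inv_f[OF surj])
  have JG: "J (G x) = x" for x unfolding J_def by (rule inv_f_f[OF inj])
  have Jlip: "\<bar>J y - J x\<bar> \<le> \<bar>y - x\<bar>" for x y
    using lo[of "J x" "J y"] lo[of "J y" "J x"] GJ by (cases "J x \<le> J y") auto
  have Jcont: "continuous_on UNIV J"
    by (rule lipschitz_on_continuous_on[of 1]) (use Jlip in \<open>auto simp: lipschitz_on_def dist_real_def\<close>)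
  have Jm: "J \<in> lborel \<rightarrow>\<^sub>M borel" using Jcont by (simp add: borel_measurable_continuous_onI)
  define M where "M = distr lborel borel J"
  have sM: "sets M = sets borel" by (simp add: M_def)
  have vim: "J -` A = G ` A" for A proof safe
    fix x assume "J x \<in> A" then show "x \<in> G ` A" using GJ[of x] by (metis imageI)
  qed (simp add: JG)
  have eM: "emeasure M A = emeasure lborel (G ` A)" if "A \<in> sets borel" for A
    using emeasure_distr[OF Jm that] by (simp add: M_def vim)
  have GB: "G ` A \<in> sets borel" if "A \<in> sets borel" for A
    using measurable_sets[OF Jm that] by (simp add: vim)
  have Gball: "G ` cball x r = {G (x - r)..G (x + r)}" if "r > 0" for x r
  proof safe
    fix y assume "y \<in> cball x r"
    then have "x - r \<le> y" "y \<le> x + r" by (auto simp: dist_real_def)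
    then show "G y \<in> {G (x - r)..G (x + r)}" using lo[of "x-r" y] lo[of y "x+r"] by auto
  next
    fix y assume y: "y \<in> {G (x - r)..G (x + r)}"
    have "x - r \<le> J y \<and> J y \<le> x + r"
      using y sm[of "J y" "x - r"] sm[of "x + r" "J y"] GJ[of y] by force
    then have "J y \<in> cball x r" by (auto simp: dist_real_def)
    then show "y \<in> G ` cball x r" using GJ[of y] by (metis imageI)
  qed
  have Mball: "emeasure M (cball x r) = ennreal (G (x + r) - G (x - r))" if "r > 0" for x r
    using that lo[of "x - r" "x + r"] by (subst eM) (auto simp: Gball[OF that])
  have Lball: "emeasure lborel (cball x r) = ennreal (2 * r)" if "r > 0" for x r :: real
    using that by (simp add: cball_eq_atLeastAtMost)
  have acM: "emeasure M A = 0" if "A \<in> null_sets lborel" for A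
  proof -
    have "negligible A" using that by (simp add: negligible_iff_null_sets null_sets_completionI)
    have "negligible (G ` A)"
      by (rule negligible_locally_Lipschitz_image[OF _ \<open>negligible A\<close>])
        (use lip in \<open>auto intro!: exI[of _ UNIV] exI[of _ c]\<close>)
    have A: "A \<in> sets borel" using null_setsD2[OF that] by simp
    show ?thesis
      using \<open>negligible (G ` A)\<close> GB[OF A] by (simp add: eM[OF A] negligible_iff_null_sets null_sets_def)
  qed
  have regM: "\<exists>U. open U \<and> E \<subseteq> U \<and> emeasure M U \<le> emeasure M E + ennreal e"
    if E: "E \<in> sets borel" and e: "e > 0" for E e
  proof -
    obtain W where W: "open W" "G ` E \<subseteq> W" "emeasure lborel W \<le> emeasure lborel (G ` E) + ennreal e"
      using lborel_outer_open[OF GB[OF E] e] by blast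
    have o: "open (G -` W)" using W(1) cont by (simp add: open_vimage)
    have "emeasure M (G -` W) \<le> emeasure M E + ennreal e"
      using W o E surj by (simp add: eM surj_image_vimage_eq)
    then show ?thesis using o W(2) by (intro exI[of _ "G -` W"]) auto
  qed
  \<comment> \<open>The short intervals need only contain \<open>t\<close> in their interior, not be
    centred at it: this makes \<open>Lo p n\<close> and \<open>Up q n\<close> open, hence
    \<open>E p q\<close> Borel, and it is what \<open>vitali_measure_compare\<close>
    accepts.\<close>
  define Lo where "Lo p n = {t. \<exists>x r. t \<in> ball x r \<and> 0 < r \<and> r < 1 / real (Suc n)
      \<and> G (x + r) - G (x - r) < p * (2 * r)}" for p n
  define Up where "Up q n = {t. \<exists>x r. t \<in> ball x r \<and> 0 < r \<and> r < 1 / real (Suc n)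
      \<and> G (x + r) - G (x - r) > q * (2 * r)}" for q n
  have oLo: "open (Lo p n)" for p n
  proof -
    have "Lo p n = (\<Union>(x, r)\<in>{(x, r). 0 < r \<and> r < 1 / real (Suc n) \<and> G (x + r) - G (x - r)
        < p * (2 * r)}. ball x r)"
      unfolding Lo_def by fast
    then show ?thesis by (auto intro!: open_UN)
  qed
  have oUp: "open (Up p n)" for p n
  proof -
    have "Up p n = (\<Union>(x, r)\<in>{(x, r). 0 < r \<and> r < 1 / real (Suc n)
        \<and> G (x + r) - G (x - r) > p * (2 * r)}. ball x r)"
      unfolding Up_def by fast
    then show ?thesis by (auto intro!: open_UN)
  qed
  define E where "E p q = (\<Inter>n. Lo p n) \<inter> (\<Inter>n. Up q n)" for p q
  have null: "negligible (E p q)" if pq: "p < q" for p q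
  proof (cases "q > 0 \<and> p > 0")
    case False
    \<comment> \<open>A way to state that \<open>E p q\<close> is empty. As p < q, this is the case
      p \<le> 0, and slopes of at least 1 leave no interval with ratio below p. The comparison in
      \<open>ennreal\<close> is thus made for positive p and q.\<close>
    have "E p q \<inter> {} = E p q"
    proof (cases "p > 0")
      case True then show ?thesis using False pq by auto
    next
      case np: False
      have "G (x + r) - G (x - r) \<ge> p * (2 * r)" if "r > 0" for x r
      proof -
        have "p * (2 * r) \<le> 0" using np that by (simp add: mult_nonpos_nonneg)
        then show ?thesis using lo[of "x - r" "x + r"] that by auto
      qed
      then have "Lo p 0 = {}" unfolding Lo_def by (auto simp: not_less[symmetric])
      then show ?thesis by (auto simp: E_def)
    qed
    then show ?thesis by simp
  next
    case pos: True
    have "negligible (E p q \<inter> cball 0 (real m))" for m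
    proof -
      define D where "D = E p q \<inter> cball 0 (real m)"
      have DB: "D \<in> sets borel" using oLo oUp by (auto simp: D_def E_def)
      have 1: "1 * emeasure M D \<le> ennreal p * emeasure lborel D"
      proof (rule vitali_measure_compare[OF DB sM _ acM lborel_outer_open[OF DB]])
        fix t d :: real assume t: "t \<in> D" and d: "0 < d"
        obtain n where n: "1 / real (Suc n) < d" using d by (meson nat_approx_posE)
        from t have "t \<in> Lo p n" by (auto simp: D_def E_def)
        then obtain x r where "t \<in> ball x r" "0 < r" "r < 1 / real (Suc n)" "G (x + r) - G (x - r)
            < p * (2 * r)"
          by (auto simp: Lo_def)
        then show "\<exists>x r. 0 < r \<and> r < d \<and> t \<in> cball x r \<and> 1 * emeasure M (cball x r)
            \<le> ennreal p * emeasure lborel (cball x r)"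
          using n pos by (intro exI[of _ x] exI[of _ r]) (auto simp: Mball Lball
            ennreal_mult[symmetric] intro!: ennreal_leI)
      qed auto
      have 2: "ennreal q * emeasure lborel D \<le> 1 * emeasure M D"
      proof (rule vitali_measure_compare[OF DB _ sM _ regM[OF DB]])
        fix t d :: real assume t: "t \<in> D" and d: "0 < d"
        obtain n where n: "1 / real (Suc n) < d" using d by (meson nat_approx_posE)
        from t have "t \<in> Up q n" by (auto simp: D_def E_def)
        then obtain x r where "t \<in> ball x r" "0 < r" "r < 1 / real (Suc n)" "G (x + r)
            - G (x - r) > q * (2 * r)"
          by (auto simp: Up_def)
        then show "\<exists>x r. 0 < r \<and> r < d \<and> t \<in> cball x r \<and> ennreal q * emeasure lborel (cball x r)
            \<le> 1 * emeasure M (cball x r)"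
          using n pos by (intro exI[of _ x] exI[of _ r]) (auto simp: Mball Lball
            ennreal_mult[symmetric] intro!: ennreal_leI)
      qed auto
      have "emeasure lborel D \<le> emeasure lborel (cball (0::real) (real m))"
        by (intro emeasure_mono) (auto simp: D_def)
      then have "emeasure lborel D < \<infinity>" using emeasure_lborel_cball_finite[of "0::real" "real m"] by auto
      then obtain l where l: "emeasure lborel D = ennreal l" "l \<ge> 0" by (cases "emeasure lborel D") auto
      have "ennreal q * emeasure lborel D \<le> ennreal p * emeasure lborel D" using 1 2 by auto
      then have "q * l \<le> p * l" using l pos by (simp add: ennreal_mult[symmetric])
      then have "l = 0" using pq l(2) by (simp add: mult_le_cancel_right)
      then show ?thesis using l DB by (simp add: negligible_iff_null_sets null_sets_def D_def)
    qed
    then have "negligible (\<Union>m. E p q \<inter> cball 0 (real m))" by (intro negligible_countable_Union) auto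
    moreover have "E p q \<subseteq> (\<Union>m. E p q \<inter> cball 0 (real m))"
      using real_arch_simple by (auto simp: dist_real_def)
    ultimately show ?thesis by (rule negligible_subset)
  qed
  have "{t. \<not> G differentiable at t} \<subseteq> (\<Union>(p, q)\<in>{(p, q). p \<in> \<rat> \<and> q \<in> \<rat> \<and> p < q}. E p q)"
  proof (rule subsetI, rule ccontr)
    fix t assume t: "t \<in> {t. \<not> G differentiable at t}"
      and nE: "t \<notin> (\<Union>(p, q)\<in>{(p, q). p \<in> \<rat> \<and> q \<in> \<rat> \<and> p < q}. E p q)"
    define Q where "Q s = (G (t + s) - G t) / s" for s
    have Q1: "1 \<le> Q s" "Q s \<le> c" if "s \<noteq> 0" for s
      using that lo[of t "t+s"] lo[of "t+s" t] up[of t "t+s"] up[of "t+s" t]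
      by (cases "s > 0"; simp add: Q_def field_simps)+
    \<comment> \<open>\<open>Sup S\<close> is the lower limit of the difference quotients at
      \<open>t\<close>.\<close>
    define S where "S = {l. \<exists>d>0. \<forall>s. 0 < \<bar>s\<bar> \<and> \<bar>s\<bar> < d \<longrightarrow> l \<le> Q s}"
    have S1: "1 \<in> S" using Q1 by (auto simp: S_def intro!: exI[of _ 1])
    have Sb: "l \<le> c" if lS: "l \<in> S" for l
    proof -
      obtain d where d: "d > 0" "\<And>s. 0 < \<bar>s\<bar> \<and> \<bar>s\<bar> < d \<Longrightarrow> l \<le> Q s" using lS unfolding S_def by blast
      then have "l \<le> Q (d/2)" by auto
      also have "\<dots> \<le> c" using Q1[of "d/2"] d(1) by auto
      finally show ?thesis .
    qed
    have bdd: "bdd_above S" unfolding bdd_above_def using Sb by blast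
    define l where "l = Sup S"
    have inLo: "t \<in> Lo p n" if s: "\<And>d. d > 0 \<Longrightarrow> \<exists>s. 0 < \<bar>s\<bar> \<and> \<bar>s\<bar> < d \<and> Q s < p" for p n
    proof -
      obtain s where s: "0 < \<bar>s\<bar>" "\<bar>s\<bar> < 1 / real (Suc n)" "Q s < p" using s[of "1 / real (Suc n)"] by auto
      define a where "a = min t (t + s)"
      define b where "b = max t (t + s)"
      have ab: "a < b" "b - a = \<bar>s\<bar>" "a \<le> t" "t \<le> b" "G b - G a < p * (b - a)"
        using s(1,3) by (auto simp: a_def b_def Q_def min_def max_def field_simps split: if_splits)
      \<comment> \<open>\<open>t\<close> is an endpoint of the interval from \<open>a\<close> to
        \<open>b\<close>. Widening it by h/2 on both sides puts \<open>t\<close> inside. The first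
        bound on h keeps the radius below 1/(n+1); the second makes the change, at most (c + |p|) h,
        smaller than the slack in the strict inequality.\<close>
      define h where "h = min (1 / real (Suc n) - \<bar>s\<bar>) ((p * (b - a) - (G b - G a)) / (4 * (c + \<bar>p\<bar>)))"
      have h: "h > 0" "h \<le> 1 / real (Suc n) - \<bar>s\<bar>" "h \<le> (p * (b - a) - (G b - G a)) / (4 * (c + \<bar>p\<bar>))"
        using s ab c1 by (auto simp: h_def)
      have h3: "4 * (c + \<bar>p\<bar>) * h \<le> p * (b - a) - (G b - G a)"
        using h(3) c1 by (simp add: field_simps)
      have "G (b + h/2) - G (a - h/2) \<le> (G b - G a) + c * h"
        using up[of b "b + h/2"] up[of "a - h/2" a] h(1) by (auto simp: algebra_simps)
      moreover have "p * (b - a) \<le> p * (b - a + h) + \<bar>p\<bar> * h" using h(1)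
        by (auto simp: abs_if algebra_simps)
      moreover have "c * h > 0" "\<bar>p\<bar> * h \<ge> 0" using c1 h(1) by auto
      ultimately have "G (b + h/2) - G (a - h/2) < p * (b - a + h)"
        using h3 by (simp add: algebra_simps)
      moreover have "(a + b)/2 + (b - a + h)/2 = b + h/2" "(a + b)/2 - (b - a + h)/2 = a - h/2"
          "2 * ((b - a + h)/2) = b - a + h"
        by (simp_all add: field_simps)
      ultimately have "G ((a + b)/2 + (b - a + h)/2) - G ((a + b)/2 - (b - a + h)/2)
          < p * (2 * ((b - a + h)/2))"
        by (simp only:)
      moreover have "t \<in> ball ((a + b)/2) ((b - a + h)/2)"
        using ab(3,4) h(1) by (auto simp: dist_real_def abs_less_iff field_simps)
      moreover have "0 < (b - a + h)/2" using ab(1) h(1) by simp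
      moreover have "(b - a + h)/2 < 1 / real (Suc n)" using ab(2) h(1,2) s(2) by argo
      ultimately show ?thesis unfolding Lo_def by blast
    qed
    have inUp: "t \<in> Up p n" if s: "\<And>d. d > 0 \<Longrightarrow> \<exists>s. 0 < \<bar>s\<bar> \<and> \<bar>s\<bar> < d \<and> Q s > p" for p n
    proof -
      obtain s where s: "0 < \<bar>s\<bar>" "\<bar>s\<bar> < 1 / real (Suc n)" "Q s > p" using s[of "1 / real (Suc n)"] by auto
      define a where "a = min t (t + s)"
      define b where "b = max t (t + s)"
      have ab: "a < b" "b - a = \<bar>s\<bar>" "a \<le> t" "t \<le> b" "G b - G a > p * (b - a)"
        using s(1,3) by (auto simp: a_def b_def Q_def min_def max_def field_simps split: if_splits)
      define h where "h = min (1 / real (Suc n) - \<bar>s\<bar>) (((G b - G a) - p * (b - a)) / (4 * (c + \<bar>p\<bar>)))"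
      have h: "h > 0" "h \<le> 1 / real (Suc n) - \<bar>s\<bar>" "h \<le> ((G b - G a) - p * (b - a)) / (4 * (c + \<bar>p\<bar>))"
        using s ab c1 by (auto simp: h_def)
      have h3: "4 * (c + \<bar>p\<bar>) * h \<le> (G b - G a) - p * (b - a)"
        using h(3) c1 by (simp add: field_simps)
      have "G (b + h/2) - G (a - h/2) \<ge> (G b - G a)"
        using lo[of b "b + h/2"] lo[of "a - h/2" a] h(1) by (auto simp: algebra_simps)
      moreover have "p * (b - a) \<ge> p * (b - a + h) - \<bar>p\<bar> * h" using h(1)
        by (auto simp: abs_if algebra_simps)
      moreover have "c * h > 0" "\<bar>p\<bar> * h \<ge> 0" using c1 h(1) by auto
      ultimately have "G (b + h/2) - G (a - h/2) > p * (b - a + h)"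
        using h3 by (simp add: algebra_simps)
      moreover have "(a + b)/2 + (b - a + h)/2 = b + h/2" "(a + b)/2 - (b - a + h)/2 = a - h/2"
          "2 * ((b - a + h)/2) = b - a + h"
        by (simp_all add: field_simps)
      ultimately have "G ((a + b)/2 + (b - a + h)/2)
          - G ((a + b)/2 - (b - a + h)/2) > p * (2 * ((b - a + h)/2))"
        by (simp only:)
      moreover have "t \<in> ball ((a + b)/2) ((b - a + h)/2)"
        using ab(3,4) h(1) by (auto simp: dist_real_def abs_less_iff field_simps)
      moreover have "0 < (b - a + h)/2" using ab(1) h(1) by simp
      moreover have "(b - a + h)/2 < 1 / real (Suc n)" using ab(2) h(1,2) s(2) by argo
      ultimately show ?thesis unfolding Up_def by blast
    qed
    have "\<exists>d>0. \<forall>s. 0 < \<bar>s\<bar> \<and> \<bar>s\<bar> < d \<longrightarrow> \<bar>Q s - l\<bar> < e" if e: "e > 0" for e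
    proof -
      obtain l' where l': "l' \<in> S" "l - e < l'"
        using less_cSupD[of S "l - e"] S1 e unfolding l_def by auto
      then obtain d1 where d1: "d1 > 0" "\<And>s. 0 < \<bar>s\<bar> \<and> \<bar>s\<bar> < d1 \<Longrightarrow> l' \<le> Q s" unfolding S_def by blast
      obtain p where p: "p \<in> \<rat>" "l < p" "p < l + e/2" using Rats_dense_in_real[of l "l+e/2"] e by auto
      obtain q where q: "q \<in> \<rat>" "p < q" "q < l + e" using Rats_dense_in_real[of p "l+e"] p e by auto
      \<comment> \<open>p lies above the lower limit, so \<open>t\<close> is in every
        \<open>Lo p n\<close>. Since \<open>t\<close> avoids \<open>E p q\<close>, some
        \<open>Up q n\<close> misses \<open>t\<close>, and the quotients at small scales are at most
        q < l + e.\<close>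
      have "p \<notin> S" using p(2) cSup_upper[OF _ bdd, of p] unfolding l_def by auto
      then have "\<exists>s. 0 < \<bar>s\<bar> \<and> \<bar>s\<bar> < d \<and> Q s < p" if "d > 0" for d
        using that unfolding S_def by (auto simp: not_le)
      then have "t \<in> (\<Inter>n. Lo p n)" using inLo by blast
      moreover have "t \<notin> E p q" using nE p q by auto
      ultimately obtain n where "t \<notin> Up q n" unfolding E_def by auto
      then obtain d2 where d2: "d2 > 0" "\<And>s. 0 < \<bar>s\<bar> \<and> \<bar>s\<bar> < d2 \<Longrightarrow> Q s \<le> q" using inUp[of q n]
        by (meson not_less)
      show ?thesis
      proof (intro exI[of _ "min d1 d2"] conjI allI impI)
        show "0 < min d1 d2" using d1 d2 by auto
        fix s assume "0 < \<bar>s\<bar> \<and> \<bar>s\<bar> < min d1 d2"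
        then have "l' \<le> Q s" "Q s \<le> q" using d1 d2 by auto
        then show "\<bar>Q s - l\<bar> < e" using l' q by auto
      qed
    qed
    then have "Q \<midarrow>0\<rightarrow> l" unfolding LIM_def by (auto simp: dist_real_def)
    then have "(G has_field_derivative l) (at t)" unfolding DERIV_def Q_def .
    then show False using t by (auto simp: real_differentiable_def)
  qed
  moreover have "negligible (\<Union>(p, q)\<in>{(p, q). p \<in> \<rat> \<and> q \<in> \<rat> \<and> p < q}. E p q)"
  proof (rule negligible_countable_Union)
    have "countable {(p::real, q). p \<in> \<rat> \<and> q \<in> \<rat> \<and> p < q}"
      by (rule countable_subset[of _ "\<rat> \<times> \<rat>"]) (auto simp: countable_rat)
    then show "countable ((\<lambda>(p, q). E p q) ` {(p, q). p \<in> \<rat> \<and> q \<in> \<rat> \<and> p < q})" by auto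
  qed (use null in auto)
  ultimately show ?thesis by (rule negligible_subset[rotated])
qed

lemma lipschitz_real_differentiable_ae:
  fixes F :: "real \<Rightarrow> real"
  assumes "\<And>s t. \<bar>F t - F s\<bar> \<le> L * \<bar>t - s\<bar>"
  shows "negligible {t. \<not> F differentiable at t}"
proof -
  \<comment> \<open>The added slope L + 1 moves the difference quotients from [-L, L] into
    [1, 2 L + 1].\<close>
  define G where "G t = F t + (L + 1) * t" for t
  have "negligible {t. \<not> G differentiable at t}"
  proof (rule bilipschitz_real_differentiable_ae[where c = "2 * L + 1"])
    fix s t :: real assume "s \<le> t"
    then show "t - s \<le> G t - G s" "G t - G s \<le> (2 * L + 1) * (t - s)"
      using assms[of t s] by (auto simp: G_def algebra_simps abs_le_iff)
  qed
  moreover have "F differentiable at t" if "G differentiable at t" for t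
  proof -
    have "(\<lambda>t. G t - (L + 1) * t) differentiable at t" using that by (intro derivative_intros) auto
    then show ?thesis by (simp add: G_def)
  qed
  ultimately show ?thesis by (metis (mono_tags, lifting) Collect_mono negligible_subset)
qed

text \<open>Tonelli for the shear \<open>(x, t) \<mapsto> x + t v\<close>, so that no coordinates adapted to \<open>v\<close> are needed.\<close>

lemma negligible_if_negligible_on_lines:
  fixes A :: "'a::euclidean_space set" and v :: 'a
  assumes A: "A \<in> sets borel" and lines: "\<And>x. negligible {t::real. x + t *\<^sub>R v \<in> A}"
  shows "negligible A"
proof -
  have m: "(\<lambda>(x, t). indicator A (x + t *\<^sub>R v) :: ennreal) \<in> borel_measurable
      (lborel \<Otimes>\<^sub>M (lborel :: real measure))"
  proof -
    have "(\<lambda>p::'a \<times> real. fst p + snd p *\<^sub>R v) \<in> borel_measurable (lborel \<Otimes>\<^sub>M (lborel :: real measure))"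
      by (intro borel_measurable_add borel_measurable_scaleR) auto
    then show ?thesis using A by (auto simp: case_prod_beta intro!: borel_measurable_indicator'
      measurable_sets_borel)
  qed
  have "(\<integral>\<^sup>+x. \<integral>\<^sup>+t. indicator A (x + t *\<^sub>R v) \<partial>(lborel::real measure) \<partial>lborel) = 0"
  proof -
    have "(\<integral>\<^sup>+t. indicator A (x + t *\<^sub>R v) \<partial>(lborel::real measure)) = 0" for x
    proof -
      have B: "{t. x + t *\<^sub>R v \<in> A} \<in> sets borel"
      proof -
        have "(\<lambda>t::real. x + t *\<^sub>R v) \<in> borel_measurable borel" by simp
        from measurable_sets[OF this A] show ?thesis by (simp add: vimage_def)
      qed
      have "(\<integral>\<^sup>+t. indicator A (x + t *\<^sub>R v) \<partial>(lborel::real measure))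
          = (\<integral>\<^sup>+t. indicator {t. x + t *\<^sub>R v \<in> A} t \<partial>lborel)"
        by (intro nn_integral_cong) (auto simp: indicator_def)
      also have "\<dots> = emeasure lborel {t. x + t *\<^sub>R v \<in> A}" using B by simp
      also have "\<dots> = 0" using lines[of x] B by (simp add: negligible_iff_null_sets null_sets_def)
      finally show ?thesis .
    qed
    then show ?thesis by simp
  qed
  also have "(\<integral>\<^sup>+x. \<integral>\<^sup>+t. indicator A (x + t *\<^sub>R v) \<partial>(lborel::real measure) \<partial>lborel)
      = (\<integral>\<^sup>+t. \<integral>\<^sup>+x. indicator A (x + t *\<^sub>R v) \<partial>lborel \<partial>(lborel::real measure))"
    using lborel_pair.Fubini'[OF m] by simp
  also have "(\<lambda>t::real. \<integral>\<^sup>+x. indicator A (x + t *\<^sub>R v) \<partial>lborel) = (\<lambda>t. emeasure lborel A)"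
  proof
    fix t :: real
    have "(\<integral>\<^sup>+x. indicator A (x + t *\<^sub>R v) \<partial>lborel) = (\<integral>\<^sup>+y. indicator A y \<partial>distr lborel borel ((+) (t *\<^sub>R v)))"
      using A by (subst nn_integral_distr) (auto simp: add.commute)
    also have "\<dots> = emeasure lborel A" using A by (simp add: lborel_distr_plus)
    finally show "(\<integral>\<^sup>+x. indicator A (x + t *\<^sub>R v) \<partial>lborel) = emeasure lborel A" .
  qed
  finally have "emeasure lborel A * \<infinity> = 0" by simp
  then have "emeasure lborel A = 0" by simp
  then show ?thesis using A by (simp add: negligible_iff_null_sets null_sets_def)
qed

section \<open>Directional derivatives and Rademacher's theorem\<close>

lemma countable_if_separated:
  fixes S :: "real set"
  assumes d: "d > 0" and sep: "\<And>s t. s \<in> S \<Longrightarrow> t \<in> S \<Longrightarrow> s < t \<Longrightarrow> t - s \<ge> d"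
  shows "countable S"
proof -
  have "inj_on (\<lambda>t. \<lfloor>t / d\<rfloor>) S"
  proof (rule linorder_inj_onI')
    fix s t assume "s \<in> S" "t \<in> S" "s < t"
    from sep[OF this] have "(s + d) / d \<le> t / d" using d by (intro divide_right_mono) auto
    then have "s / d + 1 \<le> t / d" using d by (simp add: add_divide_distrib)
    then show "\<lfloor>s / d\<rfloor> \<noteq> \<lfloor>t / d\<rfloor>" by linarith
  qed
  then show ?thesis by (metis countableI_type countable_image_inj_on)
qed

definition dir_quot :: "('a::real_normed_vector \<Rightarrow> real) \<Rightarrow> 'a \<Rightarrow> 'a \<Rightarrow> real \<Rightarrow> real" where
  "dir_quot F x v s = (F (x + s *\<^sub>R v) - F x) / s"

definition has_dir_deriv :: "('a::real_normed_vector \<Rightarrow> real) \<Rightarrow> 'a \<Rightarrow> 'a \<Rightarrow> real \<Rightarrow> bool" where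
  "has_dir_deriv F x v a \<longleftrightarrow> (dir_quot F x v \<longlongrightarrow> a) (at 0)"

lemma has_dir_deriv_unique: "has_dir_deriv F x v a \<Longrightarrow> has_dir_deriv F x v b \<Longrightarrow> a = b"
  unfolding has_dir_deriv_def by (rule tendsto_unique) auto

lemma has_dir_derivD:
  assumes "has_dir_deriv F x v a" "e > 0"
  shows "\<exists>d>0. \<forall>s. 0 < \<bar>s\<bar> \<and> \<bar>s\<bar> < d \<longrightarrow> \<bar>F (x + s *\<^sub>R v) - F x - s * a\<bar> \<le> e * \<bar>s\<bar>"
proof -
  obtain d where d: "d > 0" "\<And>s. 0 < \<bar>s\<bar> \<Longrightarrow> \<bar>s\<bar> < d \<Longrightarrow> \<bar>dir_quot F x v s - a\<bar> < e"
    using assms(1)[unfolded has_dir_deriv_def LIM_def, rule_format, OF assms(2)]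
    by (auto simp: dist_real_def)
  show ?thesis
  proof (intro exI[of _ d] conjI allI impI)
    fix s assume s: "0 < \<bar>s\<bar> \<and> \<bar>s\<bar> < d"
    then have "\<bar>F (x + s *\<^sub>R v) - F x - s * a\<bar> = \<bar>dir_quot F x v s - a\<bar> * \<bar>s\<bar>"
      unfolding abs_mult[symmetric] by (simp add: dir_quot_def ring_distribs
        nonzero_divide_mult_cancel_right flip: diff_divide_distrib) (simp add: diff_divide_distrib
        mult.commute)
    also have "\<dots> \<le> e * \<bar>s\<bar>" using d(2)[of s] s by (intro mult_right_mono) auto
    finally show "\<bar>F (x + s *\<^sub>R v) - F x - s * a\<bar> \<le> e * \<bar>s\<bar>" .
  qed (use d in auto)
qed

lemma has_dir_deriv_scale:
  assumes "has_dir_deriv F x v a"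
  shows "has_dir_deriv F x (c *\<^sub>R v) (c * a)"
proof (cases "c = 0")
  case True
  then show ?thesis by (simp add: has_dir_deriv_def dir_quot_def[abs_def])
next
  case False
  have "((\<lambda>s. dir_quot F x v (c * s)) \<longlongrightarrow> a) (at 0)"
  proof (rule filterlim_compose[OF assms[unfolded has_dir_deriv_def]])
    show "filterlim ((*) c) (at 0) (at 0)"
      using False by (auto simp: filterlim_at eventually_at_filter intro!: tendsto_eq_intros)
  qed
  then have "((\<lambda>s. c * dir_quot F x v (c * s)) \<longlongrightarrow> c * a) (at 0)" by (intro tendsto_intros)
  moreover have "(\<lambda>s. c * dir_quot F x v (c * s)) = dir_quot F x (c *\<^sub>R v)"
    using False by (auto simp: dir_quot_def fun_eq_iff mult.commute)
  ultimately show ?thesis by (simp add: has_dir_deriv_def)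
qed

text \<open>Along each line in direction v the function is Lipschitz in one variable. What remains
  before Tonelli applies is the measurability of the exceptional set.\<close>

lemma lipschitz_dir_deriv_ae:
  fixes F :: "'a::euclidean_space \<Rightarrow> real" and v :: 'a
  assumes lip: "\<And>x y. \<bar>F x - F y\<bar> \<le> L * norm (x - y)"
  shows "negligible {x. \<nexists>a. has_dir_deriv F x v a}"
proof (rule negligible_if_negligible_on_lines)
  have L0: "L \<ge> 0"
  proof -
    obtain b :: 'a where "b \<in> Basis" using nonempty_Basis by blast
    then show ?thesis using lip[of b 0] by (auto simp: abs_ge_zero intro: order_trans[OF abs_ge_zero])
  qed
  have cF: "continuous_on UNIV F"
    by (rule lipschitz_on_continuous_on[of L])
      (use lip L0 in \<open>auto simp: lipschitz_on_def dist_real_def dist_norm\<close>)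
  \<comment> \<open>The existence of the limit is written as a Cauchy condition. As \<open>F\<close>
    is continuous, each \<open>Z n m\<close> is closed, so the exceptional set is Borel.\<close>
  define Z where "Z n m = {x. \<forall>s t. 0 < \<bar>s\<bar> \<and> \<bar>s\<bar> < 1 / real (Suc m) \<and> 0 < \<bar>t\<bar> \<and> \<bar>t\<bar> < 1 / real (Suc m) \<longrightarrow>
       \<bar>dir_quot F x v s - dir_quot F x v t\<bar> \<le> 1 / real (Suc n)}" for n m
  have clZ: "closed (Z n m)" for n m
  proof -
    have "closed {x. \<bar>dir_quot F x v s - dir_quot F x v t\<bar> \<le> 1 / real (Suc n)}" for s t
    proof (intro closed_Collect_le continuous_intros)
      have "continuous_on UNIV (\<lambda>x. dir_quot F x v s)" for s
        unfolding dir_quot_def divide_inverse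
        by (intro continuous_intros continuous_on_compose2[OF cF]) auto
      then show "continuous_on UNIV (\<lambda>x. dir_quot F x v s)"
        "continuous_on UNIV (\<lambda>x. dir_quot F x v t)" by auto
    qed
    moreover have "Z n m = (\<Inter>s\<in>{s. 0 < \<bar>s\<bar> \<and> \<bar>s\<bar> < 1 / real (Suc m)}. \<Inter>t\<in>{t. 0 < \<bar>t\<bar> \<and> \<bar>t\<bar>
        < 1 / real (Suc m)}.
        {x. \<bar>dir_quot F x v s - dir_quot F x v t\<bar> \<le> 1 / real (Suc n)})"
      unfolding Z_def by blast
    ultimately show ?thesis by (auto intro!: closed_INT)
  qed
  have eq: "{x. \<exists>a. has_dir_deriv F x v a} = (\<Inter>n. \<Union>m. Z n m)"
  proof (intro equalityI subsetI)
    fix x assume "x \<in> {x. \<exists>a. has_dir_deriv F x v a}"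
    then obtain a where a: "(dir_quot F x v \<longlongrightarrow> a) (at 0)" by (auto simp: has_dir_deriv_def)
    have "\<exists>m. x \<in> Z n m" for n
    proof -
      obtain d where d: "d > 0" "\<And>s. 0 < \<bar>s\<bar> \<Longrightarrow> \<bar>s\<bar> < d \<Longrightarrow> \<bar>dir_quot F x v s - a\<bar> < 1 / real (Suc n) / 2"
        using a[unfolded LIM_def, rule_format, of "1 / real (Suc n) / 2"] by (auto simp: dist_real_def)
      obtain m where m: "1 / real (Suc m) < d" using d by (meson nat_approx_posE)
      have "x \<in> Z n m" unfolding Z_def
      proof (intro CollectI allI impI)
        fix s t assume st: "0 < \<bar>s\<bar> \<and> \<bar>s\<bar> < 1 / real (Suc m) \<and> 0 < \<bar>t\<bar> \<and> \<bar>t\<bar> < 1 / real (Suc m)"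
        then have "\<bar>dir_quot F x v s - a\<bar> < 1 / real (Suc n) / 2" "\<bar>dir_quot F x v t - a\<bar>
            < 1 / real (Suc n) / 2"
          using d(2)[of s] d(2)[of t] m by auto
        moreover have "\<bar>p - q\<bar> \<le> e" if "\<bar>p - a\<bar> < e / 2" "\<bar>q - a\<bar> < e / 2" for p q e :: real
          using that by linarith
        ultimately show "\<bar>dir_quot F x v s - dir_quot F x v t\<bar> \<le> 1 / real (Suc n)" by blast
      qed
      then show ?thesis ..
    qed
    then show "x \<in> (\<Inter>n. \<Union>m. Z n m)" by auto
  next
    fix x assume x: "x \<in> (\<Inter>n. \<Union>m. Z n m)"
    define q where "q j = dir_quot F x v (1 / real (Suc j))" for j
    have key: "\<exists>m. \<forall>s j. 0 < \<bar>s\<bar> \<and> \<bar>s\<bar> < 1 / real (Suc m) \<and> j > m \<longrightarrow> \<bar>dir_quot F x v s - q j\<bar>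
        \<le> 1 / real (Suc n)" for n
    proof -
      obtain m where m: "x \<in> Z n m" using x by auto
      show ?thesis
      proof (intro exI[of _ m] allI impI)
        fix s j assume s: "0 < \<bar>s\<bar> \<and> \<bar>s\<bar> < 1 / real (Suc m) \<and> j > m"
        then have "\<bar>1 / real (Suc j)\<bar> < 1 / real (Suc m)" "0 < \<bar>1 / real (Suc j)\<bar>"
          by (auto simp: field_simps)
        then show "\<bar>dir_quot F x v s - q j\<bar> \<le> 1 / real (Suc n)" using m s unfolding Z_def q_def by blast
      qed
    qed
    have "Cauchy q"
    proof (rule metric_CauchyI)
      fix e :: real assume "e > 0"
      then obtain n where n: "1 / real (Suc n) < e" by (meson nat_approx_posE)
      obtain m where m: "x \<in> Z n m" using x by auto
      show "\<exists>M. \<forall>i\<ge>M. \<forall>j\<ge>M. dist (q i) (q j) < e"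
      proof (intro exI[of _ "Suc m"] allI impI)
        fix i j assume "Suc m \<le> i" "Suc m \<le> j"
        then have "\<bar>1 / real (Suc j)\<bar> < 1 / real (Suc m)" "0 < \<bar>1 / real (Suc j)\<bar>"
           "\<bar>1 / real (Suc i)\<bar> < 1 / real (Suc m)" "0 < \<bar>1 / real (Suc i)\<bar>" by (auto simp: field_simps)
        then have "\<bar>q i - q j\<bar> \<le> 1 / real (Suc n)" using m unfolding Z_def q_def by blast
        then show "dist (q i) (q j) < e" using n by (simp add: dist_real_def)
      qed
    qed
    then obtain a where a: "q \<longlonglongrightarrow> a" using Cauchy_convergent convergent_def by blast
    have "(dir_quot F x v \<longlongrightarrow> a) (at 0)" unfolding LIM_def
    proof (intro allI impI)
      fix e :: real assume "e > 0"
      then obtain n where n: "1 / real (Suc n) < e" by (meson nat_approx_posE)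
      obtain m where m: "\<And>s j. 0 < \<bar>s\<bar> \<and> \<bar>s\<bar> < 1 / real (Suc m) \<and> j > m \<Longrightarrow> \<bar>dir_quot F x v s - q j\<bar>
          \<le> 1 / real (Suc n)"
        using key[of n] by blast
      have "dist (dir_quot F x v s) a < e" if s: "s \<noteq> 0" "dist s 0 < 1 / real (Suc m)" for s
      proof -
        have "(\<lambda>j. \<bar>dir_quot F x v s - q j\<bar>) \<longlonglongrightarrow> \<bar>dir_quot F x v s - a\<bar>" by (intro tendsto_intros a)
        moreover have "\<forall>\<^sub>F j in sequentially. \<bar>dir_quot F x v s - q j\<bar> \<le> 1 / real (Suc n)"
          using eventually_gt_at_top[of m] by eventually_elim (use m s in \<open>auto simp: dist_real_def\<close>)
        ultimately have "\<bar>dir_quot F x v s - a\<bar> \<le> 1 / real (Suc n)" by (rule tendsto_upperbound) auto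
        then show ?thesis using n by (simp add: dist_real_def)
      qed
      then show "\<exists>d>0. \<forall>s. s \<noteq> 0 \<and> dist s 0 < d \<longrightarrow> dist (dir_quot F x v s) a < e"
        by (intro exI[of _ "1 / real (Suc m)"]) auto
    qed
    then show "x \<in> {x. \<exists>a. has_dir_deriv F x v a}" by (auto simp: has_dir_deriv_def)
  qed
  have "(\<Inter>n. \<Union>m. Z n m) \<in> sets borel"
    using clZ by (intro sets.countable_INT'' sets.countable_UN) (auto intro: borel_closed)
  then have "- {x. \<exists>a. has_dir_deriv F x v a} \<in> sets borel" unfolding eq by (rule borel_comp)
  then show "{x. \<nexists>a. has_dir_deriv F x v a} \<in> sets borel" by (simp add: Collect_neg_eq del: not_ex)
  show "negligible {t. x + t *\<^sub>R v \<in> {x. \<nexists>a. has_dir_deriv F x v a}}" for x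
  proof -
    define g where "g t = F (x + t *\<^sub>R v)" for t
    have "negligible {t. \<not> g differentiable at t}"
    proof (rule lipschitz_real_differentiable_ae)
      fix s t
      have "\<bar>g t - g s\<bar> \<le> L * norm ((x + t *\<^sub>R v) - (x + s *\<^sub>R v))" unfolding g_def by (rule lip)
      also have "(x + t *\<^sub>R v) - (x + s *\<^sub>R v) = (t - s) *\<^sub>R v" by (simp add: algebra_simps)
      finally show "\<bar>g t - g s\<bar> \<le> (L * norm v) * \<bar>t - s\<bar>" by (simp add: mult_ac)
    qed
    moreover have "\<exists>a. has_dir_deriv F (x + t *\<^sub>R v) v a" if gt: "g differentiable at t" for t
    proof -
      obtain a where "(g has_field_derivative a) (at t)"
        using gt unfolding real_differentiable_def by blast
      then have "((\<lambda>h. (g (t + h) - g t) / h) \<longlongrightarrow> a) (at 0)" by (simp only: DERIV_def)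
      then show ?thesis unfolding g_def has_dir_deriv_def dir_quot_def[abs_def] scaleR_add_left add.assoc
        by blast
    qed
    then have "{t. x + t *\<^sub>R v \<in> {x. \<nexists>a. has_dir_deriv F x v a}} \<subseteq> {t. \<not> g differentiable at t}" by blast
    ultimately show ?thesis by (rule negligible_subset)
  qed
qed

text \<open>Fix approximate values a, b, c of the three derivatives and a scale up to which they
  hold with error e. If y and y + h u both lie in the resulting set, with h below that scale, the
  increments along u at y, along v at y + h u and along u + v at y force |c - a - b| \<le> 3 e. If c
  differs from a + b by more, the set therefore meets each line in direction u in separated points
  and is null by Tonelli. Rational values of a, b, c, e exhaust the exceptional set.\<close>

lemma lipschitz_dir_deriv_additive_ae:
  fixes F :: "'a::euclidean_space \<Rightarrow> real" and u v :: 'a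
  assumes lip: "\<And>x y. \<bar>F x - F y\<bar> \<le> L * norm (x - y)"
  shows "negligible {x. \<exists>a b c. has_dir_deriv F x u a \<and> has_dir_deriv F x v b
      \<and> has_dir_deriv F x (u + v) c \<and> c \<noteq> a + b}"
proof -
  have L0: "L \<ge> 0"
  proof -
    obtain b :: 'a where "b \<in> Basis" using nonempty_Basis by blast
    then show ?thesis using lip[of b 0] by (auto simp: abs_ge_zero intro: order_trans[OF abs_ge_zero])
  qed
  have cF: "continuous_on UNIV F"
    by (rule lipschitz_on_continuous_on[of L])
      (use lip L0 in \<open>auto simp: lipschitz_on_def dist_real_def dist_norm\<close>)
  define Z where "Z w a e m = {x. \<forall>s. 0 < s \<and> s < 1 / real (Suc m) \<longrightarrow> \<bar>F (x + s *\<^sub>R w) - F x - s * a\<bar>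
      \<le> e * s}"
    for w a e m
  have clZ: "closed (Z w a e m)" for w a e m
  proof -
    have "closed {x. \<bar>F (x + s *\<^sub>R w) - F x - s * a\<bar> \<le> e * s}" for s
      by (intro closed_Collect_le continuous_intros continuous_on_compose2[OF cF]) auto
    moreover have "Z w a e m = (\<Inter>s\<in>{s. 0 < s \<and> s < 1 / real (Suc m)}. {x. \<bar>F (x + s *\<^sub>R w) - F x
        - s * a\<bar> \<le> e * s})"
      unfolding Z_def by blast
    ultimately show ?thesis by (auto intro!: closed_INT)
  qed
  have nul: "negligible (Z u a e m \<inter> Z v b e m \<inter> Z (u + v) c e m)" if e: "3 * e < \<bar>c - a - b\<bar>" for a b c e m
  proof (rule negligible_if_negligible_on_lines[where v = u])
    show "Z u a e m \<inter> Z v b e m \<inter> Z (u + v) c e m \<in> sets borel" using clZ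
      by (intro sets.Int borel_closed) auto
    fix x
    let ?S = "{t. x + t *\<^sub>R u \<in> Z u a e m \<inter> Z v b e m \<inter> Z (u + v) c e m}"
    have "countable ?S"
    proof (rule countable_if_separated[of "1 / real (Suc m)"])
      fix s t assume s: "s \<in> ?S" and t: "t \<in> ?S" and st: "s < t"
      show "1 / real (Suc m) \<le> t - s"
      proof (rule ccontr)
        assume n: "\<not> 1 / real (Suc m) \<le> t - s"
        define h where "h = t - s"
        have h: "0 < h" "h < 1 / real (Suc m)" using st n by (auto simp: h_def)
        define y where "y = x + s *\<^sub>R u"
        have yt: "x + t *\<^sub>R u = y + h *\<^sub>R u" by (simp add: y_def h_def algebra_simps)
        have "\<bar>F (y + h *\<^sub>R u) - F y - h * a\<bar> \<le> e * h" using s h by (auto simp: Z_def y_def)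
        moreover have "\<bar>F (y + h *\<^sub>R (u + v)) - F y - h * c\<bar> \<le> e * h" using s h by (auto simp: Z_def y_def)
        moreover have "\<bar>F (y + h *\<^sub>R u + h *\<^sub>R v) - F (y + h *\<^sub>R u) - h * b\<bar> \<le> e * h"
          using t h by (auto simp: Z_def yt)
        ultimately have "\<bar>h * c - h * a - h * b\<bar> \<le> 3 * e * h" by (simp add: scaleR_add_right add.assoc)
        moreover have "\<bar>h * c - h * a - h * b\<bar> = \<bar>c - a - b\<bar> * h" using h(1)
          by (simp add: right_diff_distrib[symmetric] abs_mult)
        ultimately show False using e h(1) by simp
      qed
    qed auto
    then show "negligible ?S"
      by (simp add: countable_imp_null_set_lborel negligible_iff_null_sets null_sets_completionI)
  qed
  let ?I = "{(a, b, c, e, m). a \<in> \<rat> \<and> b \<in> \<rat> \<and> c \<in> \<rat> \<and> e \<in> \<rat> \<and> 3 * e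
      < \<bar>c - a - b\<bar>} :: (real \<times> real \<times> real \<times> real \<times> nat) set"
  let ?N = "\<Union>(a, b, c, e, m)\<in>?I. Z u a e m \<inter> Z v b e m \<inter> Z (u + v) c e m"
  have "negligible ?N"
  proof (rule negligible_countable_Union)
    have "countable ?I"
      by (rule countable_subset[of _ "\<rat> \<times> \<rat> \<times> \<rat> \<times> \<rat> \<times> UNIV"]) (auto simp: countable_rat)
    then show "countable ((\<lambda>(a, b, c, e, m). Z u a e m \<inter> Z v b e m \<inter> Z (u + v) c e m) ` ?I)" by auto
  qed (use nul in auto)
  moreover have "{x. \<exists>a b c. has_dir_deriv F x u a \<and> has_dir_deriv F x v b
      \<and> has_dir_deriv F x (u + v) c \<and> c \<noteq> a + b} \<subseteq> ?N"
  proof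
    fix x assume "x \<in> {x. \<exists>a b c. has_dir_deriv F x u a \<and> has_dir_deriv F x v b
        \<and> has_dir_deriv F x (u + v) c \<and> c \<noteq> a + b}"
    then obtain a b c where abc: "has_dir_deriv F x u a" "has_dir_deriv F x v b"
      "has_dir_deriv F x (u + v) c" "c \<noteq> a + b"
      by auto
    define D where "D = \<bar>c - a - b\<bar>"
    have D: "D > 0" using abc by (auto simp: D_def)
    have rat: "\<exists>a'\<in>\<rat>. \<bar>a' - a\<bar> \<le> D / 32" for a
      using Rats_dense_in_real[of a "a + D/32"] D by force
    obtain a' where a': "a' \<in> \<rat>" "\<bar>a' - a\<bar> \<le> D / 32" using rat by blast
    obtain b' where b': "b' \<in> \<rat>" "\<bar>b' - b\<bar> \<le> D / 32" using rat by blast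
    obtain c' where c': "c' \<in> \<rat>" "\<bar>c' - c\<bar> \<le> D / 32" using rat by blast
    \<comment> \<open>e > D/16 absorbs an error D/32 of the quotient and another of the rational
      value. e < D/8 leaves 3 e below |c' - a' - b'|, which is at least D - 3 D/32.\<close>
    obtain e where e: "e \<in> \<rat>" "D/16 < e" "e < D/8" using Rats_dense_in_real[of "D/16" "D/8"] D by force
    have inZ: "\<exists>m0. \<forall>m\<ge>m0. x \<in> Z w p' e m" if w: "has_dir_deriv F x w p" "\<bar>p' - p\<bar> \<le> D / 32" for w p p'
    proof -
      obtain d where d: "d > 0" "\<And>s. 0 < \<bar>s\<bar> \<and> \<bar>s\<bar> < d \<Longrightarrow> \<bar>F (x + s *\<^sub>R w) - F x - s * p\<bar> \<le> (D/32) * \<bar>s\<bar>"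
        using has_dir_derivD[OF w(1), of "D/32"] D by auto
      obtain m0 where m0: "1 / real (Suc m0) < d" using d by (meson nat_approx_posE)
      have "x \<in> Z w p' e m" if "m \<ge> m0" for m unfolding Z_def
      proof (intro CollectI allI impI)
        fix s assume s: "0 < s \<and> s < 1 / real (Suc m)"
        have "1 / real (Suc m) \<le> 1 / real (Suc m0)" using \<open>m \<ge> m0\<close> by (simp add: field_simps)
        then have "\<bar>F (x + s *\<^sub>R w) - F x - s * p\<bar> \<le> (D/32) * s" using d(2)[of s] m0 s by auto
        moreover have "\<bar>s * p' - s * p\<bar> \<le> s * (D/32)"
          using \<open>\<bar>p' - p\<bar> \<le> D / 32\<close> s by (simp add: right_diff_distrib[symmetric] abs_mult)
        moreover have "(D/16) * s \<le> e * s" using e s by (intro mult_right_mono) auto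
        ultimately show "\<bar>F (x + s *\<^sub>R w) - F x - s * p'\<bar> \<le> e * s" by argo
      qed
      then show ?thesis by blast
    qed
    obtain m1 m2 m3 where "\<forall>m\<ge>m1. x \<in> Z u a' e m" "\<forall>m\<ge>m2. x \<in> Z v b' e m" "\<forall>m\<ge>m3. x \<in> Z (u + v) c' e m"
      using inZ[OF abc(1) a'(2)] inZ[OF abc(2) b'(2)] inZ[OF abc(3) c'(2)] by blast
    then have "x \<in> Z u a' e (m1+m2+m3) \<inter> Z v b' e (m1+m2+m3) \<inter> Z (u + v) c' e (m1+m2+m3)" by auto
    moreover have "3 * e < \<bar>c' - a' - b'\<bar>" using a'(2) b'(2) c'(2) e D D_def by linarith
    then have "(a', b', c', e, m1+m2+m3) \<in> ?I" using a' b' c' e by auto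
    ultimately show "x \<in> ?N" by blast
  qed
  ultimately show ?thesis by (rule negligible_subset)
qed

text \<open>Outside countably many null sets the derivatives along vectors with rational coordinates
  exist and are linear over the rationals, so they are values of one linear map \<open>L'\<close>.
  By compactness of the sphere finitely many such directions suffice to make the remainder uniformly
  small; the other directions are reached by the Lipschitz bound.\<close>

theorem lipschitz_differentiable_ae_real:
  fixes F :: "'a::euclidean_space \<Rightarrow> real"
  assumes lip: "\<And>x y. \<bar>F x - F y\<bar> \<le> L * norm (x - y)"
  shows "negligible {x. \<not> F differentiable at x}"
proof -
  define G where "G = {v::'a. \<forall>b\<in>Basis. v \<bullet> b \<in> \<rat>}"
  have "countable G"
  proof -
    have "G \<subseteq> (\<lambda>f. \<Sum>b\<in>Basis. f b *\<^sub>R b) ` (Basis \<rightarrow>\<^sub>E \<rat>)"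
    proof
      fix v assume v: "v \<in> G"
      show "v \<in> (\<lambda>f. \<Sum>b\<in>Basis. f b *\<^sub>R b) ` (Basis \<rightarrow>\<^sub>E \<rat>)"
        by (rule image_eqI[of _ _ "restrict (\<lambda>b. v \<bullet> b) Basis"])
          (use v in \<open>auto simp: G_def euclidean_representation\<close>)
    qed
    moreover have "countable (Basis \<rightarrow>\<^sub>E \<rat> :: ('a \<Rightarrow> real) set)"
      by (intro countable_PiE) (auto simp: countable_rat)
    ultimately show ?thesis by (meson countable_image countable_subset)
  qed
  define N1 where "N1 v = {x. \<nexists>a. has_dir_deriv F x v a}" for v
  define N2 where "N2 u v = {x. \<exists>a b c. has_dir_deriv F x u a \<and> has_dir_deriv F x v b
      \<and> has_dir_deriv F x (u + v) c \<and> c \<noteq> a + b}" for u v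
  let ?N = "(\<Union>v\<in>G. N1 v) \<union> (\<Union>(u, v)\<in>G \<times> G. N2 u v)"
  have "negligible ?N"
  proof (intro negligible_Un negligible_countable_Union)
    show "countable (N1 ` G)" "countable ((\<lambda>(u, v). N2 u v) ` (G \<times> G))" using \<open>countable G\<close> by auto
  qed (use lipschitz_dir_deriv_ae[OF lip] lipschitz_dir_deriv_additive_ae[OF lip] in
    \<open>auto simp: N1_def N2_def\<close>)
  moreover have "F differentiable at x" if x: "x \<notin> ?N" for x
  proof -
    have "\<forall>v\<in>G. \<exists>a. has_dir_deriv F x v a" using x by (auto simp: N1_def)
    then obtain D where D: "\<And>v. v \<in> G \<Longrightarrow> has_dir_deriv F x v (D v)" by metis
    have G_add: "u + v \<in> G" if "u \<in> G" "v \<in> G" for u v using that by (auto simp: G_def inner_add_left)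
    have G_scale: "c *\<^sub>R v \<in> G" if "c \<in> \<rat>" "v \<in> G" for c v using that by (auto simp: G_def)
    have G_b: "b \<in> G" if "b \<in> Basis" for b using that by (auto simp: G_def inner_Basis)
    have D_add: "D (u + v) = D u + D v" if "u \<in> G" "v \<in> G" for u v
    proof (rule ccontr)
      assume "D (u + v) \<noteq> D u + D v"
      then have "x \<in> N2 u v" unfolding N2_def using D[OF that(1)] D[OF that(2)] D[OF G_add[OF that]]
        by blast
      then show False using x that by blast
    qed
    have D_scale: "D (c *\<^sub>R v) = c * D v" if "c \<in> \<rat>" "v \<in> G" for c v
      using has_dir_deriv_unique[OF D[OF G_scale[OF that]] has_dir_deriv_scale[OF D[OF that(2)]]] .
    define L' where "L' h = (\<Sum>b\<in>Basis. (h \<bullet> b) * D b)" for h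
    have DL: "D v = L' v" if v: "v \<in> G" for v
    proof -
      have part: "(\<Sum>b\<in>B. (v \<bullet> b) *\<^sub>R b) \<in> G \<and> D (\<Sum>b\<in>B. (v \<bullet> b) *\<^sub>R b) = (\<Sum>b\<in>B. (v \<bullet> b) * D b)"
        if "finite B" "B \<subseteq> Basis" for B
        using that
      proof (induction B rule: finite_induct)
        case empty
        have "D (0 *\<^sub>R v) = 0 * D v" by (rule D_scale) (use v in auto)
        then show ?case by (simp add: G_def)
      next
        case (insert b B)
        have vb: "v \<bullet> b \<in> \<rat>" using v insert by (auto simp: G_def)
        have "(v \<bullet> b) *\<^sub>R b \<in> G" using vb insert by (intro G_scale G_b) auto
        then show ?case using insert vb by (simp add: D_add G_add D_scale G_b)
      qed
      show ?thesis using part[of Basis] by (simp add: L'_def euclidean_representation)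
    qed
    have linL: "linear L'"
      unfolding L'_def by (rule linearI) (simp_all add: inner_add_left sum.distrib algebra_simps
        sum_distrib_left)
    then have bl: "bounded_linear L'" by (simp add: linear_conv_bounded_linear)
    obtain B where B: "B > 0" "\<And>h. norm (L' h) \<le> norm h * B" using bounded_linear.pos_bounded[OF bl]
      by blast
    have L0: "L \<ge> 0"
    proof -
      obtain b :: 'a where "b \<in> Basis" using nonempty_Basis by blast
      then show ?thesis using lip[of b 0] by (auto simp: abs_ge_zero intro: order_trans[OF abs_ge_zero])
    qed
    have G_dense: "\<exists>u\<in>G. norm (h - u) < e" if e: "e > 0" for h :: 'a and e :: real
    proof -
      have "\<exists>f. \<forall>b\<in>Basis. f b \<in> \<rat> \<and> \<bar>h \<bullet> b - f b\<bar> < e / real DIM('a)"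
      proof (rule bchoice, rule ballI)
        fix b :: 'a assume "b \<in> Basis"
        show "\<exists>r. r \<in> \<rat> \<and> \<bar>h \<bullet> b - r\<bar> < e / real DIM('a)"
          using Rats_dense_in_real[of "h \<bullet> b" "h \<bullet> b + e / real DIM('a)"] e by force
      qed
      then obtain f where f: "\<And>b. b \<in> Basis \<Longrightarrow> f b \<in> \<rat>" "\<And>b. b \<in> Basis \<Longrightarrow> \<bar>h \<bullet> b - f b\<bar>
          < e / real DIM('a)" by blast
      let ?u = "\<Sum>b\<in>Basis. f b *\<^sub>R b"
      have "norm (h - ?u) \<le> (\<Sum>b\<in>Basis. \<bar>(h - ?u) \<bullet> b\<bar>)" by (rule norm_le_l1)
      also have "\<dots> < (\<Sum>b\<in>(Basis::'a set). e / real DIM('a))"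
        by (rule sum_strict_mono) (use f(2) in \<open>auto simp: inner_diff_left\<close>)
      also have "\<dots> = e" by simp
      finally show ?thesis using f(1) by (intro bexI[of _ ?u]) (auto simp: G_def)
    qed
    have "(F has_derivative L') (at x)"
      unfolding has_derivative_at_alt
    proof (intro conjI bl allI impI)
      fix e :: real assume e: "e > 0"
      \<comment> \<open>In units of s the remainder collects e' from the direction u, L e' from
        moving y to x + s u, and B e' from replacing L' w by L' u.\<close>
      define e' where "e' = e / (L + B + 1)"
      have e': "e' > 0" using e B L0 by (simp add: e'_def)
      have "compact (sphere (0::'a) 1)" by simp
      moreover have "sphere (0::'a) 1 \<subseteq> (\<Union>u\<in>G. ball u e')"
        using G_dense[OF e'] by (fastforce simp: dist_norm norm_minus_commute)
      ultimately obtain U where U: "U \<subseteq> G" "finite U" "sphere (0::'a) 1 \<subseteq> (\<Union>u\<in>U. ball u e')"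
        by (elim compactE_image[of _ G "\<lambda>u. ball u e'"]) auto
      have "\<forall>u\<in>U. \<exists>d>0. \<forall>s. 0 < \<bar>s\<bar> \<and> \<bar>s\<bar> < d \<longrightarrow> \<bar>F (x + s *\<^sub>R u) - F x - s * L' u\<bar> \<le> e' * \<bar>s\<bar>"
        using has_dir_derivD[OF D _] e' U(1) DL by (metis subsetD)
      then obtain d where d: "\<And>u. u \<in> U \<Longrightarrow> d u > 0"
        "\<And>u s. u \<in> U \<Longrightarrow> 0 < \<bar>s\<bar> \<Longrightarrow> \<bar>s\<bar> < d u \<Longrightarrow> \<bar>F (x + s *\<^sub>R u) - F x - s * L' u\<bar> \<le> e' * \<bar>s\<bar>"
        by metis
      define d0 where "d0 = Min (insert 1 (d ` U))"
      have d0: "d0 > 0" "\<And>u. u \<in> U \<Longrightarrow> d0 \<le> d u" using U(2) d(1) by (auto simp: d0_def)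
      show "\<exists>d>0. \<forall>y. norm (y - x) < d \<longrightarrow> norm (F y - F x - L' (y - x)) \<le> e * norm (y - x)"
      proof (intro exI[of _ d0] conjI allI impI)
        fix y assume y: "norm (y - x) < d0"
        show "norm (F y - F x - L' (y - x)) \<le> e * norm (y - x)"
        proof (cases "y = x")
          case True then show ?thesis using linear_0[OF linL] by simp
        next
          case False
          define s where "s = norm (y - x)"
          define w where "w = (y - x) /\<^sub>R s"
          have s: "s > 0" using False by (simp add: s_def)
          have yw: "y - x = s *\<^sub>R w" using s by (simp add: w_def)
          have "w \<in> sphere 0 1" using s by (simp add: w_def s_def)
          then obtain u where u: "u \<in> U" "norm (w - u) < e'" using U(3)
            by (auto simp: dist_norm norm_minus_commute)
          have 1: "\<bar>F (x + s *\<^sub>R u) - F x - s * L' u\<bar> \<le> e' * s"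
            using d(2)[OF u(1), of s] s d0(2)[OF u(1)] y by (auto simp: s_def)
          have "\<bar>F y - F (x + s *\<^sub>R u)\<bar> \<le> L * norm (y - (x + s *\<^sub>R u))" by (rule lip)
          also have "y - (x + s *\<^sub>R u) = s *\<^sub>R (w - u)" using yw by (simp add: algebra_simps)
          also have "L * norm (s *\<^sub>R (w - u)) \<le> L * (s * e')" using u(2) s L0 by (intro mult_left_mono) auto
          finally have 2: "\<bar>F y - F (x + s *\<^sub>R u)\<bar> \<le> L * (s * e')" .
          have "\<bar>L' (w - u)\<bar> \<le> e' * B" using B(2)[of "w - u"] u(2) B(1)
            by (smt (verit) mult_right_mono real_norm_def)
          then have 3: "\<bar>s * L' w - s * L' u\<bar> \<le> s * (e' * B)"
            using s by (simp add: linear_diff[OF linL] right_diff_distrib[symmetric] abs_mult)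
          have "L' (y - x) = s * L' w" unfolding yw using linear_scale[OF linL, of s w] by simp
          then have "\<bar>F y - F x - L' (y - x)\<bar> \<le> e' * s + L * (s * e') + s * (e' * B)" using 1 2 3
            by linarith
          also have "\<dots> = e' * (L + B + 1) * s" by (simp add: algebra_simps)
          also have "\<dots> = e * s" using B L0 by (simp add: e'_def)
          finally show ?thesis by (simp add: s_def)
        qed
      qed (use d0 in auto)
    qed
    then show ?thesis by (auto simp: differentiable_def)
  qed
  then have "{x. \<not> F differentiable at x} \<subseteq> ?N" by blast
  ultimately show ?thesis by (rule negligible_subset)
qed

text \<open>Rademacher's theorem; the proof of additivity is the one of Nekvinda and Zajicek.\<close>

theorem lipschitz_differentiable_ae:
  fixes F :: "'a::euclidean_space \<Rightarrow> 'b::euclidean_space"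
  assumes lip: "\<And>x y. norm (F x - F y) \<le> L * norm (x - y)"
  shows "negligible {x. \<not> F differentiable at x}"
proof -
  have "negligible (\<Union>b\<in>(Basis::'b set). {x. \<not> (\<lambda>x. F x \<bullet> b) differentiable at x})"
  proof (intro negligible_Union ballI)
    fix S assume "S \<in> (\<lambda>b. {x. \<not> (\<lambda>x. F x \<bullet> b) differentiable at x}) ` (Basis::'b set)"
    then obtain b :: 'b where b: "b \<in> Basis" and S: "S = {x. \<not> (\<lambda>x. F x \<bullet> b) differentiable at x}" by auto
    show "negligible S" unfolding S
    proof (rule lipschitz_differentiable_ae_real)
      fix x y
      have "\<bar>F x \<bullet> b - F y \<bullet> b\<bar> \<le> norm (F x - F y)" using Basis_le_norm[OF b, of "F x - F y"]
        by (simp add: inner_diff_left)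
      then show "\<bar>F x \<bullet> b - F y \<bullet> b\<bar> \<le> L * norm (x - y)" using lip[of x y] by linarith
    qed
  qed auto
  then show ?thesis
    by (rule negligible_subset) (auto simp: differentiable_componentwise_within[of F])
qed

section \<open>Second-order expansions near touching points\<close>

text \<open>Convex functions occur below as attained suprema of affine functions; a subgradient at
  each point is the form in which convexity is then directly at hand.\<close>

definition subgrad :: "('a::real_inner \<Rightarrow> real) \<Rightarrow> 'a \<Rightarrow> 'a \<Rightarrow> bool" where
  "subgrad f x q \<longleftrightarrow> (\<forall>y. f x + q \<bullet> (y - x) \<le> f y)"

lemma subgrad_convex_on:
  assumes "\<And>x. \<exists>q. subgrad f x q"
  shows "convex_on UNIV f"
proof (rule convex_onI)
  fix t :: real and x y :: 'a assume t: "0 < t" "t < 1"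
  let ?z = "(1 - t) *\<^sub>R x + t *\<^sub>R y"
  obtain q where q: "subgrad f ?z q" using assms by blast
  have "(1 - t) * (f ?z + q \<bullet> (x - ?z)) \<le> (1 - t) * f x" "t * (f ?z + q \<bullet> (y - ?z)) \<le> t * f y"
    using q t by (auto simp: subgrad_def intro!: mult_left_mono)
  moreover have "(1 - t) * (q \<bullet> (x - ?z)) + t * (q \<bullet> (y - ?z)) = 0"
    by (simp add: inner_diff_right inner_add_right algebra_simps)
  ultimately show "f ?z \<le> (1 - t) * f x + t * f y" by (simp add: algebra_simps)
qed auto

lemma subgrad_continuous:
  fixes f :: "'a::euclidean_space \<Rightarrow> real"
  assumes "\<And>x. \<exists>q. subgrad f x q"
  shows "continuous_on UNIV f"
  using convex_on_continuous[OF open_UNIV subgrad_convex_on] assms by blast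

text \<open>The limit t to 0 of the first-variation arguments below, where a quadratic term leaves
  an error c t after division by t.\<close>

lemma nonneg_if_small_perturbation:
  fixes a c :: real
  assumes "\<And>t. 0 < t \<Longrightarrow> t \<le> 1 \<Longrightarrow> 0 \<le> a + c * t"
  shows "0 \<le> a"
proof (rule ccontr)
  assume a: "\<not> 0 \<le> a"
  define t where "t = min 1 (- a / (2 * (\<bar>c\<bar> + 1)))"
  have t: "0 < t" "t \<le> 1" using a by (auto simp: t_def field_simps)
  have "c * t \<le> \<bar>c\<bar> * t" using t by (intro mult_right_mono) auto
  also have "\<dots> \<le> \<bar>c\<bar> * (- a / (2 * (\<bar>c\<bar> + 1)))" by (intro mult_left_mono) (auto simp: t_def)
  also have "\<dots> \<le> - a / 2" using a by (simp add: field_simps)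
  finally show False using assms[OF t] a by linarith
qed

section \<open>The resolvent of a convex function\<close>

lemma prox_exists:
  fixes f :: "'a::euclidean_space \<Rightarrow> real"
  assumes sub: "\<And>x. \<exists>q. subgrad f x q"
  shows "\<exists>x. subgrad f x (z - x)"
proof -
  \<comment> \<open>The minimiser of \<open>g\<close> is the value at z of the resolvent of the
    subdifferential; that z - x is a subgradient there is the first-order condition.\<close>
  define g where "g x = f x + (norm (x - z))\<^sup>2 / 2" for x
  obtain q where q: "subgrad f z q" using sub by blast
  \<comment> \<open>Outside this ball the quadratic term outweighs the affine minorant of f at z,
    whose slope is \<open>q\<close>.\<close>
  define R where "R = 2 * norm q + 1"
  have R: "R > 0" by (simp add: R_def add_nonneg_pos)
  have "continuous_on (cball z R) g" unfolding g_def
    by (intro continuous_intros continuous_on_subset[OF subgrad_continuous[OF sub]]) auto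
  then obtain x where x: "x \<in> cball z R" "\<And>y. y \<in> cball z R \<Longrightarrow> g x \<le> g y"
    using continuous_attains_inf[of "cball z R" g] R by auto
  have min: "g x \<le> g y" for y
  proof (cases "y \<in> cball z R")
    case False
    then have n: "norm (y - z) > R" by (simp add: dist_norm norm_minus_commute)
    have "\<bar>q \<bullet> (y - z)\<bar> \<le> norm q * norm (y - z)" by (rule Cauchy_Schwarz_ineq2)
    moreover have "f z + q \<bullet> (y - z) \<le> f y" using q by (simp add: subgrad_def)
    moreover have "2 * norm q * norm (y - z) \<le> norm (y - z) * norm (y - z)"
      using n by (intro mult_right_mono) (auto simp: R_def)
    ultimately have "f z \<le> g y" by (simp add: g_def power2_eq_square)
    moreover have "g x \<le> g z" using x(2)[of z] R by simp
    ultimately show ?thesis by (simp add: g_def)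
  qed (use x in auto)
  have "subgrad f x (z - x)" unfolding subgrad_def
  proof
    fix y
    have "0 \<le> (f y - f x - (z - x) \<bullet> (y - x)) + ((norm (y - x))\<^sup>2 / 2) * t" if t: "0 < t" "t \<le> 1" for t
    proof -
      have c: "f ((1 - t) *\<^sub>R x + t *\<^sub>R y) \<le> (1 - t) * f x + t * f y"
        using convex_onD[OF subgrad_convex_on[OF sub], of t x y] t by auto
      have e: "(1 - t) *\<^sub>R x + t *\<^sub>R y = x + t *\<^sub>R (y - x)" by (simp add: algebra_simps)
      have "(norm (x + t *\<^sub>R (y - x) - z))\<^sup>2 = (norm (x - z))\<^sup>2 - 2 * t * ((z - x) \<bullet> (y - x))
          + t\<^sup>2 * (norm (y - x))\<^sup>2"
        unfolding power2_norm_eq_inner by (simp add: inner_diff_left inner_diff_right inner_add_left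
          inner_add_right inner_commute power2_eq_square algebra_simps)
      then have "0 \<le> t * ((f y - f x - (z - x) \<bullet> (y - x)) + ((norm (y - x))\<^sup>2 / 2) * t)"
        using min[of "x + t *\<^sub>R (y - x)"] c unfolding g_def e by (simp add: algebra_simps power2_eq_square)
      then show ?thesis using t(1) by (simp add: zero_le_mult_iff)
    qed
    then have "0 \<le> f y - f x - (z - x) \<bullet> (y - x)" by (rule nonneg_if_small_perturbation)
    then show "f x + (z - x) \<bullet> (y - x) \<le> f y" by simp
  qed
  then show ?thesis ..
qed

text \<open>Monotonicity of the subdifferential. It makes the resolvent single-valued and
  1-Lipschitz.\<close>

lemma subgrad_sum_expanding:
  assumes "subgrad f x p" "subgrad f y q"
  shows "norm (x - y) \<le> norm ((x + p) - (y + q))"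
proof -
  have "f x + p \<bullet> (y - x) \<le> f y" "f y + q \<bullet> (x - y) \<le> f x" using assms by (auto simp: subgrad_def)
  then have "0 \<le> (p - q) \<bullet> (x - y)" by (simp add: inner_diff_left inner_diff_right algebra_simps)
  then have "(x - y) \<bullet> (x - y) \<le> ((x + p) - (y + q)) \<bullet> (x - y)"
    by (simp add: inner_diff_left inner_diff_right inner_add_left)
  also have "\<dots> \<le> norm ((x + p) - (y + q)) * norm (x - y)" by (rule norm_cauchy_schwarz)
  finally have "norm (x - y) * norm (x - y) \<le> norm ((x + p) - (y + q)) * norm (x - y)"
    by (simp add: power2_norm_eq_inner[symmetric] power2_eq_square)
  then show ?thesis by (cases "x = y") (auto simp: mult_le_cancel_right)
qed

text \<open>Over n + 1 equal steps the quadratic errors add up to c/(n + 1) only. This replaces the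
  integration of a derivative that is known up to such errors.\<close>

lemma telescoping_estimate:
  fixes r :: "real \<Rightarrow> real"
  assumes "\<And>s t. 0 \<le> s \<Longrightarrow> s \<le> t \<Longrightarrow> t \<le> 1 \<Longrightarrow> \<bar>r t - r s\<bar> \<le> a * (t - s) + c * (t - s)\<^sup>2"
  shows "\<bar>r 1 - r 0\<bar> \<le> a"
proof -
  have "\<bar>r 1 - r 0\<bar> \<le> a + c * (1 / real (Suc n))" for n
  proof -
    define N where "N = real (Suc n)"
    have N: "N > 0" by (simp add: N_def)
    have "(\<Sum>i<Suc n. r (real (Suc i) / N) - r (real i / N)) = r (real (Suc n) / N) - r (real 0 / N)"
      by (rule sum_lessThan_telescope)
    then have "\<bar>r 1 - r 0\<bar> = \<bar>\<Sum>i<Suc n. r (real (Suc i) / N) - r (real i / N)\<bar>" using N by (simp add: N_def)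
    also have "\<dots> \<le> (\<Sum>i<Suc n. \<bar>r (real (Suc i) / N) - r (real i / N)\<bar>)" by (rule sum_abs)
    also have "\<dots> \<le> (\<Sum>i<Suc n. a * (1 / N) + c * (1 / N)\<^sup>2)"
    proof (rule sum_mono)
      fix i assume "i \<in> {..<Suc n}"
      then have i: "real (Suc i) \<le> N" by (simp add: N_def)
      have d: "real (Suc i) / N - real i / N = 1 / N" by (simp add: diff_divide_distrib[symmetric])
      have "\<bar>r (real (Suc i) / N) - r (real i / N)\<bar> \<le> a * (real (Suc i) / N - real i / N)
          + c * (real (Suc i) / N - real i / N)\<^sup>2"
        using N i by (intro assms) (auto simp: divide_right_mono)
      then show "\<bar>r (real (Suc i) / N) - r (real i / N)\<bar> \<le> a * (1 / N) + c * (1 / N)\<^sup>2" unfolding d .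
    qed
    also have "\<dots> = N * (a * (1 / N) + c * (1 / N)\<^sup>2)" by (simp add: N_def)
    also have "\<dots> = a + c * (1 / N)" using N by (simp add: field_simps power2_eq_square)
    finally show ?thesis by (simp add: N_def)
  qed
  moreover have "(\<lambda>n. a + c * (1 / real (Suc n))) \<longlonglongrightarrow> a + c * 0"
    by (intro tendsto_intros LIMSEQ_Suc lim_1_over_n)
  ultimately show ?thesis by (intro LIMSEQ_le_const[of "\<lambda>n. a + c * (1 / real (Suc n))"]) auto
qed

text \<open>The subgradient inequalities at the two ends of a subinterval enclose the increment of f
  between two values, which the expansion of \<open>s\<close> determines up to e |h|^2 per unit
  length and a term quadratic in the length. \<open>telescoping_estimate\<close> removes the
  latter.\<close>

lemma second_order_from_subgrad_expansion:
  fixes f :: "'a::euclidean_space \<Rightarrow> real"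
  assumes s: "\<And>y. subgrad f y (s y)" and X: "linear X"
    and d: "\<And>y. norm (y - x) < d \<Longrightarrow> norm (s y - q - X (y - x)) \<le> e * norm (y - x)"
    and h: "norm h < d" and e: "e \<ge> 0"
  shows "\<bar>f (x + h) - f x - q \<bullet> h - (h \<bullet> X h) / 2\<bar> \<le> e * (norm h)\<^sup>2"
proof -
  define r where "r t = f (x + t *\<^sub>R h) - t * (q \<bullet> h) - t\<^sup>2 * (h \<bullet> X h) / 2" for t :: real
  have sl: "\<bar>s (x + t *\<^sub>R h) \<bullet> h - q \<bullet> h - t * (h \<bullet> X h)\<bar> \<le> e * (norm h)\<^sup>2" if t: "0 \<le> t" "t \<le> 1" for t
  proof -
    have n: "norm ((x + t *\<^sub>R h) - x) \<le> norm h" using t by (simp add: mult_left_le_one_le)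
    have "s (x + t *\<^sub>R h) \<bullet> h - q \<bullet> h - t * (h \<bullet> X h) = (s (x + t *\<^sub>R h) - q - X (t *\<^sub>R h)) \<bullet> h"
      by (simp add: inner_diff_left linear_scale[OF X] inner_commute[of h])
    also have "\<bar>\<dots>\<bar> \<le> norm (s (x + t *\<^sub>R h) - q - X (t *\<^sub>R h)) * norm h" by (rule Cauchy_Schwarz_ineq2)
    also have "\<dots> \<le> (e * norm h) * norm h"
    proof (rule mult_right_mono)
      have "norm (s (x + t *\<^sub>R h) - q - X ((x + t *\<^sub>R h) - x)) \<le> e * norm ((x + t *\<^sub>R h) - x)"
        using n h by (intro d) auto
      also have "\<dots> \<le> e * norm h" using n e by (rule mult_left_mono)
      finally show "norm (s (x + t *\<^sub>R h) - q - X (t *\<^sub>R h)) \<le> e * norm h" by simp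
    qed auto
    finally show ?thesis by (simp add: power2_eq_square mult.assoc)
  qed
  have "\<bar>r 1 - r 0\<bar> \<le> e * (norm h)\<^sup>2"
  proof (rule telescoping_estimate[where c = "\<bar>h \<bullet> X h\<bar> / 2"])
    fix t0 t1 :: real assume t: "0 \<le> t0" "t0 \<le> t1" "t1 \<le> 1"
    let ?D = "t1 - t0" and ?E = "e * (norm h)\<^sup>2" and ?H = "h \<bullet> X h"
    have lo: "?D * (s (x + t0 *\<^sub>R h) \<bullet> h) \<le> f (x + t1 *\<^sub>R h) - f (x + t0 *\<^sub>R h)"
    proof -
      have "f (x + t0 *\<^sub>R h) + s (x + t0 *\<^sub>R h) \<bullet> ((x + t1 *\<^sub>R h) - (x + t0 *\<^sub>R h)) \<le> f (x + t1 *\<^sub>R h)"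
        using s[of "x + t0 *\<^sub>R h"] unfolding subgrad_def by blast
      also have "(x + t1 *\<^sub>R h) - (x + t0 *\<^sub>R h) = ?D *\<^sub>R h" by (simp add: algebra_simps)
      finally show ?thesis by simp
    qed
    have hi: "f (x + t1 *\<^sub>R h) - f (x + t0 *\<^sub>R h) \<le> ?D * (s (x + t1 *\<^sub>R h) \<bullet> h)"
    proof -
      have "f (x + t1 *\<^sub>R h) + s (x + t1 *\<^sub>R h) \<bullet> ((x + t0 *\<^sub>R h) - (x + t1 *\<^sub>R h)) \<le> f (x + t0 *\<^sub>R h)"
        using s[of "x + t1 *\<^sub>R h"] unfolding subgrad_def by blast
      also have "(x + t0 *\<^sub>R h) - (x + t1 *\<^sub>R h) = (- ?D) *\<^sub>R h" by (simp add: algebra_simps)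
      finally show ?thesis by (simp add: algebra_simps)
    qed
    have "?D * (q \<bullet> h + t0 * ?H - ?E) \<le> ?D * (s (x + t0 *\<^sub>R h) \<bullet> h)"
      using sl[of t0] t by (intro mult_left_mono) auto
    then have 1: "?D * (q \<bullet> h) + ?D * t0 * ?H - ?E * ?D \<le> ?D * (s (x + t0 *\<^sub>R h) \<bullet> h)"
      by (simp add: algebra_simps)
    have "?D * (s (x + t1 *\<^sub>R h) \<bullet> h) \<le> ?D * (q \<bullet> h + t1 * ?H + ?E)"
      using sl[of t1] t by (intro mult_left_mono) auto
    then have 2: "?D * (s (x + t1 *\<^sub>R h) \<bullet> h) \<le> ?D * (q \<bullet> h) + ?D * t1 * ?H + ?E * ?D"
      by (simp add: algebra_simps)
    have 3: "r t1 - r t0 = f (x + t1 *\<^sub>R h) - f (x + t0 *\<^sub>R h) - ?D * (q \<bullet> h) - (t1\<^sup>2 - t0\<^sup>2) * ?H / 2"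
      by (simp add: r_def field_simps)
    have 4: "(t1\<^sup>2 - t0\<^sup>2) * ?H / 2 = ?D * t0 * ?H + ?D\<^sup>2 * ?H / 2" "(t1\<^sup>2 - t0\<^sup>2) * ?H / 2
        = ?D * t1 * ?H - ?D\<^sup>2 * ?H / 2"
      by (simp_all add: power2_eq_square field_simps)
    have "\<bar>?D\<^sup>2 * ?H / 2\<bar> = \<bar>?H\<bar> / 2 * ?D\<^sup>2" by (simp add: abs_mult)
    then show "\<bar>r t1 - r t0\<bar> \<le> ?E * ?D + \<bar>?H\<bar> / 2 * ?D\<^sup>2"
      using lo hi 1 2 unfolding 3 using 4 by linarith
  qed
  then show ?thesis by (simp add: r_def algebra_simps)
qed

lemma norm_scaled_less:
  fixes h :: "'a::real_normed_vector"
  assumes "d > 0"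
  shows "norm ((d / (2 * (norm h + 1))) *\<^sub>R h) < d"
proof -
  have "a / (2 * (a + 1)) < 1" if "a \<ge> 0" for a :: real using that by (simp add: field_simps)
  from this[OF norm_ge_zero[of h]] have "d * (norm h / (2 * (norm h + 1))) < d * 1"
    using assms by (intro mult_strict_left_mono)
  moreover have "norm ((d / (2 * (norm h + 1))) *\<^sub>R h) = d * (norm h / (2 * (norm h + 1)))"
    using assms by simp
  ultimately show ?thesis by (simp only: mult_1_right)
qed

text \<open>Both forms and the error scale by t^2, so the inequality near 0 extends to every h, and
  the error can then be sent to 0.\<close>

lemma form_le_if_le_small:
  fixes A B :: "'a::real_inner \<Rightarrow> real"
  assumes A: "\<And>t h. A (t *\<^sub>R h) = t\<^sup>2 * A h" and B: "\<And>t h. B (t *\<^sub>R h) = t\<^sup>2 * B h" and c: "c \<ge> 0"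
    and small: "\<And>e. e > 0 \<Longrightarrow> \<exists>d>0. \<forall>h. norm h < d \<longrightarrow> A h \<le> B h + c * e * (norm h)\<^sup>2"
  shows "A h \<le> B h"
proof -
  have "0 \<le> (B h - A h) + (c * (norm h)\<^sup>2) * e" if e: "0 < e" for e
  proof -
    obtain d where d: "d > 0" "\<And>h. norm h < d \<Longrightarrow> A h \<le> B h + c * e * (norm h)\<^sup>2"
      using small[OF e] by blast
    define t where "t = d / (2 * (norm h + 1))"
    have t: "t > 0" using d by (simp add: t_def add_nonneg_pos)
    have "norm (t *\<^sub>R h) < d" unfolding t_def using d(1) by (rule norm_scaled_less)
    from d(2)[OF this] have "t\<^sup>2 * A h \<le> t\<^sup>2 * (B h + c * e * (norm h)\<^sup>2)"
      by (simp add: A B power_mult_distrib algebra_simps)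
    then have "A h \<le> B h + c * e * (norm h)\<^sup>2"
      using t by (simp only: mult_le_cancel_left_pos zero_less_power)
    then show ?thesis by (simp add: algebra_simps)
  qed
  then have "0 \<le> B h - A h" using nonneg_if_small_perturbation by blast
  then show ?thesis by simp
qed

lemma linear_form_scale:
  fixes X :: "'a::real_inner \<Rightarrow> 'a"
  assumes "linear X"
  shows "(t *\<^sub>R h) \<bullet> X (t *\<^sub>R h) = t\<^sup>2 * (h \<bullet> X h)"
  by (simp add: linear_scale[OF assms] power2_eq_square)

lemma linear_form_bound:
  fixes S :: "'a::euclidean_space \<Rightarrow> 'a"
  assumes "linear S"
  shows "\<exists>C\<ge>0. \<forall>h. norm (S h) \<le> C * norm h \<and> \<bar>h \<bullet> S h\<bar> \<le> C * (norm h)\<^sup>2"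
proof -
  obtain C where C: "C > 0" "\<And>h. norm (S h) \<le> norm h * C"
    using bounded_linear.pos_bounded assms linear_conv_bounded_linear by metis
  have "\<bar>h \<bullet> S h\<bar> \<le> C * (norm h)\<^sup>2" for h
  proof -
    have "\<bar>h \<bullet> S h\<bar> \<le> norm h * norm (S h)" by (rule Cauchy_Schwarz_ineq2)
    also have "\<dots> \<le> norm h * (norm h * C)" by (intro mult_left_mono C) auto
    finally show ?thesis by (simp add: power2_eq_square mult_ac)
  qed
  then show ?thesis using C by (intro exI[of _ C]) (auto simp: mult.commute)
qed

text \<open>Only the quadratic form of \<open>X\<close> enters; its symmetric part is taken when a
  superjet is formed.\<close>

definition second_order_at :: "('a::real_inner \<Rightarrow> real) \<Rightarrow> 'a \<Rightarrow> 'a \<Rightarrow> ('a \<Rightarrow> 'a) \<Rightarrow> bool" where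
  "second_order_at f x q X \<longleftrightarrow> linear X \<and>
     (\<forall>e>0. \<exists>d>0. \<forall>h. norm h < d \<longrightarrow> \<bar>f (x + h) - f x - q \<bullet> h - (h \<bullet> X h) / 2\<bar> \<le> e * (norm h)\<^sup>2)"

text \<open>A paraboloid touching \<open>f\<close> from above forces the resolvent \<open>P\<close> to be non-contracting at
  \<open>z = x + q\<close>, so that a derivative of \<open>P\<close> is invertible there.\<close>

lemma second_order_at_touching_point:
  fixes f :: "'a::euclidean_space \<Rightarrow> real"
  assumes sub: "\<And>x. \<exists>q. subgrad f x q"
    and P: "\<And>z. subgrad f (P z) (z - P z)"
    and diff: "P differentiable at z"
    and x: "x = P z" and q: "q = z - x"
    and touch: "\<And>y. f y \<le> f x + q \<bullet> (y - x) + C / 2 * (norm (y - x))\<^sup>2" and C: "C \<ge> 0"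
  shows "\<exists>X. second_order_at f x q X"
proof -
  have Pxq: "P (y + p) = y" if "subgrad f y p" for y p
    using subgrad_sum_expanding[OF that P[of "y + p"]] by simp
  have qx: "subgrad f x q" using P[of z] x q by simp
  \<comment> \<open>Move from y by the distance |y - x| in the direction of p - q. The paraboloid
    above f, compared there with the affine minorants at y and x, bounds |p - q| |y - x| by C/2 (2
    |y - x|)^2.\<close>
  have key: "norm (p - q) \<le> 2 * C * norm (y - x)" if p: "subgrad f y p" for y p
  proof (cases "p = q \<or> y = x")
    case True
    moreover have "p = q" if "y = x"
    proof -
      have "(p - q) \<bullet> h \<le> C / 2 * (norm h)\<^sup>2" for h
        using p touch[of "x + h"] \<open>y = x\<close> unfolding subgrad_def
        by (smt (verit, best) add_diff_cancel_left' inner_diff_left)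
      then have a: "(p - q) \<bullet> (t *\<^sub>R (p - q)) \<le> C / 2 * (norm (t *\<^sub>R (p - q)))\<^sup>2" for t by blast
      have "0 \<le> - ((norm (p - q))\<^sup>2) + (C / 2 * (norm (p - q))\<^sup>2) * t" if t: "0 < t" "t \<le> 1" for t
      proof -
        have "t * (norm (p - q))\<^sup>2 \<le> t * (C / 2 * (norm (p - q))\<^sup>2 * t)"
          using a[of t] t by (simp add: power2_norm_eq_inner[symmetric] power_mult_distrib
            power2_eq_square mult_ac)
        then show ?thesis using t(1) by simp
      qed
      then have "0 \<le> - ((norm (p - q))\<^sup>2)" by (rule nonneg_if_small_perturbation)
      then show "p = q" by simp
    qed
    ultimately show ?thesis using C by auto
  next
    case False
    define a where "a = norm (p - q)"
    define b where "b = norm (y - x)"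
    have ab: "a > 0" "b > 0" using False by (auto simp: a_def b_def)
    define y' where "y' = y + (b / a) *\<^sub>R (p - q)"
    have "f y + p \<bullet> (y' - y) \<le> f y'" "f x + q \<bullet> (y - x) \<le> f y" using p qx by (auto simp: subgrad_def)
    moreover have "f y' \<le> f x + q \<bullet> (y' - x) + C / 2 * (norm (y' - x))\<^sup>2" by (rule touch)
    ultimately have "p \<bullet> (y' - y) + q \<bullet> (y - x) - q \<bullet> (y' - x) \<le> C / 2 * (norm (y' - x))\<^sup>2" by linarith
    moreover have "p \<bullet> (y' - y) + q \<bullet> (y - x) - q \<bullet> (y' - x) = (p - q) \<bullet> (y' - y)"
      by (simp add: inner_diff_left inner_diff_right)
    moreover have "(p - q) \<bullet> (y' - y) = a * b"
      using ab by (simp add: y'_def power2_norm_eq_inner[symmetric] a_def[symmetric] power2_eq_square)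
    moreover have "norm (y' - x) \<le> 2 * b"
    proof -
      have "y' - x = (y - x) + (b / a) *\<^sub>R (p - q)" by (simp add: y'_def)
      then have "norm (y' - x) \<le> norm (y - x) + norm ((b / a) *\<^sub>R (p - q))" by (metis norm_triangle_ineq)
      also have "norm ((b / a) *\<^sub>R (p - q)) = b" using ab by (simp add: a_def[symmetric])
      finally show ?thesis by (simp add: b_def)
    qed
    then have "(norm (y' - x))\<^sup>2 \<le> (2 * b)\<^sup>2" by (intro power_mono) auto
    then have "C / 2 * (norm (y' - x))\<^sup>2 \<le> C / 2 * (2 * b)\<^sup>2" using C by (intro mult_left_mono) auto
    ultimately have "a * b \<le> (2 * C * b) * b" by (simp add: power2_eq_square)
    then have "a \<le> 2 * C * b" using ab by (simp add: mult_le_cancel_right)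
    then show ?thesis by (simp add: a_def b_def)
  qed
  define c where "c = 1 + 2 * C"
  have c: "c \<ge> 1" using C by (simp add: c_def)
  have key2: "norm ((y + p) - z) \<le> c * norm (y - x)" if "subgrad f y p" for y p
  proof -
    have "(y + p) - z = (y - x) + (p - q)" using q by simp
    then have "norm ((y + p) - z) \<le> norm (y - x) + norm (p - q)" by (metis norm_triangle_ineq)
    then show ?thesis using key[OF that] by (simp add: c_def algebra_simps)
  qed
  obtain D where D: "(P has_derivative D) (at z)" using diff by (auto simp: differentiable_def)
  have linD: "linear D" using D by (rule has_derivative_linear)
  have Dest: "\<exists>d>0. \<forall>k. norm k < d \<longrightarrow> norm (P (z + k) - x - D k) \<le> e * norm k" if e: "e > 0" for e
  proof -
    obtain d where "d > 0" "\<And>y. norm (y - z) < d \<Longrightarrow> norm (P y - P z - D (y - z)) \<le> e * norm (y - z)"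
      using D e unfolding has_derivative_at_alt by blast
    then show ?thesis using x by (intro exI[of _ d]) (metis add_diff_cancel_left')
  qed
  \<comment> \<open>By \<open>key2\<close>, |z' - z| \<le> c |P z' - x|. A nonzero kernel vector of
    D would violate this at a small scale.\<close>
  have "inj D"
  proof -
    have "k = 0" if Dk: "D k = 0" for k
    proof (rule ccontr)
      assume k: "k \<noteq> 0"
      obtain d where d: "d > 0" "\<And>k. norm k < d \<Longrightarrow> norm (P (z + k) - x - D k) \<le> 1 / (2 * c) * norm k"
        using Dest[of "1 / (2 * c)"] c by auto
      define w where "w = (d / (2 * norm k)) *\<^sub>R k"
      have w: "norm w < d" "w \<noteq> 0" using d(1) k by (auto simp: w_def)
      have "D w = 0" using Dk linear_scale[OF linD] by (simp add: w_def)
      then have "norm (P (z + w) - x) \<le> 1 / (2 * c) * norm w" using d(2)[OF w(1)] by simp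
      moreover have "norm w \<le> c * norm (P (z + w) - x)" using key2[OF P[of "z + w"]] by simp
      ultimately have "norm w \<le> c * (1 / (2 * c) * norm w)"
        using c by (meson mult_left_mono order_trans zero_le_one)
      then show False using c w by simp
    qed
    then show ?thesis using linear_injective_0[OF linD] by blast
  qed
  then obtain M where M: "linear M" "\<And>v. M (D v) = v" "\<And>v. D (M v) = v"
    using linear_injective_isomorphism[OF linD] by blast
  obtain b where b: "b \<ge> 0" "\<And>v. norm (M v) \<le> b * norm v" using linear_form_bound[OF M(1)] by blast
  \<comment> \<open>P inverts the sum of the identity and the subdifferential, so the derivative of
    the subdifferential at x has to be D^(-1) - id.\<close>
  define X where "X h = M h - h" for h
  have linX: "linear X" unfolding X_def using M(1)
    by (intro linear_compose_sub linear_id[unfolded id_def]) auto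
  obtain s where s: "\<And>y. subgrad f y (s y)" using sub by metis
  have "\<exists>d>0. \<forall>h. norm h < d \<longrightarrow> \<bar>f (x + h) - f x - q \<bullet> h - (h \<bullet> X h) / 2\<bar> \<le> e * (norm h)\<^sup>2"
    if e: "e > 0" for e
  proof -
    \<comment> \<open>An error e' |k| of P turns into at most e |y - x| after |k| is bounded by c |y
      - x| and M is applied.\<close>
    define e' where "e' = e / (c * (b + 1))"
    have e': "e' > 0" using e b c by (simp add: e'_def)
    obtain d where d: "d > 0" "\<And>k. norm k < d \<Longrightarrow> norm (P (z + k) - x - D k) \<le> e' * norm k"
      using Dest[OF e'] by blast
    have "norm (s y - q - X (y - x)) \<le> e * norm (y - x)" if y: "norm (y - x) < d / c" for y
    proof -
      define k where "k = y + s y - z"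
      have k: "norm k \<le> c * norm (y - x)" using key2[OF s[of y]] by (simp add: k_def)
      also have "\<dots> < d" using y c by (simp add: field_simps)
      finally have kd: "norm k < d" .
      have Pk: "P (z + k) = y" using Pxq[OF s[of y]] by (simp add: k_def)
      have "norm (y - x - D k) \<le> e' * norm k" using d(2)[OF kd] Pk by simp
      also have "\<dots> \<le> e' * (c * norm (y - x))" using k e' by (intro mult_left_mono) auto
      finally have 1: "norm (y - x - D k) \<le> e' * (c * norm (y - x))" .
      have "s y - q - X (y - x) = k - M (y - x)" using q by (simp add: X_def k_def)
      also have "\<dots> = - M (y - x - D k)" using M(2) by (simp add: linear_diff[OF M(1)])
      finally have "norm (s y - q - X (y - x)) = norm (M (y - x - D k))" by simp
      also have "\<dots> \<le> b * norm (y - x - D k)" by (rule b)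
      also have "\<dots> \<le> b * (e' * (c * norm (y - x)))" using 1 b by (intro mult_left_mono) auto
      also have "\<dots> \<le> (b + 1) * (e' * (c * norm (y - x)))" using e' c by (intro mult_right_mono) auto
      also have "\<dots> = e * norm (y - x)" using b c by (simp add: e'_def)
      finally show ?thesis .
    qed
    moreover have "d / c > 0" using d c by auto
    ultimately show ?thesis
      using second_order_from_subgrad_expansion[OF s linX, of x "d / c" q e] e
        by (intro exI[of _ "d / c"]) auto
  qed
  then show ?thesis using linX unfolding second_order_at_def by blast
qed

text \<open>The maximum points of \<open>f y - (y \<bullet> S y) / 2 - p \<bullet> y\<close>, written in the resolvent variable
  \<open>z = x + q\<close>, satisfy \<open>p = z - P z - S (P z)\<close>; this Lipschitz map would send a null set of such
  \<open>z\<close> to a null set, but all small \<open>p\<close> occur.\<close>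

theorem second_order_at_near_touching_point:
  fixes f :: "'a::euclidean_space \<Rightarrow> real" and S :: "'a \<Rightarrow> 'a"
  assumes sub: "\<And>x. \<exists>q. subgrad f x q"
    and S: "linear S" and sym: "\<And>x y. x \<bullet> S y = S x \<bullet> y"
    and rho: "\<rho> > 0"
    and touch: "\<And>y. f y \<le> f 0 + (y \<bullet> S y) / 2 - \<rho> / 2 * (norm y)\<^sup>2"
    and eps: "\<epsilon> > 0"
  shows "\<exists>x q X. norm x < \<epsilon> \<and> norm q < \<epsilon> \<and> second_order_at f x q X \<and> (\<forall>h. h \<bullet> X h \<le> h \<bullet> S h)"
proof -
  obtain C where C: "C \<ge> 0" "\<And>h. norm (S h) \<le> C * norm h" "\<And>h. \<bar>h \<bullet> S h\<bar> \<le> C * (norm h)\<^sup>2"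
    using linear_form_bound[OF S] by blast
  obtain P where P: "\<And>z. subgrad f (P z) (z - P z)" using prox_exists[OF sub] by metis
  have Plip: "norm (P z - P w) \<le> 1 * norm (z - w)" for z w
    using subgrad_sum_expanding[OF P[of z] P[of w]] by simp
  have Pxq: "P (y + p) = y" if "subgrad f y p" for y p
    using subgrad_sum_expanding[OF that P[of "y + p"]] by simp
  define G where "G z = z - P z - S (P z)" for z
  define N where "N = {z. \<not> P differentiable at z}"
  have "negligible N" unfolding N_def using Plip by (rule lipschitz_differentiable_ae)
  have "negligible (G ` N)"
  proof (rule negligible_locally_Lipschitz_image[OF order_refl \<open>negligible N\<close>])
    fix z assume "z \<in> N"
    have "norm (G w - G z) \<le> (2 + C) * norm (w - z)" for w
    proof -
      have "G w - G z = (w - z) - (P w - P z) - S (P w - P z)" by (simp add: G_def linear_diff[OF S])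
      then have "norm (G w - G z) \<le> norm (w - z) + norm (P w - P z) + norm (S (P w - P z))"
        by (smt (verit) norm_triangle_ineq4)
      also have "norm (S (P w - P z)) \<le> C * norm (P w - P z)" by (rule C)
      also have "C * norm (P w - P z) \<le> C * norm (w - z)" using Plip[of w z] C
        by (intro mult_left_mono) auto
      finally show ?thesis using Plip[of w z] by (simp add: algebra_simps)
    qed
    then show "\<exists>T B. open T \<and> z \<in> T \<and> (\<forall>y\<in>N \<inter> T. norm (G y - G z) \<le> B * norm (y - z))"
      by (intro exI[of _ UNIV] exI[of _ "2 + C"]) auto
  qed
  \<comment> \<open>The maximum point obeys |x| \<le> 2 |p|/\<rho>, and its subgradient is S x + p
    with |S x| \<le> C |x|; the three bounds make both smaller than \<epsilon>.\<close>
  define \<delta> where "\<delta> = min (\<epsilon> / 2) (min (\<rho> * \<epsilon> / 4) (\<rho> * \<epsilon> / (4 * (C + 1))))"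
  have "\<delta> > 0" using eps rho C by (auto simp: \<delta>_def)
  moreover have "\<delta> \<le> \<epsilon> / 2" unfolding \<delta>_def by (rule min.cobounded1)
  moreover have "\<delta> \<le> \<rho> * \<epsilon> / 4" unfolding \<delta>_def by (intro min.coboundedI2 min.cobounded1)
  moreover have "\<delta> \<le> \<rho> * \<epsilon> / (4 * (C + 1))" unfolding \<delta>_def by (intro min.coboundedI2 min.cobounded2)
  ultimately have \<delta>: "\<delta> > 0" "\<delta> \<le> \<epsilon> / 2" "\<delta> \<le> \<rho> * \<epsilon> / 4" "\<delta> \<le> \<rho> * \<epsilon> / (4 * (C + 1))" .
  have "\<not> ball 0 \<delta> \<subseteq> G ` N"
    using negligible_subset[OF \<open>negligible (G ` N)\<close>] open_not_negligible[of "ball 0 \<delta> :: 'a set"]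
      \<delta>(1) by auto
  then obtain p where p: "norm p < \<delta>" "p \<notin> G ` N" by (meson mem_ball_0 subsetI)
  define k where "k y = f y - (y \<bullet> S y) / 2 - p \<bullet> y" for y
  have kle: "k y \<le> k 0 - \<rho> / 2 * (norm y)\<^sup>2 + norm p * norm y" for y
  proof -
    have "\<bar>p \<bullet> y\<bar> \<le> norm p * norm y" by (rule Cauchy_Schwarz_ineq2)
    then show ?thesis using touch[of y] by (simp add: k_def)
  qed
  define R where "R = 2 * norm p / \<rho> + 1"
  have R: "R > 0" using rho by (simp add: R_def add_nonneg_pos)
  have big: "k y < k 0" if "norm y > 2 * norm p / \<rho>" for y
  proof -
    have "norm p < \<rho> / 2 * norm y" using that rho by (simp add: field_simps)
    moreover have "norm y > 0" using that rho by (smt (verit) divide_nonneg_nonneg norm_ge_zero)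
    ultimately have "norm p * norm y < \<rho> / 2 * norm y * norm y" by (intro mult_strict_right_mono) auto
    then show ?thesis using kle[of y] by (simp add: power2_eq_square mult_ac)
  qed
  have "continuous_on (cball 0 R) k" unfolding k_def
    by (intro continuous_intros continuous_on_subset[OF subgrad_continuous[OF sub]]
      linear_continuous_on S[unfolded linear_conv_bounded_linear]) auto
  then obtain x where x: "x \<in> cball 0 R" "\<And>y. y \<in> cball 0 R \<Longrightarrow> k y \<le> k x"
    using continuous_attains_sup[of "cball 0 R" k] R by auto
  have k0: "k 0 \<le> k x" using x(2)[of 0] R by simp
  have max: "k y \<le> k x" for y
  proof (cases "norm y \<le> R")
    case False
    then show ?thesis using big[of y] k0 by (simp add: R_def)
  qed (use x in auto)
  have nx: "norm x \<le> 2 * norm p / \<rho>" using big[of x] k0 by linarith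
  obtain q where q: "subgrad f x q" using sub by blast
  have expand: "(y \<bullet> S y) / 2 - (x \<bullet> S x) / 2 = S x \<bullet> (y - x) + ((y - x) \<bullet> S (y - x)) / 2" for y
  proof -
    define h where "h = y - x"
    have y: "y = x + h" by (simp add: h_def)
    have "x \<bullet> S h = S x \<bullet> h" by (rule sym)
    then show ?thesis unfolding y
      by (simp add: linear_add[OF S] inner_add_left inner_add_right inner_commute[of h "S x"] field_simps)
  qed
  have up: "f y \<le> f x + (S x + p) \<bullet> (y - x) + ((y - x) \<bullet> S (y - x)) / 2" for y
    using max[of y] expand[of y] by (simp add: k_def inner_add_left inner_diff_right)
  \<comment> \<open>The smooth function of \<open>up\<close> touches f from above at x and leaves
    its own gradient as the only possible subgradient.\<close>
  have "q = S x + p"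
  proof -
    define w where "w = q - (S x + p)"
    have "0 \<le> - (w \<bullet> w) + (w \<bullet> S w / 2) * t" if t: "0 < t" "t \<le> 1" for t
    proof -
      have "f x + q \<bullet> (t *\<^sub>R w) \<le> f (x + t *\<^sub>R w)" using q unfolding subgrad_def
        by (metis add_diff_cancel_left')
      also have "\<dots> \<le> f x + (S x + p) \<bullet> (t *\<^sub>R w) + ((t *\<^sub>R w) \<bullet> S (t *\<^sub>R w)) / 2"
        using up[of "x + t *\<^sub>R w"] by simp
      finally have "q \<bullet> (t *\<^sub>R w) \<le> (S x + p) \<bullet> (t *\<^sub>R w) + ((t *\<^sub>R w) \<bullet> S (t *\<^sub>R w)) / 2" by simp
      moreover have "q \<bullet> (t *\<^sub>R w) = (S x + p) \<bullet> (t *\<^sub>R w) + t * (w \<bullet> w)"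
        by (simp add: w_def inner_diff_left right_diff_distrib)
      moreover have "(t *\<^sub>R w) \<bullet> S (t *\<^sub>R w) = 2 * (t * ((w \<bullet> S w / 2) * t))"
        by (simp add: linear_scale[OF S])
      ultimately have "t * (w \<bullet> w) \<le> t * ((w \<bullet> S w / 2) * t)" by linarith
      then show ?thesis using t(1) by simp
    qed
    then have "0 \<le> - (w \<bullet> w)" by (rule nonneg_if_small_perturbation)
    then have "w \<bullet> w = 0" using inner_ge_zero[of w] by linarith
    then show ?thesis by (simp add: w_def)
  qed
  define z where "z = x + q"
  have Pz: "P z = x" using Pxq[OF q] by (simp add: z_def)
  have "G z = p" using \<open>q = S x + p\<close> unfolding G_def Pz by (simp add: z_def)
  then have "z \<notin> N" using p(2) by auto
  then have diff: "P differentiable at z" by (simp add: N_def)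
  have up': "f y \<le> f x + q \<bullet> (y - x) + C / 2 * (norm (y - x))\<^sup>2" for y
    using up[of y] C(3)[of "y - x"] \<open>q = S x + p\<close> by (simp add: abs_le_iff)
  obtain X where X: "second_order_at f x q X"
    using second_order_at_touching_point[OF sub P diff Pz[symmetric] _ up' C(1)] by (auto simp: z_def)
  have linX: "linear X" using X by (simp add: second_order_at_def)
  have "h \<bullet> X h \<le> h \<bullet> S h" for h
  proof (rule form_le_if_le_small[where c = 2 and A = "\<lambda>h. h \<bullet> X h" and B = "\<lambda>h. h \<bullet> S h"])
    fix e :: real assume "e > 0"
    then obtain d where d: "d > 0" "\<And>h. norm h < d \<Longrightarrow> \<bar>f (x + h) - f x - q \<bullet> h - (h \<bullet> X h) / 2\<bar>
        \<le> e * (norm h)\<^sup>2"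
      using X unfolding second_order_at_def by blast
    have "h \<bullet> X h \<le> h \<bullet> S h + 2 * e * (norm h)\<^sup>2" if "norm h < d" for h
      using d(2)[OF that] up[of "x + h"] by (simp add: \<open>q = S x + p\<close> abs_le_iff)
    then show "\<exists>d>0. \<forall>h. norm h < d \<longrightarrow> h \<bullet> X h \<le> h \<bullet> S h + 2 * e * (norm h)\<^sup>2" using d(1) by blast
  qed (auto simp only: linear_form_scale[OF S] linear_form_scale[OF linX])
  moreover have "norm x < \<epsilon>"
  proof -
    have "2 * norm p / \<rho> < 2 * \<delta> / \<rho>" using p rho by (simp add: divide_strict_right_mono)
    also have "\<dots> \<le> \<epsilon> / 2" using \<delta>(3) rho by (simp add: field_simps)
    finally show ?thesis using nx eps by linarith
  qed
  moreover have "norm q < \<epsilon>"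
  proof -
    have "norm q \<le> norm (S x) + norm p" unfolding \<open>q = S x + p\<close> by (rule norm_triangle_ineq)
    also have "norm (S x) \<le> C * norm x" by (rule C)
    also have "C * norm x \<le> C * (2 * norm p / \<rho>)" using nx C by (intro mult_left_mono) auto
    also have "\<dots> \<le> C * (2 * \<delta> / \<rho>)" using p rho C by (intro mult_left_mono divide_right_mono) auto
    also have "\<dots> \<le> (C + 1) * (2 * \<delta> / \<rho>)" using \<delta> rho by (intro mult_right_mono) auto
    also have "\<dots> \<le> \<epsilon> / 2" using \<delta>(4) rho C by (simp add: field_simps)
    finally show ?thesis using p \<delta>(2) by linarith
  qed
  ultimately show ?thesis using X by blast
qed

text \<open>This identifies the gradient at a second-order point with the one computed from the
  points where the sup-convolutions are attained.\<close>

lemma second_order_at_subgrad_unique: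
  assumes so: "second_order_at f x q X" and p: "subgrad f x p"
  shows "p = q"
proof -
  define w where "w = p - q"
  obtain d where d: "d > 0" "\<And>h. norm h < d \<Longrightarrow> \<bar>f (x + h) - f x - q \<bullet> h - (h \<bullet> X h) / 2\<bar> \<le> 1 * (norm h)\<^sup>2"
    using so zero_less_one unfolding second_order_at_def by blast
  have X: "linear X" using so by (simp add: second_order_at_def)
  define s where "s = d / (2 * (norm w + 1))"
  have s: "s > 0" using d by (simp add: s_def add_nonneg_pos)
  have "0 \<le> - (w \<bullet> w) + (s * (w \<bullet> X w / 2 + w \<bullet> w)) * t" if t: "0 < t" "t \<le> 1" for t
  proof -
    have "norm ((t * s) *\<^sub>R w) \<le> norm (s *\<^sub>R w)" using t s by (simp add: mult_left_le_one_le mult_right_mono)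
    also have "\<dots> < d" unfolding s_def using d(1) by (rule norm_scaled_less)
    finally have "norm ((t * s) *\<^sub>R w) < d" .
    from d(2)[OF this] have "f (x + (t * s) *\<^sub>R w) - f x
        \<le> q \<bullet> ((t * s) *\<^sub>R w) + (t * s)\<^sup>2 * (w \<bullet> X w) / 2 + (t * s)\<^sup>2 * (w \<bullet> w)"
      unfolding linear_form_scale[OF X] by (simp add: power2_norm_eq_inner power_mult_distrib abs_le_iff)
    moreover have "p \<bullet> ((t * s) *\<^sub>R w) \<le> f (x + (t * s) *\<^sub>R w) - f x"
      using p unfolding subgrad_def by (metis add_diff_cancel_left' le_diff_eq add.commute)
    moreover have "p \<bullet> ((t * s) *\<^sub>R w) = q \<bullet> ((t * s) *\<^sub>R w) + (t * s) * (w \<bullet> w)"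
      by (simp add: w_def inner_diff_left right_diff_distrib)
    moreover have "(t * s)\<^sup>2 * (w \<bullet> X w) / 2 + (t * s)\<^sup>2 * (w \<bullet> w)
        = (t * s) * ((s * (w \<bullet> X w / 2 + w \<bullet> w)) * t)"
      by (simp add: power2_eq_square algebra_simps)
    ultimately have "(t * s) * (w \<bullet> w) \<le> (t * s) * ((s * (w \<bullet> X w / 2 + w \<bullet> w)) * t)" by linarith
    then show ?thesis using t s by simp
  qed
  then have "0 \<le> - (w \<bullet> w)" by (rule nonneg_if_small_perturbation)
  then have "w \<bullet> w = 0" using inner_ge_zero[of w] by linarith
  then show ?thesis by (simp add: w_def)
qed

section \<open>The theorem on sums\<close>

text \<open>Relative to \<open>K\<close> because the sup-convolutions below range over compact sets;
  at interior points of \<open>K\<close> it is the usual second-order superjet.\<close>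

definition superjet :: "'a::real_inner set \<Rightarrow> ('a \<Rightarrow> real) \<Rightarrow> 'a \<Rightarrow> 'a \<Rightarrow> ('a \<Rightarrow> 'a) \<Rightarrow> bool" where
  "superjet K U z p X \<longleftrightarrow> linear X \<and> (\<forall>x y. x \<bullet> X y = X x \<bullet> y) \<and>
     (\<forall>e>0. \<exists>d>0. \<forall>h. norm h < d \<and> z + h \<in> K \<longrightarrow> U (z + h) \<le> U z + p \<bullet> h + (h \<bullet> X h) / 2 + e * (norm h)\<^sup>2)"

text \<open>Completing the square shows that \<open>f\<close> is the sup-convolution of U - p
  \<bullet> (z - z0), recentred at z0, plus \<mu>/2 |\<eta>|^2. In this form it is a supremum of
  affine functions of \<eta>, hence convex.\<close>

lemma sup_convolution_attained:
  fixes U :: "'a::euclidean_space \<Rightarrow> real"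
  assumes K: "compact K" "z0 \<in> K" and U: "continuous_on K U"
  shows "\<exists>f. (\<forall>\<eta>. \<exists>z\<in>K. f \<eta> = U z - p \<bullet> (z - z0) - \<mu> / 2 * (norm (z - z0))\<^sup>2 + \<mu> * ((z - z0) \<bullet> \<eta>)) \<and>
     (\<forall>\<eta>. \<forall>z\<in>K. U z - p \<bullet> (z - z0) - \<mu> / 2 * (norm (z - z0))\<^sup>2 + \<mu> * ((z - z0) \<bullet> \<eta>) \<le> f \<eta>)"
proof -
  let ?g = "\<lambda>\<eta> z. U z - p \<bullet> (z - z0) - \<mu> / 2 * (norm (z - z0))\<^sup>2 + \<mu> * ((z - z0) \<bullet> \<eta>)"
  have "\<exists>z\<in>K. \<forall>y\<in>K. ?g \<eta> y \<le> ?g \<eta> z" for \<eta>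
    using K by (intro continuous_attains_sup continuous_intros U) auto
  then obtain m where "\<And>\<eta>. m \<eta> \<in> K \<and> (\<forall>y\<in>K. ?g \<eta> y \<le> ?g \<eta> (m \<eta>))" by metis
  then show ?thesis by (intro exI[of _ "\<lambda>\<eta>. ?g \<eta> (m \<eta>)"]) auto
qed

text \<open>Shifting \<eta> and the maximising point z by the same h leaves their distance in the
  sup-convolution unchanged. So an upper expansion of \<open>f\<close> at \<eta> becomes one of
  \<open>U\<close> at z, with the Hessian lowered by \<mu> to undo the convexifying term.\<close>

lemma superjet_from_sup_convolution:
  fixes U :: "'a::euclidean_space \<Rightarrow> real" and M :: "'a \<Rightarrow> 'a"
  assumes z: "z \<in> K" "f \<eta> = U z - p \<bullet> (z - z0) - \<mu> / 2 * (norm (z - z0))\<^sup>2 + \<mu> * ((z - z0) \<bullet> \<eta>)"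
    and ub: "\<And>\<eta> z. z \<in> K \<Longrightarrow> U z - p \<bullet> (z - z0) - \<mu> / 2 * (norm (z - z0))\<^sup>2 + \<mu> * ((z - z0) \<bullet> \<eta>) \<le> f \<eta>"
    and M: "linear M"
    and ex: "\<And>e. e > 0 \<Longrightarrow> \<exists>d>0. \<forall>h. norm h < d \<longrightarrow> f (\<eta> + h) \<le> f \<eta> + q \<bullet> h + (h \<bullet> M h) / 2 + e * (norm h)\<^sup>2"
    and q: "q = \<mu> *\<^sub>R (z - z0)"
  shows "\<exists>X. superjet K U z (p + q - \<mu> *\<^sub>R \<eta>) X \<and> (\<forall>h. h \<bullet> X h = h \<bullet> M h - \<mu> * (norm h)\<^sup>2)"
proof -
  define X where "X h = (1/2) *\<^sub>R (M h + adjoint M h) - \<mu> *\<^sub>R h" for h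
  have adj: "x \<bullet> adjoint M y = M x \<bullet> y" for x y by (rule adjoint_works[OF M])
  have adj': "x \<bullet> M y = adjoint M x \<bullet> y" for x y using adj[of y x] by (simp add: inner_commute)
  have linX: "linear X"
    unfolding X_def
    by (rule linearI) (simp_all add: linear_add[OF M] linear_scale[OF M] linear_add[OF
      adjoint_linear[OF M]] linear_scale[OF adjoint_linear[OF M]] algebra_simps)
  have symX: "x \<bullet> X y = X x \<bullet> y" for x y
    by (simp add: X_def inner_add_left inner_add_right inner_diff_left inner_diff_right adj adj')
  have form: "h \<bullet> X h = h \<bullet> M h - \<mu> * (norm h)\<^sup>2" for h
    by (simp add: X_def inner_add_right inner_diff_right adj power2_norm_eq_inner inner_commute[of "M h"])
  have "superjet K U z (p + q - \<mu> *\<^sub>R \<eta>) X" unfolding superjet_def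
  proof (intro conjI allI impI linX symX)
    fix e :: real assume "e > 0"
    from ex[OF this] obtain d where d: "d > 0"
      "\<And>h. norm h < d \<Longrightarrow> f (\<eta> + h) \<le> f \<eta> + q \<bullet> h + (h \<bullet> M h) / 2 + e * (norm h)\<^sup>2" by blast
    show "\<exists>d>0. \<forall>h. norm h < d \<and> z + h \<in> K \<longrightarrow> U (z + h) \<le> U z + (p + q - \<mu> *\<^sub>R \<eta>) \<bullet> h + (h \<bullet> X h) / 2
        + e * (norm h)\<^sup>2"
    proof (intro exI[of _ d] conjI allI impI d(1))
      fix h assume h: "norm h < d \<and> z + h \<in> K"
      define a where "a = z - z0"
      have "U (z + h) - p \<bullet> (a + h) - \<mu> / 2 * (norm (a + h))\<^sup>2 + \<mu> * ((a + h) \<bullet> (\<eta> + h)) \<le> f (\<eta> + h)"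
        using ub[of "z + h" "\<eta> + h"] h by (simp add: a_def algebra_simps)
      also have "\<dots> \<le> f \<eta> + q \<bullet> h + (h \<bullet> M h) / 2 + e * (norm h)\<^sup>2" using d(2) h by auto
      finally have "U (z + h) \<le> p \<bullet> (a + h) + \<mu> / 2 * (norm (a + h))\<^sup>2 - \<mu> * ((a + h) \<bullet> (\<eta> + h))
          + f \<eta> + q \<bullet> h + (h \<bullet> M h) / 2 + e * (norm h)\<^sup>2"
        by linarith
      also have "\<dots> = U z + (p + q - \<mu> *\<^sub>R \<eta>) \<bullet> h + (h \<bullet> X h) / 2 + e * (norm h)\<^sup>2"
      proof -
        have "\<mu> / 2 * (norm (a + h))\<^sup>2 = \<mu> / 2 * (norm a)\<^sup>2 + \<mu> * (a \<bullet> h) + \<mu> / 2 * (norm h)\<^sup>2"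
          unfolding power2_norm_eq_inner by (simp add: inner_add_left inner_add_right
            inner_commute[of h a] algebra_simps)
        moreover have "q \<bullet> h = \<mu> * (a \<bullet> h)" by (simp add: q a_def)
        moreover have "\<mu> * ((a + h) \<bullet> (\<eta> + h)) = \<mu> * (a \<bullet> \<eta>) + \<mu> * (a \<bullet> h) + \<mu> * (\<eta> \<bullet> h) + \<mu> * (norm h)\<^sup>2"
          unfolding power2_norm_eq_inner by (simp add: inner_add_left inner_add_right
            inner_commute[of h \<eta>] algebra_simps)
        ultimately show ?thesis unfolding z(2) form a_def[symmetric]
          by (simp add: inner_add_left inner_add_right inner_diff_left field_simps)
      qed
      finally show "U (z + h) \<le> U z + (p + q - \<mu> *\<^sub>R \<eta>) \<bullet> h + (h \<bullet> X h) / 2 + e * (norm h)\<^sup>2" .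
    qed
  qed
  then show ?thesis using form by blast
qed

text \<open>A version of the Crandall--Ishii theorem on sums. The quadratic form of \<open>S\<close> dominates the
  sup-convolution, with parameter \<open>\<mu>\<close>, of the form \<open>J\<close> in the contact condition.\<close>

theorem superjets_of_sum:
  fixes U V :: "'a::euclidean_space \<Rightarrow> real" and J :: "'a \<times> 'a \<Rightarrow> real" and S :: "'a \<times> 'a \<Rightarrow> 'a \<times> 'a"
  assumes K: "compact K1" "z0 \<in> K1" "compact K2" "w0 \<in> K2"
    and UV: "continuous_on K1 U" "continuous_on K2 V"
    and contact: "\<And>z w. z \<in> K1 \<Longrightarrow> w \<in> K2 \<Longrightarrow>
       U z + V w \<le> U z0 + V w0 + p \<bullet> (z - z0) + q \<bullet> (w - w0) + J (z - z0, w - w0) / 2"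
    and S: "linear S" "\<And>x y. x \<bullet> S y = S x \<bullet> y"
    and JS: "\<And>\<xi> \<eta>. J \<xi> \<le> \<eta> \<bullet> S \<eta> + \<mu> * (norm (\<xi> - \<eta>))\<^sup>2"
    and J: "\<And>\<xi>. J \<xi> \<le> \<mu> * (norm \<xi>)\<^sup>2" and lam: "\<mu> > 0"
    and eps: "\<epsilon> > 0"
  shows "\<exists>z\<in>K1. \<exists>w\<in>K2. \<exists>p' q' X Y. norm (z - z0) < \<epsilon> \<and> norm (w - w0) < \<epsilon> \<and> norm (p' - p) < \<epsilon>
      \<and> norm (q' - q) < \<epsilon> \<and>
     superjet K1 U z p' X \<and> superjet K2 V w q' Y \<and>
     (\<forall>h k. h \<bullet> X h + k \<bullet> Y k \<le> (h, k) \<bullet> S (h, k) + \<epsilon> * ((norm h)\<^sup>2 + (norm k)\<^sup>2)) \<and>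
     (\<forall>h. - \<mu> * (norm h)\<^sup>2 \<le> h \<bullet> X h) \<and> (\<forall>h. - \<mu> * (norm h)\<^sup>2 \<le> h \<bullet> Y h)"
proof -
  obtain f1 where f1: "\<And>\<eta>. \<exists>z\<in>K1. f1 \<eta> = U z - p \<bullet> (z - z0) - \<mu> / 2 * (norm (z - z0))\<^sup>2 + \<mu> * ((z - z0) \<bullet> \<eta>)"
    "\<And>\<eta> z. z \<in> K1 \<Longrightarrow> U z - p \<bullet> (z - z0) - \<mu> / 2 * (norm (z - z0))\<^sup>2 + \<mu> * ((z - z0) \<bullet> \<eta>) \<le> f1 \<eta>"
    using sup_convolution_attained[OF K(1,2) UV(1), of p \<mu>] by blast
  obtain f2 where f2: "\<And>\<eta>. \<exists>w\<in>K2. f2 \<eta> = V w - q \<bullet> (w - w0) - \<mu> / 2 * (norm (w - w0))\<^sup>2 + \<mu> * ((w - w0) \<bullet> \<eta>)"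
    "\<And>\<eta> w. w \<in> K2 \<Longrightarrow> V w - q \<bullet> (w - w0) - \<mu> / 2 * (norm (w - w0))\<^sup>2 + \<mu> * ((w - w0) \<bullet> \<eta>) \<le> f2 \<eta>"
    using sup_convolution_attained[OF K(3,4) UV(2), of q \<mu>] by blast
  have sub1: "subgrad f1 \<eta> (\<mu> *\<^sub>R (z - z0))"
    if "z \<in> K1" "f1 \<eta> = U z - p \<bullet> (z - z0) - \<mu> / 2 * (norm (z - z0))\<^sup>2 + \<mu> * ((z - z0) \<bullet> \<eta>)" for z \<eta>
    unfolding subgrad_def
  proof
    fix y
    from f1(2)[OF that(1), of y] that(2) show "f1 \<eta> + \<mu> *\<^sub>R (z - z0) \<bullet> (y - \<eta>) \<le> f1 y"
      by (simp add: inner_diff_right right_diff_distrib)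
  qed
  have sub2: "subgrad f2 \<eta> (\<mu> *\<^sub>R (w - w0))"
    if "w \<in> K2" "f2 \<eta> = V w - q \<bullet> (w - w0) - \<mu> / 2 * (norm (w - w0))\<^sup>2 + \<mu> * ((w - w0) \<bullet> \<eta>)" for w \<eta>
    unfolding subgrad_def
  proof
    fix y
    from f2(2)[OF that(1), of y] that(2) show "f2 \<eta> + \<mu> *\<^sub>R (w - w0) \<bullet> (y - \<eta>) \<le> f2 y"
      by (simp add: inner_diff_right right_diff_distrib)
  qed
  define f where "f \<eta> = f1 (fst \<eta>) + f2 (snd \<eta>)" for \<eta>
  have subf: "subgrad f \<eta> (a, b)" if "subgrad f1 (fst \<eta>) a" "subgrad f2 (snd \<eta>) b" for \<eta> a b
    using that unfolding subgrad_def f_def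
      by (auto simp: inner_prod_def intro: add_mono order_trans[OF _ add_mono])
      (smt (verit))
  have "\<exists>q. subgrad f x q" for x
    using f1(1)[of "fst x"] f2(1)[of "snd x"] sub1 sub2 subf by meson
  \<comment> \<open>\<open>\<mu>\<close> accounts for the convexifying terms in f1 and f2;
    \<open>\<epsilon>\<close> makes the touching at 0 strict, as
    \<open>second_order_at_near_touching_point\<close> requires.\<close>
  moreover define S' where "S' \<eta> = S \<eta> + (\<mu> + \<epsilon>) *\<^sub>R \<eta>" for \<eta>
  have linS': "linear S'" unfolding S'_def
    by (rule linearI) (simp_all add: linear_add[OF S(1)] linear_scale[OF S(1)] algebra_simps)
  have symS': "x \<bullet> S' y = S' x \<bullet> y" for x y by (simp add: S'_def inner_add_left inner_add_right S(2))
  have fU: "f \<eta> \<le> U z0 + V w0 + (\<eta> \<bullet> S' \<eta>) / 2 - \<epsilon> / 2 * (norm \<eta>)\<^sup>2"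
    and f0: "f 0 = U z0 + V w0" for \<eta>
  proof -
    \<comment> \<open>Insert the maximisers into the contact condition and complete the square;
      \<open>JS\<close> then trades J \<xi> for the form of S at \<eta>, and \<open>J\<close> gives
      the exact value at 0.\<close>
    have gen: "\<exists>\<xi>. f \<eta> \<le> U z0 + V w0 + J \<xi> / 2 - \<mu> / 2 * (norm (\<xi> - \<eta>))\<^sup>2 + \<mu> / 2 * (norm \<eta>)\<^sup>2" for \<eta>
    proof -
      obtain z w where z: "z \<in> K1" "f1 (fst \<eta>) = U z - p \<bullet> (z - z0) - \<mu> / 2 * (norm (z - z0))\<^sup>2
          + \<mu> * ((z - z0) \<bullet> fst \<eta>)"
        and w: "w \<in> K2" "f2 (snd \<eta>) = V w - q \<bullet> (w - w0) - \<mu> / 2 * (norm (w - w0))\<^sup>2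
            + \<mu> * ((w - w0) \<bullet> snd \<eta>)"
        using f1(1)[of "fst \<eta>"] f2(1)[of "snd \<eta>"] by blast
      define \<xi> where "\<xi> = (z - z0, w - w0)"
      have "(norm \<xi>)\<^sup>2 = (norm (z - z0))\<^sup>2 + (norm (w - w0))\<^sup>2" by (simp add: \<xi>_def norm_Pair)
      moreover have "\<xi> \<bullet> \<eta> = (z - z0) \<bullet> fst \<eta> + (w - w0) \<bullet> snd \<eta>" by (simp add: \<xi>_def inner_prod_def)
      moreover have "(norm (\<xi> - \<eta>))\<^sup>2 = (norm \<xi>)\<^sup>2 - 2 * (\<xi> \<bullet> \<eta>) + (norm \<eta>)\<^sup>2"
        unfolding power2_norm_eq_inner by (simp add: inner_diff_left inner_diff_right inner_commute)
      ultimately have nE: "(norm (\<xi> - \<eta>))\<^sup>2 = ((norm (z - z0))\<^sup>2 + (norm (w - w0))\<^sup>2)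
          - 2 * ((z - z0) \<bullet> fst \<eta> + (w - w0) \<bullet> snd \<eta>) + (norm \<eta>)\<^sup>2" by simp
      have "\<mu> / 2 * (norm (z - z0))\<^sup>2 + \<mu> / 2 * (norm (w - w0))\<^sup>2 - \<mu> * ((z - z0) \<bullet> fst \<eta>)
          - \<mu> * ((w - w0) \<bullet> snd \<eta>)
          = \<mu> / 2 * (norm (\<xi> - \<eta>))\<^sup>2 - \<mu> / 2 * (norm \<eta>)\<^sup>2"
        unfolding nE by (simp add: algebra_simps)
      then show ?thesis using contact[OF z(1) w(1)] unfolding f_def z w \<xi>_def[symmetric]
        by (intro exI[of _ \<xi>]) linarith
    qed
    obtain \<xi> where \<xi>: "f \<eta> \<le> U z0 + V w0 + J \<xi> / 2 - \<mu> / 2 * (norm (\<xi> - \<eta>))\<^sup>2 + \<mu> / 2 * (norm \<eta>)\<^sup>2"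
      using gen by blast
    have "\<eta> \<bullet> S' \<eta> = \<eta> \<bullet> S \<eta> + \<mu> * (norm \<eta>)\<^sup>2 + \<epsilon> * (norm \<eta>)\<^sup>2"
      by (simp add: S'_def inner_add_right power2_norm_eq_inner algebra_simps)
    then show "f \<eta> \<le> U z0 + V w0 + (\<eta> \<bullet> S' \<eta>) / 2 - \<epsilon> / 2 * (norm \<eta>)\<^sup>2"
      using \<xi> JS[of \<xi> \<eta>] by (simp add: add_divide_distrib)
    obtain \<xi>0 where "f 0 \<le> U z0 + V w0 + J \<xi>0 / 2 - \<mu> / 2 * (norm (\<xi>0 - 0))\<^sup>2
        + \<mu> / 2 * (norm (0::'a \<times> 'a))\<^sup>2" using gen by blast
    then have "f 0 \<le> U z0 + V w0" using J[of \<xi>0] by simp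
    moreover have "U z0 + V w0 \<le> f 0" using f1(2)[OF K(2), of 0] f2(2)[OF K(4), of 0] by (simp add: f_def)
    ultimately show "f 0 = U z0 + V w0" by simp
  qed
  \<comment> \<open>The components of g are \<mu> (z - z0) and \<mu> (w - w0), so |g| < \<epsilon>
    \<mu> controls the points; the gradients move by at most (\<mu> + 1) \<epsilon>1.\<close>
  define \<epsilon>1 where "\<epsilon>1 = min (\<epsilon> * \<mu>) (\<epsilon> / (2 * (\<mu> + 1)))"
  have \<epsilon>1: "\<epsilon>1 > 0" using eps lam by (simp add: \<epsilon>1_def)
  have \<epsilon>1': "\<epsilon>1 \<le> \<epsilon> * \<mu>" "\<epsilon>1 \<le> \<epsilon> / (2 * (\<mu> + 1))" unfolding \<epsilon>1_def by (rule min.cobounded1 min.cobounded2)+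
  ultimately obtain x g M where x: "norm x < \<epsilon>1" "norm g < \<epsilon>1" "second_order_at f x g M"
    "\<And>h. h \<bullet> M h \<le> h \<bullet> S' h"
    using second_order_at_near_touching_point[OF _ linS' symS' eps _ \<epsilon>1, of f] fU f0 by auto
  have linM: "linear M" using x(3) by (simp add: second_order_at_def)
  obtain z w where z: "z \<in> K1" "f1 (fst x) = U z - p \<bullet> (z - z0) - \<mu> / 2 * (norm (z - z0))\<^sup>2
      + \<mu> * ((z - z0) \<bullet> fst x)"
    and w: "w \<in> K2" "f2 (snd x) = V w - q \<bullet> (w - w0) - \<mu> / 2 * (norm (w - w0))\<^sup>2 + \<mu> * ((w - w0) \<bullet> snd x)"
    using f1(1)[of "fst x"] f2(1)[of "snd x"] by blast
  have s12: "subgrad f1 (fst x) (\<mu> *\<^sub>R (z - z0))" "subgrad f2 (snd x) (\<mu> *\<^sub>R (w - w0))"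
    using sub1[OF z] sub2[OF w] by auto
  have g: "g = (\<mu> *\<^sub>R (z - z0), \<mu> *\<^sub>R (w - w0))"
    using second_order_at_subgrad_unique[OF x(3) subf[OF s12]] by simp
  \<comment> \<open>The diagonal blocks of M. As f is a sum of functions of separate variables,
    dropping the mixed terms does not increase the form, which is \<open>split\<close>.\<close>
  define M1 where "M1 h = fst (M (h, 0))" for h
  define M2 where "M2 h = snd (M (0, h))" for h
  have linM1: "linear M1" unfolding M1_def
    using linear_add[OF linM, of "(_, 0)" "(_, 0)"] linear_scale[OF linM, of _ "(_, 0)"]
      by (intro linearI) simp_all
  have linM2: "linear M2" unfolding M2_def
    using linear_add[OF linM, of "(0, _)" "(0, _)"] linear_scale[OF linM, of _ "(0, _)"]
      by (intro linearI) simp_all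
  have ex: "\<exists>d>0. \<forall>h. norm h < d \<longrightarrow> \<bar>f (x + h) - f x - g \<bullet> h - (h \<bullet> M h) / 2\<bar> \<le> e * (norm h)\<^sup>2"
    if "e > 0" for e
    using x(3) that unfolding second_order_at_def by blast
  have e1: "\<bar>f1 (fst x + h) - f1 (fst x) - (\<mu> *\<^sub>R (z - z0)) \<bullet> h - (h \<bullet> M1 h) / 2\<bar> \<le> e * (norm h)\<^sup>2"
    if d: "\<And>h. norm h < d \<Longrightarrow> \<bar>f (x + h) - f x - g \<bullet> h - (h \<bullet> M h) / 2\<bar> \<le> e * (norm h)\<^sup>2"
      and "norm h < d" for h d e
    using d[of "(h, 0)"] that(2) by (simp add: norm_Pair f_def g inner_prod_def M1_def)
  have e2: "\<bar>f2 (snd x + h) - f2 (snd x) - (\<mu> *\<^sub>R (w - w0)) \<bullet> h - (h \<bullet> M2 h) / 2\<bar> \<le> e * (norm h)\<^sup>2"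
    if d: "\<And>h. norm h < d \<Longrightarrow> \<bar>f (x + h) - f x - g \<bullet> h - (h \<bullet> M h) / 2\<bar> \<le> e * (norm h)\<^sup>2"
      and "norm h < d" for h d e
    using d[of "(0, h)"] that(2) by (simp add: norm_Pair f_def g inner_prod_def M2_def)
  have split: "fst h \<bullet> M1 (fst h) + snd h \<bullet> M2 (snd h) \<le> h \<bullet> M h" for h
  proof (rule form_le_if_le_small[where c = 4 and A = "\<lambda>h. fst h \<bullet> M1 (fst h) + snd h \<bullet> M2 (snd h)"
    and B = "\<lambda>h. h \<bullet> M h"])
    show "fst (t *\<^sub>R h) \<bullet> M1 (fst (t *\<^sub>R h)) + snd (t *\<^sub>R h) \<bullet> M2 (snd (t *\<^sub>R h))
        = t\<^sup>2 * (fst h \<bullet> M1 (fst h) + snd h \<bullet> M2 (snd h))" for t h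
      by (simp add: linear_form_scale[OF linM1, unfolded inner_scaleR_left] linear_form_scale[OF
        linM2, unfolded inner_scaleR_left] distrib_left)
    show "(t *\<^sub>R h) \<bullet> M (t *\<^sub>R h) = t\<^sup>2 * (h \<bullet> M h)" for t h by (rule linear_form_scale[OF linM])
    fix e :: real assume "e > 0"
    from ex[OF this] obtain d where d: "d > 0" "\<And>h. norm h < d \<Longrightarrow> \<bar>f (x + h) - f x - g \<bullet> h
        - (h \<bullet> M h) / 2\<bar> \<le> e * (norm h)\<^sup>2" by blast
    show "\<exists>d>0. \<forall>h. norm h < d \<longrightarrow> fst h \<bullet> M1 (fst h) + snd h \<bullet> M2 (snd h) \<le> h \<bullet> M h + 4 * e * (norm h)\<^sup>2"
    proof (intro exI[of _ d] conjI allI impI d(1))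
      fix h :: "'a \<times> 'a" assume h: "norm h < d"
      have n: "norm (fst h) < d" "norm (snd h) < d"
        using h norm_fst_le[of "fst h" "snd h"] norm_snd_le[of "snd h" "fst h"] by auto
      have 0: "(norm h)\<^sup>2 = (norm (fst h))\<^sup>2 + (norm (snd h))\<^sup>2" by (simp add: norm_prod_def)
      have "e * (norm h)\<^sup>2 = e * (norm (fst h))\<^sup>2 + e * (norm (snd h))\<^sup>2" unfolding 0
        by (simp add: distrib_left)
      moreover have "f (x + h) - f x - g \<bullet> h
          = (f1 (fst x + fst h) - f1 (fst x) - (\<mu> *\<^sub>R (z - z0)) \<bullet> fst h)
          + (f2 (snd x + snd h) - f2 (snd x) - (\<mu> *\<^sub>R (w - w0)) \<bullet> snd h)"
        by (simp add: f_def g inner_prod_def)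
      ultimately show "fst h \<bullet> M1 (fst h) + snd h \<bullet> M2 (snd h) \<le> h \<bullet> M h + 4 * e * (norm h)\<^sup>2"
        using d(2)[OF h] e1[OF d(2) n(1)] e2[OF d(2) n(2)] by linarith
    qed
  qed simp
  \<comment> \<open>Convexity of f1 and f2 makes their second-order forms nonnegative. This becomes
    the lower bound -\<mu> for X and Y, which keeps them bounded independently of
    \<epsilon>.\<close>
  have pos: "0 \<le> h \<bullet> N h" if N: "linear N" and s: "subgrad F y a"
    and F: "\<And>e. e > 0 \<Longrightarrow> \<exists>d>0. \<forall>h. norm h < d \<longrightarrow> \<bar>F (y + h) - F y - a \<bullet> h - (h \<bullet> N h) / 2\<bar> \<le> e * (norm h)\<^sup>2"
    for N :: "'a \<Rightarrow> 'a" and F y a h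
  proof (rule form_le_if_le_small[where c = 2 and A = "\<lambda>_. 0" and B = "\<lambda>h. h \<bullet> N h"])
    show "(t *\<^sub>R h) \<bullet> N (t *\<^sub>R h) = t\<^sup>2 * (h \<bullet> N h)" for t h by (rule linear_form_scale[OF N])
    fix e :: real assume "e > 0"
    from F[OF this] obtain d where d: "d > 0" "\<And>h. norm h < d \<Longrightarrow> \<bar>F (y + h) - F y - a \<bullet> h
        - (h \<bullet> N h) / 2\<bar> \<le> e * (norm h)\<^sup>2" by blast
    have "F y + a \<bullet> h \<le> F (y + h)" for h using s unfolding subgrad_def by (metis add_diff_cancel_left')
    then have "0 \<le> h \<bullet> N h + 2 * e * (norm h)\<^sup>2" if "norm h < d" for h
      using d(2)[OF that] \<open>\<And>h. F y + a \<bullet> h \<le> F (y + h)\<close>[of h] by linarith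
    then show "\<exists>d>0. \<forall>h. norm h < d \<longrightarrow> 0 \<le> h \<bullet> N h + 2 * e * (norm h)\<^sup>2" using d(1) by blast
  qed auto
  have exp1: "\<exists>d>0. \<forall>h. norm h < d \<longrightarrow> \<bar>f1 (fst x + h) - f1 (fst x) - (\<mu> *\<^sub>R (z - z0)) \<bullet> h
      - (h \<bullet> M1 h) / 2\<bar> \<le> e * (norm h)\<^sup>2" if "e > 0" for e
    using ex[OF that] e1 by metis
  have exp2: "\<exists>d>0. \<forall>h. norm h < d \<longrightarrow> \<bar>f2 (snd x + h) - f2 (snd x) - (\<mu> *\<^sub>R (w - w0)) \<bullet> h
      - (h \<bullet> M2 h) / 2\<bar> \<le> e * (norm h)\<^sup>2" if "e > 0" for e
    using ex[OF that] e2 by metis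
  have up: "\<exists>d>0. \<forall>h. norm h < d \<longrightarrow> F (y + h) \<le> F y + a \<bullet> h + (h \<bullet> N h) / 2 + e * (norm h)\<^sup>2"
    if "\<exists>d>0. \<forall>h. norm h < d \<longrightarrow> \<bar>F (y + h) - F y - a \<bullet> h - (h \<bullet> N h) / 2\<bar> \<le> e * (norm h)\<^sup>2"
    for N :: "'a \<Rightarrow> 'a" and F y a e
  proof -
    have "u \<le> b + c + d + e" if "\<bar>u - b - c - d\<bar> \<le> e" for u b c d e :: real using that by linarith
    with that show ?thesis by blast
  qed
  obtain X where X: "superjet K1 U z (p + \<mu> *\<^sub>R (z - z0) - \<mu> *\<^sub>R fst x) X" "\<And>h. h \<bullet> X h
      = h \<bullet> M1 h - \<mu> * (norm h)\<^sup>2"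
    using superjet_from_sup_convolution[where f = f1 and U = U, OF z f1(2) linM1 up[OF exp1] refl] by blast
  obtain Y where Y: "superjet K2 V w (q + \<mu> *\<^sub>R (w - w0) - \<mu> *\<^sub>R snd x) Y" "\<And>h. h \<bullet> Y h
      = h \<bullet> M2 h - \<mu> * (norm h)\<^sup>2"
    using superjet_from_sup_convolution[where f = f2 and U = V, OF w f2(2) linM2 up[OF exp2] refl] by blast
  have ng: "norm (\<mu> *\<^sub>R (z - z0)) < \<epsilon>1" "norm (\<mu> *\<^sub>R (w - w0)) < \<epsilon>1"
    using x(2) norm_fst_le[of "fst g" "snd g"] norm_snd_le[of "snd g" "fst g"] by (auto simp: g)
  have nx: "norm (fst x) < \<epsilon>1" "norm (snd x) < \<epsilon>1"
    using x(1) norm_fst_le[of "fst x" "snd x"] norm_snd_le[of "snd x" "fst x"] by auto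
  have close: "norm a < \<epsilon>" if "norm (\<mu> *\<^sub>R a) < \<epsilon>1" for a :: 'a
  proof -
    have "norm (\<mu> *\<^sub>R a) = \<mu> * norm a" using lam by simp
    then have "\<mu> * norm a < \<epsilon> * \<mu>" using that \<epsilon>1'(1) by linarith
    then show ?thesis using lam by (simp add: mult.commute)
  qed
  have close2: "norm (r + a - \<mu> *\<^sub>R b - r) < \<epsilon>" if "norm a < \<epsilon>1" "norm b < \<epsilon>1" for r a b :: 'a
  proof -
    have "norm (r + a - \<mu> *\<^sub>R b - r) \<le> norm a + \<mu> * norm b"
      using norm_triangle_ineq4[of a "\<mu> *\<^sub>R b"] lam by (simp add: algebra_simps)
    also have "\<dots> < \<epsilon>1 + \<mu> * \<epsilon>1" using that lam by (intro add_strict_mono) auto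
    also have "\<dots> = (\<mu> + 1) * \<epsilon>1" by (simp add: algebra_simps)
    also have "\<dots> \<le> (\<mu> + 1) * (\<epsilon> / (2 * (\<mu> + 1)))" using \<epsilon>1'(2) lam by (intro mult_left_mono) auto
    also have "\<dots> = \<epsilon> / 2" using lam by (simp add: field_simps)
    also have "\<dots> < \<epsilon>" using eps by simp
    finally show ?thesis .
  qed
  have "h \<bullet> X h + k \<bullet> Y k \<le> (h, k) \<bullet> S (h, k) + \<epsilon> * ((norm h)\<^sup>2 + (norm k)\<^sup>2)" for h k
  proof -
    have "(h, k) \<bullet> S' (h, k) = (h, k) \<bullet> S (h, k) + (\<mu> + \<epsilon>) * ((norm h)\<^sup>2 + (norm k)\<^sup>2)"
      by (simp add: S'_def inner_prod_def power2_norm_eq_inner inner_add_right algebra_simps)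
    then show ?thesis using split[of "(h, k)"] x(4)[of "(h, k)"] X(2)[of h] Y(2)[of k]
      by (simp add: algebra_simps)
  qed
  moreover have "- \<mu> * (norm h)\<^sup>2 \<le> h \<bullet> X h" for h using pos[OF linM1 s12(1) exp1, of h] X(2)[of h] by simp
  moreover have "- \<mu> * (norm h)\<^sup>2 \<le> h \<bullet> Y h" for h using pos[OF linM2 s12(2) exp2, of h] Y(2)[of h] by simp
  ultimately show ?thesis
    using z(1) w(1) X(1) Y(1) close[OF ng(1)] close[OF ng(2)] close2[OF ng(1) nx(1), of p] close2[OF
      ng(2) nx(2), of q]
    by blast
qed

section \<open>Test functions\<close>

text \<open>\<open>C2_on\<close> with the derivatives as parameters, so that gradient, time
  derivative and Hessian of a composed test function can be read off.\<close>

definition C2_with :: "'a::real_normed_vector set \<Rightarrow> ('a \<Rightarrow> real) \<Rightarrow> ('a \<Rightarrow> 'a \<Rightarrow>\<^sub>L real) \<Rightarrow>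
    ('a \<Rightarrow> 'a \<Rightarrow>\<^sub>L ('a \<Rightarrow>\<^sub>L real)) \<Rightarrow> bool" where
  "C2_with S f f' f'' \<longleftrightarrow> (\<forall>x\<in>S. (f has_derivative blinfun_apply (f' x)) (at x)) \<and>
     (\<forall>x\<in>S. (f' has_derivative blinfun_apply (f'' x)) (at x)) \<and> continuous_on S f''"

lemma C2_with_imp_C2_on: "C2_with S f f' f'' \<Longrightarrow> C2_on S f"
  unfolding C2_with_def C2_on_def by blast

lemma C2_with_add:
  assumes "C2_with S f f' f''" "C2_with S g g' g''"
  shows "C2_with S (\<lambda>x. f x + g x) (\<lambda>x. f' x + g' x) (\<lambda>x. f'' x + g'' x)"
  using assms unfolding C2_with_def by (auto simp: plus_blinfun.rep_eq intro!: has_derivative_add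
    continuous_on_add)

lemma C2_with_cmult:
  assumes "C2_with S f f' f''"
  shows "C2_with S (\<lambda>x. c * f x) (\<lambda>x. c *\<^sub>R f' x) (\<lambda>x. c *\<^sub>R f'' x)"
  using assms unfolding C2_with_def
  by (auto simp: scaleR_blinfun.rep_eq intro!: has_derivative_mult_right has_derivative_scaleR_right
    continuous_on_scaleR continuous_on_const)

lemma C2_with_linear: "C2_with S (\<lambda>z. p \<bullet> (z - z0)) (\<lambda>z. blinfun_inner_right p) (\<lambda>z. 0)"
  unfolding C2_with_def
  by (auto simp: zero_blinfun.rep_eq blinfun_inner_right.rep_eq intro!: derivative_eq_intros)

lemma C2_with_quadratic:
  fixes W :: "'a::euclidean_space \<Rightarrow> 'a"
  assumes W: "linear W" and sym: "\<And>x y. x \<bullet> W y = W x \<bullet> y"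
  shows "C2_with S (\<lambda>z. ((z - z0) \<bullet> W (z - z0)) / 2) (\<lambda>z. blinfun_inner_right (W (z - z0)))
    (\<lambda>z. Blinfun (\<lambda>h. blinfun_inner_right (W h)))"
proof -
  have bl: "bounded_linear W" using W by (simp add: linear_conv_bounded_linear)
  have bl2: "bounded_linear (\<lambda>h. blinfun_inner_right (W h))"
    by (rule bounded_linear_compose[OF bounded_linear_blinfun_inner_right bl])
  have d: "((\<lambda>z. W (z - z0)) has_derivative W) (at x)" for x
    by (rule derivative_eq_intros bounded_linear.has_derivative[OF bl] refl | simp)+
  have "((\<lambda>z. ((z - z0) \<bullet> W (z - z0)) / 2) has_derivative blinfun_inner_right (W (x - z0))) (at x)" for x
  proof -
    have "((\<lambda>z. ((z - z0) \<bullet> W (z - z0)) / 2) has_derivative (\<lambda>h. ((x - z0) \<bullet> W h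
        + h \<bullet> W (x - z0)) / 2)) (at x)"
      by (auto intro!: derivative_eq_intros d)
    moreover have "((x - z0) \<bullet> W h + h \<bullet> W (x - z0)) / 2 = blinfun_inner_right (W (x - z0)) h" for h
      using sym[of "x - z0" h] by (simp add: blinfun_inner_right.rep_eq inner_commute[of h])
    ultimately show ?thesis by simp
  qed
  moreover have "((\<lambda>z. blinfun_inner_right (W (z - z0))) has_derivative blinfun_apply
      (Blinfun (\<lambda>h. blinfun_inner_right (W h)))) (at x)" for x
    unfolding bounded_linear_Blinfun_apply[OF bl2]
    by (rule bounded_linear.has_derivative[OF bounded_linear_blinfun_inner_right d])
  ultimately show ?thesis unfolding C2_with_def by auto
qed

lemma C2_with_compose:
  assumes f: "C2_with S f f' f''"
    and d1: "\<And>x. x \<in> S \<Longrightarrow> (\<phi> has_real_derivative \<phi>' (f x)) (at (f x))"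
    and d2: "\<And>x. x \<in> S \<Longrightarrow> (\<phi>' has_real_derivative \<phi>'' (f x)) (at (f x))"
    and c: "continuous_on (f ` S) \<phi>''"
  shows "C2_with S (\<lambda>x. \<phi> (f x)) (\<lambda>x. \<phi>' (f x) *\<^sub>R f' x)
     (\<lambda>x. \<phi>' (f x) *\<^sub>R f'' x + \<phi>'' (f x) *\<^sub>R (blinfun_scaleR_left (f' x) o\<^sub>L f' x))"
  unfolding C2_with_def
proof (intro conjI ballI)
  fix x assume x: "x \<in> S"
  have fd: "(f has_derivative f' x) (at x)" and fd2: "(f' has_derivative f'' x) (at x)" using f x
    by (auto simp: C2_with_def)
  have "((\<lambda>x. \<phi> (f x)) has_derivative (\<lambda>h. f' x h * \<phi>' (f x))) (at x)"
    using has_derivative_compose[OF fd d1[OF x, unfolded has_field_derivative_def]]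
      by (simp add: mult.commute)
  then show "((\<lambda>x. \<phi> (f x)) has_derivative blinfun_apply (\<phi>' (f x) *\<^sub>R f' x)) (at x)"
    by (simp add: scaleR_blinfun.rep_eq mult.commute)
  have "((\<lambda>x. \<phi>' (f x)) has_derivative (\<lambda>h. \<phi>'' (f x) * f' x h)) (at x)"
    using has_derivative_compose[OF fd d2[OF x, unfolded has_field_derivative_def]] by simp
  from has_derivative_scaleR[OF this fd2]
  show "((\<lambda>x. \<phi>' (f x) *\<^sub>R f' x) has_derivative
      blinfun_apply (\<phi>' (f x) *\<^sub>R f'' x + \<phi>'' (f x) *\<^sub>R (blinfun_scaleR_left (f' x) o\<^sub>L f' x))) (at x)"
    by (simp add: plus_blinfun.rep_eq scaleR_blinfun.rep_eq blinfun_compose.rep_eq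
      blinfun_scaleR_left.rep_eq)
next
  have cf: "continuous_on S f" and cf': "continuous_on S f'"
    using f unfolding C2_with_def by (auto intro!: has_derivative_continuous_on intro:
      has_derivative_at_withinI)
  have cf'': "continuous_on S f''" using f by (simp add: C2_with_def)
  have "continuous_on (f ` S) \<phi>'"
    using d2 by (intro DERIV_continuous_on[where D = \<phi>'']) (auto intro: has_field_derivative_at_within)
  then have c1: "continuous_on S (\<lambda>x. \<phi>' (f x))" by (rule continuous_on_compose2[OF _ cf]) auto
  have c2: "continuous_on S (\<lambda>x. \<phi>'' (f x))" by (rule continuous_on_compose2[OF c cf]) auto
  show "continuous_on S (\<lambda>x. \<phi>' (f x) *\<^sub>R f'' x + \<phi>'' (f x) *\<^sub>R (blinfun_scaleR_left (f' x) o\<^sub>L f' x))"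
    by (intro continuous_intros c1 c2 cf'' cf' bounded_linear.continuous_on[OF
      bounded_linear_blinfun_scaleR_left])
qed

text \<open>Applied with L the projection to space, to regard |x - y|^k as a function on
  space-time.\<close>

lemma C2_with_pullback:
  fixes L :: "'b::real_normed_vector \<Rightarrow>\<^sub>L 'a::real_normed_vector"
  assumes f: "C2_with S f f' f''" and S: "\<And>z. z \<in> S' \<Longrightarrow> L z - y \<in> S"
  shows "C2_with S' (\<lambda>z. f (L z - y)) (\<lambda>z. f' (L z - y) o\<^sub>L L)
     (\<lambda>z. Blinfun (\<lambda>B. B o\<^sub>L L) o\<^sub>L f'' (L z - y) o\<^sub>L L)"
  unfolding C2_with_def
proof (intro conjI ballI)
  fix z assume z: "z \<in> S'"
  have fd: "(f has_derivative f' (L z - y)) (at (L z - y))"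
    and fd2: "(f' has_derivative f'' (L z - y)) (at (L z - y))"
    using f S[OF z] by (auto simp: C2_with_def)
  have L: "((\<lambda>z. L z - y) has_derivative L) (at z)"
    by (auto intro!: derivative_eq_intros bounded_linear_imp_has_derivative blinfun.bounded_linear_right)
  show "((\<lambda>z. f (L z - y)) has_derivative blinfun_apply (f' (L z - y) o\<^sub>L L)) (at z)"
    using has_derivative_compose[OF L fd] by (simp add: blinfun_compose.rep_eq o_def)
  have "((\<lambda>z. f' (L z - y)) has_derivative (\<lambda>h. f'' (L z - y) (L h))) (at z)"
    using has_derivative_compose[OF L fd2] .
  from bounded_linear.has_derivative[OF bounded_bilinear.bounded_linear_left[OF
    bounded_bilinear_blinfun_compose] this]
  show "((\<lambda>z. f' (L z - y) o\<^sub>L L) has_derivative blinfun_apply (Blinfun (\<lambda>B. B o\<^sub>L L) o\<^sub>L f'' (L z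
      - y) o\<^sub>L L)) (at z)"
    by (simp add: blinfun_compose.rep_eq o_def bounded_linear_Blinfun_apply
      bounded_bilinear.bounded_linear_left[OF bounded_bilinear_blinfun_compose])
next
  have "continuous_on S f''" using f by (simp add: C2_with_def)
  then have "continuous_on S' (\<lambda>z. f'' (L z - y))"
    by (rule continuous_on_compose2) (use S in \<open>auto intro!: continuous_intros\<close>)
  then show "continuous_on S' (\<lambda>z. Blinfun (\<lambda>B. B o\<^sub>L L) o\<^sub>L f'' (L z - y) o\<^sub>L L)" by (intro continuous_intros)
qed

lemma space_gradient_C2_with:
  assumes f: "C2_with S f f' f''" and z: "z \<in> S"
  shows "space_gradient f z $ j = f' z (axis j 1, 0)"
proof -
  have "((\<lambda>x. f (x, snd z)) has_derivative (\<lambda>h. f' z (h, 0))) (at (fst z))"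
  proof -
    have "((\<lambda>x. (x, snd z)) has_derivative (\<lambda>h. (h, 0))) (at (fst z))"
      by (auto intro!: derivative_eq_intros)
    moreover have "(f has_derivative f' z) (at (fst z, snd z))" using f z by (simp add: C2_with_def)
    ultimately show ?thesis by (rule has_derivative_compose)
  qed
  from frechet_derivative_at[OF this, symmetric] show ?thesis by (simp add: space_gradient_def gradient_def)
qed

lemma space_gradient_eqI:
  assumes "C2_with S f f' f''" "z \<in> S" "\<And>j. f' z (axis j 1, 0) = v $ j"
  shows "space_gradient f z = v"
  by (simp add: vec_eq_iff space_gradient_C2_with[OF assms(1,2)] assms(3))

lemma time_deriv_C2_with:
  assumes f: "C2_with S f f' f''" and z: "z \<in> S"
  shows "time_deriv f z = f' z (0, 1)"
proof -
  have "((\<lambda>t. f (fst z, t)) has_derivative (\<lambda>h. f' z (0, h))) (at (snd z))"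
  proof -
    have "((\<lambda>t. (fst z, t)) has_derivative (\<lambda>h. (0, h))) (at (snd z))"
      by (auto intro!: derivative_eq_intros)
    moreover have "(f has_derivative f' z) (at (fst z, snd z))" using f z by (simp add: C2_with_def)
    ultimately show ?thesis by (rule has_derivative_compose)
  qed
  moreover have "(\<lambda>h. f' z (0, h)) = (*) (f' z (0, 1))"
  proof
    show "f' z (0, h) = f' z (0, 1) * h" for h
      using blinfun.scaleR_right[of "f' z" h "(0, 1)"] by simp
  qed
  ultimately have "((\<lambda>t. f (fst z, t)) has_real_derivative f' z (0, 1)) (at (snd z))"
    by (simp only: has_field_derivative_def)
  then show ?thesis unfolding time_deriv_def by (rule DERIV_imp_deriv)
qed

text \<open>The gradient has to be identified in a neighbourhood of z before it can be
  differentiated, hence the open S.\<close>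

lemma space_hessian_C2_with:
  fixes S :: "((real ^ 'n) \<times> real) set"
  assumes f: "C2_with S f f' f''" and S: "open S" and z: "z \<in> S"
  shows "space_hessian f z $ i $ j = f'' z (axis i 1, 0) (axis j 1, 0)"
proof -
  have "((\<lambda>x. f' (x, snd z) (axis j 1, 0)) has_derivative (\<lambda>h. f'' z (h, 0) (axis j 1, 0))) (at (fst z))"
  proof -
    have "((\<lambda>x. (x, snd z)) has_derivative (\<lambda>h. (h, 0))) (at (fst z))"
      by (auto intro!: derivative_eq_intros)
    moreover have "(f' has_derivative f'' z) (at (fst z, snd z))" using f z by (simp add: C2_with_def)
    ultimately have "((\<lambda>x. f' (x, snd z)) has_derivative (\<lambda>h. f'' z (h, 0))) (at (fst z))"
      by (rule has_derivative_compose)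
    then show ?thesis by (rule bounded_linear.has_derivative[OF blinfun.bounded_linear_left])
  qed
  moreover
  have "\<forall>\<^sub>F x in nhds (fst z). f' (x, snd z) (axis j 1, 0) = gradient (\<lambda>x. f (x, snd z)) x $ j"
  proof -
    have "open ((\<lambda>x. (x, snd z)) -` S)" using S by (intro open_vimage continuous_intros) auto
    then have "\<forall>\<^sub>F x in nhds (fst z). (x, snd z) \<in> S"
      using eventually_nhds_in_open[of "(\<lambda>x. (x, snd z)) -` S" "fst z"] z by simp
    then show ?thesis
    proof eventually_elim
      case (elim x)
      show ?case using space_gradient_C2_with[OF f elim, of j]
        by (simp only: space_gradient_def fst_conv snd_conv)
    qed
  qed
  note ev = this
  then have "\<forall>\<^sub>F x in at (fst z). f' (x, snd z) (axis j 1, 0) = gradient (\<lambda>x. f (x, snd z)) x $ j"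
    unfolding eventually_at_filter by (rule eventually_mono) simp
  ultimately have "((\<lambda>x. gradient (\<lambda>x. f (x, snd z)) x $ j) has_derivative
      (\<lambda>h. f'' z (h, 0) (axis j 1, 0))) (at (fst z))"
    by (rule has_derivative_transform_eventually) (use eventually_nhds_x_imp_x[OF ev] in simp_all)
  from frechet_derivative_at[OF this, symmetric] show ?thesis
    unfolding space_hessian_def hessian_def by simp
qed

definition spatial_matrix :: "((real ^ 'n) \<times> real \<Rightarrow> (real ^ 'n) \<times> real) \<Rightarrow> real ^ 'n ^ 'n" where
  "spatial_matrix X = (\<chi> i j. (axis i 1, 0) \<bullet> X (axis j 1, 0))"

text \<open>The function \<open>r \<mapsto> \<delta> r / (\<delta> + r)\<close> agrees with \<open>r\<close> to first order at \<open>0\<close>; composed with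
  a positive definite quadratic form it keeps the 2-jet at the vertex, but its gradient is
  uniformly of order \<open>\<surd>\<delta>\<close>.\<close>

definition tame :: "real \<Rightarrow> real \<Rightarrow> real" where
  "tame \<delta> r = \<delta> * r / (\<delta> + r)"

text \<open>The factor (\<delta>/(\<delta> + q))^2 is the derivative of \<open>tame \<delta>\<close>
  at the value q of the form. At z0 it is 1, and the term with the second derivative vanishes
  together with W (z - z0), so the Hessian there is W itself.\<close>

lemma C2_with_tame:
  fixes W :: "'a::euclidean_space \<Rightarrow> 'a"
  assumes W: "linear W" "\<And>x y. x \<bullet> W y = W x \<bullet> y" "\<And>h. 0 \<le> h \<bullet> W h" and \<delta>: "\<delta> > 0"
  shows "\<exists>f' f''. C2_with S (\<lambda>z. tame \<delta> (((z - z0) \<bullet> W (z - z0)) / 2)) f' f'' \<and>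
     (\<forall>z. f' z = (\<delta> / (\<delta> + ((z - z0) \<bullet> W (z - z0)) / 2))\<^sup>2 *\<^sub>R blinfun_inner_right (W (z - z0))) \<and>
     (\<forall>h k. f'' z0 h k = W h \<bullet> k)"
proof -
  let ?q = "\<lambda>z. ((z - z0) \<bullet> W (z - z0)) / 2"
  have q0: "0 \<le> ?q z" for z using W(3) by simp
  have bl: "bounded_linear (\<lambda>h. blinfun_inner_right (W h))"
    using W(1) bounded_linear_compose[OF bounded_linear_blinfun_inner_right]
      by (simp add: linear_conv_bounded_linear)
  have c: "C2_with S (\<lambda>z. tame \<delta> (?q z)) (\<lambda>z. (\<delta> / (\<delta> + ?q z))\<^sup>2 *\<^sub>R blinfun_inner_right (W (z - z0)))
     (\<lambda>z. (\<delta> / (\<delta> + ?q z))\<^sup>2 *\<^sub>R Blinfun (\<lambda>h. blinfun_inner_right (W h)) +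
        (- 2 * \<delta>\<^sup>2 / (\<delta> + ?q z) ^ 3) *\<^sub>R (blinfun_scaleR_left (blinfun_inner_right (W (z - z0))) o\<^sub>L
            blinfun_inner_right (W (z - z0))))"
  proof (rule C2_with_compose[OF C2_with_quadratic[OF W(1,2)], where \<phi>' = "\<lambda>r. (\<delta> / (\<delta> + r))\<^sup>2"
    and \<phi>'' = "\<lambda>r. - 2 * \<delta>\<^sup>2 / (\<delta> + r) ^ 3"])
    fix z
    have p: "\<delta> + ?q z > 0" using q0[of z] \<delta> by linarith
    then show "(tame \<delta> has_real_derivative (\<delta> / (\<delta> + ?q z))\<^sup>2) (at (?q z))"
      unfolding tame_def[abs_def] by (auto intro!: derivative_eq_intros simp: power2_eq_square field_simps)
    have "((\<lambda>r. \<delta> / (\<delta> + r)) has_real_derivative - \<delta> / (\<delta> + ?q z)\<^sup>2) (at (?q z))"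
      using p by (auto intro!: derivative_eq_intros simp: power2_eq_square)
    from DERIV_power[OF this, of 2]
    have "((\<lambda>r. (\<delta> / (\<delta> + r))\<^sup>2) has_real_derivative 2 * (\<delta> / (\<delta> + ?q z)) * (- \<delta> / (\<delta> + ?q z)\<^sup>2)) (at (?q z))"
      by (simp only: mult_ac of_nat_numeral numeral_2_eq_2 diff_Suc_1 power_one_right flip:
        One_nat_def) simp
    moreover have "2 * (\<delta> / D) * (- \<delta> / D\<^sup>2) = - 2 * \<delta>\<^sup>2 / D ^ 3" for D :: real
      by (simp add: power2_eq_square power3_eq_cube)
    ultimately show "((\<lambda>r. (\<delta> / (\<delta> + r))\<^sup>2) has_real_derivative - 2 * \<delta>\<^sup>2 / (\<delta> + ?q z) ^ 3) (at (?q z))"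
      by (simp only:)
  next
    have "\<delta> + r \<noteq> 0" if r: "r \<in> ?q ` S" for r
    proof -
      obtain x where "r = ?q x" using r by blast
      then show ?thesis using q0[of x] \<delta> by linarith
    qed
    then show "continuous_on (?q ` S) (\<lambda>r. - 2 * \<delta>\<^sup>2 / (\<delta> + r) ^ 3)"
      by (intro continuous_intros) auto
  qed
  show ?thesis
    apply (rule exI, rule exI, rule conjI, rule c)
    using \<delta> by (simp add: linear_0[OF W(1)] bounded_linear_Blinfun_apply[OF bl] plus_blinfun.rep_eq
      minus_blinfun.rep_eq scaleR_blinfun.rep_eq
        blinfun_inner_right.rep_eq o_def blinfun_compose.rep_eq blinfun_scaleR_left.rep_eq)
qed

text \<open>With \<delta> = s^2/2 the damping factor is at most s^2/(s^2 + |y|^2), and 2 s |y| \<le>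
  s^2 + |y|^2 bounds its product with |y| by s/2, whatever the size of y.\<close>

lemma tame_gradient_bound:
  fixes v y :: "'a::real_inner"
  assumes v: "norm v \<le> B * norm y" and q: "(norm y)\<^sup>2 / 2 \<le> q" and s: "s > 0" and B: "B \<ge> 0"
  shows "norm ((s\<^sup>2 / 2 / (s\<^sup>2 / 2 + q))\<^sup>2 *\<^sub>R v) \<le> B * s / 2"
proof -
  define Y where "Y = norm y"
  have Y: "Y \<ge> 0" by (simp add: Y_def)
  define t where "t = s\<^sup>2 / 2 / (s\<^sup>2 / 2 + q)"
  have q0: "q \<ge> 0" using q zero_le_power2[of "norm y"] by linarith
  have D: "s\<^sup>2 / 2 + q > 0" using s q0 by (simp add: add_pos_nonneg)
  have t: "0 \<le> t" "t \<le> 1" using D q0 s by (auto simp: t_def divide_le_eq)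
  have tt: "t \<le> s\<^sup>2 / (s\<^sup>2 + Y\<^sup>2)"
  proof -
    have "t \<le> s\<^sup>2 / 2 / (s\<^sup>2 / 2 + Y\<^sup>2 / 2)" unfolding t_def
      using q s by (intro divide_left_mono mult_pos_pos) (auto simp: Y_def add_pos_nonneg D)
    also have "\<dots> = s\<^sup>2 / (s\<^sup>2 + Y\<^sup>2)" by (simp add: add_divide_distrib[symmetric])
    finally show ?thesis .
  qed
  have am: "s\<^sup>2 / (s\<^sup>2 + Y\<^sup>2) * Y \<le> s / 2"
  proof -
    have "2 * s * Y \<le> s\<^sup>2 + Y\<^sup>2" using sum_squares_bound[of s Y] by simp
    then have "s * (2 * s * Y) \<le> s * (s\<^sup>2 + Y\<^sup>2)" using s by (intro mult_left_mono) auto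
    moreover have "s\<^sup>2 + Y\<^sup>2 > 0" using s by (simp add: add_pos_nonneg)
    ultimately show ?thesis by (simp add: field_simps power2_eq_square)
  qed
  have "norm (t\<^sup>2 *\<^sub>R v) = t\<^sup>2 * norm v" by simp
  also have "\<dots> \<le> t * norm v" using t by (intro mult_right_mono) (auto simp: power2_eq_square
    mult_left_le_one_le)
  also have "\<dots> \<le> t * (B * Y)" using t v by (intro mult_left_mono) (auto simp: Y_def)
  also have "\<dots> = B * (t * Y)" by simp
  also have "\<dots> \<le> B * (s\<^sup>2 / (s\<^sup>2 + Y\<^sup>2) * Y)" using tt Y B by (intro mult_left_mono mult_right_mono) auto
  also have "\<dots> \<le> B * (s / 2)" using am B by (intro mult_left_mono) auto
  finally show ?thesis by (simp add: t_def)
qed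

lemma tame_bound:
  assumes "\<delta> > 0" "q \<ge> 0"
  shows "\<bar>tame \<delta> q - q\<bar> \<le> q\<^sup>2 / \<delta>"
proof -
  have "tame \<delta> q - q = - (q\<^sup>2 / (\<delta> + q))" using assms by (simp add: tame_def field_simps power2_eq_square)
  then have "\<bar>tame \<delta> q - q\<bar> = q\<^sup>2 / (\<delta> + q)" using assms by simp
  also have "\<dots> \<le> q\<^sup>2 / \<delta>" using assms by (intro divide_left_mono) auto
  finally show ?thesis .
qed

text \<open>Compatibility restricts a test function at all its critical points in Q, not only at z0,
  so \<psi> is built with a spatial gradient that never vanishes. Damping works for positive
  definite forms, so Z is written as a difference of two of them, each damped separately.\<close>

lemma test_function_with_jet:
  fixes z0 p :: "(real ^ 'n) \<times> real"
  assumes Z: "linear Z" "\<And>x y. x \<bullet> Z y = Z x \<bullet> y" and p: "fst p \<noteq> 0" and Q: "open Q" "z0 \<in> Q"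
  shows "\<exists>\<psi>. C2_compatible A Q \<psi> \<and> space_gradient \<psi> z0 = fst p \<and> time_deriv \<psi> z0 = snd p \<and>
     space_hessian \<psi> z0 = spatial_matrix Z \<and>
     (\<forall>e>0. \<exists>d>0. \<forall>h. norm h < d \<longrightarrow> \<bar>\<psi> (z0 + h) - \<psi> z0 - p \<bullet> h - (h \<bullet> Z h) / 2\<bar> \<le> e * (norm h)\<^sup>2)"
proof -
  obtain C where C: "C \<ge> 0" "\<And>h. norm (Z h) \<le> C * norm h" "\<And>h. \<bar>h \<bullet> Z h\<bar> \<le> C * (norm h)\<^sup>2"
    using linear_form_bound[OF Z(1)] by blast
  define B where "B = 2 * C + 1"
  have B: "B \<ge> 1" using C by (simp add: B_def)
  \<comment> \<open>C + 1 exceeds the bound of Z by 1, so both forms are at least |h|^2; their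
    difference is Z.\<close>
  define W1 where "W1 h = Z h + (C + 1) *\<^sub>R h" for h
  define W2 where "W2 h = (C + 1) *\<^sub>R h" for h :: "(real ^ 'n) \<times> real"
  have W1: "linear W1" "\<And>x y. x \<bullet> W1 y = W1 x \<bullet> y"
    unfolding W1_def by (rule linearI) (simp_all add: linear_add[OF Z(1)] linear_scale[OF Z(1)]
      algebra_simps inner_add_left inner_add_right Z(2))
  have W2: "linear W2" "\<And>x y. x \<bullet> W2 y = W2 x \<bullet> y"
    unfolding W2_def by (rule linearI) (simp_all add: algebra_simps)
  have f1: "h \<bullet> W1 h = h \<bullet> Z h + (C + 1) * (norm h)\<^sup>2" for h
    by (simp add: W1_def inner_add_right power2_norm_eq_inner)
  have f2: "h \<bullet> W2 h = (C + 1) * (norm h)\<^sup>2" for h by (simp add: W2_def power2_norm_eq_inner)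
  have lo1: "(norm h)\<^sup>2 \<le> h \<bullet> W1 h" and up1: "h \<bullet> W1 h \<le> B * (norm h)\<^sup>2" for h
    using C(3)[of h] by (auto simp: f1 B_def algebra_simps abs_le_iff)
  have lo2: "(norm h)\<^sup>2 \<le> h \<bullet> W2 h" and up2: "h \<bullet> W2 h \<le> B * (norm h)\<^sup>2" for h
    using C(1) by (auto simp: f2 B_def algebra_simps)
  have n1: "norm (W1 h) \<le> B * norm h" for h
  proof -
    have "norm (W1 h) \<le> norm (Z h) + norm ((C + 1) *\<^sub>R h)" unfolding W1_def by (rule norm_triangle_ineq)
    moreover have "norm ((C + 1) *\<^sub>R h) = (C + 1) * norm h" using C(1) by simp
    ultimately have "norm (W1 h) \<le> C * norm h + (C + 1) * norm h" using C(2)[of h] by linarith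
    then show ?thesis by (simp add: B_def algebra_simps)
  qed
  have n2: "norm (W2 h) \<le> B * norm h" for h
    using C(1) by (simp add: W2_def B_def mult_right_mono)
  \<comment> \<open>Each damped gradient is at most B s/2, together half of |fst p|, which leaves
    the spatial gradient of \<psi> nonzero everywhere.\<close>
  define s where "s = norm (fst p) / (2 * B)"
  have s: "s > 0" using p B by (simp add: s_def)
  define \<delta> where "\<delta> = s\<^sup>2 / 2"
  have \<delta>: "\<delta> > 0" using s by (simp add: \<delta>_def)
  have pos1: "0 \<le> h \<bullet> W1 h" and pos2: "0 \<le> h \<bullet> W2 h" for h
    using lo1[of h] lo2[of h] zero_le_power2[of "norm h"] by linarith+
  let ?q1 = "\<lambda>z. ((z - z0) \<bullet> W1 (z - z0)) / 2" and ?q2 = "\<lambda>z. ((z - z0) \<bullet> W2 (z - z0)) / 2"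
  obtain g1 G1 where g1: "C2_with Q (\<lambda>z. tame \<delta> (?q1 z)) g1 G1"
    "\<And>z. g1 z = (\<delta> / (\<delta> + ?q1 z))\<^sup>2 *\<^sub>R blinfun_inner_right (W1 (z - z0))" "\<And>h k. G1 z0 h k = W1 h \<bullet> k"
    using C2_with_tame[OF W1 pos1 \<delta>, of Q z0] by blast
  obtain g2 G2 where g2: "C2_with Q (\<lambda>z. tame \<delta> (?q2 z)) g2 G2"
    "\<And>z. g2 z = (\<delta> / (\<delta> + ?q2 z))\<^sup>2 *\<^sub>R blinfun_inner_right (W2 (z - z0))" "\<And>h k. G2 z0 h k = W2 h \<bullet> k"
    using C2_with_tame[OF W2 pos2 \<delta>, of Q z0] by blast
  define \<psi> where "\<psi> z = p \<bullet> (z - z0) + (tame \<delta> (?q1 z) + (-1) * tame \<delta> (?q2 z))" for z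
  define f' where "f' z = blinfun_inner_right p + (g1 z + (-1) *\<^sub>R g2 z)" for z
  define f'' where "f'' z = 0 + (G1 z + (-1) *\<^sub>R G2 z)" for z
  have C2: "C2_with Q \<psi> f' f''" unfolding \<psi>_def f'_def f''_def
    by (intro C2_with_add C2_with_linear C2_with_cmult g1(1) g2(1))
  define v where "v z = p + (\<delta> / (\<delta> + ?q1 z))\<^sup>2 *\<^sub>R W1 (z - z0) - (\<delta> / (\<delta> + ?q2 z))\<^sup>2 *\<^sub>R W2 (z - z0)" for z
  have f'v: "f' z h = v z \<bullet> h" for z h
    by (simp add: f'_def v_def g1(2) g2(2) plus_blinfun.rep_eq scaleR_blinfun.rep_eq
      uminus_blinfun.rep_eq minus_blinfun.rep_eq blinfun_inner_right.rep_eq inner_add_left inner_diff_left)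
  have grad: "space_gradient \<psi> z = fst (v z)" if "z \<in> Q" for z
    by (rule space_gradient_eqI[OF C2 that]) (simp add: f'v inner_prod_def inner_axis)
  have v0: "v z0 = p" by (simp add: v_def linear_0[OF W1(1)] linear_0[OF W2(1)])
  have nz: "fst (v z) \<noteq> 0" for z
  proof
    assume 0: "fst (v z) = 0"
    let ?a = "(\<delta> / (\<delta> + ?q1 z))\<^sup>2 *\<^sub>R W1 (z - z0)" and ?b = "(\<delta> / (\<delta> + ?q2 z))\<^sup>2 *\<^sub>R W2 (z - z0)"
    have "norm ?a \<le> B * s / 2" unfolding \<delta>_def
      by (rule tame_gradient_bound[OF n1 _ s]) (use lo1[of "z - z0"] B in auto)
    moreover have "norm ?b \<le> B * s / 2" unfolding \<delta>_def
      by (rule tame_gradient_bound[OF n2 _ s]) (use lo2[of "z - z0"] B in auto)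
    moreover have "norm (fst p) \<le> norm (fst ?a) + norm (fst ?b)"
    proof -
      have "fst p = fst ?b - fst ?a" using 0 by (simp add: v_def algebra_simps)
      then have "norm (fst p) \<le> norm (fst ?b) + norm (fst ?a)" by (simp only: norm_triangle_ineq4)
      then show ?thesis by (simp only: add.commute)
    qed
    moreover have "norm (fst ?a) \<le> norm ?a" "norm (fst ?b) \<le> norm ?b"
      using norm_fst_le[of "fst ?a" "snd ?a"] norm_fst_le[of "fst ?b" "snd ?b"]
        by (simp_all only: prod.collapse)
    ultimately have "norm (fst p) \<le> B * s" by linarith
    also have "\<dots> = norm (fst p) / 2" using B by (simp add: s_def)
    finally show False using p by simp
  qed
  have "C2_compatible A Q \<psi>" unfolding C2_compatible_def
    using C2_with_imp_C2_on[OF C2] grad nz by auto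
  moreover have "space_gradient \<psi> z0 = fst p" using grad[OF Q(2)] v0 by simp
  moreover have "time_deriv \<psi> z0 = snd p"
    using time_deriv_C2_with[OF C2 Q(2)] by (simp add: f'v v0 inner_prod_def)
  moreover have "space_hessian \<psi> z0 = spatial_matrix Z"
  proof -
    have "f'' z0 h k = h \<bullet> Z k" for h k
      by (simp add: f''_def plus_blinfun.rep_eq scaleR_blinfun.rep_eq uminus_blinfun.rep_eq
        minus_blinfun.rep_eq g1(3) g2(3) W1_def W2_def inner_add_left Z(2))
    then show ?thesis by (simp add: vec_eq_iff space_hessian_C2_with[OF C2 Q] spatial_matrix_def)
  qed
  moreover have "\<exists>d>0. \<forall>h. norm h < d \<longrightarrow> \<bar>\<psi> (z0 + h) - \<psi> z0 - p \<bullet> h - (h \<bullet> Z h) / 2\<bar> \<le> e * (norm h)\<^sup>2"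
    if e: "e > 0" for e
  proof -
    \<comment> \<open>Each damping error is at most (B |h|^2/2)^2/\<delta>, which does not exceed
      e/2 |h|^2 once |h| is below this d.\<close>
    define d where "d = sqrt (2 * \<delta> * e) / B"
    have d: "d > 0" using e \<delta> B by (simp add: d_def)
    have "\<bar>\<psi> (z0 + h) - \<psi> z0 - p \<bullet> h - (h \<bullet> Z h) / 2\<bar> \<le> e * (norm h)\<^sup>2" if h: "norm h < d" for h
    proof -
      let ?a = "(h \<bullet> W1 h) / 2" and ?b = "(h \<bullet> W2 h) / 2" and ?N = "(norm h)\<^sup>2"
      have sq: "q\<^sup>2 / \<delta> \<le> (e / 2) * ?N" if q: "0 \<le> q" "q \<le> B * ?N / 2" for q
      proof -
        have "?N \<le> d\<^sup>2" using h by (intro power_mono) auto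
        also have "d\<^sup>2 = 2 * \<delta> * e / B\<^sup>2" using \<delta> e by (simp add: d_def power_divide)
        finally have "B\<^sup>2 * ?N \<le> 2 * \<delta> * e" using B by (simp add: field_simps)
        then have "B\<^sup>2 * ?N * ?N \<le> 2 * \<delta> * e * ?N" by (intro mult_right_mono) auto
        moreover have "q\<^sup>2 \<le> (B * ?N / 2)\<^sup>2" using q by (intro power_mono) auto
        ultimately have "q\<^sup>2 \<le> \<delta> * e / 2 * ?N" by (simp add: power2_eq_square field_simps)
        then show ?thesis using \<delta> by (simp add: field_simps)
      qed
      have "\<bar>tame \<delta> ?a - ?a\<bar> \<le> (e / 2) * ?N"
        using pos1[of h] up1[of h] by (intro order_trans[OF tame_bound[OF \<delta>] sq]) auto
      moreover have "\<bar>tame \<delta> ?b - ?b\<bar> \<le> (e / 2) * ?N"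
        using pos2[of h] up2[of h] by (intro order_trans[OF tame_bound[OF \<delta>] sq]) auto
      moreover have "?a - ?b = (h \<bullet> Z h) / 2" by (simp add: f1 f2 add_divide_distrib)
      moreover have "\<psi> (z0 + h) - \<psi> z0 = p \<bullet> h + tame \<delta> ?a - tame \<delta> ?b"
        by (simp add: \<psi>_def linear_0[OF W1(1)] linear_0[OF W2(1)] tame_def)
      ultimately show ?thesis by linarith
    qed
    then show ?thesis using d by blast
  qed
  ultimately show ?thesis by blast
qed

section \<open>Viscosity inequalities for superjets\<close>

lemma spatial_matrix_shift:
  "spatial_matrix (\<lambda>h. X h + c *\<^sub>R h) = spatial_matrix X + c *\<^sub>R mat 1"
  by (auto simp: spatial_matrix_def vec_eq_iff inner_add_right mat_def inner_axis_axis)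

lemma spatial_matrix_uminus: "spatial_matrix (\<lambda>h. - X h) = - spatial_matrix X"
  by (simp add: spatial_matrix_def vec_eq_iff)

lemma trace_matrix_shift:
  fixes A M :: "real ^ 'n ^ 'n"
  shows "trace (A ** (M + c *\<^sub>R mat 1)) = trace (A ** M) + c * trace A"
  by (simp add: matrix_add_ldistrib trace_add) (simp add: trace_def matrix_matrix_mult_def mat_def
    if_distrib sum_distrib_left mult_ac cong: if_cong)

lemma trace_matrix_uminus: "trace (A ** (- M)) = - trace (A ** (M :: real ^ 'n ^ 'n))"
  by (simp add: trace_def matrix_matrix_mult_def sum_negf)

text \<open>Adding e to the Hessian keeps the test function above \<open>u\<close> near z despite
  the o(|h|^2) error of the jet. The trace depends linearly on e, which is then sent to 0. The
  gradient must be nonzero for \<open>test_function_with_jet\<close>.\<close>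

lemma F_subsolution_superjet:
  fixes u :: "(real ^ 'n) \<times> real \<Rightarrow> real"
  assumes u: "F_subsolution Q A H u" and Q: "open Q" "z \<in> Q" and K: "z \<in> interior K"
    and jet: "superjet K u z p X" and p: "fst p \<noteq> 0"
  shows "snd p - trace (A (fst p) ** spatial_matrix X) + H z (fst p) \<le> 0"
proof -
  have X: "linear X" "\<And>x y. x \<bullet> X y = X x \<bullet> y" using jet by (auto simp: superjet_def)
  obtain dK where dK: "dK > 0" "ball z dK \<subseteq> K" using K by (meson mem_interior)
  have "0 \<le> (- snd p + trace (A (fst p) ** spatial_matrix X) - H z (fst p)) + trace (A (fst p)) * e"
    if e: "0 < e" for e
  proof -
    define Z where "Z h = X h + e *\<^sub>R h" for h
    have Z: "linear Z" "\<And>x y. x \<bullet> Z y = Z x \<bullet> y"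
      unfolding Z_def by (rule linearI) (simp_all add: linear_add[OF X(1)] linear_scale[OF X(1)]
        algebra_simps inner_add_left inner_add_right X(2))
    obtain \<psi> where \<psi>: "C2_compatible A Q \<psi>" "space_gradient \<psi> z = fst p" "time_deriv \<psi> z = snd p"
      "space_hessian \<psi> z = spatial_matrix Z"
      "\<And>e. e > 0 \<Longrightarrow> \<exists>d>0. \<forall>h. norm h < d \<longrightarrow> \<bar>\<psi> (z + h) - \<psi> z - p \<bullet> h - (h \<bullet> Z h) / 2\<bar> \<le> e * (norm h)\<^sup>2"
      using test_function_with_jet[OF Z p Q, of A] by blast
    obtain d1 where d1: "d1 > 0" "\<And>h. norm h < d1 \<Longrightarrow> \<bar>\<psi> (z + h) - \<psi> z - p \<bullet> h - (h \<bullet> Z h) / 2\<bar>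
        \<le> e/4 * (norm h)\<^sup>2"
      using \<psi>(5)[of "e/4"] e by auto
    obtain d2 where d2: "d2 > 0" "\<And>h. norm h < d2 \<Longrightarrow> z + h \<in> K \<Longrightarrow> u (z + h)
        \<le> u z + p \<bullet> h + (h \<bullet> X h) / 2 + e/4 * (norm h)\<^sup>2"
      using jet e unfolding superjet_def by (metis zero_less_divide_iff zero_less_numeral)
    define d where "d = min dK (min d1 d2)"
    have "u w - \<psi> w \<le> u z - \<psi> z" if w: "w \<in> ball z d" for w
    proof -
      define h where "h = w - z"
      have wz: "w = z + h" by (simp add: h_def)
      have h: "norm h < dK" "norm h < d1" "norm h < d2" using w
        by (auto simp: d_def h_def dist_norm norm_minus_commute)
      have "z + h \<in> K" using h(1) dK(2) by (auto simp: dist_norm)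
      from d2(2)[OF h(3) this] d1(2)[OF h(2)] have "u (z + h) - u z - (\<psi> (z + h) - \<psi> z)
          \<le> (h \<bullet> X h) / 2 - (h \<bullet> Z h) / 2 + e/4 * (norm h)\<^sup>2 + e/4 * (norm h)\<^sup>2"
        by (simp only: abs_le_iff) linarith
      also have "(h \<bullet> Z h) / 2 = (h \<bullet> X h) / 2 + e/4 * (norm h)\<^sup>2 + e/4 * (norm h)\<^sup>2"
        by (simp add: Z_def inner_add_right power2_norm_eq_inner add_divide_distrib)
      finally show ?thesis unfolding wz by linarith
    qed
    moreover have "d > 0" using dK(1) d1(1) d2(1) by (simp add: d_def)
    ultimately have "\<forall>\<^sub>F w in nhds z. u w - \<psi> w \<le> u z - \<psi> z"
      unfolding eventually_nhds_metric by (intro exI[of _ d]) (auto simp: dist_commute)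
    then have "snd p - trace (A (fst p) ** spatial_matrix Z) + H z (fst p) \<le> 0"
      using u \<psi> Q(2) p unfolding F_subsolution_def by (metis (no_types, lifting))
    moreover have "spatial_matrix Z = spatial_matrix X + e *\<^sub>R mat 1" unfolding Z_def
      by (rule spatial_matrix_shift)
    ultimately show ?thesis by (simp add: trace_matrix_shift mult.commute)
  qed
  then have "0 \<le> - snd p + trace (A (fst p) ** spatial_matrix X) - H z (fst p)"
    using nonneg_if_small_perturbation by blast
  then show ?thesis by linarith
qed

text \<open>\<open>p\<close> and \<open>X\<close> belong to -v, so the test function for v has
  gradient -p and Hessian -(X + e), and A is evaluated at \<open>- fst p\<close>.\<close>

lemma F_supersolution_superjet:
  fixes v :: "(real ^ 'n) \<times> real \<Rightarrow> real"
  assumes v: "F_supersolution Q A H v" and Q: "open Q" "z \<in> Q" and K: "z \<in> interior K"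
    and jet: "superjet K (\<lambda>z. - v z) z p X" and p: "fst p \<noteq> 0"
  shows "- snd p + trace (A (- fst p) ** spatial_matrix X) + H z (- fst p) \<ge> 0"
proof -
  have X: "linear X" "\<And>x y. x \<bullet> X y = X x \<bullet> y" using jet by (auto simp: superjet_def)
  obtain dK where dK: "dK > 0" "ball z dK \<subseteq> K" using K by (meson mem_interior)
  have "0 \<le> (- snd p + trace (A (- fst p) ** spatial_matrix X) + H z (- fst p))
      + trace (A (- fst p)) * e" if e: "0 < e" for e
  proof -
    define Y where "Y h = X h + e *\<^sub>R h" for h
    define Z where "Z h = - Y h" for h
    have Z: "linear Z" "\<And>x y. x \<bullet> Z y = Z x \<bullet> y"
      unfolding Z_def Y_def by (rule linearI) (simp_all add: linear_add[OF X(1)] linear_scale[OF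
        X(1)] algebra_simps inner_add_left inner_add_right X(2))
    have p': "fst (- p) \<noteq> 0" using p by simp
    obtain \<psi> where \<psi>: "C2_compatible A Q \<psi>" "space_gradient \<psi> z = fst (- p)" "time_deriv \<psi> z = snd (- p)"
      "space_hessian \<psi> z = spatial_matrix Z"
      "\<And>e. e > 0 \<Longrightarrow> \<exists>d>0. \<forall>h. norm h < d \<longrightarrow> \<bar>\<psi> (z + h) - \<psi> z - (- p) \<bullet> h - (h \<bullet> Z h) / 2\<bar> \<le> e * (norm h)\<^sup>2"
      using test_function_with_jet[OF Z p' Q, of A] by blast
    obtain d1 where d1: "d1 > 0" "\<And>h. norm h < d1 \<Longrightarrow> \<bar>\<psi> (z + h) - \<psi> z - (- p) \<bullet> h - (h \<bullet> Z h) / 2\<bar>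
        \<le> e/4 * (norm h)\<^sup>2"
      using \<psi>(5)[of "e/4"] e by auto
    obtain d2 where d2: "d2 > 0" "\<And>h. norm h < d2 \<Longrightarrow> z + h \<in> K \<Longrightarrow> - v (z + h)
        \<le> - v z + p \<bullet> h + (h \<bullet> X h) / 2 + e/4 * (norm h)\<^sup>2"
      using jet e unfolding superjet_def by (metis zero_less_divide_iff zero_less_numeral)
    define d where "d = min dK (min d1 d2)"
    have "v w - \<psi> w \<ge> v z - \<psi> z" if w: "w \<in> ball z d" for w
    proof -
      define h where "h = w - z"
      have wz: "w = z + h" by (simp add: h_def)
      have h: "norm h < dK" "norm h < d1" "norm h < d2" using w
        by (auto simp: d_def h_def dist_norm norm_minus_commute)
      have "z + h \<in> K" using h(1) dK(2) by (auto simp: dist_norm)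
      from d2(2)[OF h(3) this] d1(2)[OF h(2)] have "v z - v (z + h) + (\<psi> (z + h) - \<psi> z)
          \<le> (h \<bullet> X h) / 2 + (h \<bullet> Z h) / 2 + e/4 * (norm h)\<^sup>2 + e/4 * (norm h)\<^sup>2"
        by (simp only: abs_le_iff inner_minus_left) linarith
      also have "(h \<bullet> Z h) / 2 = - ((h \<bullet> X h) / 2 + e/4 * (norm h)\<^sup>2 + e/4 * (norm h)\<^sup>2)"
        by (simp add: Z_def Y_def inner_add_right inner_diff_right power2_norm_eq_inner
          add_divide_distrib diff_divide_distrib)
      finally show ?thesis unfolding wz by linarith
    qed
    moreover have "d > 0" using dK(1) d1(1) d2(1) by (simp add: d_def)
    ultimately have "\<forall>\<^sub>F w in nhds z. v w - \<psi> w \<ge> v z - \<psi> z"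
      unfolding eventually_nhds_metric by (intro exI[of _ d]) (auto simp: dist_commute)
    then have "snd (- p) - trace (A (fst (- p)) ** spatial_matrix Z) + H z (fst (- p)) \<ge> 0"
      using v \<psi> Q(2) p' unfolding F_supersolution_def by (metis (no_types, lifting))
    moreover have "spatial_matrix Z = - (spatial_matrix X + e *\<^sub>R mat 1)"
      unfolding Z_def Y_def by (simp only: spatial_matrix_uminus spatial_matrix_shift)
    ultimately show ?thesis by (simp only: trace_matrix_uminus trace_matrix_shift fst_uminus
      snd_uminus) (simp add: mult.commute)
  qed
  then show ?thesis using nonneg_if_small_perturbation by blast
qed

section \<open>Powers of the norm\<close>

text \<open>As \<open>0 powr a = 0\<close>, this formula and that of \<open>powr_hess\<close> give 0
  at the origin, also where the exponent k - 4 is negative.\<close>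

definition powr_grad :: "real \<Rightarrow> 'a::real_inner \<Rightarrow> 'a" where
  "powr_grad k x = (k * norm x powr (k - 2)) *\<^sub>R x"

definition powr_hess :: "real \<Rightarrow> 'a::real_inner \<Rightarrow> 'a \<Rightarrow>\<^sub>L 'a" where
  "powr_hess k x = (k * norm x powr (k - 2)) *\<^sub>R id_blinfun +
     (k * (k - 2) * norm x powr (k - 4)) *\<^sub>R (blinfun_scaleR_left x o\<^sub>L blinfun_inner_right x)"

lemma powr_hess_apply:
  "powr_hess k x h = (k * norm x powr (k - 2)) *\<^sub>R h + (k * (k - 2) * norm x powr (k - 4) * (x \<bullet> h)) *\<^sub>R x"
  by (simp add: powr_hess_def plus_blinfun.rep_eq scaleR_blinfun.rep_eq id_blinfun.rep_eq
    blinfun_compose.rep_eq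
      blinfun_scaleR_left.rep_eq blinfun_inner_right.rep_eq)

lemma has_derivative_zero_powr:
  fixes F :: "'a::real_normed_vector \<Rightarrow> 'b::real_normed_vector"
  assumes F: "\<And>x. norm (F x) \<le> c * norm x powr a" and a: "a > 1"
  shows "(F has_derivative (\<lambda>h. 0)) (at 0)"
  unfolding has_derivative_at_alt
proof (intro conjI allI impI)
  have F0: "F 0 = 0" using F[of 0] a by simp
  fix e :: real assume e: "e > 0"
  have "((\<lambda>x::'a. \<bar>c\<bar> * norm x powr (a - 1)) \<longlongrightarrow> \<bar>c\<bar> * 0) (at 0)"
    by (intro tendsto_intros tendsto_zero_powrI[where b = "a - 1"] tendsto_norm_zero) (use a in auto)
  then have "\<forall>\<^sub>F x in at (0::'a). \<bar>c\<bar> * norm x powr (a - 1) < e" using e by (intro order_tendstoD) auto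
  then obtain d where d: "d > 0" "\<And>x::'a. x \<noteq> 0 \<Longrightarrow> norm x < d \<Longrightarrow> \<bar>c\<bar> * norm x powr (a - 1) < e"
    unfolding eventually_at by auto
  show "\<exists>d>0. \<forall>y. norm (y - 0) < d \<longrightarrow> norm (F y - F 0 - 0) \<le> e * norm (y - 0)"
  proof (intro exI[of _ d] conjI allI impI d(1))
    fix y :: 'a assume y: "norm (y - 0) < d"
    show "norm (F y - F 0 - 0) \<le> e * norm (y - 0)"
    proof (cases "y = 0")
      case False
      have "norm (F y) \<le> c * norm y powr a" by (rule F)
      also have "\<dots> \<le> \<bar>c\<bar> * norm y powr a" by (intro mult_right_mono) auto
      also have "norm y powr a = norm y powr (a - 1) * norm y" using False by (simp add: powr_diff)
      also have "\<bar>c\<bar> * (norm y powr (a - 1) * norm y) \<le> e * norm y"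
        using d(2)[OF False] y mult_right_mono[of "\<bar>c\<bar> * norm y powr (a - 1)" e "norm y"]
          by (simp add: mult.assoc)
      finally show ?thesis using F0 by simp
    qed simp
  qed
qed (rule bounded_linear_zero)

lemma has_derivative_norm_powr:
  fixes x :: "'a::real_inner"
  assumes "x \<noteq> 0"
  shows "((\<lambda>x. norm x powr a) has_derivative (\<lambda>h. a * norm x powr (a - 2) * (x \<bullet> h))) (at x)"
proof -
  have "((\<lambda>r. r powr a) has_real_derivative a * norm x powr (a - 1)) (at (norm x))"
    using assms by (intro has_real_derivative_powr) simp
  from has_derivative_compose[OF has_derivative_norm[OF assms] this[unfolded has_field_derivative_def]]
  have "((\<lambda>x. norm x powr a) has_derivative (\<lambda>h. a * norm x powr (a - 1) * (sgn x \<bullet> h))) (at x)"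
    by (simp add: inner_commute[of _ "sgn x"])
  moreover have "a * norm x powr (a - 1) * (sgn x \<bullet> h) = a * norm x powr (a - 2) * (x \<bullet> h)" for h
  proof -
    have "norm x powr (a - 1) = norm x powr (a - 2) * norm x"
      using assms powr_mult_base[of "norm x" "a - 2"] by (simp add: mult.commute)
    then show ?thesis using assms by (simp add: sgn_div_norm)
  qed
  ultimately show ?thesis by (simp only:)
qed

lemma norm_powr_hess_le:
  fixes x :: "'a::real_inner"
  assumes "k > 2"
  shows "norm (powr_hess k x) \<le> k * (k - 1) * norm x powr (k - 2)"
proof (rule norm_blinfun_bound)
  fix h :: 'a
  have "norm (powr_hess k x h) \<le> norm ((k * norm x powr (k - 2)) *\<^sub>R h)
      + norm ((k * (k - 2) * norm x powr (k - 4) * (x \<bullet> h)) *\<^sub>R x)"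
    unfolding powr_hess_apply by (rule norm_triangle_ineq)
  also have "norm ((k * norm x powr (k - 2)) *\<^sub>R h) = k * norm x powr (k - 2) * norm h" using assms by simp
  also have "norm ((k * (k - 2) * norm x powr (k - 4) * (x \<bullet> h)) *\<^sub>R x)
      = k * (k - 2) * (norm x powr (k - 4) * (\<bar>x \<bullet> h\<bar> * norm x))"
    using assms by (simp add: abs_mult)
  also have "\<dots> \<le> k * (k - 2) * (norm x powr (k - 4) * ((norm x * norm h) * norm x))"
    using assms Cauchy_Schwarz_ineq2[of x h] by (intro mult_left_mono mult_right_mono) auto
  also have "norm x powr (k - 4) * ((norm x * norm h) * norm x) = norm x powr (k - 2) * norm h"
  proof (cases "x = 0")
    case False
    have "norm x powr (k - 2) = norm x powr (k - 4) * (norm x * norm x)"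
      using powr_add[of "norm x" "k - 4" 2] False by (simp add: powr_numeral power2_eq_square)
    then show ?thesis by simp
  qed simp
  finally show "norm (powr_hess k x h) \<le> k * (k - 1) * norm x powr (k - 2) * norm h"
    by (simp add: algebra_simps)
qed (use assms in auto)

lemma powr_grad_has_derivative:
  fixes x :: "'a::real_inner"
  assumes k: "k > 2"
  shows "(powr_grad k has_derivative powr_hess k x) (at x)"
proof (cases "x = 0")
  case True
  have "(powr_grad k has_derivative (\<lambda>h. 0::'a)) (at 0)"
  proof (rule has_derivative_zero_powr[where c = k and a = "k - 1"])
    fix x :: 'a
    have "norm x powr (k - 1) = norm x powr (k - 2) * norm x"
      using powr_mult_base[of "norm x" "k - 2"] by (simp add: mult.commute)
    then show "norm (powr_grad k x) \<le> k * norm x powr (k - 1)" using k by (simp add: powr_grad_def)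
  qed (use k in auto)
  moreover have "blinfun_apply (powr_hess k (0::'a)) = (\<lambda>h. 0)" by (simp add: fun_eq_iff powr_hess_apply)
  ultimately show ?thesis using True by simp
next
  case False
  have "((\<lambda>x. k * norm x powr (k - 2)) has_derivative
      (\<lambda>h. k * ((k - 2) * norm x powr (k - 2 - 2) * (x \<bullet> h)))) (at x)"
    by (intro has_derivative_mult_right has_derivative_norm_powr False)
  from has_derivative_scaleR[OF this has_derivative_ident]
  have "(powr_grad k has_derivative (\<lambda>h. (k * norm x powr (k - 2)) *\<^sub>R h
      + (k * ((k - 2) * norm x powr (k - 2 - 2) * (x \<bullet> h))) *\<^sub>R x)) (at x)"
    by (simp add: powr_grad_def[abs_def])
  moreover have "blinfun_apply (powr_hess k x)
      = (\<lambda>h. (k * norm x powr (k - 2)) *\<^sub>R h + (k * ((k - 2) * norm x powr (k - 2 - 2) * (x \<bullet> h))) *\<^sub>R x)"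
    by (simp add: fun_eq_iff powr_hess_apply mult.assoc)
  ultimately show ?thesis by (simp only:)
qed

text \<open>At the origin the bound by a multiple of |x|^(k-2) with k > 2 decides; the factor with
  exponent k - 4 need not be bounded by itself.\<close>

lemma continuous_powr_hess:
  assumes k: "k > 2"
  shows "continuous_on UNIV (powr_hess k :: 'a::real_inner \<Rightarrow> _)"
  unfolding continuous_on_eq_continuous_at[OF open_UNIV]
proof (intro ballI)
  fix x :: 'a
  show "isCont (powr_hess k) x"
  proof (cases "x = 0")
    case True
    have h0: "powr_hess k (0::'a) = 0" by (rule blinfun_eqI) (simp add: powr_hess_apply)
    have "((\<lambda>x::'a. k * (k - 1) * norm x powr (k - 2)) \<longlongrightarrow> k * (k - 1) * 0) (at 0)"
      by (intro tendsto_intros tendsto_zero_powrI[where b = "k - 2"] tendsto_norm_zero) (use k in auto)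
    then have g: "((\<lambda>x::'a. k * (k - 1) * norm x powr (k - 2)) \<longlongrightarrow> 0) (at 0)" by simp
    have "(powr_hess k \<longlongrightarrow> 0) (at (0::'a))"
      by (rule Lim_null_comparison[OF _ g]) (simp add: norm_powr_hess_le[OF k])
    then show ?thesis using True h0 by (simp add: isCont_def)
  next
    case False
    have p: "isCont (\<lambda>x::'a. norm x powr a) x" for a
      using has_derivative_norm_powr[OF False] by (rule has_derivative_continuous)
    have "isCont (\<lambda>x::'a. blinfun_scaleR_left x o\<^sub>L blinfun_inner_right x) x"
      by (intro bounded_bilinear.continuous[OF bounded_bilinear_blinfun_compose] continuous_ident
          bounded_linear.continuous[OF bounded_linear_blinfun_scaleR_left]
            bounded_linear.continuous[OF bounded_linear_blinfun_inner_right])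
    then show ?thesis unfolding powr_hess_def[abs_def]
      by (intro continuous_add continuous_scaleR continuous_mult continuous_const p)
  qed
qed

lemma C2_with_norm_powr:
  assumes k: "k > 2"
  shows "C2_with UNIV (\<lambda>x::'a::real_inner. norm x powr k) (\<lambda>x. blinfun_inner_right (powr_grad k x))
    (\<lambda>x. Blinfun blinfun_inner_right o\<^sub>L powr_hess k x)"
  unfolding C2_with_def
proof (intro conjI ballI)
  fix x :: 'a
  show "((\<lambda>x. norm x powr k) has_derivative blinfun_inner_right (powr_grad k x)) (at x)"
  proof (cases "x = 0")
    case True
    have "((\<lambda>x::'a. norm x powr k) has_derivative (\<lambda>h. 0)) (at 0)"
      by (rule has_derivative_zero_powr[where c = 1 and a = k]) (use k in auto)
    moreover have "blinfun_apply (blinfun_inner_right (powr_grad k (0::'a))) = (\<lambda>h. 0)"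
      by (simp add: fun_eq_iff powr_grad_def blinfun_inner_right.rep_eq)
    ultimately show ?thesis using True by simp
  next
    case False
    have "blinfun_apply (blinfun_inner_right (powr_grad k x)) = (\<lambda>h. k * norm x powr (k - 2) * (x \<bullet> h))"
      by (simp add: fun_eq_iff powr_grad_def blinfun_inner_right.rep_eq)
    then show ?thesis using has_derivative_norm_powr[OF False, of k] by simp
  qed
  show "((\<lambda>x. blinfun_inner_right (powr_grad k x)) has_derivative
      (Blinfun blinfun_inner_right o\<^sub>L powr_hess k x)) (at x)"
    using bounded_linear.has_derivative[OF bounded_linear_blinfun_inner_right
      powr_grad_has_derivative[OF k]]
    by (simp add: blinfun_compose.rep_eq bounded_linear_Blinfun_apply[OF
      bounded_linear_blinfun_inner_right] o_def)
next
  show "continuous_on UNIV (\<lambda>x::'a. Blinfun blinfun_inner_right o\<^sub>L powr_hess k x)"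
    by (intro continuous_intros continuous_powr_hess k)
qed

lemma gradient_cmult_norm_powr:
  fixes x :: "real ^ 'n"
  assumes k: "k > 2"
  shows "gradient (\<lambda>x. K * norm x powr k) x = K *\<^sub>R powr_grad k x"
proof -
  have "((\<lambda>x. K * norm x powr k) has_derivative (\<lambda>h. K * (powr_grad k x \<bullet> h))) (at x)"
    using C2_with_norm_powr[OF k, where 'a = "real ^ 'n"] unfolding C2_with_def
    by (intro has_derivative_mult_right) (auto simp: blinfun_inner_right.rep_eq)
  from frechet_derivative_at[OF this, symmetric] show ?thesis
    by (simp add: gradient_def vec_eq_iff inner_axis)
qed

definition powr_hess_matrix :: "real \<Rightarrow> real ^ 'n \<Rightarrow> real ^ 'n ^ 'n" where
  "powr_hess_matrix k x = (\<chi> i j. k * norm x powr (k - 2) * (if i = j then 1 else 0)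
      + k * (k - 2) * norm x powr (k - 4) * (x $ i * x $ j))"

lemma axis_nth: "axis i (1::real) $ j = (if j = i then 1 else 0)"
  by (simp add: axis_def)

lemma hessian_cmult_norm_powr:
  fixes x :: "real ^ 'n"
  assumes k: "k > 2"
  shows "hessian (\<lambda>x. K * norm x powr k) x = K *\<^sub>R powr_hess_matrix k x"
proof -
  have "((\<lambda>x. (K *\<^sub>R powr_grad k x) $ j) has_derivative (\<lambda>h. (K *\<^sub>R powr_hess k x h) $ j)) (at x)" for j
    by (intro bounded_linear.has_derivative[OF bounded_linear_vec_nth] has_derivative_scaleR_right
      powr_grad_has_derivative k)
  from frechet_derivative_at[OF this, symmetric] show ?thesis
    unfolding hessian_def gradient_cmult_norm_powr[OF k]
    by (auto simp: vec_eq_iff powr_hess_apply powr_hess_matrix_def inner_axis axis_nth algebra_simps)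
qed

section \<open>Powers of the norm as members of the class \<F>\<close>

lemma psd_diag_nonneg: "psd A \<Longrightarrow> 0 \<le> A $ i $ i"
proof -
  assume "psd A"
  then have "0 \<le> axis i 1 \<bullet> (A *v axis i 1)" by (simp add: psd_def)
  then show ?thesis by (simp add: matrix_vector_mul_component inner_axis inner_axis' column_def)
qed

text \<open>Positivity is tested on the sum and on the difference of two coordinate vectors.\<close>

lemma psd_entry_le_trace:
  assumes A: "psd (A :: real ^ 'n ^ 'n)"
  shows "\<bar>A $ i $ j\<bar> \<le> trace A"
proof -
  have d: "A $ i $ i \<le> trace A" for i
    unfolding trace_def using psd_diag_nonneg[OF A] by (intro member_le_sum) auto
  have e: "axis i 1 \<bullet> (A *v axis j 1) = A $ i $ j" for i j
    by (simp add: matrix_vector_mult_basis inner_axis inner_axis' column_def)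
  have sym: "A $ j $ i = A $ i $ j" 
  proof -
    have "A $ j $ i = transpose A $ i $ j" by (simp add: transpose_def)
    also have "transpose A = A" using A by (simp add: psd_def)
    finally show ?thesis .
  qed
  have "0 \<le> (axis i 1 + axis j 1) \<bullet> (A *v (axis i 1 + axis j 1))" "0
      \<le> (axis i 1 - axis j 1) \<bullet> (A *v (axis i 1 - axis j 1))"
    using A by (auto simp: psd_def)
  then have "0 \<le> A $ i $ i + 2 * A $ i $ j + A $ j $ j" "0 \<le> A $ i $ i - 2 * A $ i $ j + A $ j $ j"
    by (simp_all add: matrix_vector_right_distrib matrix_vector_mult_diff_distrib inner_add_left
      inner_add_right inner_diff_left inner_diff_right e sym)
  then show ?thesis using d[of i] d[of j] by (simp add: abs_le_iff)
qed

text \<open>The rank-one part of the Hessian contributes a nonnegative multiple of x \<bullet> A x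
  and is dropped.\<close>

lemma trace_powr_hess_matrix_ge:
  assumes A: "psd (A :: real ^ 'n ^ 'n)" and k: "k > 2"
  shows "k * norm x powr (k - 2) * trace A \<le> trace (A ** powr_hess_matrix k x)"
proof -
  have "trace (A ** powr_hess_matrix k x) = (\<Sum>i\<in>UNIV. \<Sum>j\<in>UNIV. A $ i $ j * powr_hess_matrix k x $ j $ i)"
    by (simp add: trace_def matrix_matrix_mult_def)
  also have "\<dots> = (\<Sum>i\<in>UNIV. \<Sum>j\<in>UNIV. (if i = j then k * norm x powr (k - 2) * A $ i $ j else 0)
       + k * (k - 2) * norm x powr (k - 4) * (x $ i * (A $ i $ j * x $ j)))"
    by (intro sum.cong refl) (auto simp: powr_hess_matrix_def algebra_simps)
  also have "\<dots> = k * norm x powr (k - 2) * trace A + k * (k - 2) * norm x powr (k - 4) * (x \<bullet> (A *v x))"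
    by (simp add: sum.distrib sum_distrib_left[symmetric] trace_def inner_vec_def matrix_vector_mult_def)
  finally show ?thesis using A k by (simp add: psd_def)
qed

lemma op_norm_nonneg: "0 \<le> op_norm M"
  unfolding op_norm_def by (rule onorm_pos_le) (simp add: matrix_vector_mul_bounded_linear)

text \<open>(A1) controls a trace, while \<open>F_class\<close> asks for the operator norm. For this
  Hessian they are comparable: the trace dominates k |x|^(k-2) tr A, and the entries of the product
  are bounded by the same quantity up to k - 1, |s| and the dimension.\<close>

lemma op_norm_mult_powr_hess_matrix_le:
  assumes A: "psd (A :: real ^ 'n ^ 'n)" and k: "k > 2"
  shows "op_norm (A ** (s *\<^sub>R powr_hess_matrix k x))
      \<le> real CARD('n) ^ 3 * \<bar>s\<bar> * (k - 1) * trace (A ** powr_hess_matrix k x)"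
proof -
  have tr: "0 \<le> trace A" using psd_entry_le_trace[OF A, of undefined undefined] by linarith
  have "\<bar>powr_hess_matrix k x $ i $ j\<bar> \<le> k * (k - 1) * norm x powr (k - 2)" for i j
  proof -
    have "\<bar>powr_hess_matrix k x $ i $ j\<bar> = \<bar>powr_hess k x (axis j 1) $ i\<bar>"
      by (simp add: powr_hess_matrix_def powr_hess_apply inner_axis axis_nth mult_ac)
    also have "\<dots> \<le> norm (powr_hess k x (axis j 1))" by (rule component_le_norm_cart)
    also have "\<dots> \<le> norm (powr_hess k x) * norm (axis j 1 :: real ^ 'n)" by (rule norm_blinfun)
    also have "\<dots> \<le> k * (k - 1) * norm x powr (k - 2)" using norm_powr_hess_le[OF k, of x] by simp
    finally show ?thesis .
  qed
  then have e: "\<bar>(A ** (s *\<^sub>R powr_hess_matrix k x)) $ i $ j\<bar>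
      \<le> real CARD('n) * (trace A * (\<bar>s\<bar> * (k * (k - 1) * norm x powr (k - 2))))" for i j
  proof -
    have "\<bar>(A ** (s *\<^sub>R powr_hess_matrix k x)) $ i $ j\<bar>
        \<le> (\<Sum>l\<in>UNIV. \<bar>A $ i $ l * (s * powr_hess_matrix k x $ l $ j)\<bar>)"
      by (simp add: matrix_matrix_mult_def sum_abs)
    also have "\<dots> \<le> (\<Sum>l\<in>(UNIV::'n set). trace A * (\<bar>s\<bar> * (k * (k - 1) * norm x powr (k - 2))))"
      unfolding abs_mult
      using tr k \<open>\<And>i j. \<bar>powr_hess_matrix k x $ i $ j\<bar> \<le> k * (k - 1) * norm x powr (k - 2)\<close>
      by (intro sum_mono mult_mono psd_entry_le_trace[OF A] mult_left_mono) auto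
    finally show ?thesis by simp
  qed
  have "op_norm (A ** (s *\<^sub>R powr_hess_matrix k x))
      \<le> (\<Sum>i\<in>UNIV. \<Sum>j\<in>UNIV. \<bar>(A ** (s *\<^sub>R powr_hess_matrix k x)) $ i $ j\<bar>)"
    unfolding op_norm_def by (rule onorm_le_matrix_component_sum)
  also have "\<dots> \<le> (\<Sum>i\<in>(UNIV::'n set). \<Sum>j\<in>(UNIV::'n set). real CARD('n) *
      (trace A * (\<bar>s\<bar> * (k * (k - 1) * norm x powr (k - 2)))))"
    by (intro sum_mono e)
  also have "\<dots> = real CARD('n) ^ 3 * \<bar>s\<bar> * (k - 1) * (k * norm x powr (k - 2) * trace A)"
    by (simp add: power3_eq_cube mult_ac)
  also have "\<dots> \<le> real CARD('n) ^ 3 * \<bar>s\<bar> * (k - 1) * trace (A ** powr_hess_matrix k x)"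
    using k by (intro mult_left_mono trace_powr_hess_matrix_ge[OF A k]) auto
  finally show ?thesis .
qed

text \<open>The gradient of s |x|^k at x is the gradient of |x|^k at c x if c |c|^(k-2) = s; a
  negative s gives a negative c. So A is evaluated at the vectors that occur in (A1), and one
  assumption yields both signs and every factor K.\<close>

lemma powr_in_F_class:
  fixes A :: "real ^ 'n \<Rightarrow> real ^ 'n ^ 'n"
  assumes k: "k > 2" and K: "K > 0" and A: "\<And>\<xi>. \<xi> \<noteq> 0 \<Longrightarrow> psd (A \<xi>)"
    and A1: "((\<lambda>x. trace (A (gradient (\<lambda>y. norm y powr k) x) ** hessian (\<lambda>y. norm y powr k) x)) \<longlongrightarrow> 0) (at 0)"
  shows "(\<lambda>r. K * r powr k) \<in> F_class A"
proof -
  let ?T = "\<lambda>x. trace (A (powr_grad k x) ** powr_hess_matrix k x)"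
  have T: "(?T \<longlongrightarrow> 0) (at 0)"
    using A1 by (simp add: gradient_cmult_norm_powr[OF k, of 1, simplified]
      hessian_cmult_norm_powr[OF k, of 1, simplified])
  have lim: "((\<lambda>x. op_norm (A (gradient (\<lambda>x. s * norm x powr k) x) ** hessian
      (\<lambda>x. s * norm x powr k) x)) \<longlongrightarrow> 0) (at 0)"
    if s: "s \<noteq> 0" for s
  proof -
    define c where "c = sgn s * \<bar>s\<bar> powr (1 / (k - 1))"
    have c0: "c \<noteq> 0" using s by (simp add: c_def sgn_eq_0_iff)
    have absc: "\<bar>c\<bar> = \<bar>s\<bar> powr (1 / (k - 1))" using s by (simp add: c_def abs_mult abs_sgn_eq)
    have cs: "c * \<bar>c\<bar> powr (k - 2) = s"
    proof -
      have "\<bar>c\<bar> * \<bar>c\<bar> powr (k - 2) = \<bar>c\<bar> powr (k - 1)"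
        using powr_mult_base[of "\<bar>c\<bar>" "k - 2"] by simp
      also have "\<dots> = \<bar>s\<bar>" using s k by (simp add: absc powr_powr)
      finally have "\<bar>c\<bar> * \<bar>c\<bar> powr (k - 2) = \<bar>s\<bar>" .
      moreover have "c = sgn s * \<bar>c\<bar>" using absc by (simp add: c_def)
      from arg_cong[OF this, of "\<lambda>y. y * \<bar>c\<bar> powr (k - 2)"]
      have "c * \<bar>c\<bar> powr (k - 2) = sgn s * (\<bar>c\<bar> * \<bar>c\<bar> powr (k - 2))" by (simp only: mult.assoc)
      ultimately show ?thesis by (simp only: sgn_mult_abs)
    qed
    have g: "powr_grad k (c *\<^sub>R x) = s *\<^sub>R powr_grad k x" for x :: "real ^ 'n"
    proof -
      have "powr_grad k (c *\<^sub>R x) = (c * \<bar>c\<bar> powr (k - 2)) *\<^sub>R powr_grad k x"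
        by (simp add: powr_grad_def powr_mult mult_ac)
      then show ?thesis using cs by simp
    qed
    have h: "powr_hess_matrix k (c *\<^sub>R x) = \<bar>c\<bar> powr (k - 2) *\<^sub>R powr_hess_matrix k x" for x :: "real ^ 'n"
    proof -
      have "\<bar>c\<bar> powr (k - 2) = \<bar>c\<bar> powr (k - 4) * (c * c)"
        using powr_add[of "\<bar>c\<bar>" "k - 4" 2] c0 by (simp add: powr_numeral power2_eq_square)
      then have "(\<bar>c\<bar> * norm x) powr (k - 4) * (c * c) = \<bar>c\<bar> powr (k - 2) * norm x powr (k - 4)"
        "(\<bar>c\<bar> * norm x) powr (k - 2) = \<bar>c\<bar> powr (k - 2) * norm x powr (k - 2)"
        by (simp_all add: powr_mult)
      note e = this
      have "k * (\<bar>c\<bar> * norm x) powr (k - 2) * d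
          + k * (k - 2) * (\<bar>c\<bar> * norm x) powr (k - 4) * ((c * a) * (c * b))
          = \<bar>c\<bar> powr (k - 2) * (k * norm x powr (k - 2) * d
              + k * (k - 2) * norm x powr (k - 4) * (a * b))" for a b d
      proof -
        have "k * (k - 2) * (\<bar>c\<bar> * norm x) powr (k - 4) * ((c * a) * (c * b))
            = k * (k - 2) * ((\<bar>c\<bar> * norm x) powr (k - 4) * (c * c)) * (a * b)"
          by (simp only: mult_ac)
        then show ?thesis unfolding e by (simp add: distrib_left mult_ac)
      qed
      then show ?thesis by (simp only: powr_hess_matrix_def vec_eq_iff vec_lambda_beta norm_scaleR
        vector_scaleR_component real_scaleR_def)
        (intro allI refl)
    qed
    have filt: "filterlim (\<lambda>x. c *\<^sub>R x) (at (0 :: real ^ 'n)) (at 0)"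
      unfolding filterlim_at
    proof
      show "\<forall>\<^sub>F x in at (0 :: real ^ 'n). c *\<^sub>R x \<in> UNIV \<and> c *\<^sub>R x \<noteq> 0"
        unfolding eventually_at_filter by (rule always_eventually) (use c0 in simp)
      show "((\<lambda>x :: real ^ 'n. c *\<^sub>R x) \<longlongrightarrow> 0) (at 0)"
        using tendsto_scaleR[OF tendsto_const[of c] tendsto_ident_at[of "0 :: real ^ 'n" UNIV]] by simp
    qed
    \<comment> \<open>Passing from x to c x multiplies the Hessian of |x|^k by |c|^(k-2);
      \<open>s'\<close> undoes this.\<close>
    define s' where "s' = s * \<bar>c\<bar> powr (2 - k)"
    have sh: "s *\<^sub>R powr_hess_matrix k x = s' *\<^sub>R powr_hess_matrix k (c *\<^sub>R x)" for x :: "real ^ 'n"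
    proof -
      have "\<bar>c\<bar> powr (2 - k) * \<bar>c\<bar> powr (k - 2) = 1" using c0 by (simp flip: powr_add)
      then show ?thesis by (simp add: h s'_def)
    qed
    let ?B = "\<lambda>x. real CARD('n) ^ 3 * \<bar>s'\<bar> * (k - 1) * ?T (c *\<^sub>R x)"
    have "(?B \<longlongrightarrow> real CARD('n) ^ 3 * \<bar>s'\<bar> * (k - 1) * 0) (at 0)"
      by (intro tendsto_mult tendsto_const filterlim_compose[OF T filt])
    then have B: "(?B \<longlongrightarrow> 0) (at 0)" by simp
    have "\<forall>\<^sub>F x in at (0 :: real ^ 'n). norm
        (op_norm (A (gradient (\<lambda>x. s * norm x powr k) x) ** hessian (\<lambda>x. s * norm x powr k) x)) \<le> ?B x"
      unfolding eventually_at_filter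
    proof (intro always_eventually allI impI)
      fix x :: "real ^ 'n" assume x: "x \<noteq> 0"
      have "powr_grad k (c *\<^sub>R x) \<noteq> 0" using x c0 k by (simp add: powr_grad_def)
      then have "psd (A (powr_grad k (c *\<^sub>R x)))" by (rule A)
      from op_norm_mult_powr_hess_matrix_le[OF this k, of s' "c *\<^sub>R x"]
      show "norm (op_norm (A (gradient (\<lambda>x. s * norm x powr k) x) ** hessian (\<lambda>x. s * norm x powr k)
          x)) \<le> ?B x"
        unfolding gradient_cmult_norm_powr[OF k] hessian_cmult_norm_powr[OF k] sh g[symmetric]
        by (simp only: real_norm_def abs_of_nonneg[OF op_norm_nonneg])
    qed
    then show ?thesis using B by (rule Lim_null_comparison)
  qed
  have d0: "((\<lambda>r::real. r powr a) has_real_derivative 0) (at 0 within {0..})" if a: "a > 1" for a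
  proof -
    \<comment> \<open>The absolute value gives a function with a two-sided derivative at 0 that
      agrees with \<open>r powr a\<close> on {0..}, where the one-sided derivative is
      wanted.\<close>
    have "((\<lambda>r::real. \<bar>r\<bar> powr a) has_derivative (\<lambda>h. 0)) (at 0)"
      by (rule has_derivative_zero_powr[where c = 1 and a = a]) (use a in auto)
    then have "((\<lambda>r::real. \<bar>r\<bar> powr a) has_derivative (\<lambda>h. 0)) (at 0 within {0..})"
      by (rule has_derivative_at_withinI)
    then have "((\<lambda>r::real. r powr a) has_derivative (\<lambda>h. 0)) (at 0 within {0..})"
      by (rule has_derivative_transform[rotated 2]) auto
    moreover have "(\<lambda>h::real. 0::real) = (*) 0" by (simp add: fun_eq_iff)
    ultimately show ?thesis by (simp only: has_field_derivative_def)
  qed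
  have d: "((\<lambda>r::real. c * r powr a) has_real_derivative c * (a * r powr (a - 1)))
      (at r within {0..})" if a: "a > 1" and r: "r \<ge> 0" for a r c
  proof (cases "r = 0")
    case True
    moreover have "c * (a * 0 powr (a - 1)) = c * 0" by simp
    ultimately show ?thesis using DERIV_cmult[OF d0[OF a], of c] by (simp only:)
  next
    case False
    then show ?thesis using r by (intro DERIV_cmult has_field_derivative_at_within[OF
      has_real_derivative_powr]) auto
  qed
  have "\<exists>f' f''. (\<forall>r\<ge>0. ((\<lambda>r. K * r powr k) has_real_derivative f' r) (at r within {0..})) \<and>
               (\<forall>r\<ge>0. (f' has_real_derivative f'' r) (at r within {0..})) \<and>
               continuous_on {0..} f'' \<and>
               K * 0 powr k = 0 \<and> f' 0 = 0 \<and> f'' 0 = 0 \<and> (\<forall>r>0. f'' r > 0)"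
  proof (intro exI conjI allI impI)
    fix r :: real assume r: "r \<ge> 0"
    show "((\<lambda>r. K * r powr k) has_real_derivative (\<lambda>r. (K * k) * r powr (k - 1)) r) (at r within {0..})"
      using d[of k r K] k r by (simp add: mult.assoc)
    show "((\<lambda>r. (K * k) * r powr (k - 1)) has_real_derivative
        (\<lambda>r. (K * k) * ((k - 1) * r powr (k - 1 - 1))) r) (at r within {0..})"
      using d[of "k - 1" r "K * k"] k r by simp
  next
    show "continuous_on {0..} (\<lambda>r. (K * k) * ((k - 1) * r powr (k - 1 - 1)))"
      by (intro continuous_intros continuous_on_powr') (use k in auto)
  next
    fix r :: real assume "r > 0"
    then show "(K * k) * ((k - 1) * r powr (k - 1 - 1)) > 0" using K k by simp
  qed (use k in auto)
  moreover have "((\<lambda>x. op_norm (A (gradient R x) ** hessian R x)) \<longlongrightarrow> 0) (at 0)"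
    if "R \<in> {\<lambda>x. K * norm x powr k, \<lambda>x. - (K * norm x powr k)}" for R
    using that lim[of K] lim[of "- K"] K by auto
  ultimately show ?thesis unfolding F_class_def by simp
qed

text \<open>\<open>C2_compatible\<close> wants a remainder that depends on |t - t0| only, so the
  remainders on the two sides of t are added.\<close>

lemma small_o_first_order_remainder:
  fixes \<tau> :: "real \<Rightarrow> real"
  assumes "(\<tau> has_real_derivative D) (at t)"
  shows "\<exists>\<omega>. \<omega> \<in> o[nhds 0](\<lambda>s. s) \<and> (\<forall>r. \<bar>\<tau> r - \<tau> t - D * (r - t)\<bar> \<le> \<omega> \<bar>r - t\<bar>)"
proof -
  define \<rho> where "\<rho> s = \<bar>\<tau> (t + s) - \<tau> t - D * s\<bar>" for s
  have \<rho>: "\<exists>d>0. \<forall>s. \<bar>s\<bar> < d \<longrightarrow> \<rho> s \<le> c * \<bar>s\<bar>" if c: "c > 0" for c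
  proof -
    have "(\<tau> has_derivative (*) D) (at t)" using assms by (simp add: has_field_derivative_def)
    then obtain d where d: "d > 0" "\<And>y. norm (y - t) < d \<Longrightarrow> norm (\<tau> y - \<tau> t - D * (y - t))
        \<le> c * norm (y - t)"
      using c unfolding has_derivative_at_alt by blast
    have "\<rho> s \<le> c * \<bar>s\<bar>" if "\<bar>s\<bar> < d" for s using d(2)[of "t + s"] that by (simp add: \<rho>_def)
    then show ?thesis using d(1) by blast
  qed
  have "(\<lambda>s. \<rho> s + \<rho> (- s)) \<in> o[nhds 0](\<lambda>s. s)"
  proof (rule landau_o.smallI)
    fix c :: real assume "c > 0"
    then obtain d where d: "d > 0" "\<And>s. \<bar>s\<bar> < d \<Longrightarrow> \<rho> s \<le> c/2 * \<bar>s\<bar>" using \<rho>[of "c/2"] by auto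
    have "norm (\<rho> s + \<rho> (- s)) \<le> c * norm s" if "\<bar>s\<bar> < d" for s
      using d(2)[of s] d(2)[of "- s"] that by (simp add: \<rho>_def)
    then show "\<forall>\<^sub>F s in nhds 0. norm (\<rho> s + \<rho> (- s)) \<le> c * norm s"
      unfolding eventually_nhds_metric using d(1) by (intro exI[of _ d]) (auto simp: dist_real_def)
  qed
  moreover have "\<bar>\<tau> r - \<tau> t - D * (r - t)\<bar> \<le> \<rho> \<bar>r - t\<bar> + \<rho> (- \<bar>r - t\<bar>)" for r
    by (cases "r \<ge> t") (auto simp: \<rho>_def)
  ultimately show ?thesis by blast
qed

text \<open>The spatial gradient vanishes precisely where x = y, and there the deviation from the
  first-order expansion in time is at most K |x - y|^k plus o(|t - t0|), so
  \<open>powr_in_F_class\<close> applies. The sign s is 1 for subsolutions and -1 for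
  supersolutions.\<close>

lemma radial_test_function:
  fixes y :: "real ^ 'n"
  assumes k: "k > 2" and K: "K > 0" and A: "\<And>\<xi>. \<xi> \<noteq> 0 \<Longrightarrow> psd (A \<xi>)"
    and A1: "((\<lambda>x. trace (A (gradient (\<lambda>y. norm y powr k) x) ** hessian (\<lambda>y. norm y powr k) x)) \<longlongrightarrow> 0) (at 0)"
    and t1: "\<And>t. t \<in> snd ` Q \<Longrightarrow> (\<tau> has_real_derivative \<tau>' t) (at t)"
    and t2: "\<And>t. t \<in> snd ` Q \<Longrightarrow> (\<tau>' has_real_derivative \<tau>'' t) (at t)"
    and t3: "continuous_on (snd ` Q) \<tau>''"
    and s: "\<bar>s\<bar> = 1"
  shows "C2_compatible A Q (\<lambda>z. s * (K * norm (fst z - y) powr k + \<tau> (snd z)))"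
    and "(y, t0) \<in> Q \<Longrightarrow> space_gradient (\<lambda>z. s * (K * norm (fst z - y) powr k + \<tau> (snd z))) (y, t0) = 0"
    and "(y, t0) \<in> Q \<Longrightarrow> time_deriv (\<lambda>z. s * (K * norm (fst z - y) powr k + \<tau> (snd z))) (y, t0) = s * \<tau>' t0"
proof -
  let ?\<psi> = "\<lambda>z. s * (K * norm (fst z - y) powr k + \<tau> (snd z))"
  obtain g'' where g: "C2_with Q (\<lambda>z. norm (fst z - y) powr k)
      (\<lambda>z. blinfun_inner_right (powr_grad k (fst z - y)) o\<^sub>L fst_blinfun) g''"
    using C2_with_pullback[OF C2_with_norm_powr[OF k], of Q fst_blinfun y]
      by (auto simp: fst_blinfun.rep_eq)
  have lin: "C2_with Q (\<lambda>z. (0, 1) \<bullet> (z - 0)) (\<lambda>z. blinfun_inner_right (0 :: real ^ 'n, 1 :: real)) (\<lambda>z. 0)"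
    by (rule C2_with_linear)
  have sn: "(\<lambda>z::(real ^ 'n) \<times> real. (0, 1) \<bullet> (z - 0)) = snd" by (auto simp: fun_eq_iff)
  obtain h'' where h: "C2_with Q (\<lambda>z. \<tau> (snd z))
      (\<lambda>z. \<tau>' (snd z) *\<^sub>R blinfun_inner_right (0 :: real ^ 'n, 1 :: real)) h''"
    using C2_with_compose[OF lin[unfolded sn], of \<tau> \<tau>' \<tau>''] t1 t2 t3 by auto
  define f' where "f' z = s *\<^sub>R (K *\<^sub>R (blinfun_inner_right (powr_grad k (fst z - y)) o\<^sub>L fst_blinfun)
      + \<tau>' (snd z) *\<^sub>R blinfun_inner_right (0 :: real ^ 'n, 1 :: real))"
    for z :: "(real ^ 'n) \<times> real"
  have C2: "C2_with Q ?\<psi> f' (\<lambda>z. s *\<^sub>R (K *\<^sub>R g'' z + h'' z))" unfolding f'_def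
    by (intro C2_with_cmult C2_with_add g h)
  have f': "f' z h = s * (K * (powr_grad k (fst z - y) \<bullet> fst h) + \<tau>' (snd z) * snd h)" for z h
    by (simp add: f'_def plus_blinfun.rep_eq scaleR_blinfun.rep_eq blinfun_compose.rep_eq
      fst_blinfun.rep_eq blinfun_inner_right.rep_eq inner_prod_def)
  have grad: "space_gradient ?\<psi> z = (s * K) *\<^sub>R powr_grad k (fst z - y)" if "z \<in> Q" for z
    by (rule space_gradient_eqI[OF C2 that]) (simp add: f' inner_axis)
  have td: "time_deriv ?\<psi> z = s * \<tau>' (snd z)" if "z \<in> Q" for z
    using time_deriv_C2_with[OF C2 that] by (simp add: f')
  show "(y, t0) \<in> Q \<Longrightarrow> space_gradient ?\<psi> (y, t0) = 0" using grad by (simp add: powr_grad_def)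
  show "(y, t0) \<in> Q \<Longrightarrow> time_deriv ?\<psi> (y, t0) = s * \<tau>' t0" using td by simp
  show "C2_compatible A Q ?\<psi>" unfolding C2_compatible_def
  proof (intro conjI C2_with_imp_C2_on[OF C2], clarify)
    fix x1 t1 assume z1: "(x1, t1) \<in> Q" "space_gradient ?\<psi> (x1, t1) = 0"
    then have "x1 = y" using grad[OF z1(1)] s K k by (auto simp: powr_grad_def)
    have "t1 \<in> snd ` Q" using z1(1) by force
    then obtain \<omega> where \<omega>: "\<omega> \<in> o[nhds 0](\<lambda>s. s)" "\<And>r. \<bar>\<tau> r - \<tau> t1 - \<tau>' t1 * (r - t1)\<bar> \<le> \<omega> \<bar>r - t1\<bar>"
      using small_o_first_order_remainder[OF t1] by blast
    have "\<bar>?\<psi> (x, t) - ?\<psi> (x1, t1) - time_deriv ?\<psi> (x1, t1) * (t - t1)\<bar> \<le> K * norm (x - x1) powr k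
        + \<omega> \<bar>t - t1\<bar>" for x t
    proof -
      have "?\<psi> (x, t) - ?\<psi> (x1, t1) - time_deriv ?\<psi> (x1, t1) * (t - t1)
          = s * (K * norm (x - x1) powr k + (\<tau> t - \<tau> t1 - \<tau>' t1 * (t - t1)))"
        using td[OF z1(1)] \<open>x1 = y\<close> by (simp add: algebra_simps)
      then have "\<bar>?\<psi> (x, t) - ?\<psi> (x1, t1) - time_deriv ?\<psi> (x1, t1) * (t - t1)\<bar>
          = \<bar>K * norm (x - x1) powr k + (\<tau> t - \<tau> t1 - \<tau>' t1 * (t - t1))\<bar>"
        using s by (simp add: abs_mult)
      also have "\<dots> \<le> K * norm (x - x1) powr k + \<bar>\<tau> t - \<tau> t1 - \<tau>' t1 * (t - t1)\<bar>"
        using abs_triangle_ineq[of "K * norm (x - x1) powr k"] K by simp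
      also have "\<dots> \<le> K * norm (x - x1) powr k + \<omega> \<bar>t - t1\<bar>" using \<omega>(2)[of t] by simp
      finally show ?thesis .
    qed
    then show "\<exists>f\<in>F_class A. \<exists>\<omega>. \<omega> \<in> o[nhds 0](\<lambda>s. s) \<and> (\<forall>\<^sub>F (x, t) in nhds (x1, t1).
        \<bar>?\<psi> (x, t) - ?\<psi> (x1, t1) - time_deriv ?\<psi> (x1, t1) * (t - t1)\<bar> \<le> f (norm (x - x1)) + \<omega> \<bar>t - t1\<bar>)"
      using \<omega>(1) powr_in_F_class[OF k K A A1]
      by (intro bexI[of _ "\<lambda>r. K * r powr k"] exI[of _ \<omega>] conjI) (auto intro!: always_eventually)
  qed
qed

section \<open>Square roots of nonnegative matrices\<close>

text \<open>A nonnegative form is minimal at its zeros, so its derivative 2 S e vanishes there; the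
  variation is taken in the direction S e, which stays in V.\<close>

lemma form_zero_imp_zero:
  fixes S :: "'a::real_inner \<Rightarrow> 'a"
  assumes S: "linear S" "\<And>x y. x \<bullet> S y = S x \<bullet> y" and V: "subspace V" "\<And>x. x \<in> V \<Longrightarrow> S x \<in> V"
    and pos: "\<And>x. x \<in> V \<Longrightarrow> 0 \<le> x \<bullet> S x" and e: "e \<in> V" "e \<bullet> S e = 0"
  shows "S e = 0"
proof -
  define v where "v = S e"
  have v: "v \<in> V" using V(2) e(1) by (simp add: v_def)
  have "0 \<le> - 2 * (v \<bullet> v) + (v \<bullet> S v) * t" if t: "0 < t" "t \<le> 1" for t
  proof -
    have "e - t *\<^sub>R v \<in> V" using V(1) e(1) v by (simp add: subspace_diff subspace_scale)
    then have "0 \<le> (e - t *\<^sub>R v) \<bullet> S (e - t *\<^sub>R v)" by (rule pos)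
    also have "\<dots> = e \<bullet> S e - t * (e \<bullet> S v) - t * (v \<bullet> S e) + t * t * (v \<bullet> S v)"
      by (simp add: linear_diff[OF S(1)] linear_scale[OF S(1)] inner_diff_left inner_diff_right
        algebra_simps)
    also have "\<dots> = t * (- 2 * (v \<bullet> v) + (v \<bullet> S v) * t)"
      using S(2)[of e v] e(2) by (simp add: v_def[symmetric] algebra_simps)
    finally show ?thesis using t(1) by (simp add: zero_le_mult_iff)
  qed
  then have "0 \<le> - 2 * (v \<bullet> v)" by (rule nonneg_if_small_perturbation)
  then have "v \<bullet> v = 0" using inner_ge_zero[of v] by linarith
  then show ?thesis by (simp add: v_def)
qed

text \<open>Let e maximise x \<bullet> T x on the unit sphere of V, with maximum \<mu>. The form of
  \<mu> - T is nonnegative on V and zero at e, so \<open>form_zero_imp_zero\<close> makes e an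
  eigenvector.\<close>

lemma self_adjoint_eigenvector:
  fixes T :: "'a::euclidean_space \<Rightarrow> 'a"
  assumes T: "linear T" "\<And>x y. x \<bullet> T y = T x \<bullet> y" and V: "subspace V" "\<And>x. x \<in> V \<Longrightarrow> T x \<in> V"
    and ne: "V \<noteq> {0}"
  shows "\<exists>e\<in>V. \<exists>\<mu>. norm e = 1 \<and> T e = \<mu> *\<^sub>R e"
proof -
  obtain x where x: "x \<in> V" "x \<noteq> 0" using ne V(1) subspace_0 by blast
  have "x /\<^sub>R norm x \<in> V \<inter> sphere 0 1" using x V(1) by (simp add: subspace_scale)
  moreover have "compact (V \<inter> sphere 0 1)" using closed_subspace[OF V(1)] by (simp add: closed_Int_compact)
  moreover have "continuous_on (V \<inter> sphere 0 1) (\<lambda>x. x \<bullet> T x)"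
    using T(1) by (intro continuous_intros linear_continuous_on) (simp add: linear_conv_bounded_linear)
  ultimately obtain e where e: "e \<in> V \<inter> sphere 0 1" "\<And>y. y \<in> V \<inter> sphere 0 1 \<Longrightarrow> y \<bullet> T y \<le> e \<bullet> T e"
    using continuous_attains_sup[of "V \<inter> sphere 0 1" "\<lambda>x. x \<bullet> T x"] by blast
  define \<mu> where "\<mu> = e \<bullet> T e"
  define S where "S x = \<mu> *\<^sub>R x - T x" for x
  have e1: "norm e = 1" using e(1) by simp
  have "S e = 0"
  proof (rule form_zero_imp_zero[where V = V and S = S and e = e])
    show "linear S" unfolding S_def by (rule linearI) (simp_all add: linear_add[OF T(1)]
      linear_scale[OF T(1)] algebra_simps)
    show "x \<bullet> S y = S x \<bullet> y" for x y by (simp add: S_def inner_diff_left inner_diff_right T(2))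
    show "S x \<in> V" if "x \<in> V" for x unfolding S_def using that V by (simp add: subspace_diff subspace_scale)
    show "0 \<le> x \<bullet> S x" if "x \<in> V" for x
    proof (cases "x = 0")
      case False
      have "x /\<^sub>R norm x \<in> V \<inter> sphere 0 1" using that False V(1) by (simp add: subspace_scale)
      from e(2)[OF this] have "(x \<bullet> T x) / (norm x * norm x) \<le> \<mu>"
        by (simp add: \<mu>_def linear_scale[OF T(1)] divide_inverse mult_ac)
      then have "x \<bullet> T x \<le> \<mu> * (norm x * norm x)" using False by (simp add: divide_le_eq)
      then show ?thesis by (simp add: S_def inner_diff_right power2_norm_eq_inner[symmetric]
        power2_eq_square)
    qed (simp add: S_def)
    show "e \<bullet> S e = 0" using e1 by (simp add: S_def inner_diff_right \<mu>_def power2_norm_eq_inner[symmetric])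
  qed (use V(1) e in auto)
  then show ?thesis using e e1 by (intro bexI[of _ e] exI[of _ \<mu>]) (auto simp: S_def)
qed

text \<open>Induction on the dimension: the orthogonal complement of an eigenvector in V is
  invariant again.\<close>

lemma self_adjoint_eigenbasis_subspace:
  fixes T :: "'a::euclidean_space \<Rightarrow> 'a"
  assumes T: "linear T" "\<And>x y. x \<bullet> T y = T x \<bullet> y"
  shows "subspace V \<Longrightarrow> (\<And>x. x \<in> V \<Longrightarrow> T x \<in> V) \<Longrightarrow>
    \<exists>B m. finite B \<and> B \<subseteq> V \<and> (\<forall>b\<in>B. \<forall>c\<in>B. b \<bullet> c = (if b = c then 1 else 0)) \<and> (\<forall>b\<in>B. T b = m b *\<^sub>R b) \<and>
      (\<forall>x\<in>V. x = (\<Sum>b\<in>B. (x \<bullet> b) *\<^sub>R b))"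
proof (induction "dim V" arbitrary: V rule: less_induct)
  case less
  show ?case
  proof (cases "V = {0}")
    case True
    then show ?thesis by (intro exI[of _ "{}"]) auto
  next
    case False
    obtain e \<mu> where e: "e \<in> V" "norm e = 1" "T e = \<mu> *\<^sub>R e"
      using self_adjoint_eigenvector[OF T less.prems False] by blast
    have ee: "e \<bullet> e = 1" using e(2) by (simp add: power2_norm_eq_inner[symmetric])
    define W where "W = {x \<in> V. x \<bullet> e = 0}"
    have subW: "subspace W" using less.prems(1) unfolding W_def subspace_def by (auto simp: inner_add_left)
    have "e \<notin> W" by (simp add: W_def ee)
    then have WV: "W \<subset> V" using e(1) by (auto simp only: W_def)
    have "span W = W" "span V = V" using subW less.prems(1) by (simp_all add: span_eq_iff)
    then have d: "dim W < dim V" using WV by (intro dim_psubset) (simp only:)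
    have TW: "T x \<in> W" if "x \<in> W" for x
      using that less.prems(2) e(3) T(2)[of x e] by (auto simp: W_def)
    have "\<exists>B m. finite B \<and> B \<subseteq> W \<and> (\<forall>b\<in>B. \<forall>c\<in>B. b \<bullet> c = (if b = c then 1 else 0)) \<and> (\<forall>b\<in>B. T b = m b *\<^sub>R b) \<and>
      (\<forall>x\<in>W. x = (\<Sum>b\<in>B. (x \<bullet> b) *\<^sub>R b))"
      by (rule less.hyps[OF d subW]) (rule TW)
    then obtain B m where B': "finite B \<and> B \<subseteq> W \<and> (\<forall>b\<in>B. \<forall>c\<in>B. b \<bullet> c = (if b = c then 1 else 0))
        \<and> (\<forall>b\<in>B. T b = m b *\<^sub>R b) \<and>
      (\<forall>x\<in>W. x = (\<Sum>b\<in>B. (x \<bullet> b) *\<^sub>R b))"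
      by (elim exE) (rule that)
    note B = B'[THEN conjunct1] B'[THEN conjunct2, THEN conjunct1] B'[THEN conjunct2, THEN
      conjunct2, THEN conjunct1, rule_format]
      B'[THEN conjunct2, THEN conjunct2, THEN conjunct2, THEN conjunct1, rule_format]
      B'[THEN conjunct2, THEN conjunct2, THEN conjunct2, THEN conjunct2, rule_format]
    have eB: "b \<bullet> e = 0" "e \<bullet> b = 0" if "b \<in> B" for b using that B(2) by (auto simp: W_def inner_commute)
    have enB: "e \<notin> B" using eB(1)[of e] ee by auto
    have "x = (\<Sum>b\<in>insert e B. (x \<bullet> b) *\<^sub>R b)" if x: "x \<in> V" for x
    proof -
      define y where "y = x - (x \<bullet> e) *\<^sub>R e"
      have "y \<in> W" using x e(1) less.prems(1) ee
        by (simp add: y_def W_def subspace_diff subspace_scale inner_diff_left)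
      then have "y = (\<Sum>b\<in>B. (y \<bullet> b) *\<^sub>R b)" by (rule B(5))
      also have "\<dots> = (\<Sum>b\<in>B. (x \<bullet> b) *\<^sub>R b)"
        by (intro sum.cong refl) (simp add: y_def inner_diff_left eB)
      finally show ?thesis using B(1) enB by (simp add: y_def algebra_simps)
    qed
    moreover have "\<forall>b\<in>insert e B. \<forall>c\<in>insert e B. b \<bullet> c = (if b = c then 1 else 0)"
      using B(3) eB enB ee by auto
    moreover have "\<forall>b\<in>insert e B. T b = (m(e := \<mu>)) b *\<^sub>R b" using B(4) e(3) enB by auto
    ultimately show ?thesis using B(1,2) WV e(1)
      by (intro exI[of _ "insert e B"] exI[of _ "m(e := \<mu>)"]) auto
  qed
qed

lemma matrix_self_adjoint:
  fixes M :: "real ^ 'n ^ 'n"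
  assumes "transpose M = M"
  shows "x \<bullet> (M *v y) = (M *v x) \<bullet> y"
  using assms by (metis dot_lmul_matrix vector_transpose_matrix)

lemma symmetric_matrix_eigenbasis:
  fixes M :: "real ^ 'n ^ 'n"
  assumes "transpose M = M"
  obtains B m where "finite B" "\<And>b c. b \<in> B \<Longrightarrow> c \<in> B \<Longrightarrow> b \<bullet> c = (if b = c then 1 else 0)"
    "\<And>b. b \<in> B \<Longrightarrow> M *v b = m b *\<^sub>R b" "\<And>x. x = (\<Sum>b\<in>B. (x \<bullet> b) *\<^sub>R b)"
proof -
  have "\<exists>B m. finite B \<and> B \<subseteq> UNIV \<and> (\<forall>b\<in>B. \<forall>c\<in>B. b \<bullet> c = (if b = c then 1 else 0)) \<and>
      (\<forall>b\<in>B. M *v b = m b *\<^sub>R b) \<and> (\<forall>x\<in>UNIV. x = (\<Sum>b\<in>B. (x \<bullet> b) *\<^sub>R b))"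
    by (rule self_adjoint_eigenbasis_subspace) (simp_all add: matrix_self_adjoint[OF assms])
  then show thesis by (elim exE conjE) (rule that; blast)
qed

lemma psd_matrix_kernel:
  fixes M :: "real ^ 'n ^ 'n"
  assumes "psd M" "x \<bullet> (M *v x) = 0"
  shows "M *v x = 0"
  by (rule form_zero_imp_zero[where V = UNIV and S = "(*v) M" and e = x])
    (use assms matrix_self_adjoint[of M] in \<open>auto simp: psd_def\<close>)

text \<open>The root acts by \<open>sqrt (m b)\<close> on an orthonormal eigenbasis.\<close>

lemma psd_sqrt_exists:
  fixes M :: "real ^ 'n ^ 'n"
  assumes M: "psd M"
  shows "\<exists>R. psd R \<and> R ** R = M"
proof -
  obtain B m where B: "finite B" "\<And>b c. b \<in> B \<Longrightarrow> c \<in> B \<Longrightarrow> b \<bullet> c = (if b = c then 1 else 0)"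
    "\<And>b. b \<in> B \<Longrightarrow> M *v b = m b *\<^sub>R b" "\<And>x. x = (\<Sum>b\<in>B. (x \<bullet> b) *\<^sub>R b)"
    by (rule symmetric_matrix_eigenbasis[OF conjunct1[OF M[unfolded psd_def]]]) (rule that)
  have m0: "m b \<ge> 0" if "b \<in> B" for b
  proof -
    have "0 \<le> b \<bullet> (M *v b)" using M by (simp add: psd_def)
    then show ?thesis using B(2)[OF that that] B(3)[OF that] by simp
  qed
  define f where "f x = (\<Sum>b\<in>B. (sqrt (m b) * (x \<bullet> b)) *\<^sub>R b)" for x
  have linf: "linear f"
    unfolding f_def by (rule linearI) (simp_all add: inner_add_left sum.distrib algebra_simps
      scaleR_sum_right)
  have fb: "f x \<bullet> c = sqrt (m c) * (x \<bullet> c)" if "c \<in> B" for x c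
  proof -
    have "f x \<bullet> c = (\<Sum>b\<in>B. if b = c then sqrt (m b) * (x \<bullet> b) else 0)"
      unfolding f_def inner_sum_left by (intro sum.cong refl) (auto simp: B(2)[OF _ that])
    then show ?thesis using B(1) that by simp
  qed
  have sa: "x \<bullet> f y = (\<Sum>b\<in>B. sqrt (m b) * (x \<bullet> b) * (y \<bullet> b))" for x y
    by (simp add: f_def inner_sum_right mult_ac)
  let ?R = "matrix f"
  have R: "?R *v x = f x" for x by (rule matrix_works[OF linear_matrix_vector_mul_eq[THEN iffD2, OF linf]])
  have "transpose ?R = ?R"
  proof -
    have "?R $ i $ j = ?R $ j $ i" for i j
    proof -
      have "?R $ i $ j = axis i 1 \<bullet> f (axis j 1)" for i j by (simp add: matrix_def inner_axis')
      then show ?thesis by (simp add: sa mult_ac)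
    qed
    then show ?thesis by (simp add: transpose_def vec_eq_iff)
  qed
  moreover have "0 \<le> x \<bullet> (?R *v x)" for x
    unfolding R sa using m0 by (auto intro!: sum_nonneg simp: mult.assoc)
  moreover have "?R ** ?R = M"
  proof -
    have "(?R ** ?R) *v x = M *v x" for x
    proof -
      have "(?R ** ?R) *v x = f (f x)" by (simp add: matrix_vector_mul_assoc[symmetric] R)
      also have "\<dots> = (\<Sum>b\<in>B. (x \<bullet> b) *\<^sub>R (M *v b))"
        unfolding f_def[of "f x"] using m0 by (intro sum.cong refl) (simp add: fb B(3))
      also have "\<dots> = M *v (\<Sum>b\<in>B. (x \<bullet> b) *\<^sub>R b)"
        by (simp add: linear_sum[OF matrix_vector_mul_linear] linear_scale[OF matrix_vector_mul_linear])
      also have "\<dots> = M *v x" using B(4)[of x] by simp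
      finally show ?thesis .
    qed
    then show ?thesis by (simp add: matrix_eq)
  qed
  ultimately show ?thesis by (auto simp: psd_def)
qed

text \<open>For an eigenvector b of B - C with eigenvalue m, equality of the squares gives m (b
  \<bullet> B b + b \<bullet> C b) = 0. If m is not 0, both forms vanish at b, and then so do B b
  and C b.\<close>

lemma psd_sqrt_unique:
  fixes B C :: "real ^ 'n ^ 'n"
  assumes B: "psd B" and C: "psd C" and eq: "B ** B = C ** C"
  shows "B = C"
proof -
  have "transpose (B - C) = B - C" using B C by (simp add: psd_def transpose_def vec_eq_iff)
  then obtain E m where E: "finite E" "\<And>b c. b \<in> E \<Longrightarrow> c \<in> E \<Longrightarrow> b \<bullet> c = (if b = c then 1 else 0)"
    "\<And>b. b \<in> E \<Longrightarrow> (B - C) *v b = m b *\<^sub>R b" "\<And>x. x = (\<Sum>b\<in>E. (x \<bullet> b) *\<^sub>R b)"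
    by (rule symmetric_matrix_eigenbasis) (rule that)
  have sym: "x \<bullet> (B *v y) = (B *v x) \<bullet> y" "x \<bullet> (C *v y) = (C *v x) \<bullet> y" for x y
    using B C matrix_self_adjoint by (auto simp: psd_def)
  have z: "(B - C) *v b = 0" if b: "b \<in> E" for b
  proof (rule ccontr)
    assume nz: "(B - C) *v b \<noteq> 0"
    have d: "B *v b - C *v b = m b *\<^sub>R b" using E(3)[OF b] by (simp add: matrix_vector_mult_diff_rdistrib)
    have mb: "m b \<noteq> 0" using nz E(3)[OF b] by auto
    have "(B *v b) \<bullet> (B *v b) = b \<bullet> ((B ** B) *v b)"
      by (simp add: sym(1)[of b "B *v b"] matrix_vector_mul_assoc[symmetric])
    also have "\<dots> = (C *v b) \<bullet> (C *v b)" unfolding eq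
      by (simp add: sym(2)[of b "C *v b"] matrix_vector_mul_assoc[symmetric])
    finally have "(B *v b - C *v b) \<bullet> (B *v b + C *v b) = 0"
      by (simp add: inner_diff_left inner_diff_right inner_add_right inner_add_left inner_commute)
    then have "m b * (b \<bullet> (B *v b) + b \<bullet> (C *v b)) = 0" by (simp add: d inner_add_right distrib_left)
    then have "b \<bullet> (B *v b) + b \<bullet> (C *v b) = 0" using mb by simp
    moreover have "0 \<le> b \<bullet> (B *v b)" "0 \<le> b \<bullet> (C *v b)" using B C by (auto simp: psd_def)
    ultimately have "B *v b = 0" "C *v b = 0" using psd_matrix_kernel B C by (metis add_nonneg_eq_0_iff)+
    then show False using nz by (simp add: matrix_vector_mult_diff_rdistrib)
  qed
  have "(B - C) *v x = 0" for x
  proof -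
    have "(B - C) *v x = (B - C) *v (\<Sum>b\<in>E. (x \<bullet> b) *\<^sub>R b)" using E(4)[of x] by simp
    also have "\<dots> = (\<Sum>b\<in>E. (x \<bullet> b) *\<^sub>R ((B - C) *v b))"
      by (simp only: linear_sum[OF matrix_vector_mul_linear] linear_scale[OF matrix_vector_mul_linear])
    also have "\<dots> = 0" using z by simp
    finally show ?thesis .
  qed
  then have "B *v x = C *v x" for x by (simp add: matrix_vector_mult_diff_rdistrib)
  then show ?thesis by (simp add: matrix_eq)
qed

lemma psd_sqrt:
  assumes "psd M"
  shows "psd (psd_sqrt M)" "psd_sqrt M ** psd_sqrt M = M"
proof -
  have "\<exists>!R. psd R \<and> R ** R = M" using psd_sqrt_exists[OF assms] psd_sqrt_unique by metis
  from theI'[OF this] show "psd (psd_sqrt M)" "psd_sqrt M ** psd_sqrt M = M" by (auto simp: psd_sqrt_def)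
qed

lemma trace_sandwich:
  fixes R X :: "real ^ 'n ^ 'n"
  assumes "transpose R = R"
  shows "trace ((R ** R) ** X) = (\<Sum>i\<in>UNIV. (R *v axis i 1) \<bullet> (X *v (R *v axis i 1)))"
proof -
  have "trace ((R ** R) ** X) = trace ((R ** X) ** R)"
    using trace_mul_sym[of R "R ** X"] by (simp add: matrix_mul_assoc)
  also have "\<dots> = (\<Sum>i\<in>UNIV. axis i 1 \<bullet> ((R ** X ** R) *v axis i 1))"
    by (simp add: trace_def inner_axis' matrix_vector_mult_basis column_def)
  also have "\<dots> = (\<Sum>i\<in>UNIV. (R *v axis i 1) \<bullet> (X *v (R *v axis i 1)))"
    by (intro sum.cong refl) (simp add: matrix_self_adjoint[OF assms, symmetric]
      matrix_vector_mul_assoc matrix_mul_assoc)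
  finally show ?thesis .
qed

text \<open>The square roots enter here: the form inequality is applied to the images of each
  coordinate vector under the roots of A0 and A1, and summed. The factor m meets only the difference
  of the two images, which the norm of the difference of the roots bounds.\<close>

lemma trace_sum_le:
  fixes A0 A1 X Y :: "real ^ 'n ^ 'n"
  assumes A: "psd A0" "psd A1" and m: "m \<ge> 0"
    and XY: "\<And>h k. h \<bullet> (X *v h) + k \<bullet> (Y *v k) \<le> m * (norm (h - k))\<^sup>2 + e * ((norm h)\<^sup>2 + (norm k)\<^sup>2)"
  shows "trace (A0 ** X) + trace (A1 ** Y)
      \<le> m * real CARD('n) * (op_norm (psd_sqrt A0 - psd_sqrt A1))\<^sup>2 + e * (trace A0 + trace A1)"
proof -
  let ?R = "psd_sqrt A0" and ?S = "psd_sqrt A1"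
  have t: "transpose ?R = ?R" "transpose ?S = ?S" using psd_sqrt(1) A by (auto simp: psd_def)
  have sq: "(\<Sum>i\<in>UNIV. (norm (R *v axis i 1))\<^sup>2) = trace (R ** R)" if "transpose R = R"
    for R :: "real ^ 'n ^ 'n"
    using trace_sandwich[OF that, of "mat 1"] by (simp add: power2_norm_eq_inner)
  have "trace (A0 ** X) + trace (A1 ** Y) = trace ((?R ** ?R) ** X) + trace ((?S ** ?S) ** Y)"
    by (simp add: psd_sqrt(2) A)
  also have "\<dots> = (\<Sum>i\<in>UNIV. (?R *v axis i 1) \<bullet> (X *v (?R *v axis i 1))
      + (?S *v axis i 1) \<bullet> (Y *v (?S *v axis i 1)))"
    by (simp only: trace_sandwich t sum.distrib)
  also have "\<dots> \<le> (\<Sum>i\<in>UNIV. m * (norm (?R *v axis i 1 - ?S *v axis i 1))\<^sup>2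
      + e * ((norm (?R *v axis i 1))\<^sup>2 + (norm (?S *v axis i 1))\<^sup>2))"
    by (intro sum_mono XY)
  also have "\<dots> \<le> (\<Sum>i\<in>(UNIV::'n set). m * (op_norm (?R - ?S))\<^sup>2
      + e * ((norm (?R *v axis i 1))\<^sup>2 + (norm (?S *v axis i 1))\<^sup>2))"
  proof (intro sum_mono add_right_mono mult_left_mono power_mono m)
    fix i
    have "norm ((?R - ?S) *v axis i 1) \<le> op_norm (?R - ?S) * norm (axis i 1 :: real ^ 'n)"
      unfolding op_norm_def by (rule onorm) (simp add: matrix_vector_mul_bounded_linear)
    then show "norm (?R *v axis i 1 - ?S *v axis i 1) \<le> op_norm (?R - ?S)"
      by (simp add: matrix_vector_mult_diff_rdistrib)
  qed auto
  also have "\<dots> = m * real CARD('n) * (op_norm (?R - ?S))\<^sup>2 + e * (trace (?R ** ?R) + trace (?S ** ?S))"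
    by (simp add: sum.distrib sum_distrib_left[symmetric] sq t)
  also have "\<dots> = m * real CARD('n) * (op_norm (?R - ?S))\<^sup>2 + e * (trace A0 + trace A1)"
    by (simp add: psd_sqrt(2) A)
  finally show ?thesis .
qed

lemma spatial_matrix_form:
  assumes "linear X"
  shows "h \<bullet> (spatial_matrix X *v h) = (h, 0) \<bullet> X (h, 0)"
proof -
  define e where "e i = (axis i 1 :: real ^ 'a, 0 :: real)" for i
  have h: "(h, 0) = (\<Sum>i\<in>UNIV. (h $ i) *\<^sub>R e i)"
  proof -
    have "h = (\<Sum>i\<in>UNIV. (h $ i) *\<^sub>R axis i 1)" using basis_expansion[of h]
      by (simp add: scalar_mult_eq_scaleR)
    then show ?thesis by (simp add: prod_eq_iff fst_sum snd_sum e_def)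
  qed
  have 1: "(h, 0) \<bullet> v = (\<Sum>i\<in>UNIV. h $ i * (e i \<bullet> v))" for v
    by (simp only: h inner_sum_left inner_scaleR_left)
  have "X (h, 0) = (\<Sum>j\<in>UNIV. h $ j *\<^sub>R X (e j))" unfolding h
    by (simp add: linear_sum[OF assms] linear_scale[OF assms])
  then have "e i \<bullet> X (h, 0) = (\<Sum>j\<in>UNIV. h $ j * (e i \<bullet> X (e j)))" for i
    by (simp only: inner_sum_right inner_scaleR_right)
  then show ?thesis unfolding 1 by (simp add: spatial_matrix_def inner_vec_def
    matrix_vector_mult_def mult_ac e_def)
qed

section \<open>Doubling of variables\<close>

text \<open>|h| \<le> |x| keeps the segment in the ball of radius 2 |x|, where the Hessian is at
  most k (k - 1) (2 |x|)^(k-2); hence the factor 2^(k-2).\<close>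

lemma norm_powr_taylor:
  fixes x h :: "'a::real_inner"
  assumes k: "k > 2" and h: "norm h \<le> norm x"
  shows "norm (x + h) powr k \<le> norm x powr k + powr_grad k x \<bullet> h
      + k * (k - 1) * 2 powr (k - 2) * norm x powr (k - 2) / 2 * (norm h)\<^sup>2"
proof -
  define B where "B = k * (k - 1) * 2 powr (k - 2) * norm x powr (k - 2)"
  have lip: "norm (powr_grad k (x + t *\<^sub>R h) - powr_grad k x) \<le> B * (t * norm h)" if t: "0 \<le> t" "t \<le> 1" for t
  proof -
    have n: "norm (t *\<^sub>R h) \<le> norm x" using t h mult_left_le_one_le[of "norm h" t] by simp
    have "norm (powr_grad k (x + t *\<^sub>R h) - powr_grad k x) \<le> B * norm (x + t *\<^sub>R h - x)"
    proof (rule differentiable_bound[where S = "cball 0 (2 * norm x)"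
      and f' = "\<lambda>y. blinfun_apply (powr_hess k y)"])
      fix y :: 'a assume y: "y \<in> cball 0 (2 * norm x)"
      show "(powr_grad k has_derivative blinfun_apply (powr_hess k y)) (at y within cball 0 (2 * norm x))"
        by (rule has_derivative_at_withinI[OF powr_grad_has_derivative[OF k]])
      have "onorm (blinfun_apply (powr_hess k y)) = norm (powr_hess k y)" by (simp add: norm_blinfun.rep_eq)
      also have "\<dots> \<le> k * (k - 1) * norm y powr (k - 2)" by (rule norm_powr_hess_le[OF k])
      also have "\<dots> \<le> k * (k - 1) * (2 * norm x) powr (k - 2)"
        using y k by (intro mult_left_mono powr_mono2) auto
      also have "\<dots> = B" by (simp add: B_def powr_mult)
      finally show "onorm (blinfun_apply (powr_hess k y)) \<le> B" .
    next
      show "x + t *\<^sub>R h \<in> cball 0 (2 * norm x)" using n norm_triangle_ineq[of x "t *\<^sub>R h"] by simp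
    qed auto
    then show ?thesis using t by simp
  qed
  define G where "G t = norm (x + t *\<^sub>R h) powr k - t * (powr_grad k x \<bullet> h) - B / 2 * (norm h)\<^sup>2 * t\<^sup>2"
    for t :: real
  have "G 1 \<le> G 0"
  proof (rule DERIV_nonpos_imp_nonincreasing[of 0 1 G])
    fix t :: real assume t: "0 \<le> t" "t \<le> 1"
    have f: "((\<lambda>x. norm x powr k) has_derivative blinfun_inner_right (powr_grad k (x + t *\<^sub>R h)))
        (at (x + t *\<^sub>R h))"
      using C2_with_norm_powr[OF k, where 'a = 'a] by (simp add: C2_with_def)
    have "((\<lambda>t. x + t *\<^sub>R h) has_derivative (\<lambda>s. s *\<^sub>R h)) (at t)" by (auto intro!: derivative_eq_intros)
    from has_derivative_compose[OF this f]
    have "((\<lambda>t. norm (x + t *\<^sub>R h) powr k) has_derivative (\<lambda>s. (powr_grad k (x + t *\<^sub>R h) \<bullet> h) * s)) (at t)"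
      by (simp add: blinfun_inner_right.rep_eq mult.commute)
    then have d: "((\<lambda>t. norm (x + t *\<^sub>R h) powr k) has_real_derivative powr_grad k (x + t *\<^sub>R h) \<bullet> h) (at t)"
      by (simp add: has_field_derivative_def)
    have "(G has_real_derivative (powr_grad k (x + t *\<^sub>R h) \<bullet> h - powr_grad k x \<bullet> h
        - B * (norm h)\<^sup>2 * t)) (at t)"
      unfolding G_def by (rule derivative_eq_intros d refl | simp)+
    moreover have "powr_grad k (x + t *\<^sub>R h) \<bullet> h - powr_grad k x \<bullet> h - B * (norm h)\<^sup>2 * t \<le> 0"
    proof -
      have "powr_grad k (x + t *\<^sub>R h) \<bullet> h - powr_grad k x \<bullet> h
          \<le> norm (powr_grad k (x + t *\<^sub>R h) - powr_grad k x) * norm h"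
        unfolding inner_diff_left[symmetric] by (rule norm_cauchy_schwarz)
      also have "\<dots> \<le> B * (t * norm h) * norm h" by (intro mult_right_mono lip t) auto
      finally show ?thesis by (simp add: power2_eq_square mult_ac)
    qed
    ultimately show "\<exists>y. DERIV G t :> y \<and> y \<le> 0" by blast
  qed auto
  then show ?thesis using k by (simp add: G_def B_def)
qed

text \<open>The spatial part sees only the difference of the two arguments, so equal vectors cost
  nothing. In time a crude bound by separate squares is enough: the equation has no second time
  derivative, and c disappears from the conclusion of \<open>interior_inequality\<close>.\<close>

definition coupling_form :: "real \<Rightarrow> real \<Rightarrow> ('a::real_inner \<times> real) \<times> ('a \<times> real) \<Rightarrow> real" where
  "coupling_form m c \<xi> = m * (norm (fst (fst \<xi>) - fst (snd \<xi>)))\<^sup>2 + c * ((snd (fst \<xi>))\<^sup>2 + (snd (snd \<xi>))\<^sup>2)"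

definition coupling_map :: "real \<Rightarrow> real \<Rightarrow> ('a::real_inner \<times> real) \<times> ('a \<times> real) \<Rightarrow> ('a \<times> real) \<times>
    ('a \<times> real)" where
  "coupling_map m c \<xi> = ((m *\<^sub>R (fst (fst \<xi>) - fst (snd \<xi>)), c * snd (fst \<xi>)),
      (- (m *\<^sub>R (fst (fst \<xi>) - fst (snd \<xi>))), c * snd (snd \<xi>)))"

lemma coupling_map_linear: "linear (coupling_map m c)"
  unfolding coupling_map_def by (rule linearI) (simp_all add: algebra_simps)

lemma coupling_map_self_adjoint: "x \<bullet> coupling_map m c y = coupling_map m c x \<bullet> y"
  by (simp add: coupling_map_def inner_prod_def inner_diff_left inner_diff_right algebra_simps)

lemma coupling_map_form: "\<xi> \<bullet> coupling_map m c \<xi> = coupling_form m c \<xi>"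
  unfolding coupling_form_def power2_norm_eq_inner
  by (simp add: coupling_map_def inner_prod_def inner_diff_left inner_diff_right power2_eq_square
    algebra_simps)

lemma norm_coupled_le:
  fixes a b :: "'a::real_inner"
  shows "(norm (a - b))\<^sup>2 \<le> 2 * ((norm a)\<^sup>2 + (norm b)\<^sup>2)"
proof -
  have "(norm (a - b))\<^sup>2 + (norm (a + b))\<^sup>2 = 2 * ((norm a)\<^sup>2 + (norm b)\<^sup>2)"
    unfolding power2_norm_eq_inner by (simp add: inner_diff_left inner_diff_right inner_add_left
      inner_add_right)
  then show ?thesis using zero_le_power2[of "norm (a + b)"] by linarith
qed

lemma norm_product_expand:
  "(norm \<xi>)\<^sup>2 = (norm (fst (fst \<xi>)))\<^sup>2 + (snd (fst \<xi>))\<^sup>2 + ((norm (fst (snd \<xi>)))\<^sup>2 + (snd (snd \<xi>))\<^sup>2)"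
  for \<xi> :: "('a::real_inner \<times> real) \<times> ('a \<times> real)"
  by (simp add: norm_prod_def)

lemma coupling_form_le_norm:
  fixes \<xi> :: "('a::real_inner \<times> real) \<times> ('a \<times> real)"
  assumes "m \<ge> 0" "c \<ge> 0"
  shows "coupling_form m c \<xi> \<le> (2 * m + c) * (norm \<xi>)\<^sup>2"
proof -
  have "(norm (fst (fst \<xi>) - fst (snd \<xi>)))\<^sup>2 \<le> 2 * (norm \<xi>)\<^sup>2"
  proof -
    have "X \<le> 2 * (a + s + (b + t))" if "X \<le> 2 * (a + b)" "0 \<le> s" "0 \<le> t" for X a b s t :: real
      using that by argo
    then show ?thesis unfolding norm_product_expand
      using norm_coupled_le zero_le_power2 by blast
  qed
  moreover have "(snd (fst \<xi>))\<^sup>2 + (snd (snd \<xi>))\<^sup>2 \<le> (norm \<xi>)\<^sup>2" by (simp add: norm_product_expand)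
  ultimately have "m * (norm (fst (fst \<xi>) - fst (snd \<xi>)))\<^sup>2 \<le> m * (2 * (norm \<xi>)\<^sup>2)"
    "c * ((snd (fst \<xi>))\<^sup>2 + (snd (snd \<xi>))\<^sup>2) \<le> c * (norm \<xi>)\<^sup>2"
    using assms by (auto intro: mult_left_mono)
  then show ?thesis by (simp add: coupling_form_def algebra_simps)
qed

text \<open>From J (a + b) \<le> 2 J a + 2 J b with \<xi> = \<eta> + (\<xi> - \<eta>). It supplies
  the domination of the sup-convolution asked by \<open>superjets_of_sum\<close>; the factor 2 only
  affects constants.\<close>

lemma coupling_form_shift:
  fixes \<xi> \<eta> :: "('a::real_inner \<times> real) \<times> ('a \<times> real)"
  assumes "m \<ge> 0" "c \<ge> 0"
  shows "coupling_form m c \<xi> \<le> coupling_form (2 * m) (2 * c) \<eta> + (4 * m + 2 * c) * (norm (\<xi> - \<eta>))\<^sup>2"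
proof -
  have two: "(norm a)\<^sup>2 \<le> 2 * (norm b)\<^sup>2 + 2 * (norm (a - b))\<^sup>2" for a b :: "'b::real_inner"
    using norm_coupled_le[of b "b - a"] by (simp add: norm_minus_commute)
  have "coupling_form m c \<xi> \<le> 2 * coupling_form m c \<eta> + 2 * coupling_form m c (\<xi> - \<eta>)"
  proof -
    have 1: "(norm (fst (fst \<xi>) - fst (snd \<xi>)))\<^sup>2 \<le> 2 * (norm (fst (fst \<eta>) - fst (snd \<eta>)))\<^sup>2
       + 2 * (norm (fst (fst (\<xi> - \<eta>)) - fst (snd (\<xi> - \<eta>))))\<^sup>2"
      using two[of "fst (fst \<xi>) - fst (snd \<xi>)" "fst (fst \<eta>) - fst (snd \<eta>)"] by (simp add: algebra_simps)
    have 2: "(snd (fst \<xi>))\<^sup>2 \<le> 2 * (snd (fst \<eta>))\<^sup>2 + 2 * (snd (fst (\<xi> - \<eta>)))\<^sup>2"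
      "(snd (snd \<xi>))\<^sup>2 \<le> 2 * (snd (snd \<eta>))\<^sup>2 + 2 * (snd (snd (\<xi> - \<eta>)))\<^sup>2"
      using two[of "snd (fst \<xi>)" "snd (fst \<eta>)"] two[of "snd (snd \<xi>)" "snd (snd \<eta>)"] by simp_all
    have "m * (norm (fst (fst \<xi>) - fst (snd \<xi>)))\<^sup>2 \<le> m * (2 * (norm (fst (fst \<eta>) - fst (snd \<eta>)))\<^sup>2
       + 2 * (norm (fst (fst (\<xi> - \<eta>)) - fst (snd (\<xi> - \<eta>))))\<^sup>2)"
      using 1 assms by (intro mult_left_mono)
    moreover have "c * ((snd (fst \<xi>))\<^sup>2 + (snd (snd \<xi>))\<^sup>2)
        \<le> c * ((2 * (snd (fst \<eta>))\<^sup>2 + 2 * (snd (fst (\<xi> - \<eta>)))\<^sup>2)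
       + (2 * (snd (snd \<eta>))\<^sup>2 + 2 * (snd (snd (\<xi> - \<eta>)))\<^sup>2))"
      using 2 assms by (intro mult_left_mono add_mono)
    ultimately show ?thesis unfolding coupling_form_def
      by (simp only: distrib_left mult.left_commute[of _ 2])
  qed
  moreover have "coupling_form m c (\<xi> - \<eta>) \<le> (2 * m + c) * (norm (\<xi> - \<eta>))\<^sup>2"
    by (rule coupling_form_le_norm[OF assms])
  moreover have "coupling_form (2 * m) (2 * c) \<eta> = 2 * coupling_form m c \<eta>"
    by (simp add: coupling_form_def algebra_simps)
  ultimately show ?thesis by (simp add: algebra_simps)
qed

section \<open>The inequality at an interior maximum\<close>

lemma spatial_matrix_entry_bound:
  fixes X :: "(real ^ 'n) \<times> real \<Rightarrow> (real ^ 'n) \<times> real"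
  assumes X: "linear X" "\<And>x y. x \<bullet> X y = X x \<bullet> y" and B: "\<And>h. \<bar>h \<bullet> X h\<bar> \<le> B * (norm h)\<^sup>2"
  shows "\<bar>spatial_matrix X $ i $ j\<bar> \<le> B"
proof -
  define a b where "a = (axis i 1 :: real ^ 'n, 0 :: real)" and "b = (axis j 1 :: real ^ 'n, 0 :: real)"
  have n: "norm a = 1" "norm b = 1" by (simp_all add: a_def b_def norm_Pair)
  have "4 * (a \<bullet> X b) = (a + b) \<bullet> X (a + b) - (a - b) \<bullet> X (a - b)"
    using X(2)[of b a] by (simp add: linear_add[OF X(1)] linear_diff[OF X(1)] inner_add_left
      inner_add_right inner_diff_left inner_diff_right inner_commute[of "X b"])
  then have "4 * \<bar>a \<bullet> X b\<bar> \<le> B * (norm (a + b))\<^sup>2 + B * (norm (a - b))\<^sup>2"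
    using B[of "a + b"] B[of "a - b"] by linarith
  also have "\<dots> = B * ((norm (a + b))\<^sup>2 + (norm (a - b))\<^sup>2)" by (simp add: distrib_left)
  also have "(norm (a + b))\<^sup>2 + (norm (a - b))\<^sup>2 = 4"
  proof -
    have "(norm (a + b))\<^sup>2 + (norm (a - b))\<^sup>2 = 2 * ((norm a)\<^sup>2 + (norm b)\<^sup>2)"
      unfolding power2_norm_eq_inner by (simp add: inner_diff_left inner_diff_right inner_add_left
        inner_add_right)
    then show ?thesis using n by simp
  qed
  finally show ?thesis by (simp add: spatial_matrix_def a_def b_def)
qed

lemma trace_mult_perturb:
  fixes A A' X :: "real ^ 'n ^ 'n"
  assumes "\<And>i j. \<bar>X $ i $ j\<bar> \<le> B" and "norm (A' - A) \<le> e"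
  shows "trace (A' ** X) \<le> trace (A ** X) + real CARD('n) ^ 2 * e * B"
proof -
  have e: "\<bar>(A' - A) $ i $ j\<bar> \<le> e" for i j
    using component_le_norm_cart[of "(A' - A) $ i" j] Finite_Cartesian_Product.norm_nth_le[of "A'
        - A" i] assms(2) by (simp add: component_le_norm_cart)
  have B0: "0 \<le> e" using assms(2) norm_ge_zero order_trans by blast
  have "trace (A' ** X) - trace (A ** X) = (\<Sum>i\<in>UNIV. \<Sum>j\<in>UNIV. (A' - A) $ i $ j * X $ j $ i)"
    by (simp add: trace_def matrix_matrix_mult_def sum_subtractf left_diff_distrib)
  also have "\<dots> \<le> (\<Sum>i\<in>(UNIV::'n set). \<Sum>j\<in>(UNIV::'n set). e * B)"
  proof (intro sum_mono)
    fix i j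
    have "(A' - A) $ i $ j * X $ j $ i \<le> \<bar>(A' - A) $ i $ j\<bar> * \<bar>X $ j $ i\<bar>" by (simp flip: abs_mult)
    also have "\<dots> \<le> e * B" using e assms(1) B0 by (intro mult_mono) auto
    finally show "(A' - A) $ i $ j * X $ j $ i \<le> e * B" .
  qed
  also have "\<dots> = real CARD('n) ^ 2 * e * B" by (simp add: power2_eq_square)
  finally show ?thesis by simp
qed

lemma continuous_on_openD:
  fixes f :: "'a::metric_space \<Rightarrow> 'b::metric_space"
  assumes "continuous_on S f" "open S" "x \<in> S" "e > 0"
  shows "\<exists>d>0. \<forall>y. dist y x < d \<longrightarrow> dist (f y) (f x) < e"
proof -
  have "isCont f x" using assms(1-3) by (simp add: continuous_on_eq_continuous_at)
  then show ?thesis using \<open>e > 0\<close> unfolding continuous_at_eps_delta by blast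
qed

text \<open>\<open>superjets_of_sum\<close> yields jets at points near z0 and w0, with gradients
  only near P. Their Hessians are bounded by B independently of \<epsilon>, so continuity of the
  coefficients moves everything to z0, w0 and P at an arbitrarily small cost \<kappa>.\<close>

lemma interior_inequality:
  fixes u v :: "(real ^ 'n) \<times> real \<Rightarrow> real"
  assumes Q: "open Q" "z0 \<in> Q" "w0 \<in> Q"
    and sub: "F_subsolution Q A1 H1 u" and super: "F_supersolution Q A2 H2 v"
    and uv: "continuous_on Q u" "continuous_on Q v"
    and A: "continuous_on (- {0}) A1" "continuous_on (- {0}) A2" "psd (A1 P)" "psd (A2 P)"
    and H: "continuous_on (Q \<times> UNIV) (\<lambda>(z, \<xi>). H1 z \<xi>)" "continuous_on (Q \<times> UNIV) (\<lambda>(z, \<xi>). H2 z \<xi>)"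
    and P: "P \<noteq> 0" and m: "m \<ge> 0" and c: "c \<ge> 0" and \<rho>: "\<rho> > 0"
    and contact: "\<And>z w. z \<in> cball z0 \<rho> \<Longrightarrow> w \<in> cball w0 \<rho> \<Longrightarrow>
       u z - v w \<le> u z0 - v w0 + (P, a) \<bullet> (z - z0) + (- P, b) \<bullet> (w - w0)
           + coupling_form m c (z - z0, w - w0) / 2"
  shows "a + b \<le> 2 * m * real CARD('n) * (op_norm (psd_sqrt (A1 P) - psd_sqrt (A2 P)))\<^sup>2
      + (H2 w0 P - H1 z0 P)"
proof (rule field_le_epsilon)
  fix \<kappa> :: real assume \<kappa>: "\<kappa> > 0"
  obtain r1 r2 where r12: "r1 > 0" "cball z0 r1 \<subseteq> Q" "r2 > 0" "cball w0 r2 \<subseteq> Q"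
    using Q open_contains_cball by meson
  define r where "r = min \<rho> (min r1 r2)"
  have r: "r > 0" "r \<le> \<rho>" "cball z0 r \<subseteq> Q" "cball w0 r \<subseteq> Q"
    using r12 \<rho> by (auto simp: r_def)
  define \<mu> where "\<mu> = 4 * m + 2 * c + 1"
  define B where "B = \<mu> + (4 * m + 2 * c) + 1"
  have mu: "\<mu> > 0" and B: "B > 0" using m c by (simp_all add: \<mu>_def B_def)
  define N where "N = real CARD('n) ^ 2 * B"
  have N: "N \<ge> 0" using B by (simp add: N_def)
  \<comment> \<open>The two coefficient matrices cost N \<kappa>1 each and the two Hamiltonians
    \<kappa>1 each; the other half of \<kappa> is kept for the terms with \<epsilon>.\<close>
  define \<kappa>1 where "\<kappa>1 = \<kappa> / (2 * (2 * N + 2))"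
  have \<kappa>1: "\<kappa>1 > 0" "(2 * N + 2) * \<kappa>1 = \<kappa> / 2" using \<kappa> N by (simp_all add: \<kappa>1_def field_simps)
  define W where "W = 2 + \<bar>trace (A1 P)\<bar> + \<bar>trace (A2 P)\<bar>"
  have W: "W > 0" by (simp add: W_def)
  obtain d1 where d1: "d1 > 0" "\<And>\<xi>. dist \<xi> P < d1 \<Longrightarrow> dist (A1 \<xi>) (A1 P) < \<kappa>1"
  proof -
    have "\<exists>d>0. \<forall>\<xi>. dist \<xi> P < d \<longrightarrow> dist (A1 \<xi>) (A1 P) < \<kappa>1"
      by (rule continuous_on_openD[OF A(1)]) (use P \<kappa>1(1) in auto)
    then show thesis using that by blast
  qed
  obtain d2 where d2: "d2 > 0" "\<And>\<xi>. dist \<xi> P < d2 \<Longrightarrow> dist (A2 \<xi>) (A2 P) < \<kappa>1"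
  proof -
    have "\<exists>d>0. \<forall>\<xi>. dist \<xi> P < d \<longrightarrow> dist (A2 \<xi>) (A2 P) < \<kappa>1"
      by (rule continuous_on_openD[OF A(2)]) (use P \<kappa>1(1) in auto)
    then show thesis using that by blast
  qed
  have oQ: "open (Q \<times> (UNIV :: (real ^ 'n) set))" using Q(1) by (simp add: open_Times)
  obtain d3 where d3: "d3 > 0" "\<And>z \<xi>. dist (z, \<xi>) (z0, P) < d3 \<Longrightarrow> dist (H1 z \<xi>) (H1 z0 P) < \<kappa>1"
  proof -
    have "\<exists>d>0. \<forall>y. dist y (z0, P) < d \<longrightarrow> dist (case y of (z, \<xi>) \<Rightarrow> H1 z \<xi>)
        (case (z0, P) of (z, \<xi>) \<Rightarrow> H1 z \<xi>) < \<kappa>1"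
      by (rule continuous_on_openD[OF H(1) oQ]) (use Q(2) \<kappa>1(1) in simp_all)
    then show thesis using that by (metis case_prod_conv)
  qed
  obtain d4 where d4: "d4 > 0" "\<And>z \<xi>. dist (z, \<xi>) (w0, P) < d4 \<Longrightarrow> dist (H2 z \<xi>) (H2 w0 P) < \<kappa>1"
  proof -
    have "\<exists>d>0. \<forall>y. dist y (w0, P) < d \<longrightarrow> dist (case y of (z, \<xi>) \<Rightarrow> H2 z \<xi>)
        (case (w0, P) of (z, \<xi>) \<Rightarrow> H2 z \<xi>) < \<kappa>1"
      by (rule continuous_on_openD[OF H(2) oQ]) (use Q(3) \<kappa>1(1) in simp_all)
    then show thesis using that by (metis case_prod_conv)
  qed
  \<comment> \<open>The bound by \<open>norm P\<close> keeps the gradients of the jets nonzero, the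
    halves of d3 and d4 leave room for the errors in point and gradient, and the last bound handles
    \<epsilon> (tr A1 + tr A2) together with the errors in a and b.\<close>
  define \<epsilon> where "\<epsilon> = Min {1, r, norm P, d1, d2, d3 / 2, d4 / 2, \<kappa> / (2 * W)}"
  have \<epsilon>: "\<epsilon> > 0" using r(1) P d1(1) d2(1) d3(1) d4(1) \<kappa> W by (simp add: \<epsilon>_def)
  have \<epsilon>le: "\<epsilon> \<le> 1" "\<epsilon> \<le> r" "\<epsilon> \<le> norm P" "\<epsilon> \<le> d1" "\<epsilon> \<le> d2" "\<epsilon> \<le> d3 / 2" "\<epsilon> \<le> d4 / 2" "\<epsilon> \<le> \<kappa> / (2 * W)"
    unfolding \<epsilon>_def by (rule Min_le; simp)+
  have S: "coupling_form m c \<xi> \<le> \<eta> \<bullet> coupling_map (2 * m) (2 * c) \<eta> + \<mu> * (norm (\<xi> - \<eta>))\<^sup>2"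
    for \<xi> \<eta> :: "((real ^ 'n) \<times> real) \<times> ((real ^ 'n) \<times> real)"
  proof -
    have "(4 * m + 2 * c) * (norm (\<xi> - \<eta>))\<^sup>2 \<le> \<mu> * (norm (\<xi> - \<eta>))\<^sup>2"
      by (intro mult_right_mono) (simp_all add: \<mu>_def)
    then show ?thesis using coupling_form_shift[OF m c, of \<xi> \<eta>] unfolding coupling_map_form by linarith
  qed
  have J: "coupling_form m c \<xi> \<le> \<mu> * (norm \<xi>)\<^sup>2" for \<xi> :: "((real ^ 'n) \<times> real) \<times> ((real ^ 'n) \<times> real)"
  proof -
    have "(2 * m + c) * (norm \<xi>)\<^sup>2 \<le> \<mu> * (norm \<xi>)\<^sup>2" using m c
      by (intro mult_right_mono) (simp_all add: \<mu>_def)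
    then show ?thesis using coupling_form_le_norm[OF m c, of \<xi>] by linarith
  qed
  have contact': "u z + - v w \<le> u z0 + - v w0 + (P, a) \<bullet> (z - z0) + (- P, b) \<bullet> (w - w0)
      + coupling_form m c (z - z0, w - w0) / 2"
    if "z \<in> cball z0 r" "w \<in> cball w0 r" for z w
    using contact[of z w] that r(2) by auto
  have cu: "continuous_on (cball z0 r) u" and cv: "continuous_on (cball w0 r) (\<lambda>w. - v w)"
    using uv r by (auto intro: continuous_on_subset continuous_on_minus)
  have "\<exists>z\<in>cball z0 r. \<exists>w\<in>cball w0 r. \<exists>p' q' X Y. norm (z - z0) < \<epsilon> \<and> norm (w - w0) < \<epsilon>
      \<and> norm (p' - (P, a)) < \<epsilon> \<and> norm (q' - (- P, b)) < \<epsilon> \<and>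
     superjet (cball z0 r) u z p' X \<and> superjet (cball w0 r) (\<lambda>w. - v w) w q' Y \<and>
     (\<forall>h k. h \<bullet> X h + k \<bullet> Y k \<le> (h, k) \<bullet> coupling_map (2 * m) (2 * c) (h, k)
         + \<epsilon> * ((norm h)\<^sup>2 + (norm k)\<^sup>2)) \<and>
     (\<forall>h. - \<mu> * (norm h)\<^sup>2 \<le> h \<bullet> X h) \<and> (\<forall>h. - \<mu> * (norm h)\<^sup>2 \<le> h \<bullet> Y h)"
    by (rule superjets_of_sum[OF compact_cball _ compact_cball _ cu cv contact' coupling_map_linear
      coupling_map_self_adjoint S J mu \<epsilon>])
      (use r(1) in auto)
  then obtain z w p' q' X Y where jets: "norm (z - z0) < \<epsilon>" "norm (w - w0) < \<epsilon>" "norm (p' - (P, a))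
      < \<epsilon>" "norm (q' - (- P, b)) < \<epsilon>"
     "superjet (cball z0 r) u z p' X" "superjet (cball w0 r) (\<lambda>w. - v w) w q' Y"
     "\<And>h k. h \<bullet> X h + k \<bullet> Y k \<le> (h, k) \<bullet> coupling_map (2 * m) (2 * c) (h, k) + \<epsilon> * ((norm h)\<^sup>2 + (norm k)\<^sup>2)"
     "\<And>h. - \<mu> * (norm h)\<^sup>2 \<le> h \<bullet> X h" "\<And>h. - \<mu> * (norm h)\<^sup>2 \<le> h \<bullet> Y h"
    by blast
  have zi: "z \<in> interior (cball z0 r)" "w \<in> interior (cball w0 r)"
    using jets(1,2) \<epsilon>le(2) by (auto simp: dist_norm norm_minus_commute)
  then have zQ: "z \<in> Q" "w \<in> Q" using r(3,4) interior_subset by blast+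
  have comp: "norm (fst p) \<le> norm p" "\<bar>snd p\<bar> \<le> norm p" for p :: "(real ^ 'n) \<times> real"
    using norm_fst_le[of "fst p" "snd p"] norm_snd_le[of "snd p" "fst p"] by simp_all
  have p1: "norm (fst p' - P) < \<epsilon>" "\<bar>snd p' - a\<bar> < \<epsilon>" using comp[of "p' - (P, a)"] jets(3) by simp_all
  have q1: "norm (- fst q' - P) < \<epsilon>" "\<bar>snd q' - b\<bar> < \<epsilon>"
    using comp[of "q' - (- P, b)"] jets(4) norm_minus_commute[of "- fst q'" P]
      by (simp_all add: add.commute)
  have nz: "fst p' \<noteq> 0" "fst q' \<noteq> 0" using p1(1) q1(1) \<epsilon>le(3) by auto
  have i1: "snd p' - trace (A1 (fst p') ** spatial_matrix X) + H1 z (fst p') \<le> 0"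
    by (rule F_subsolution_superjet[OF sub Q(1) zQ(1) zi(1) jets(5) nz(1)])
  have i2: "- snd q' + trace (A2 (- fst q') ** spatial_matrix Y) + H2 w (- fst q') \<ge> 0"
    by (rule F_supersolution_superjet[OF super Q(1) zQ(2) zi(2) jets(6) nz(2)])
  have X: "linear X" "\<And>x y. x \<bullet> X y = X x \<bullet> y" and Y: "linear Y" "\<And>x y. x \<bullet> Y y = Y x \<bullet> y"
    using jets(5,6) by (auto simp: superjet_def)
  have fb: "coupling_form (2 * m) (2 * c) \<xi> \<le> (4 * m + 2 * c) * (norm \<xi>)\<^sup>2"
    for \<xi> :: "((real ^ 'n) \<times> real) \<times> ((real ^ 'n) \<times> real)"
    using coupling_form_le_norm[of "2 * m" "2 * c" \<xi>] m c by simp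
  have Xb: "\<bar>h \<bullet> X h\<bar> \<le> B * (norm h)\<^sup>2" and Yb: "\<bar>h \<bullet> Y h\<bar> \<le> B * (norm h)\<^sup>2" for h
  proof -
    have "\<epsilon> * (norm h)\<^sup>2 \<le> 1 * (norm h)\<^sup>2" using \<epsilon>le(1) by (intro mult_right_mono) auto
    moreover have "\<mu> * (norm h)\<^sup>2 \<ge> 0" "(4 * m + 2 * c) * (norm h)\<^sup>2 \<ge> 0" "(norm h)\<^sup>2 \<ge> 0" using mu m c by auto
    moreover have "B * (norm h)\<^sup>2 = \<mu> * (norm h)\<^sup>2 + (4 * m + 2 * c) * (norm h)\<^sup>2 + (norm h)\<^sup>2"
      by (simp add: B_def distrib_right)
    moreover have "h \<bullet> X h \<le> (4 * m + 2 * c) * (norm h)\<^sup>2 + \<epsilon> * (norm h)\<^sup>2"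
      using jets(7)[of h 0] fb[of "(h, 0)"] linear_0[OF Y(1)] by (simp add: coupling_map_form norm_Pair)
    moreover have "h \<bullet> Y h \<le> (4 * m + 2 * c) * (norm h)\<^sup>2 + \<epsilon> * (norm h)\<^sup>2"
      using jets(7)[of 0 h] fb[of "(0, h)"] linear_0[OF X(1)] by (simp add: coupling_map_form norm_Pair)
    moreover have "- (\<mu> * (norm h)\<^sup>2) \<le> h \<bullet> X h" "- (\<mu> * (norm h)\<^sup>2) \<le> h \<bullet> Y h"
      using jets(8)[of h] jets(9)[of h] by simp_all
    ultimately show "\<bar>h \<bullet> X h\<bar> \<le> B * (norm h)\<^sup>2" "\<bar>h \<bullet> Y h\<bar> \<le> B * (norm h)\<^sup>2" by linarith+
  qed
  have t1: "trace (A1 (fst p') ** spatial_matrix X) \<le> trace (A1 P ** spatial_matrix X)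
      + real CARD('n) ^ 2 * \<kappa>1 * B"
    by (rule trace_mult_perturb[OF spatial_matrix_entry_bound[OF X Xb]])
      (use d1(2)[of "fst p'"] p1(1) \<epsilon>le(4) in \<open>simp add: dist_norm\<close>)
  have t2: "trace (A2 (- fst q') ** spatial_matrix Y) \<le> trace (A2 P ** spatial_matrix Y)
      + real CARD('n) ^ 2 * \<kappa>1 * B"
    by (rule trace_mult_perturb[OF spatial_matrix_entry_bound[OF Y Yb]])
      (use d2(2)[of "- fst q'"] q1(1) \<epsilon>le(5) in \<open>simp add: dist_norm\<close>)
  \<comment> \<open>Only vectors with zero time component are inserted, so c drops out.\<close>
  have t3: "trace (A1 P ** spatial_matrix X) + trace (A2 P ** spatial_matrix Y)
      \<le> 2 * m * real CARD('n) * (op_norm (psd_sqrt (A1 P) - psd_sqrt (A2 P)))\<^sup>2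
          + \<epsilon> * (trace (A1 P) + trace (A2 P))"
  proof (rule trace_sum_le[OF A(3,4)])
    fix h k :: "real ^ 'n"
    show "h \<bullet> (spatial_matrix X *v h) + k \<bullet> (spatial_matrix Y *v k)
        \<le> 2 * m * (norm (h - k))\<^sup>2 + \<epsilon> * ((norm h)\<^sup>2 + (norm k)\<^sup>2)"
      using jets(7)[of "(h, 0)" "(k, 0)"] unfolding coupling_map_form
      by (simp add: spatial_matrix_form X(1) Y(1) coupling_form_def norm_Pair)
  qed (use m in simp)
  have h1: "\<bar>H1 z (fst p') - H1 z0 P\<bar> < \<kappa>1"
  proof -
    have "dist (z, fst p') (z0, P) \<le> norm (z - z0) + norm (fst p' - P)"
      unfolding dist_norm using norm_Pair_le[of "z - z0" "fst p' - P"] by simp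
    then show ?thesis using d3(2)[of z "fst p'"] jets(1) p1(1) \<epsilon>le(6) by (simp add: dist_real_def)
  qed
  have h2: "\<bar>H2 w (- fst q') - H2 w0 P\<bar> < \<kappa>1"
  proof -
    have "dist (w, - fst q') (w0, P) \<le> norm (w - w0) + norm (- fst q' - P)"
      unfolding dist_norm using norm_Pair_le[of "w - w0" "- fst q' - P"] by simp
    then show ?thesis using d4(2)[of w "- fst q'"] jets(2) q1(1) \<epsilon>le(7) by (simp add: dist_real_def)
  qed
  have "\<epsilon> * (trace (A1 P) + trace (A2 P)) + 2 * \<epsilon> \<le> \<epsilon> * W"
  proof -
    have "\<epsilon> * (trace (A1 P) + trace (A2 P) + 2) \<le> \<epsilon> * W" using \<epsilon>
      by (intro mult_left_mono) (auto simp: W_def)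
    then show ?thesis by (simp add: distrib_left)
  qed
  also have "\<epsilon> * W \<le> \<kappa> / (2 * W) * W" using \<epsilon>le(8) W by (intro mult_right_mono) auto
  also have "\<dots> = \<kappa> / 2" using W by simp
  finally have e1: "\<epsilon> * (trace (A1 P) + trace (A2 P)) + 2 * \<epsilon> \<le> \<kappa> / 2" .
  have e2: "2 * (real CARD('n) ^ 2 * \<kappa>1 * B) + 2 * \<kappa>1 = \<kappa> / 2" using \<kappa>1(2)
    by (simp add: N_def algebra_simps)
  show "a + b \<le> 2 * m * real CARD('n) * (op_norm (psd_sqrt (A1 P) - psd_sqrt (A2 P)))\<^sup>2
      + (H2 w0 P - H1 z0 P) + \<kappa>"
    using i1 i2 t1 t2 t3 h1 h2 e1 e2 p1(2) q1(2) by linarith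
qed

text \<open>The terms with \<eta> keep maximum points away from time T, where nothing is prescribed;
  l t is the surplus that contradicts the equations at an interior maximum.\<close>

definition doubling :: "real \<Rightarrow> real \<Rightarrow> real \<Rightarrow> real \<Rightarrow> real \<Rightarrow> real \<Rightarrow>
    ('a::real_normed_vector \<times> real \<Rightarrow> real) \<Rightarrow> ('a \<times> real \<Rightarrow> real) \<Rightarrow> 'a \<times> real \<Rightarrow> 'a \<times> real \<Rightarrow> real" where
  "doubling K k \<delta> l \<eta> T u v z w = u z - v w - K * norm (fst z - fst w) powr k - (snd z - snd w)\<^sup>2 / (2 * \<delta>)
     - l * snd z - \<eta> / (T - snd z) - \<eta> / (T - snd w)"

lemma doubling_maximum:
  fixes u v :: "'a::euclidean_space \<times> real \<Rightarrow> real"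
  assumes \<Omega>: "bounded \<Omega>" "\<Omega> \<noteq> {}" and T: "T > 0" and k: "k > 0"
    and cont: "continuous_on (closure \<Omega> \<times> {0..<T}) u" "continuous_on (closure \<Omega> \<times> {0..<T}) v"
    and bd: "\<And>z. z \<in> closure \<Omega> \<times> {0..<T} \<Longrightarrow> \<bar>u z\<bar> \<le> B" "\<And>z. z \<in> closure \<Omega> \<times> {0..<T} \<Longrightarrow> \<bar>v z\<bar> \<le> B"
    and par: "K \<ge> 0" "\<delta> > 0" "l \<ge> 0" "\<eta> > 0"
  shows "\<exists>z\<in>closure \<Omega> \<times> {0..<T}. \<exists>w\<in>closure \<Omega> \<times> {0..<T}. \<forall>z'\<in>closure \<Omega> \<times> {0..<T}. \<forall>w'\<in>closure \<Omega> \<times> {0..<T}.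
     doubling K k \<delta> l \<eta> T u v z' w' \<le> doubling K k \<delta> l \<eta> T u v z w"
proof -
  let ?D = "closure \<Omega> \<times> {0..<T}" and ?\<Phi> = "doubling K k \<delta> l \<eta> T u v"
  obtain x1 where "x1 \<in> closure \<Omega>" using \<Omega>(2) closure_subset by blast
  then have z1: "(x1, 0) \<in> ?D" using T by auto
  define c0 where "c0 = ?\<Phi> (x1, 0) (x1, 0)"
  have B: "B \<ge> 0" using bd(1)[OF z1] by linarith
  \<comment> \<open>Within \<sigma> of T one barrier is at least 2 B + |c0| + 1, so the value is
    below the one at (x1, 0); the search is thus confined to a compact set.\<close>
  define \<sigma> where "\<sigma> = min T (\<eta> / (2 * B + \<bar>c0\<bar> + 1))"
  have pos: "2 * B + \<bar>c0\<bar> + 1 > 0" using B by linarith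
  have \<sigma>: "\<sigma> > 0" "\<sigma> \<le> T" "\<sigma> \<le> \<eta> / (2 * B + \<bar>c0\<bar> + 1)" using T par(4) pos by (auto simp: \<sigma>_def)
  have far: "2 * B + \<bar>c0\<bar> + 1 \<le> \<eta> / (T - t)" if t: "T - \<sigma> < t" "t < T" for t
  proof -
    have "\<eta> / (\<eta> / (2 * B + \<bar>c0\<bar> + 1)) \<le> \<eta> / (T - t)"
      using t \<sigma>(3) par(4) pos by (intro divide_left_mono) auto
    then show ?thesis using par(4) by simp
  qed
  have up: "?\<Phi> z w \<le> 2 * B - \<eta> / (T - snd z)" "?\<Phi> z w \<le> 2 * B - \<eta> / (T - snd w)"
    if "z \<in> ?D" "w \<in> ?D" for z w
  proof -
    have "\<eta> / (T - snd z) \<ge> 0" "\<eta> / (T - snd w) \<ge> 0" "l * snd z \<ge> 0" "(snd z - snd w)\<^sup>2 / (2 * \<delta>)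
        \<ge> 0" "K * norm (fst z - fst w) powr k \<ge> 0"
      using that par by auto
    then show "?\<Phi> z w \<le> 2 * B - \<eta> / (T - snd z)" "?\<Phi> z w \<le> 2 * B - \<eta> / (T - snd w)"
      using bd(1)[OF that(1)] bd(2)[OF that(2)] unfolding doubling_def by linarith+
  qed
  define C where "C = closure \<Omega> \<times> {0..T - \<sigma>}"
  have CD: "C \<subseteq> ?D" using \<sigma> by (auto simp: C_def)
  have z1C: "(x1, 0) \<in> C" using z1 \<sigma> by (auto simp: C_def)
  have "compact (C \<times> C)" unfolding C_def using \<Omega>(1) by (intro compact_Times) (auto simp: compact_closure)
  moreover have "C \<times> C \<noteq> {}" using z1C by auto
  moreover have "continuous_on (C \<times> C) (\<lambda>p. ?\<Phi> (fst p) (snd p))"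
  proof -
    have 1: "continuous_on (C \<times> C) (\<lambda>p. u (fst p))" "continuous_on (C \<times> C) (\<lambda>p. v (snd p))"
      using CD by (auto intro!: continuous_on_compose2[OF cont(1)] continuous_on_compose2[OF
        cont(2)] continuous_intros)
    have 2: "continuous_on (C \<times> C) (\<lambda>p. norm (fst (fst p) - fst (snd p)) powr k)"
      by (rule continuous_on_powr') (use k in \<open>auto intro!: continuous_intros\<close>)
    have 3: "T - snd (fst p) \<noteq> 0" "T - snd (snd p) \<noteq> 0" if "p \<in> C \<times> C" for p
      using that \<sigma>(1) by (auto simp: C_def)
    show ?thesis unfolding doubling_def
      by (intro continuous_on_diff continuous_on_mult continuous_on_divide continuous_on_const
        continuous_on_power
          continuous_on_snd continuous_on_fst continuous_on_id 1 2) (use 3 par(2) in auto)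
  qed
  ultimately obtain p where p: "p \<in> C \<times> C" "\<And>q. q \<in> C \<times> C \<Longrightarrow> ?\<Phi> (fst q) (snd q) \<le> ?\<Phi> (fst p) (snd p)"
    using continuous_attains_sup[of "C \<times> C" "\<lambda>p. ?\<Phi> (fst p) (snd p)"] by blast
  have "?\<Phi> z w \<le> ?\<Phi> (fst p) (snd p)" if zw: "z \<in> ?D" "w \<in> ?D" for z w
  proof (cases "z \<in> C \<and> w \<in> C")
    case True then show ?thesis using p(2)[of "(z, w)"] by simp
  next
    case False
    have "c0 \<le> ?\<Phi> (fst p) (snd p)" using p(2)[of "((x1, 0), (x1, 0))"] z1C by (simp add: c0_def)
    moreover have "?\<Phi> z w \<le> c0"
    proof -
      have "T - \<sigma> < snd z \<and> snd z < T \<or> T - \<sigma> < snd w \<and> snd w < T" using False zw by (auto simp: C_def)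
      then show ?thesis using far[of "snd z"] far[of "snd w"] up[OF zw] by linarith
    qed
    ultimately show ?thesis by linarith
  qed
  then show ?thesis using p(1) CD by (intro bexI[of _ "fst p"] bexI[of _ "snd p"]) auto
qed

text \<open>L r^(\<theta>-k) d^k meets the Hoelder bound L d^\<theta> exactly at d = r and exceeds
  it beyond. Used with the exponent k in space and 2 in time.\<close>

lemma powr_scale_bound:
  fixes d r :: real
  assumes le: "L * r powr (\<theta> - k) * d powr k \<le> L * d powr \<theta>" and L: "L > 0" and r: "r > 0"
    and d: "d \<ge> 0" and \<theta>: "\<theta> < k"
  shows "d \<le> r"
proof (rule ccontr)
  assume "\<not> d \<le> r"
  then have dr: "r < d" "d > 0" using r by auto
  have "L * r powr (\<theta> - k) * d powr k = L * d powr \<theta> * (r powr (\<theta> - k) * d powr (k - \<theta>))"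
    using dr(2) by (simp add: powr_diff)
  moreover have "1 < r powr (\<theta> - k) * d powr (k - \<theta>)"
  proof -
    have "r powr (k - \<theta>) < d powr (k - \<theta>)" using dr r \<theta> by (intro powr_less_mono2) auto
    then have "r powr (\<theta> - k) * r powr (k - \<theta>) < r powr (\<theta> - k) * d powr (k - \<theta>)" using r
      by (intro mult_strict_left_mono) auto
    then show ?thesis using r by (simp flip: powr_add)
  qed
  moreover have "L * d powr \<theta> > 0" using L dr by simp
  ultimately show False
    using le mult_strict_left_mono[of 1 "r powr (\<theta> - k) * d powr (k - \<theta>)" "L * d powr \<theta>"] by linarith
qed

text \<open>The quadratic upper bound through which the barriers \<eta>/(T - t) enter the contact
  condition.\<close>

lemma reciprocal_upper_expansion:
  fixes \<tau> h :: real
  assumes \<tau>: "\<tau> > 0" and h: "\<bar>h\<bar> \<le> \<tau> / 2"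
  shows "1 / (\<tau> - h) \<le> 1 / \<tau> + h / \<tau>\<^sup>2 + 2 * h\<^sup>2 / \<tau> ^ 3"
proof -
  have p: "\<tau> - h \<ge> \<tau> / 2" "\<tau> - h > 0" using assms by argo+
  have "1 / (\<tau> - h) = 1 / \<tau> + h / \<tau>\<^sup>2 + h\<^sup>2 / \<tau>\<^sup>2 * (1 / (\<tau> - h))"
    using \<tau> p(2) by (simp add: field_simps power2_eq_square)
  also have "h\<^sup>2 / \<tau>\<^sup>2 * (1 / (\<tau> - h)) \<le> h\<^sup>2 / \<tau>\<^sup>2 * (1 / (\<tau> / 2))"
    using p \<tau> by (intro mult_left_mono divide_left_mono) auto
  also have "h\<^sup>2 / \<tau>\<^sup>2 * (1 / (\<tau> / 2)) = 2 * h\<^sup>2 / \<tau> ^ 3" by (simp add: power2_eq_square power3_eq_cube)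
  finally show ?thesis by simp
qed

lemma norm_powr_grad: "k > 2 \<Longrightarrow> norm (powr_grad k x) = k * norm x powr (k - 1)"
  using powr_mult_base[of "norm x" "k - 2"] by (simp add: powr_grad_def mult.commute)

text \<open>Replacing the position of z by that of w removes the spatial penalty and otherwise
  affects only the value of u, so the penalty is at most a Hoelder increment of u.\<close>

lemma doubling_spatial_distance:
  fixes z w :: "'a::euclidean_space \<times> real"
  assumes z: "z \<in> D \<times> I" and w: "w \<in> D \<times> I"
    and max: "\<And>z' w'. z' \<in> D \<times> I \<Longrightarrow> w' \<in> D \<times> I \<Longrightarrow> doubling K k \<delta> l \<eta> T u v z' w'
        \<le> doubling K k \<delta> l \<eta> T u v z w"
    and hold: "\<And>z w. z \<in> D \<times> I \<Longrightarrow> w \<in> D \<times> I \<Longrightarrow> \<bar>u z - u w\<bar>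
        \<le> L * (norm (fst z - fst w) powr \<theta> + \<bar>snd z - snd w\<bar> powr \<theta>)"
    and K: "K = L * r powr (\<theta> - k)" and L: "L > 0" and r: "r > 0" and \<theta>: "0 < \<theta>" "\<theta> < k"
  shows "norm (fst z - fst w) \<le> r"
proof -
  have m: "(fst w, snd z) \<in> D \<times> I" using z w by (auto simp: mem_Times_iff)
  have "K * norm (fst z - fst w) powr k \<le> u z - u (fst w, snd z)"
    using max[OF m w] by (simp add: doubling_def)
  also have "\<dots> \<le> L * norm (fst z - fst w) powr \<theta>" using hold[OF z m] \<theta> by simp
  finally show ?thesis unfolding K by (rule powr_scale_bound) (use L r \<theta> in auto)
qed

text \<open>The later of the two times is moved back to the earlier one. This increases neither l t
  nor the barriers, so the time penalty is at most a Hoelder increment of u or v, whichever was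
  moved.\<close>

lemma doubling_time_distance:
  fixes z w :: "'a::euclidean_space \<times> real"
  assumes z: "z \<in> D \<times> {0..<T}" and w: "w \<in> D \<times> {0..<T}"
    and max: "\<And>z' w'. z' \<in> D \<times> {0..<T} \<Longrightarrow> w' \<in> D \<times> {0..<T} \<Longrightarrow> doubling K k \<delta> l \<eta> T u v z' w'
        \<le> doubling K k \<delta> l \<eta> T u v z w"
    and hu: "\<And>z w. z \<in> D \<times> {0..<T} \<Longrightarrow> w \<in> D \<times> {0..<T} \<Longrightarrow> \<bar>u z - u w\<bar>
        \<le> L * (norm (fst z - fst w) powr \<theta> + \<bar>snd z - snd w\<bar> powr \<theta>)"
    and hv: "\<And>z w. z \<in> D \<times> {0..<T} \<Longrightarrow> w \<in> D \<times> {0..<T} \<Longrightarrow> \<bar>v z - v w\<bar>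
        \<le> L * (norm (fst z - fst w) powr \<theta> + \<bar>snd z - snd w\<bar> powr \<theta>)"
    and \<delta>: "\<delta> = r powr (2 - \<theta>) / (2 * L)" and L: "L > 0" and r: "r > 0" and \<theta>: "0 < \<theta>" "\<theta> < 2"
      and l: "l \<ge> 0" and \<eta>: "\<eta> > 0"
  shows "\<bar>snd z - snd w\<bar> \<le> r"
proof -
  have "(snd z - snd w)\<^sup>2 / (2 * \<delta>) \<le> L * \<bar>snd z - snd w\<bar> powr \<theta>"
  proof (cases "snd w \<le> snd z")
    case True
    have m: "(fst z, snd w) \<in> D \<times> {0..<T}" using z w by (auto simp: mem_Times_iff)
    have "l * snd w \<le> l * snd z" using True l by (rule mult_left_mono)
    moreover have "\<eta> / (T - snd w) \<le> \<eta> / (T - snd z)" using True z w \<eta>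
      by (intro divide_left_mono) (auto simp: mem_Times_iff)
    ultimately have "(snd z - snd w)\<^sup>2 / (2 * \<delta>) \<le> u z - u (fst z, snd w)"
      using max[OF m w] by (simp add: doubling_def)
    also have "\<dots> \<le> L * \<bar>snd z - snd w\<bar> powr \<theta>" using hu[OF z m] \<theta> by simp
    finally show ?thesis .
  next
    case False
    have m: "(fst w, snd z) \<in> D \<times> {0..<T}" using z w by (auto simp: mem_Times_iff)
    have "\<eta> / (T - snd z) \<le> \<eta> / (T - snd w)" using False z w \<eta>
      by (intro divide_left_mono) (auto simp: mem_Times_iff)
    then have "(snd z - snd w)\<^sup>2 / (2 * \<delta>) \<le> v (fst w, snd z) - v w"
      using max[OF z m] by (simp add: doubling_def)
    also have "\<dots> \<le> L * \<bar>snd z - snd w\<bar> powr \<theta>" using hv[OF m w] \<theta> by simp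
    finally show ?thesis .
  qed
  moreover have "(snd z - snd w)\<^sup>2 / (2 * \<delta>) = L * r powr (\<theta> - 2) * \<bar>snd z - snd w\<bar> powr 2"
  proof -
    have "2 * \<delta> = r powr (2 - \<theta>) / L" by (simp add: \<delta>)
    moreover have "r powr (\<theta> - 2) = 1 / r powr (2 - \<theta>)" using r
      by (simp add: powr_minus[of r "2 - \<theta>", simplified] inverse_eq_divide)
    ultimately show ?thesis by (simp add: powr_numeral)
  qed
  ultimately have "L * r powr (\<theta> - 2) * \<bar>snd z - snd w\<bar> powr 2 \<le> L * \<bar>snd z - snd w\<bar> powr \<theta>" by simp
  then show ?thesis by (rule powr_scale_bound) (use L r \<theta> in auto)
qed

text \<open>\<open>E\<close> is the matrix error, bounded for all gradients that the penalty can
  have at distances up to r. \<open>l\<close> exceeds the sum of the three errors, from comparing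
  the Hamiltonians, from their Lipschitz bound and from the matrices, so that an interior maximum is
  contradictory.\<close>

lemma one_sided_estimate:
  fixes u v :: "(real ^ 'n) \<times> real \<Rightarrow> real" and \<Omega> :: "(real ^ 'n) set"
  defines "D \<equiv> \<lambda>T. closure \<Omega> \<times> {0..<T}"
  assumes \<Omega>: "open \<Omega>" "bounded \<Omega>" "\<Omega> \<noteq> {}" and T: "T > 0" and k: "k > 2" and \<theta>: "0 < \<theta>" "\<theta> \<le> 1"
    and L: "L > 0" and L_H: "L_H \<ge> 0"
    and r: "0 < r" "r \<le> 1" and K: "K = L * r powr (\<theta> - k)"
    and A: "continuous_on (- {0}) A1" "continuous_on (- {0}) A2" "\<And>\<xi>. \<xi> \<noteq> 0 \<Longrightarrow> psd (A1 \<xi>)" "\<And>\<xi>. \<xi> \<noteq> 0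
        \<Longrightarrow> psd (A2 \<xi>)"
    and A1: "((\<lambda>x. trace (A1 (gradient (\<lambda>y. norm y powr k) x) ** hessian (\<lambda>y. norm y powr k) x)) \<longlongrightarrow>
        0) (at 0)"
    and A2: "((\<lambda>x. trace (A2 (gradient (\<lambda>y. norm y powr k) x) ** hessian (\<lambda>y. norm y powr k) x)) \<longlongrightarrow>
        0) (at 0)"
    and H: "continuous_on (space_time_cylinder \<Omega> T \<times> UNIV) (\<lambda>(z, \<xi>). H1 z \<xi>)"
      "continuous_on (space_time_cylinder \<Omega> T \<times> UNIV) (\<lambda>(z, \<xi>). H2 z \<xi>)"
    and HL: "\<And>z w \<xi>. z \<in> space_time_cylinder \<Omega> T \<Longrightarrow> w \<in> space_time_cylinder \<Omega> T \<Longrightarrow>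
       \<bar>H2 z \<xi> - H2 w \<xi>\<bar> \<le> L_H * (1 + norm \<xi>) * (norm (fst z - fst w) + \<bar>snd z - snd w\<bar>)"
    and HC: "\<And>z \<xi>. z \<in> space_time_cylinder \<Omega> T \<Longrightarrow> \<bar>H1 z \<xi> - H2 z \<xi>\<bar> \<le> c_H"
    and uv: "continuous_on (D T) u" "continuous_on (D T) v" "bounded (u ` D T)" "bounded (v ` D T)"
    and sub: "F_subsolution (space_time_cylinder \<Omega> T) A1 H1 u"
      and super: "F_supersolution (space_time_cylinder \<Omega> T) A2 H2 v"
    and hu: "\<And>z w. z \<in> D T \<Longrightarrow> w \<in> D T \<Longrightarrow> \<bar>u z - u w\<bar>
        \<le> L * (norm (fst z - fst w) powr \<theta> + \<bar>snd z - snd w\<bar> powr \<theta>)"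
    and hv: "\<And>z w. z \<in> D T \<Longrightarrow> w \<in> D T \<Longrightarrow> \<bar>v z - v w\<bar>
        \<le> L * (norm (fst z - fst w) powr \<theta> + \<bar>snd z - snd w\<bar> powr \<theta>)"
    and bdry: "\<And>z. z \<in> parabolic_boundary \<Omega> T \<Longrightarrow> u z - v z \<le> M"
    and E: "\<And>d \<xi>. 0 < d \<Longrightarrow> d \<le> r \<Longrightarrow> norm \<xi> = K * (k * d powr (k - 1)) \<Longrightarrow>
       2 * (K * (k * (k - 1) * 2 powr (k - 2) * d powr (k - 2))) * real CARD('n) *
           (op_norm (psd_sqrt (A1 \<xi>) - psd_sqrt (A2 \<xi>)))\<^sup>2 \<le> E" "0 \<le> E"
    and l: "c_H + L_H * (1 + k * L * r powr (\<theta> - 1)) * (2 * r) + E < l" and l0: "l \<ge> 0"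
  shows "\<forall>z\<in>D T. u z - v z \<le> M + 2 * L * r powr \<theta> + l * T"
proof
  fix z1 assume z1: "z1 \<in> D T"
  let ?Q = "space_time_cylinder \<Omega> T"
  have oQ: "open ?Q" using \<Omega>(1) by (simp add: space_time_cylinder_def open_Times)
  have QD: "?Q \<subseteq> D T" using closure_subset[of \<Omega>] by (auto simp: space_time_cylinder_def D_def)
  have K0: "K > 0" using K L r by simp
  define \<delta> where "\<delta> = r powr (2 - \<theta>) / (2 * L)"
  have \<delta>: "\<delta> > 0" using r L by (simp add: \<delta>_def)
  have t1: "T - snd z1 > 0" using z1 by (auto simp: D_def)
  obtain B1 B2 where B: "\<And>z. z \<in> D T \<Longrightarrow> \<bar>u z\<bar> \<le> B1" "\<And>z. z \<in> D T \<Longrightarrow> \<bar>v z\<bar> \<le> B2"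
    using uv(3,4) unfolding bounded_iff by auto
  show "u z1 - v z1 \<le> M + 2 * L * r powr \<theta> + l * T"
  proof (rule field_le_epsilon)
    fix e :: real assume e: "e > 0"
    \<comment> \<open>The two barriers at z1 then sum to e.\<close>
    define \<eta> where "\<eta> = e * (T - snd z1) / 2"
    have \<eta>: "\<eta> > 0" using e t1 by (simp add: \<eta>_def)
    let ?\<Phi> = "doubling K k \<delta> l \<eta> T u v"
    have "\<exists>z\<in>D T. \<exists>w\<in>D T. \<forall>z'\<in>D T. \<forall>w'\<in>D T. ?\<Phi> z' w' \<le> ?\<Phi> z w"
      unfolding D_def
    proof (rule doubling_maximum[where B = "max B1 B2"])
      fix z assume "z \<in> closure \<Omega> \<times> {0..<T}"
      then have "z \<in> D T" by (simp add: D_def)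
      from B(1)[OF this] B(2)[OF this] show "\<bar>u z\<bar> \<le> max B1 B2" "\<bar>v z\<bar> \<le> max B1 B2" by linarith+
    qed (use \<Omega> T k K0 \<delta> \<eta> l0 uv in \<open>auto simp: D_def\<close>)
    then obtain z w where zw: "z \<in> D T" "w \<in> D T" and max: "\<And>z' w'. z' \<in> D T \<Longrightarrow> w' \<in> D T \<Longrightarrow> ?\<Phi> z' w' \<le> ?\<Phi> z w"
      by blast
    have sx: "norm (fst z - fst w) \<le> r"
      by (rule doubling_spatial_distance[OF zw[unfolded D_def] max[unfolded D_def] hu[unfolded
        D_def] K L r(1)]) (use \<theta> k in auto)
    have st: "\<bar>snd z - snd w\<bar> \<le> r"
      by (rule doubling_time_distance[OF zw[unfolded D_def] max[unfolded D_def] hu[unfolded D_def]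
        hv[unfolded D_def] \<delta>_def L r(1) _ _ l0 \<eta>]) (use \<theta> in auto)
    define tz where "tz = T - snd z"
    define tw where "tw = T - snd w"
    have tau: "tz > 0" "tw > 0" using zw by (auto simp: tz_def tw_def D_def)
    have "\<not> (z \<in> ?Q \<and> w \<in> ?Q)"
    proof
      assume zwQ: "z \<in> ?Q \<and> w \<in> ?Q"
      define d where "d = fst z - fst w"
      define \<beta> where "\<beta> = (snd z - snd w) / \<delta>"
      \<comment> \<open>a and b are the time slopes of the penalty in z and in w; \<beta> cancels in
        their sum, which is at least l.\<close>
      define a where "a = \<beta> + l + \<eta> / tz\<^sup>2"
      define b where "b = - \<beta> + \<eta> / tw\<^sup>2"
      have ab: "l \<le> a + b" using \<eta> by (simp add: a_def b_def)
      define P where "P = K *\<^sub>R powr_grad k d"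
      have nP: "norm P = K * (k * norm d powr (k - 1))" using K0 by (simp add: P_def norm_powr_grad[OF k])
      have HH: "H2 w P - H1 z P \<le> c_H + L_H * (1 + k * L * r powr (\<theta> - 1)) * (2 * r)"
      proof -
        have "norm P \<le> K * (k * r powr (k - 1))" unfolding nP
          using sx K0 k by (intro mult_left_mono powr_mono2) (auto simp: d_def)
        also have "\<dots> = k * L * (r powr (\<theta> - k) * r powr (k - 1))" by (simp add: K)
        also have "r powr (\<theta> - k) * r powr (k - 1) = r powr (\<theta> - 1)" by (simp flip: powr_add)
        finally have nP': "norm P \<le> k * L * r powr (\<theta> - 1)" .
        have "H2 w P - H2 z P \<le> L_H * (1 + norm P) * (norm (fst w - fst z) + \<bar>snd w - snd z\<bar>)"
          using HL[of w z P] zwQ by (simp add: abs_le_iff)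
        also have "\<dots> \<le> L_H * (1 + k * L * r powr (\<theta> - 1)) * (2 * r)"
          using nP' sx st L_H k L by (intro mult_mono mult_left_mono) (auto simp: norm_minus_commute
            abs_minus_commute)
        finally show ?thesis using HC[of z P] zwQ by (simp add: abs_le_iff)
      qed
      show False
      proof (cases "d = 0")
        \<comment> \<open>Here the gradient is 0. With w frozen, the maximum in z turns the penalty
          into a compatible test function for u; with z frozen, its negative is one for v.\<close>
        case True
        have P0: "P = 0" by (simp add: P_def True powr_grad_def)
        have fzw: "fst z = fst w" using True by (simp add: d_def)
        have dt: "((\<lambda>t. (t - s)\<^sup>2 / (2 * \<delta>) + c * t + \<eta> / (T - t)) has_real_derivative (t - s) / \<delta>
            + c + \<eta> / (T - t)\<^sup>2) (at t)"
          if "t < T" for s c t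
          using that \<delta> by (auto intro!: derivative_eq_intros simp: power2_eq_square field_simps)
        have dt2: "((\<lambda>t. (t - s) / \<delta> + c + \<eta> / (T - t)\<^sup>2) has_real_derivative 1 / \<delta>
            + 2 * \<eta> / (T - t) ^ 3) (at t)"
          if "t < T" for s c t
        proof -
          have "T - t \<noteq> 0" using that by simp
          then have "((\<lambda>t. 1 / (T - t)) has_real_derivative 1 / (T - t)\<^sup>2) (at t)"
            by (auto intro!: derivative_eq_intros simp: power2_eq_square)
          from DERIV_power[OF this, of 2]
          have "((\<lambda>t. (1 / (T - t))\<^sup>2) has_real_derivative 2 * (1 / (T - t)\<^sup>2 * (1 / (T - t))))
              (at t)" by simp
          from DERIV_cmult[OF this, of \<eta>]
          have "((\<lambda>t. \<eta> / (T - t)\<^sup>2) has_real_derivative 2 * \<eta> / (T - t) ^ 3) (at t)"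
            by (simp add: power_divide power2_eq_square power3_eq_cube mult_ac)
          moreover have "((\<lambda>t. (t - s) / \<delta> + c) has_real_derivative 1 / \<delta>) (at t)"
            using \<delta> by (auto intro!: derivative_eq_intros)
          ultimately show ?thesis by (rule DERIV_add[rotated])
        qed
        have sQ: "t < T" if "t \<in> snd ` ?Q" for t using that
          by (auto simp: space_time_cylinder_def split: if_splits)
        have ct: "continuous_on (snd ` ?Q) (\<lambda>t. 1 / \<delta> + 2 * \<eta> / (T - t) ^ 3)"
          using sQ by (intro continuous_intros) force
        have zQ: "(fst w, snd z) \<in> ?Q" "(fst z, snd w) \<in> ?Q" using zwQ fzw
          by (auto simp: prod_eq_iff) (metis prod.collapse)+
        let ?\<tau> = "\<lambda>s c t. (t - s)\<^sup>2 / (2 * \<delta>) + c * t + \<eta> / (T - t)"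
        have i1: "(snd z - snd w) / \<delta> + l + \<eta> / (T - snd z)\<^sup>2 + H1 z 0 \<le> 0"
        proof -
          let ?\<psi> = "\<lambda>z'. 1 * (K * norm (fst z' - fst w) powr k + ?\<tau> (snd w) l (snd z'))"
          note rt = radial_test_function[where \<tau> = "?\<tau> (snd w) l"
            and \<tau>' = "\<lambda>t. (t - snd w) / \<delta> + l + \<eta> / (T - t)\<^sup>2"
              and \<tau>'' = "\<lambda>t. 1 / \<delta> + 2 * \<eta> / (T - t) ^ 3" and s = 1 and y = "fst w", OF k K0 _ A1 _ _ ct]
          have tf: "C2_compatible A1 ?Q ?\<psi>"
            by (rule rt(1)) (use A(3) dt dt2 sQ in simp_all)
          have tf2: "space_gradient ?\<psi> (fst w, snd z) = 0"
            by (rule rt(2)) (use A(3) dt dt2 sQ zQ in simp_all)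
          have tf3: "time_deriv ?\<psi> (fst w, snd z) = 1 * ((snd z - snd w) / \<delta> + l + \<eta> / (T - snd z)\<^sup>2)"
            by (rule rt(3)) (use A(3) dt dt2 sQ zQ in simp_all)
          have zz: "(fst w, snd z) = z" using fzw by (simp add: prod_eq_iff)
          have "\<forall>\<^sub>F z' in nhds z. z' \<in> ?Q" using eventually_nhds_in_open[OF oQ] zwQ by blast
          then have "\<forall>\<^sub>F z' in nhds z. u z' - ?\<psi> z' \<le> u z - ?\<psi> z"
          proof eventually_elim
            case (elim z')
            then have "z' \<in> D T" using QD by blast
            from max[OF this zw(2)] show ?case by (simp add: doubling_def)
          qed
          moreover have "space_gradient ?\<psi> z = 0" "time_deriv ?\<psi> z
              = 1 * ((snd z - snd w) / \<delta> + l + \<eta> / (T - snd z)\<^sup>2)"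
            using tf2 tf3 unfolding zz by simp_all
          moreover have "if space_gradient ?\<psi> z \<noteq> 0
             then time_deriv ?\<psi> z - trace (A1 (space_gradient ?\<psi> z) ** space_hessian ?\<psi> z)
                 + H1 z (space_gradient ?\<psi> z) \<le> 0
             else time_deriv ?\<psi> z + H1 z 0 \<le> 0"
            using sub[unfolded F_subsolution_def, THEN conjunct2, THEN conjunct2, rule_format, of ?\<psi>
              z] tf zwQ
              \<open>\<forall>\<^sub>F z' in nhds z. u z' - ?\<psi> z' \<le> u z - ?\<psi> z\<close> by blast
          ultimately show ?thesis by simp
        qed
        have i2: "(snd z - snd w) / \<delta> - \<eta> / (T - snd w)\<^sup>2 + H2 w 0 \<ge> 0"
        proof -
          let ?\<psi> = "\<lambda>w'. (-1) * (K * norm (fst w' - fst z) powr k + ?\<tau> (snd z) 0 (snd w'))"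
          note rt = radial_test_function[where \<tau> = "?\<tau> (snd z) 0"
            and \<tau>' = "\<lambda>t. (t - snd z) / \<delta> + 0 + \<eta> / (T - t)\<^sup>2"
              and \<tau>'' = "\<lambda>t. 1 / \<delta> + 2 * \<eta> / (T - t) ^ 3" and s = "-1" and y = "fst z", OF k K0 _ A2 _ _ ct]
          have tf: "C2_compatible A2 ?Q ?\<psi>"
            by (rule rt(1)) (use A(4) dt[of _ "snd z" 0] dt2[of _ "snd z" 0] sQ in simp_all)
          have tf2: "space_gradient ?\<psi> (fst z, snd w) = 0"
            by (rule rt(2)) (use A(4) dt[of _ "snd z" 0] dt2[of _ "snd z" 0] sQ zQ in simp_all)
          have tf3: "time_deriv ?\<psi> (fst z, snd w) = (-1) * ((snd w - snd z) / \<delta> + 0 + \<eta> / (T - snd w)\<^sup>2)"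
            by (rule rt(3)) (use A(4) dt[of _ "snd z" 0] dt2[of _ "snd z" 0] sQ zQ in simp_all)
          have zz: "(fst z, snd w) = w" using fzw by (simp add: prod_eq_iff)
          have "\<forall>\<^sub>F w' in nhds w. w' \<in> ?Q" using eventually_nhds_in_open[OF oQ] zwQ by blast
          then have "\<forall>\<^sub>F w' in nhds w. v w' - ?\<psi> w' \<ge> v w - ?\<psi> w"
          proof eventually_elim
            case (elim w')
            then have "w' \<in> D T" using QD by blast
            from max[OF zw(1) this] show ?case
              by (simp add: doubling_def norm_minus_commute power2_commute)
          qed
          moreover have "space_gradient ?\<psi> w = 0" "time_deriv ?\<psi> w
              = (-1) * ((snd w - snd z) / \<delta> + 0 + \<eta> / (T - snd w)\<^sup>2)"
            using tf2 tf3 unfolding zz by simp_all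
          moreover have "if space_gradient ?\<psi> w \<noteq> 0
             then time_deriv ?\<psi> w - trace (A2 (space_gradient ?\<psi> w) ** space_hessian ?\<psi> w)
                 + H2 w (space_gradient ?\<psi> w) \<ge> 0
             else time_deriv ?\<psi> w + H2 w 0 \<ge> 0"
            using super[unfolded F_supersolution_def, THEN conjunct2, THEN conjunct2, rule_format,
              of ?\<psi> w] tf zwQ
              \<open>\<forall>\<^sub>F w' in nhds w. v w' - ?\<psi> w' \<ge> v w - ?\<psi> w\<close> by blast
          ultimately have "(-1) * ((snd w - snd z) / \<delta> + 0 + \<eta> / (T - snd w)\<^sup>2) + H2 w 0 \<ge> 0" by simp
          then show ?thesis by (simp add: diff_divide_distrib)
        qed
        have "\<eta> / (T - snd z)\<^sup>2 \<ge> 0" "\<eta> / (T - snd w)\<^sup>2 \<ge> 0" using \<eta> by auto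
        then have "l \<le> H2 w P - H1 z P" using i1 i2 unfolding P0 by linarith
        then show False using HH l E(2) by linarith
      next
        case False
        define m where "m = K * (k * (k - 1) * 2 powr (k - 2) * norm d powr (k - 2))"
        \<comment> \<open>Twice the coefficients of the squares: (s1 - s2)^2/(2 \<delta>) \<le>
          (s1^2 + s2^2)/\<delta>, and 2 \<eta>/\<tau>^3 from each barrier.\<close>
        define c where "c = 2 / \<delta> + 4 * \<eta> / tz ^ 3 + 4 * \<eta> / tw ^ 3"
        have mc: "m \<ge> 0" "c \<ge> 0" using K0 k \<delta> \<eta> tau by (simp_all add: m_def c_def)
        have P: "P \<noteq> 0" using False K0 k by (simp add: P_def powr_grad_def)
        obtain r1 r2 where r12: "r1 > 0" "cball z r1 \<subseteq> ?Q" "r2 > 0" "cball w r2 \<subseteq> ?Q"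
          using oQ zwQ open_contains_cball by meson
        \<comment> \<open>Half of |d| for each point keeps the change of x - y within |d|, as
          \<open>norm_powr_taylor\<close> requires; half of tz and of tw serves
          \<open>reciprocal_upper_expansion\<close>; r1 and r2 keep the balls in the
          cylinder.\<close>
        define \<rho> where "\<rho> = Min {r1, r2, norm d / 2, tz / 2, tw / 2}"
        have \<rho>: "\<rho> > 0" using r12 False tau by (simp add: \<rho>_def)
        have \<rho>le: "\<rho> \<le> r1" "\<rho> \<le> r2" "\<rho> \<le> norm d / 2" "\<rho> \<le> tz / 2" "\<rho> \<le> tw / 2"
          unfolding \<rho>_def by (rule Min_le; simp)+
        have contact: "u z' - v w' \<le> u z - v w + (P, a) \<bullet> (z' - z) + (- P, b) \<bullet> (w' - w)
            + coupling_form m c (z' - z, w' - w) / 2"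
          if z': "z' \<in> cball z \<rho>" and w': "w' \<in> cball w \<rho>" for z' w'
        proof -
          define hz where "hz = z' - z"
          define hw where "hw = w' - w"
          have n: "norm hz \<le> \<rho>" "norm hw \<le> \<rho>" using z' w'
            by (auto simp: hz_def hw_def dist_norm norm_minus_commute)
          have comp: "norm (fst p) \<le> norm p" "\<bar>snd p\<bar> \<le> norm p" for p :: "(real ^ 'n) \<times> real"
            using norm_fst_le[of "fst p" "snd p"] norm_snd_le[of "snd p" "fst p"] by simp_all
          have "z' \<in> cball z r1" "w' \<in> cball w r2" using z' w' \<rho>le(1,2) by auto
          then have "z' \<in> D T" "w' \<in> D T" using r12(2,4) QD by blast+
          from max[OF this] have M: "u z' - v w'
              \<le> u z - v w + (K * norm (fst z' - fst w') powr k - K * norm d powr k)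
             + ((snd z' - snd w')\<^sup>2 / (2 * \<delta>) - (snd z - snd w)\<^sup>2 / (2 * \<delta>)) + l * snd hz
             + (\<eta> / (T - snd z') - \<eta> / tz) + (\<eta> / (T - snd w') - \<eta> / tw)"
            by (simp add: doubling_def d_def hz_def tz_def tw_def algebra_simps)
          have 1: "K * norm (fst z' - fst w') powr k - K * norm d powr k
              \<le> P \<bullet> (fst hz - fst hw) + m / 2 * (norm (fst hz - fst hw))\<^sup>2"
          proof -
            have "norm (fst hz - fst hw) \<le> norm (fst hz) + norm (fst hw)" by (rule norm_triangle_ineq4)
            then have "norm (fst hz - fst hw) \<le> norm d" using comp(1)[of hz] comp(1)[of hw] n \<rho>le(3)
              by linarith
            from norm_powr_taylor[OF k this]
            have "K * norm (d + (fst hz - fst hw)) powr k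
                \<le> K * (norm d powr k + powr_grad k d \<bullet> (fst hz - fst hw)
                + k * (k - 1) * 2 powr (k - 2) * norm d powr (k - 2) / 2 * (norm (fst hz - fst hw))\<^sup>2)"
              using K0 by (intro mult_left_mono) auto
            also have "d + (fst hz - fst hw) = fst z' - fst w'" by (simp add: d_def hz_def hw_def)
            finally show ?thesis by (simp add: P_def m_def algebra_simps)
          qed
          have 2: "(snd z' - snd w')\<^sup>2 / (2 * \<delta>) - (snd z - snd w)\<^sup>2 / (2 * \<delta>)
              \<le> \<beta> * (snd hz - snd hw) + 1 / \<delta> * ((snd hz)\<^sup>2 + (snd hw)\<^sup>2)"
          proof -
            have "snd z' - snd w' = (snd z - snd w) + (snd hz - snd hw)" by (simp add: hz_def hw_def)
            then have "(snd z' - snd w')\<^sup>2 - (snd z - snd w)\<^sup>2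
                = 2 * (snd z - snd w) * (snd hz - snd hw) + (snd hz - snd hw)\<^sup>2"
              by (simp only:) (simp add: power2_eq_square algebra_simps)
            also have "(snd hz - snd hw)\<^sup>2 \<le> 2 * ((snd hz)\<^sup>2 + (snd hw)\<^sup>2)"
              using norm_coupled_le[of "snd hz" "snd hw"] by simp
            finally have "((snd z' - snd w')\<^sup>2 - (snd z - snd w)\<^sup>2) / (2 * \<delta>)
                \<le> (2 * (snd z - snd w) * (snd hz - snd hw) + 2 * ((snd hz)\<^sup>2 + (snd hw)\<^sup>2)) / (2 * \<delta>)"
              using \<delta> by (intro divide_right_mono) auto
            also have "\<dots> = \<beta> * (snd hz - snd hw) + 1 / \<delta> * ((snd hz)\<^sup>2 + (snd hw)\<^sup>2)"
            proof -
              have "(2 * p * q + 2 * s) / (2 * \<delta>) = p / \<delta> * q + 1 / \<delta> * s" for p q s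
                using \<delta> by (simp add: field_simps)
              then show ?thesis unfolding \<beta>_def .
            qed
            finally show ?thesis by (simp add: diff_divide_distrib)
          qed
          have rec: "\<eta> / (\<tau> - h) - \<eta> / \<tau> \<le> \<eta> / \<tau>\<^sup>2 * h + 2 * \<eta> / \<tau> ^ 3 * h\<^sup>2" if "\<tau> > 0" "\<bar>h\<bar> \<le> \<tau> / 2" for \<tau> h
          proof -
            have "\<eta> * (1 / (\<tau> - h)) \<le> \<eta> * (1 / \<tau> + h / \<tau>\<^sup>2 + 2 * h\<^sup>2 / \<tau> ^ 3)"
              using reciprocal_upper_expansion[OF that] \<eta> by (intro mult_left_mono) auto
            then show ?thesis by (simp add: distrib_left mult_ac)
          qed
          have 3: "\<eta> / (T - snd z') - \<eta> / tz \<le> \<eta> / tz\<^sup>2 * snd hz + 2 * \<eta> / tz ^ 3 * (snd hz)\<^sup>2"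
          proof -
            have "\<bar>snd hz\<bar> \<le> tz / 2" using comp(2)[of hz] n(1) \<rho>le(4) by linarith
            moreover have "tz - snd hz = T - snd z'" by (simp add: tz_def hz_def)
            ultimately show ?thesis using rec[OF tau(1), of "snd hz"] by simp
          qed
          have 4: "\<eta> / (T - snd w') - \<eta> / tw \<le> \<eta> / tw\<^sup>2 * snd hw + 2 * \<eta> / tw ^ 3 * (snd hw)\<^sup>2"
          proof -
            have "\<bar>snd hw\<bar> \<le> tw / 2" using comp(2)[of hw] n(2) \<rho>le(5) by linarith
            moreover have "tw - snd hw = T - snd w'" by (simp add: tw_def hw_def)
            ultimately show ?thesis using rec[OF tau(2), of "snd hw"] by simp
          qed
          have 5: "2 * \<eta> / tz ^ 3 * (snd hz)\<^sup>2 + 2 * \<eta> / tw ^ 3 * (snd hw)\<^sup>2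
              + 1 / \<delta> * ((snd hz)\<^sup>2 + (snd hw)\<^sup>2) \<le> c / 2 * ((snd hz)\<^sup>2 + (snd hw)\<^sup>2)"
          proof -
            have "c / 2 * ((snd hz)\<^sup>2 + (snd hw)\<^sup>2) = 2 * \<eta> / tz ^ 3 * (snd hz)\<^sup>2
                + 2 * \<eta> / tw ^ 3 * (snd hw)\<^sup>2 + 1 / \<delta> * ((snd hz)\<^sup>2 + (snd hw)\<^sup>2)
               + (2 * \<eta> / tz ^ 3 * (snd hw)\<^sup>2 + 2 * \<eta> / tw ^ 3 * (snd hz)\<^sup>2)"
              by (simp add: c_def algebra_simps)
            moreover have "2 * \<eta> / tz ^ 3 * (snd hw)\<^sup>2 \<ge> 0" "2 * \<eta> / tw ^ 3 * (snd hz)\<^sup>2 \<ge> 0"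
              using \<eta> tau by auto
            ultimately show ?thesis by linarith
          qed
          have 6: "(P, a) \<bullet> hz + (- P, b) \<bullet> hw = P \<bullet> (fst hz - fst hw) + \<beta> * (snd hz - snd hw)
              + l * snd hz + \<eta> / tz\<^sup>2 * snd hz + \<eta> / tw\<^sup>2 * snd hw"
            by (simp add: inner_prod_def a_def b_def inner_diff_right algebra_simps)
          have 7: "coupling_form m c (hz, hw) / 2 = m / 2 * (norm (fst hz - fst hw))\<^sup>2
              + c / 2 * ((snd hz)\<^sup>2 + (snd hw)\<^sup>2)"
            by (simp add: coupling_form_def add_divide_distrib)
          show ?thesis unfolding hz_def[symmetric] hw_def[symmetric]
            using M 1 2 3 4 5 6 7 by linarith
        qed
        have "a + b \<le> 2 * m * real CARD('n) * (op_norm (psd_sqrt (A1 P) - psd_sqrt (A2 P)))\<^sup>2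
            + (H2 w P - H1 z P)"
          by (rule interior_inequality[OF oQ zwQ[THEN conjunct1] zwQ[THEN conjunct2] sub super
                continuous_on_subset[OF uv(1) QD] continuous_on_subset[OF uv(2) QD]
                A(1,2) A(3)[OF P] A(4)[OF P] H P mc \<rho> contact])
        moreover have "2 * m * real CARD('n) * (op_norm (psd_sqrt (A1 P) - psd_sqrt (A2 P)))\<^sup>2 \<le> E"
          unfolding m_def by (rule E(1)) (use False sx nP in \<open>auto simp: d_def\<close>)
        ultimately show False using ab HH l by linarith
      qed
    qed
    moreover have "x \<in> parabolic_boundary \<Omega> T" if "x \<in> D T" "x \<notin> ?Q" for x
    proof -
      have x: "fst x \<in> closure \<Omega>" "0 \<le> snd x" "snd x < T" using that(1)
        by (simp_all add: D_def mem_Times_iff)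
      show ?thesis
      proof (cases "fst x \<in> \<Omega>")
        case True
        then have "snd x = 0" using that(2) x by (simp add: space_time_cylinder_def mem_Times_iff)
        then show ?thesis using True by (simp add: parabolic_boundary_def mem_Times_iff)
      next
        case False
        then have "fst x \<in> frontier \<Omega>" using x(1) \<Omega>(1) by (simp add: frontier_def interior_open)
        then show ?thesis using x by (simp add: parabolic_boundary_def mem_Times_iff)
      qed
    qed
    ultimately have "z \<in> parabolic_boundary \<Omega> T \<or> w \<in> parabolic_boundary \<Omega> T" using zw by blast
    moreover have hz: "L * (norm (fst z - fst w) powr \<theta> + \<bar>snd z - snd w\<bar> powr \<theta>) \<le> 2 * L * r powr \<theta>"
    proof -
      have "norm (fst z - fst w) powr \<theta> \<le> r powr \<theta>" "\<bar>snd z - snd w\<bar> powr \<theta> \<le> r powr \<theta>"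
        using sx st \<theta> by (auto intro!: powr_mono2)
      then have "L * (norm (fst z - fst w) powr \<theta> + \<bar>snd z - snd w\<bar> powr \<theta>) \<le> L * (r powr \<theta> + r powr \<theta>)"
        using L by (intro mult_left_mono) auto
      then show ?thesis by (simp add: algebra_simps)
    qed
    \<comment> \<open>The boundary estimate is used at z or at w, whichever is on the parabolic
      boundary; the Hoelder bound of v in the first case and of u in the second reaches the other
      point.\<close>
    ultimately have main: "u z - v w \<le> M + 2 * L * r powr \<theta>"
      using bdry[of z] bdry[of w] hu[OF zw] hv[OF zw] by (auto simp: abs_le_iff)
    have "?\<Phi> z1 z1 \<le> ?\<Phi> z w" by (rule max[OF z1 z1])
    moreover have "?\<Phi> z1 z1 = u z1 - v z1 - l * snd z1 - 2 * (\<eta> / (T - snd z1))" by (simp add: doubling_def)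
    moreover have "\<eta> / (T - snd z1) = e / 2"
    proof -
      have "e * x / 2 / x = e / 2" if "x > 0" for x :: real using that by simp
      from this[OF t1] show ?thesis unfolding \<eta>_def .
    qed
    moreover have "?\<Phi> z w \<le> u z - v w"
    proof -
      have "K * norm (fst z - fst w) powr k \<ge> 0" "(snd z - snd w)\<^sup>2 / (2 * \<delta>) \<ge> 0" "l * snd z
          \<ge> 0" "\<eta> / tz \<ge> 0" "\<eta> / tw \<ge> 0"
        using K0 \<delta> l0 \<eta> tau zw by (auto simp: D_def)
      then show ?thesis unfolding doubling_def tz_def tw_def by linarith
    qed
    moreover have "l * snd z1 \<le> l * T" using z1 l0 by (intro mult_left_mono) (auto simp: D_def)
    ultimately show "u z1 - v z1 \<le> M + 2 * L * r powr \<theta> + l * T + e" using main by linarith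
  qed
qed

text \<open>With q the denominator in the exponent of r, \<epsilon>^\<alpha> = r^q. By (1 + y)^2
  \<le> 2 + 2 y^2 the quantity splits into a term without the gradient and one with its power 2
  \<beta>. At d = r they are of order r^(\<theta>-2+2q) and r^(\<theta>-2+2q-2(1-\<theta>)\<beta>);
  q \<ge> 1 and q \<ge> 1 + (1-\<theta>) \<beta> bring both below a multiple of r^\<theta>, since r
  \<le> 1.\<close>

lemma coefficient_estimate:
  fixes k \<beta> c_A \<theta> L \<alpha> \<epsilon> d x :: real
  defines "r \<equiv> \<epsilon> powr (\<alpha> / (1 + (1 - \<theta>) * max \<beta> 0))"
  defines "K \<equiv> L * r powr (\<theta> - k)"
  assumes k: "k > 2" and \<beta>: "\<beta> > (2 - k) / (2 * (k - 1))" and c_A: "c_A > 0" and \<theta>: "0 < \<theta>" "\<theta> \<le> 1"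
    and L: "L > 0"
    and \<epsilon>: "0 < \<epsilon>" "\<epsilon> < 1" and \<alpha>: "\<alpha> > 0" and d: "0 < d" "d \<le> r" and C: "C \<ge> 0"
    and x: "0 \<le> x" "x \<le> c_A * \<epsilon> powr \<alpha> * (1 + (K * (k * d powr (k - 1))) powr \<beta>)"
  shows "K * (C * d powr (k - 2)) * x\<^sup>2 \<le> C * c_A\<^sup>2 * (2 * L + 2 * L * (k * L) powr (2 * \<beta>)) * r powr \<theta>"
proof -
  define q where "q = 1 + (1 - \<theta>) * max \<beta> 0"
  have q: "q \<ge> 1" using \<theta> by (simp add: q_def)
  have r: "0 < r" "r \<le> 1" using \<epsilon> \<alpha> q by (auto simp: r_def q_def[symmetric] powr_le1)
  have K: "K > 0" using L r by (simp add: K_def)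
  define s where "s = K * (k * d powr (k - 1))"
  have s: "s > 0" using K k d by (simp add: s_def)
  have \<epsilon>r: "(\<epsilon> powr \<alpha>)\<^sup>2 = r powr (2 * q)"
  proof -
    have "r powr (2 * q) = \<epsilon> powr (2 * \<alpha>)" using q
      by (simp add: r_def q_def[symmetric] powr_powr mult.commute)
    then show ?thesis using \<epsilon> by (simp add: power2_eq_square flip: powr_add)
  qed
  have x2: "x\<^sup>2 \<le> c_A\<^sup>2 * r powr (2 * q) * (2 + 2 * s powr (2 * \<beta>))"
  proof -
    have "x\<^sup>2 \<le> (c_A * \<epsilon> powr \<alpha> * (1 + s powr \<beta>))\<^sup>2" using x by (intro power_mono) (auto simp: s_def)
    also have "\<dots> = c_A\<^sup>2 * r powr (2 * q) * (1 + s powr \<beta>)\<^sup>2" by (simp add: power_mult_distrib \<epsilon>r)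
    also have "(1 + s powr \<beta>)\<^sup>2 \<le> 2 + 2 * (s powr \<beta>)\<^sup>2"
      using sum_squares_bound[of 1 "s powr \<beta>"] by (simp add: power2_eq_square algebra_simps)
    also have "(s powr \<beta>)\<^sup>2 = s powr (2 * \<beta>)" by (simp add: power2_eq_square flip: powr_add)
    finally show ?thesis by (simp add: mult_left_mono)
  qed
  define R where "R = r powr (\<theta> - 2 * q)"
  have KR: "K * r powr (k - 2) = L * r powr (\<theta> - 2)"
    by (simp add: K_def flip: powr_add)
  have b1: "K * d powr (k - 2) \<le> L * R"
  proof -
    have "K * d powr (k - 2) \<le> K * r powr (k - 2)" using d k K by (intro mult_left_mono powr_mono2) auto
    also have "\<dots> = L * r powr (\<theta> - 2)" by (rule KR)
    also have "\<dots> \<le> L * R" unfolding R_def using r q L by (intro mult_left_mono powr_mono') auto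
    finally show ?thesis .
  qed
  have b2: "K * d powr (k - 2) * s powr (2 * \<beta>) \<le> L * (k * L) powr (2 * \<beta>) * R"
  proof -
    \<comment> \<open>The exponent of d in the second term. For negative \<beta> the power of the
      gradient blows up as d tends to 0; the lower bound on \<beta> gives p \<ge> 0, so that d = r
      is still the worst case.\<close>
    define p where "p = k - 2 + (k - 1) * (2 * \<beta>)"
    have p: "p \<ge> 0"
    proof -
      have "2 - k < \<beta> * (2 * (k - 1))" using \<beta> k by (simp add: divide_less_eq)
      then show ?thesis by (simp add: p_def algebra_simps)
    qed
    have e: "K * t powr (k - 2) * (K * (k * t powr (k - 1))) powr (2 * \<beta>)
        = K * (K * k) powr (2 * \<beta>) * t powr p" if "t > 0" for t
    proof -
      have "(K * (k * t powr (k - 1))) powr (2 * \<beta>) = (K * k) powr (2 * \<beta>) * t powr ((k - 1) * (2 * \<beta>))"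
        using K k that by (simp add: powr_mult powr_powr flip: mult.assoc)
      then show ?thesis by (simp add: p_def powr_add)
    qed
    have "K * d powr (k - 2) * s powr (2 * \<beta>) = K * (K * k) powr (2 * \<beta>) * d powr p" unfolding s_def
      by (rule e[OF d(1)])
    also have "\<dots> \<le> K * (K * k) powr (2 * \<beta>) * r powr p" using d p K
      by (intro mult_left_mono powr_mono2) auto
    also have "\<dots> = K * r powr (k - 2) * (K * (k * r powr (k - 1))) powr (2 * \<beta>)"
      by (rule e[OF r(1), symmetric])
    also have "K * (k * r powr (k - 1)) = (k * L) * r powr (\<theta> - 1)" by (simp add: K_def flip: powr_add)
    also have "((k * L) * r powr (\<theta> - 1)) powr (2 * \<beta>) = (k * L) powr (2 * \<beta>) * r powr ((\<theta> - 1) * (2 * \<beta>))"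
      using k L r by (simp add: powr_mult powr_powr)
    also have "K * r powr (k - 2) * ((k * L) powr (2 * \<beta>) * r powr ((\<theta> - 1) * (2 * \<beta>)))
        = L * (k * L) powr (2 * \<beta>) * r powr (\<theta> - 2 + (\<theta> - 1) * (2 * \<beta>))"
      unfolding KR by (simp add: powr_add)
    also have "\<dots> \<le> L * (k * L) powr (2 * \<beta>) * R" unfolding R_def
    proof (intro mult_left_mono powr_mono')
      have "(1 - \<theta>) * \<beta> \<le> (1 - \<theta>) * max \<beta> 0" using \<theta> by (intro mult_left_mono) auto
      then show "\<theta> - 2 * q \<le> \<theta> - 2 + (\<theta> - 1) * (2 * \<beta>)" by (simp add: q_def algebra_simps)
    qed (use r L in auto)
    finally show ?thesis .
  qed
  have "K * (C * d powr (k - 2)) * x\<^sup>2 \<le> K * (C * d powr (k - 2)) * (c_A\<^sup>2 * r powr (2 * q) * (2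
      + 2 * s powr (2 * \<beta>)))"
    using x2 K C by (intro mult_left_mono) auto
  also have "\<dots> = C * c_A\<^sup>2 * r powr (2 * q) * (2 * (K * d powr (k - 2))
      + 2 * (K * d powr (k - 2) * s powr (2 * \<beta>)))"
    by (simp add: algebra_simps)
  also have "\<dots> \<le> C * c_A\<^sup>2 * r powr (2 * q) * (2 * (L * R) + 2 * (L * (k * L) powr (2 * \<beta>) * R))"
    using b1 b2 C by (intro mult_left_mono add_mono) auto
  also have "\<dots> = C * c_A\<^sup>2 * (2 * L + 2 * L * (k * L) powr (2 * \<beta>)) * (r powr (2 * q) * R)"
    by (simp add: algebra_simps)
  also have "r powr (2 * q) * R = r powr \<theta>" unfolding R_def by (simp flip: powr_add)
  finally show ?thesis .
qed

section \<open>Assembly of the two one-sided estimates\<close>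

lemma op_norm_minus_commute: "op_norm (A - B) = op_norm (B - A)"
proof -
  have "(\<lambda>x. (A - B) *v x) = (\<lambda>x. - ((B - A) *v x))" by (simp add: matrix_vector_mult_diff_rdistrib)
  then show ?thesis by (simp add: op_norm_def onorm_neg)
qed

theorem theorem1p1:
  fixes T k L_H \<beta> c_A \<theta> L :: real
  assumes "T > 0" and "k > 2" and "L_H \<ge> 0" and "\<beta> > (2 - k) / (2 * (k - 1))" and "c_A > 0"
    and "\<theta> \<in> {0<..1}" and "L > 0"
  shows "\<exists>C>0. \<forall>(\<Omega> :: (real ^ 'n) set)
      (A :: real \<Rightarrow> real ^ 'n \<Rightarrow> real ^ 'n ^ 'n)
      (H :: real \<Rightarrow> (real ^ 'n) \<times> real \<Rightarrow> real ^ 'n \<Rightarrow> real)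
      (g :: real \<Rightarrow> (real ^ 'n) \<times> real \<Rightarrow> real)
      (u :: real \<Rightarrow> (real ^ 'n) \<times> real \<Rightarrow> real)
      (\<alpha>::real) (c_H::real) (\<gamma>::real).
    \<comment> \<open>bounded domain\<close>
    open \<Omega> \<and> connected \<Omega> \<and> \<Omega> \<noteq> {} \<and> bounded \<Omega> \<longrightarrow>
    \<comment> \<open>standing assumptions on the coefficients\<close>
    (\<forall>\<epsilon>\<ge>0. continuous_on (- {0}) (A \<epsilon>) \<and> (\<forall>\<xi>. \<xi> \<noteq> 0 \<longrightarrow> psd (A \<epsilon> \<xi>)) \<and> F_class (A \<epsilon>) \<noteq> {}) \<longrightarrow>
    (\<forall>\<epsilon>\<ge>0. continuous_on (space_time_cylinder \<Omega> T \<times> UNIV) (\<lambda>(z, \<xi>). H \<epsilon> z \<xi>)) \<longrightarrow>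
    \<comment> \<open>(A1)\<close>
    (\<exists>\<epsilon>1>0. \<forall>\<epsilon>\<in>{0..<\<epsilon>1}.
       ((\<lambda>x. trace (A \<epsilon> (gradient (\<lambda>y. norm y powr k) x) ** hessian (\<lambda>y. norm y powr k) x))
          \<longlongrightarrow> 0) (at 0)) \<longrightarrow>
    \<comment> \<open>(A2)\<close>
    (\<forall>\<epsilon>\<ge>0. \<forall>(x1, t1)\<in>space_time_cylinder \<Omega> T. \<forall>(x2, t2)\<in>space_time_cylinder \<Omega> T. \<forall>\<xi>.
       \<bar>H \<epsilon> (x1, t1) \<xi> - H \<epsilon> (x2, t2) \<xi>\<bar>
         \<le> L_H * (1 + norm \<xi>) * (norm (x1 - x2) + \<bar>t1 - t2\<bar>)) \<longrightarrow>
    \<comment> \<open>(C1)\<close>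
    \<alpha> > 0 \<longrightarrow>
    (\<exists>\<epsilon>1>0. \<forall>\<epsilon>\<in>{0<..<\<epsilon>1}. \<forall>\<xi>. \<xi> \<noteq> 0 \<longrightarrow>
       op_norm (psd_sqrt (A \<epsilon> \<xi>) - psd_sqrt (A 0 \<xi>))
         \<le> c_A * \<epsilon> powr \<alpha> * (1 + norm \<xi> powr \<beta>)) \<longrightarrow>
    \<comment> \<open>(C2)\<close>
    c_H > 0 \<and> \<gamma> > 0 \<longrightarrow>
    (\<exists>\<epsilon>1>0. \<forall>\<epsilon>\<in>{0<..<\<epsilon>1}. \<forall>z\<in>space_time_cylinder \<Omega> T. \<forall>\<xi>.
       \<bar>H \<epsilon> z \<xi> - H 0 z \<xi>\<bar> \<le> c_H * \<epsilon> powr \<gamma>) \<longrightarrow>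
    \<comment> \<open>bounded solutions of the initial-boundary value problems\<close>
    (\<forall>\<epsilon>\<ge>0. continuous_on (parabolic_boundary \<Omega> T) (g \<epsilon>) \<and>
       continuous_on (closure \<Omega> \<times> {0..<T}) (u \<epsilon>) \<and>
       bounded (u \<epsilon> ` (closure \<Omega> \<times> {0..<T})) \<and>
       F_solution (space_time_cylinder \<Omega> T) (A \<epsilon>) (H \<epsilon>) (u \<epsilon>) \<and>
       (\<forall>z\<in>parabolic_boundary \<Omega> T. u \<epsilon> z = g \<epsilon> z)) \<longrightarrow>
    \<comment> \<open>uniform Hoelder bound\<close>
    (\<exists>\<epsilon>1>0. \<forall>\<epsilon>\<in>{0..<\<epsilon>1}.
       \<forall>(x1, t1)\<in>closure \<Omega> \<times> {0..<T}. \<forall>(x2, t2)\<in>closure \<Omega> \<times> {0..<T}.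
       \<bar>u \<epsilon> (x1, t1) - u \<epsilon> (x2, t2)\<bar>
         \<le> L * (norm (x1 - x2) powr \<theta> + \<bar>t1 - t2\<bar> powr \<theta>)) \<longrightarrow>
    (\<exists>\<epsilon>0>0. \<forall>\<epsilon>\<in>{0<..<\<epsilon>0}.
       (SUP z\<in>closure \<Omega> \<times> {0..<T}. \<bar>u \<epsilon> z - u 0 z\<bar>)
         \<le> (SUP z\<in>parabolic_boundary \<Omega> T. \<bar>g \<epsilon> z - g 0 z\<bar>)
            + C * \<epsilon> powr (\<alpha> * \<theta> / (1 + (1 - \<theta>) * max \<beta> 0))
            + c_H * T * \<epsilon> powr \<gamma>)"
proof -
  have \<theta>: "0 < \<theta>" "\<theta> \<le> 1" using assms(6) by auto
  define N where "N = real CARD('n)"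
  \<comment> \<open>\<open>Ck\<close> is the Taylor constant of |x|^k, and \<open>CE\<close> is the
    matrix error with the dimension. In \<open>C1\<close> the first summand is the Lipschitz error
    of the Hamiltonian and the 1 makes the inequality for l strict. In \<open>C\<close>, 2 L comes
    from the boundary step and T C1 from the term l T.\<close>
  define Ck where "Ck = k * (k - 1) * 2 powr (k - 2)"
  define CE where "CE = 2 * N * (Ck * c_A\<^sup>2 * (2 * L + 2 * L * (k * L) powr (2 * \<beta>)))"
  define C1 where "C1 = 2 * L_H * (1 + k * L) + CE + 1"
  define C where "C = 2 * L + T * C1"
  have Ck: "Ck \<ge> 0" using assms(2) by (simp add: Ck_def)
  have CE: "CE \<ge> 0" using Ck \<open>L > 0\<close> by (simp add: CE_def N_def)
  have C1: "C1 > 0" using CE assms by (simp add: C1_def add_nonneg_pos)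
  have C: "C > 0" using C1 \<open>L > 0\<close> \<open>T > 0\<close> by (simp add: C_def add_pos_pos)
  show ?thesis
  proof (rule exI[of _ C], intro conjI C allI impI)
    fix \<Omega> :: "(real ^ 'n) set" and A :: "real \<Rightarrow> real ^ 'n \<Rightarrow> real ^ 'n ^ 'n"
      and H :: "real \<Rightarrow> (real ^ 'n) \<times> real \<Rightarrow> real ^ 'n \<Rightarrow> real"
      and g u :: "real \<Rightarrow> (real ^ 'n) \<times> real \<Rightarrow> real" and \<alpha> c_H \<gamma> :: real
    let ?Q = "space_time_cylinder \<Omega> T" and ?D = "closure \<Omega> \<times> {0..<T}" and ?P = "parabolic_boundary \<Omega> T"
    assume \<Omega>: "open \<Omega> \<and> connected \<Omega> \<and> \<Omega> \<noteq> {} \<and> bounded \<Omega>"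
      and A: "\<forall>\<epsilon>\<ge>0. continuous_on (- {0}) (A \<epsilon>) \<and> (\<forall>\<xi>. \<xi> \<noteq> 0 \<longrightarrow> psd (A \<epsilon> \<xi>)) \<and> F_class (A \<epsilon>) \<noteq> {}"
      and H: "\<forall>\<epsilon>\<ge>0. continuous_on (?Q \<times> UNIV) (\<lambda>(z, \<xi>). H \<epsilon> z \<xi>)"
      and A1: "\<exists>\<epsilon>1>0. \<forall>\<epsilon>\<in>{0..<\<epsilon>1}. ((\<lambda>x. trace (A \<epsilon> (gradient (\<lambda>y. norm y powr k) x) ** hessian
          (\<lambda>y. norm y powr k) x)) \<longlongrightarrow> 0) (at 0)"
      and A2: "\<forall>\<epsilon>\<ge>0. \<forall>(x1, t1)\<in>?Q. \<forall>(x2, t2)\<in>?Q. \<forall>\<xi>. \<bar>H \<epsilon> (x1, t1) \<xi> - H \<epsilon> (x2, t2) \<xi>\<bar>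
          \<le> L_H * (1 + norm \<xi>) * (norm (x1 - x2) + \<bar>t1 - t2\<bar>)"
      and \<alpha>: "\<alpha> > 0"
      and CA: "\<exists>\<epsilon>1>0. \<forall>\<epsilon>\<in>{0<..<\<epsilon>1}. \<forall>\<xi>. \<xi> \<noteq> 0 \<longrightarrow> op_norm (psd_sqrt (A \<epsilon> \<xi>) - psd_sqrt (A 0 \<xi>))
          \<le> c_A * \<epsilon> powr \<alpha> * (1 + norm \<xi> powr \<beta>)"
      and cH: "c_H > 0 \<and> \<gamma> > 0"
      and CH: "\<exists>\<epsilon>1>0. \<forall>\<epsilon>\<in>{0<..<\<epsilon>1}. \<forall>z\<in>?Q. \<forall>\<xi>. \<bar>H \<epsilon> z \<xi> - H 0 z \<xi>\<bar> \<le> c_H * \<epsilon> powr \<gamma>"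
      and sol: "\<forall>\<epsilon>\<ge>0. continuous_on ?P (g \<epsilon>) \<and> continuous_on ?D (u \<epsilon>) \<and> bounded (u \<epsilon> ` ?D)
          \<and> F_solution ?Q (A \<epsilon>) (H \<epsilon>) (u \<epsilon>) \<and> (\<forall>z\<in>?P. u \<epsilon> z = g \<epsilon> z)"
      and Ho: "\<exists>\<epsilon>1>0. \<forall>\<epsilon>\<in>{0..<\<epsilon>1}. \<forall>(x1, t1)\<in>?D. \<forall>(x2, t2)\<in>?D. \<bar>u \<epsilon> (x1, t1) - u \<epsilon> (x2, t2)\<bar>
          \<le> L * (norm (x1 - x2) powr \<theta> + \<bar>t1 - t2\<bar> powr \<theta>)"
    obtain e1 where e1: "e1 > 0" "\<And>\<epsilon>. 0 \<le> \<epsilon> \<Longrightarrow> \<epsilon> < e1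
        \<Longrightarrow> ((\<lambda>x. trace (A \<epsilon> (gradient (\<lambda>y. norm y powr k) x) ** hessian (\<lambda>y. norm y powr k) x)) \<longlongrightarrow> 0) (at 0)"
      using A1 by (elim exE conjE) (rule that, assumption, simp)
    obtain e2 where e2: "e2 > 0" "\<And>\<epsilon> \<xi>. 0 < \<epsilon> \<Longrightarrow> \<epsilon> < e2 \<Longrightarrow> \<xi> \<noteq> 0
        \<Longrightarrow> op_norm (psd_sqrt (A \<epsilon> \<xi>) - psd_sqrt (A 0 \<xi>)) \<le> c_A * \<epsilon> powr \<alpha> * (1 + norm \<xi> powr \<beta>)"
      using CA by (elim exE conjE) (rule that, assumption, simp)
    obtain e3 where e3: "e3 > 0" "\<And>\<epsilon> z \<xi>. 0 < \<epsilon> \<Longrightarrow> \<epsilon> < e3 \<Longrightarrow> z \<in> ?Q \<Longrightarrow> \<bar>H \<epsilon> z \<xi> - H 0 z \<xi>\<bar> \<le> c_H * \<epsilon> powr \<gamma>"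
      using CH by (elim exE conjE) (rule that, assumption, simp)
    obtain e4 where e4: "e4 > 0" "\<forall>\<epsilon>\<in>{0..<e4}. \<forall>(x1, t1)\<in>?D. \<forall>(x2, t2)\<in>?D. \<bar>u \<epsilon> (x1, t1)
        - u \<epsilon> (x2, t2)\<bar> \<le> L * (norm (x1 - x2) powr \<theta> + \<bar>t1 - t2\<bar> powr \<theta>)"
      using Ho by (elim exE conjE) (rule that)
    have hold: "\<bar>u \<epsilon> z - u \<epsilon> w\<bar> \<le> L * (norm (fst z - fst w) powr \<theta> + \<bar>snd z - snd w\<bar> powr \<theta>)"
      if "0 \<le> \<epsilon>" "\<epsilon> < e4" "z \<in> ?D" "w \<in> ?D" for \<epsilon> z w
    proof -
      have "\<forall>(x1, t1)\<in>?D. \<forall>(x2, t2)\<in>?D. \<bar>u \<epsilon> (x1, t1) - u \<epsilon> (x2, t2)\<bar>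
          \<le> L * (norm (x1 - x2) powr \<theta> + \<bar>t1 - t2\<bar> powr \<theta>)"
        using e4(2) that(1,2) by simp
      then show ?thesis using that(3,4) by (cases z; cases w) fastforce
    qed
    have HL: "\<bar>H \<epsilon> z \<xi> - H \<epsilon> w \<xi>\<bar> \<le> L_H * (1 + norm \<xi>) * (norm (fst z - fst w) + \<bar>snd z - snd w\<bar>)"
      if "0 \<le> \<epsilon>" "z \<in> ?Q" "w \<in> ?Q" for \<epsilon> z w \<xi>
    proof -
      have "\<forall>(x1, t1)\<in>?Q. \<forall>(x2, t2)\<in>?Q. \<forall>\<xi>. \<bar>H \<epsilon> (x1, t1) \<xi> - H \<epsilon> (x2, t2) \<xi>\<bar>
          \<le> L_H * (1 + norm \<xi>) * (norm (x1 - x2) + \<bar>t1 - t2\<bar>)"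
        using A2 that(1) by simp
      then show ?thesis using that(2,3) by (cases z; cases w) fastforce
    qed
    have PD: "?P \<subseteq> ?D" using closure_subset[of \<Omega>] frontier_subset_closed \<open>T > 0\<close>
      by (auto simp: parabolic_boundary_def frontier_def)
    \<comment> \<open>The different notions of small \<epsilon> in the hypotheses are merged; the
      bound by 1 gives r \<le> 1.\<close>
    define e0 where "e0 = Min {1, e1, e2, e3, e4}"
    have e0: "e0 > 0" using e1(1) e2(1) e3(1) e4(1) by (simp add: e0_def)
    have e0le: "e0 \<le> 1" "e0 \<le> e1" "e0 \<le> e2" "e0 \<le> e3" "e0 \<le> e4" unfolding e0_def by (rule Min_le; simp)+
    show "\<exists>\<epsilon>0>0. \<forall>\<epsilon>\<in>{0<..<\<epsilon>0}. (SUP z\<in>?D. \<bar>u \<epsilon> z - u 0 z\<bar>)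
       \<le> (SUP z\<in>?P. \<bar>g \<epsilon> z - g 0 z\<bar>) + C * \<epsilon> powr (\<alpha> * \<theta> / (1 + (1 - \<theta>) * max \<beta> 0)) + c_H * T * \<epsilon> powr \<gamma>"
    proof (rule exI[of _ e0], intro conjI e0 ballI)
      fix \<epsilon> assume "\<epsilon> \<in> {0<..<e0}"
      then have \<epsilon>: "0 < \<epsilon>" "\<epsilon> < e0" by auto
      define r where "r = \<epsilon> powr (\<alpha> / (1 + (1 - \<theta>) * max \<beta> 0))"
      define K where "K = L * r powr (\<theta> - k)"
      have q: "1 + (1 - \<theta>) * max \<beta> 0 > 0" using \<theta> by (simp add: add_pos_nonneg)
      have r: "0 < r" "r \<le> 1" using \<epsilon> e0le(1) \<alpha> q by (auto simp: r_def powr_le1)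
      have r\<theta>: "r powr \<theta> = \<epsilon> powr (\<alpha> * \<theta> / (1 + (1 - \<theta>) * max \<beta> 0))" by (simp add: r_def powr_powr)
      define M where "M = (SUP z\<in>?P. \<bar>g \<epsilon> z - g 0 z\<bar>)"
      define l where "l = c_H * \<epsilon> powr \<gamma> + C1 * r powr \<theta>"
      have l0: "l \<ge> 0" using C1 cH by (simp add: l_def)
      \<comment> \<open>The Lipschitz error of the Hamiltonian has parts of order r and r^\<theta>;
        as r \<le> 1 and \<theta> \<le> 1, the latter dominates.\<close>
      have lt: "c_H * \<epsilon> powr \<gamma> + L_H * (1 + k * L * r powr (\<theta> - 1)) * (2 * r) + CE * r powr \<theta> < l"
      proof -
        have "r powr (\<theta> - 1) * r = r powr \<theta>" using r by (simp add: powr_diff)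
        then have "L_H * (1 + k * L * r powr (\<theta> - 1)) * (2 * r) = 2 * L_H * (r + k * L * r powr \<theta>)"
          by (simp add: algebra_simps)
        also have "\<dots> \<le> 2 * L_H * (r powr \<theta> + k * L * r powr \<theta>)"
        proof -
          have "r powr 1 \<le> r powr \<theta>" using r \<theta> by (intro powr_mono') auto
          then show ?thesis using r \<open>L_H \<ge> 0\<close> by (intro mult_left_mono) auto
        qed
        also have "\<dots> = 2 * L_H * (1 + k * L) * r powr \<theta>" by (simp add: algebra_simps)
        finally have "L_H * (1 + k * L * r powr (\<theta> - 1)) * (2 * r) \<le> 2 * L_H * (1 + k * L) * r powr \<theta>" .
        moreover have "C1 * r powr \<theta> = 2 * L_H * (1 + k * L) * r powr \<theta> + CE * r powr \<theta> + r powr \<theta>"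
          by (simp add: C1_def distrib_right)
        moreover have "r powr \<theta> > 0" using r by simp
        ultimately show ?thesis unfolding l_def by linarith
      qed
      have Ebd: "2 * (K * (k * (k - 1) * 2 powr (k - 2) * d powr (k - 2))) * real CARD('n) *
          (op_norm (psd_sqrt (A \<epsilon> \<xi>) - psd_sqrt (A 0 \<xi>)))\<^sup>2 \<le> CE * r powr \<theta>"
        if d: "0 < d" "d \<le> r" and \<xi>: "norm \<xi> = K * (k * d powr (k - 1))" for d \<xi>
      proof -
        have "norm \<xi> > 0" unfolding \<xi> using r \<open>L > 0\<close> \<open>k > 2\<close> d by (simp add: K_def)
        then have "\<xi> \<noteq> 0" by auto
        then have "op_norm (psd_sqrt (A \<epsilon> \<xi>) - psd_sqrt (A 0 \<xi>))
            \<le> c_A * \<epsilon> powr \<alpha> * (1 + (K * (k * d powr (k - 1))) powr \<beta>)"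
          using e2(2)[of \<epsilon> \<xi>] \<epsilon> e0le(3) \<xi> by simp
        then have "K * (Ck * d powr (k - 2)) * (op_norm (psd_sqrt (A \<epsilon> \<xi>) - psd_sqrt (A 0 \<xi>)))\<^sup>2
           \<le> Ck * c_A\<^sup>2 * (2 * L + 2 * L * (k * L) powr (2 * \<beta>)) * r powr \<theta>"
          unfolding K_def r_def using assms \<theta> \<epsilon> e0le(1) \<alpha> d Ck
          by (intro coefficient_estimate op_norm_nonneg) (auto simp: r_def)
        then have "2 * N * (K * (Ck * d powr (k - 2)) * (op_norm (psd_sqrt (A \<epsilon> \<xi>) - psd_sqrt (A 0 \<xi>)))\<^sup>2)
           \<le> 2 * N * (Ck * c_A\<^sup>2 * (2 * L + 2 * L * (k * L) powr (2 * \<beta>)) * r powr \<theta>)"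
          by (intro mult_left_mono) (auto simp: N_def)
        then show ?thesis by (simp add: CE_def N_def Ck_def mult_ac)
      qed
      have Ebd': "2 * (K * (k * (k - 1) * 2 powr (k - 2) * d powr (k - 2))) * real CARD('n) *
          (op_norm (psd_sqrt (A 0 \<xi>) - psd_sqrt (A \<epsilon> \<xi>)))\<^sup>2 \<le> CE * r powr \<theta>"
        if "0 < d" "d \<le> r" "norm \<xi> = K * (k * d powr (k - 1))" for d \<xi>
        using Ebd[OF that] by (simp only: op_norm_minus_commute)
      have CEr: "0 \<le> CE * r powr \<theta>" using CE by simp
      have bd: "bounded (u \<epsilon> ` ?D)" "bounded (u 0 ` ?D)" using sol \<epsilon> by auto
      \<comment> \<open>The real \<open>SUP\<close> needs an upper bound; it comes from the bounded
        solutions, which equal the data on the parabolic boundary.\<close>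
      have bdd: "bdd_above ((\<lambda>z. \<bar>g \<epsilon> z - g 0 z\<bar>) ` ?P)"
      proof -
        obtain B1 B2 where B: "\<forall>y\<in>u \<epsilon> ` ?D. norm y \<le> B1" "\<forall>y\<in>u 0 ` ?D. norm y \<le> B2"
          using bd unfolding bounded_iff by blast
        show ?thesis
        proof (rule bdd_aboveI2)
          fix z assume z: "z \<in> ?P"
          have "g \<epsilon> z = u \<epsilon> z" "g 0 z = u 0 z" using sol \<epsilon> z by auto
          moreover have "\<bar>u \<epsilon> z\<bar> \<le> B1" "\<bar>u 0 z\<bar> \<le> B2"
            using B z PD unfolding real_norm_def[symmetric] by blast+
          ultimately show "\<bar>g \<epsilon> z - g 0 z\<bar> \<le> B1 + B2" by linarith
        qed
      qed
      have gM: "\<bar>u \<epsilon> z - u 0 z\<bar> \<le> M" if z: "z \<in> ?P" for z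
      proof -
        have "g \<epsilon> z = u \<epsilon> z" "g 0 z = u 0 z" using sol \<epsilon> z by auto
        then show ?thesis using cSUP_upper[OF z bdd] by (simp add: M_def)
      qed
      have \<epsilon>': "0 \<le> \<epsilon>" "\<epsilon> < e1" "\<epsilon> < e2" "\<epsilon> < e3" "\<epsilon> < e4" using \<epsilon> e0le by auto
      have S\<epsilon>: "F_subsolution ?Q (A \<epsilon>) (H \<epsilon>) (u \<epsilon>)" "F_supersolution ?Q (A \<epsilon>) (H \<epsilon>) (u \<epsilon>)"
        "continuous_on ?D (u \<epsilon>)"
        and S0: "F_subsolution ?Q (A 0) (H 0) (u 0)" "F_supersolution ?Q (A 0) (H 0) (u 0)"
          "continuous_on ?D (u 0)"
        using sol \<epsilon>'(1) by (auto simp: F_solution_def)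
      have A\<epsilon>: "continuous_on (- {0}) (A \<epsilon>)" "\<And>\<xi>. \<xi> \<noteq> 0 \<Longrightarrow> psd (A \<epsilon> \<xi>)"
        and A0: "continuous_on (- {0}) (A 0)" "\<And>\<xi>. \<xi> \<noteq> 0 \<Longrightarrow> psd (A 0 \<xi>)"
        using A \<epsilon>'(1) by auto
      have H\<epsilon>: "continuous_on (?Q \<times> UNIV) (\<lambda>(z, \<xi>). H \<epsilon> z \<xi>)"
        and H0: "continuous_on (?Q \<times> UNIV) (\<lambda>(z, \<xi>). H 0 z \<xi>)"
        using H \<epsilon>'(1) by auto
      have HC: "\<bar>H \<epsilon> z \<xi> - H 0 z \<xi>\<bar> \<le> c_H * \<epsilon> powr \<gamma>" "\<bar>H 0 z \<xi> - H \<epsilon> z \<xi>\<bar> \<le> c_H * \<epsilon> powr \<gamma>"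
        if "z \<in> ?Q" for z \<xi>
        using e3(2)[OF \<epsilon>(1) \<epsilon>'(4) that, of \<xi>] by (simp_all add: abs_minus_commute)
      have \<Omega>': "open \<Omega>" "bounded \<Omega>" "\<Omega> \<noteq> {}" using \<Omega> by auto
      note tr\<epsilon> = e1(2)[OF \<epsilon>'(1,2)] and tr0 = e1(2)[OF order_refl e1(1)]
      have upper: "\<forall>z\<in>?D. u \<epsilon> z - u 0 z \<le> M + 2 * L * r powr \<theta> + l * T"
      proof (rule one_sided_estimate[OF \<Omega>' \<open>T > 0\<close> \<open>k > 2\<close> \<theta> \<open>L > 0\<close> \<open>L_H \<ge> 0\<close> r K_def
            A\<epsilon>(1) A0(1) _ _ tr\<epsilon> tr0 H\<epsilon> H0 _ _ S\<epsilon>(3) S0(3) bd(1) bd(2) S\<epsilon>(1) S0(2) _ _ _ _ CEr lt l0])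
        show "psd (A \<epsilon> \<xi>)" "psd (A 0 \<xi>)" if "\<xi> \<noteq> 0" for \<xi> using A\<epsilon>(2) A0(2) that by auto
        show "u \<epsilon> z - u 0 z \<le> M" if "z \<in> ?P" for z using gM[OF that] by simp
        show "\<bar>H 0 z \<xi> - H 0 w \<xi>\<bar> \<le> L_H * (1 + norm \<xi>) * (norm (fst z - fst w) + \<bar>snd z - snd w\<bar>)"
          if "z \<in> ?Q" "w \<in> ?Q" for z w \<xi> using HL[OF order_refl that] .
        show "\<bar>H \<epsilon> z \<xi> - H 0 z \<xi>\<bar> \<le> c_H * \<epsilon> powr \<gamma>" if "z \<in> ?Q" for z \<xi> using HC[OF that] by simp
        show "\<bar>u \<epsilon> z - u \<epsilon> w\<bar> \<le> L * (norm (fst z - fst w) powr \<theta> + \<bar>snd z - snd w\<bar> powr \<theta>)"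
          "\<bar>u 0 z - u 0 w\<bar> \<le> L * (norm (fst z - fst w) powr \<theta> + \<bar>snd z - snd w\<bar> powr \<theta>)"
          if "z \<in> ?D" "w \<in> ?D" for z w using hold[OF \<epsilon>'(1,5) that] hold[OF order_refl e4(1) that]
            by simp_all
      qed (rule Ebd)
      \<comment> \<open>The roles of \<epsilon> and 0 are exchanged; the Lipschitz condition is now
        used for \<open>H \<epsilon>\<close>.\<close>
      have lower: "\<forall>z\<in>?D. u 0 z - u \<epsilon> z \<le> M + 2 * L * r powr \<theta> + l * T"
      proof (rule one_sided_estimate[OF \<Omega>' \<open>T > 0\<close> \<open>k > 2\<close> \<theta> \<open>L > 0\<close> \<open>L_H \<ge> 0\<close> r K_def
            A0(1) A\<epsilon>(1) _ _ tr0 tr\<epsilon> H0 H\<epsilon> _ _ S0(3) S\<epsilon>(3) bd(2) bd(1) S0(1) S\<epsilon>(2) _ _ _ _ CEr lt l0])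
        show "psd (A 0 \<xi>)" "psd (A \<epsilon> \<xi>)" if "\<xi> \<noteq> 0" for \<xi> using A\<epsilon>(2) A0(2) that by auto
        show "u 0 z - u \<epsilon> z \<le> M" if "z \<in> ?P" for z using gM[OF that] by simp
        show "\<bar>H \<epsilon> z \<xi> - H \<epsilon> w \<xi>\<bar> \<le> L_H * (1 + norm \<xi>) * (norm (fst z - fst w) + \<bar>snd z - snd w\<bar>)"
          if "z \<in> ?Q" "w \<in> ?Q" for z w \<xi> using HL[OF \<epsilon>'(1) that] .
        show "\<bar>H 0 z \<xi> - H \<epsilon> z \<xi>\<bar> \<le> c_H * \<epsilon> powr \<gamma>" if "z \<in> ?Q" for z \<xi> using HC[OF that] by simp
        show "\<bar>u 0 z - u 0 w\<bar> \<le> L * (norm (fst z - fst w) powr \<theta> + \<bar>snd z - snd w\<bar> powr \<theta>)"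
          "\<bar>u \<epsilon> z - u \<epsilon> w\<bar> \<le> L * (norm (fst z - fst w) powr \<theta> + \<bar>snd z - snd w\<bar> powr \<theta>)"
          if "z \<in> ?D" "w \<in> ?D" for z w using hold[OF \<epsilon>'(1,5) that] hold[OF order_refl e4(1) that]
            by simp_all
      qed (rule Ebd')
      have fin: "M + 2 * L * r powr \<theta> + l * T = M + C * \<epsilon> powr (\<alpha> * \<theta> / (1 + (1 - \<theta>) * max \<beta> 0))
          + c_H * T * \<epsilon> powr \<gamma>"
        unfolding r\<theta>[symmetric] by (simp add: l_def C_def algebra_simps)
      show "(SUP z\<in>?D. \<bar>u \<epsilon> z - u 0 z\<bar>) \<le> (SUP z\<in>?P. \<bar>g \<epsilon> z - g 0 z\<bar>)
          + C * \<epsilon> powr (\<alpha> * \<theta> / (1 + (1 - \<theta>) * max \<beta> 0)) + c_H * T * \<epsilon> powr \<gamma>"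
        unfolding M_def[symmetric] fin[symmetric]
      proof (rule cSUP_least)
        show "?D \<noteq> {}" using \<Omega> \<open>T > 0\<close> closure_subset[of \<Omega>] by auto
        show "\<bar>u \<epsilon> z - u 0 z\<bar> \<le> M + 2 * L * r powr \<theta> + l * T" if "z \<in> ?D" for z
          using upper lower that by (auto simp: abs_le_iff)
      qed
    qed
  qed
qed

end
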